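(* Let $d\ge 1$, let $C\subset\mathbb{R}^d$ be a bounded measurable set with $|C|=1$ and $|\partial C|=0$, and let $V$ be a positive random variable with $\mathrm{E}V=1$ and distribution function $F$ whose tail $\bar F=1-F$ is regularly varying with exponent $\gamma\in(1,2)$, i.e. $\lim_{v\to\infty}\bar F(av)/\bar F(v)=a^{-\gamma}$ for all $a>0$. Let $J_{\lambda,\rho}$ be the random grain functional with grain shape $C$, mean grain density $\lambda$ and grain volumes distributed as $\rho V$ (see context), and put $F_\rho(v)=F(v/\rho)$, $\bar F_\rho=1-F_\rho$. Let $\alpha\in(0,2-\gamma)$. Then the following three limits hold in the sense of finite-dimensional distributions of random functionals as $\lambda\to\infty$ and $\rho\to0$: (i) (Large-grain scaling) If $\lambda\bar F_\rho(1)\to\infty$, then $$\frac{J_{\lambda,\rho}(\phi)-\mathrm{E}J_{\lambda,\rho}(\phi)}{(\gamma\lambda\bar F_\rho(1))^{1/2}}\longrightarrow W_{\gamma,C}(\phi),\qquad \phi\in M^\alpha,$$ where $W_{\gamma,C}$ is the centered Gaussian random linear functional on $M^{2-\gamma}$ with $$\mathrm{E}W_{\gamma,C}(\phi)W_{\gamma,C}(\psi)=\int_{\mathbb{R}^d}\int_{\mathbb{R}^d}\phi(dx)K_{\gamma,C}(x-y)\psi(dy),\qquad K_{\gamma,C}(x)=\int_0^\infty|(v^{-1/d}x+C)\cap C|\,v^{-\gamma}\,dv.$$ (ii) (Intermediate scaling) If $\lambda\bar F_\rho(1)\to\sigma_0>0$, then $$J_{\lambda,\rho}(\phi)-\mathrm{E}J_{\lambda,\rho}(\phi)\longrightarrow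 J^*_{\gamma,C}(\phi_\sigma),\qquad\phi\in M^\alpha,$$ where $J^*_{\gamma,C}$ is defined on $M^{2-\gamma}$ as a centered integral with respect to the Poisson random measure $N_\gamma(dx,dv)$ on $\mathbb{R}^d\times\mathbb{R}_+$ with intensity measure $dx\,v^{-\gamma-1}\,dv$, $$J^*_{\gamma,C}(\phi)=\int_{\mathbb{R}^d}\int_0^\infty\phi(x+v^{1/d}C)\,\bigl(N_\gamma(dx,dv)-dx\,v^{-\gamma-1}\,dv\bigr),$$ and where $\phi_\sigma$ is defined by $\phi_\sigma(A)=\phi(\sigma A)$ with $\sigma=(\gamma\sigma_0)^{1/((\gamma-1)d)}$. (iii) (Small-grain scaling) If $\lambda\bar F_\rho(1)\to0$, then $$\frac{J_{\lambda,\rho}(\phi)-\mathrm{E}J_{\lambda,\rho}(\phi)}{c_\gamma\,(1/\bar F_\rho)^{\leftarrow}(\gamma\lambda)}\longrightarrow\Lambda_\gamma(\phi),\qquad\phi\in L^1\cap L^2,$$ where $\Lambda_\gamma$ is the independently scattered $\gamma$-stable random measure on $\mathbb{R}^d$ with Lebesgue control measure and unit skewness (see context), $(1/\bar F_\rho)^{\leftarrow}(u)=\inf\{v:1/\bar F_\rho(v)\ge u\}$ is the quantile function of $F_\rho$, and $$c_\gamma=\Bigl(-\frac{\Gamma(2-\gamma)}{\gamma(\gamma-1)}\cos\Bigl(\frac{\pi\gamma}{2}\Bigr)\Bigr)^{1/\gamma}.$$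
   Context: $|\cdot|$ applied to sets is Lebesgue measure on $\mathbb{R}^d$; $\partial C$ is the boundary of $C$; measurable means Borel; $\mathbb{R}_+=[0,\infty)$; $L^p=L^p(\mathbb{R}^d)$ (real-valued functions). Spaces of test measures. $M^1$ is the linear space of signed (Borel) measures $\phi$ on $\mathbb{R}^d$ with finite total variation $\|\phi\|_1<\infty$. A function $\phi\in L^1$ is identified with the signed measure $\phi(x)\,dx\in M^1$, so $L^1\subset M^1$. For $\alpha\in(0,1)$, $$M^\alpha=\Bigl\{\phi\in M^1:\int_{\mathbb{R}^d}\int_{\mathbb{R}^d}\frac{|\phi|(dx)\,|\phi|(dy)}{|x-y|^{(1-\alpha)d}}<\infty\Bigr\},$$ where $|\phi|$ is the total variation measure. (One has $M^{\alpha}\subset M^{2-\gamma}$ for $\alpha<2-\gamma$.) Random grain functional. For $\lambda,\rho>0$ let $N_{\lambda,\rho}(dx,dv)$ be a Poisson random measure on $\mathbb{R}^d\times\mathbb{R}_+$ with intensity measure $\lambda\,dx\,F_\rho(dv)$, where $F_\rho(v)=F(v/\rho)$ is the distribution function of $\rho V$. For $\phi\in M^1$, $$J_{\lambda,\rho}(\phi)=\int_{\mathbb{R}^d}\int_{\mathbb{R}_+}\phi(x+v^{1/d}C)\,N_{\lambda,\rho}(dx,dv).$$ Centered Poisson integrals. For a Poisson random measure $N$ with intensity measure $\eta$ and a measurable $f$ with $\int(|f|\wedge f^2)\,d\eta<\infty$, the centered integral $\int f\,(dN-d\eta)$ exists as a limit in probability and its law is given by $\mathrm{E}\exp(i\int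 f(dN-d\eta))=\exp\int\Psi(f)\,d\eta$, with $\Psi(v)=e^{iv}-1-iv$. Stable random measure. $\Lambda_\gamma$ is the random linear functional on $L^\gamma$ characterized by $$\mathrm{E}e^{i\Lambda_\gamma(\phi)}=\exp\Bigl(-\sigma_\phi^\gamma\bigl(1-i\beta_\phi\tan(\tfrac{\pi\gamma}{2})\bigr)\Bigr),\quad \sigma_\phi=\|\phi\|_\gamma,\quad \beta_\phi=\|\phi\|_\gamma^{-\gamma}\bigl(\|\phi_+\|_\gamma^\gamma-\|\phi_-\|_\gamma^\gamma\bigr),$$ with $\phi_+=\max(\phi,0)$, $\phi_-=-\min(\phi,0)$ and $\|\cdot\|_\gamma$ the $L^\gamma$ norm. Conventions. A random linear functional on a vector space is a family of real random variables indexed by the space, almost surely linear in the index for each finite linear combination. Convergence in the sense of finite-dimensional distributions means joint convergence in distribution for every finite collection of test elements from the stated index space. The limits are taken with $\lambda=\lambda(\rho)\to\infty$ as $\rho\to0$ subject to the stated condition on $\lambda\bar F_\rho(1)$. *)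

theory Defs
  imports "HOL-Probability.Probability"
begin

subsection \<open>Signed measures\<close>

text \<open>
  A signed measure is a countably additive real-valued function on the Borel sets. It is set to
  \<open>0\<close> off the Borel sets, so that equality of functions is equality of signed measures.
\<close>

definition signed_measure :: "('a::topological_space set \<Rightarrow> real) \<Rightarrow> bool" where
  "signed_measure \<phi> \<longleftrightarrow>
     \<phi> {} = 0 \<and> (\<forall>A. A \<notin> sets borel \<longrightarrow> \<phi> A = 0) \<and>
     (\<forall>A :: nat \<Rightarrow> 'a set. range A \<subseteq> sets borel \<longrightarrow> disjoint_family A \<longrightarrow>
        (\<lambda>i. \<phi> (A i)) sums \<phi> (\<Union>i. A i))"

text \<open>
  Jordan decomposition: the positive part is \<open>A \<mapsto> sup {\<phi> B | B \<subseteq> A}\<close>. Negative values of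
  \<open>\<phi> B\<close> are truncated to \<open>0\<close> by \<^const>\<open>ennreal\<close>, which is harmless because \<open>B = {}\<close> is allowed.
\<close>

definition jordan_pos :: "('a::topological_space set \<Rightarrow> real) \<Rightarrow> 'a measure" where
  "jordan_pos \<phi> =
     measure_of UNIV (sets borel) (\<lambda>A. SUP B\<in>{B \<in> sets borel. B \<subseteq> A}. ennreal (\<phi> B))"

definition jordan_neg :: "('a::topological_space set \<Rightarrow> real) \<Rightarrow> 'a measure" where
  "jordan_neg \<phi> = jordan_pos (\<lambda>A. - \<phi> A)"

definition total_variation :: "('a::topological_space set \<Rightarrow> real) \<Rightarrow> 'a measure" where
  "total_variation \<phi> =
     measure_of UNIV (sets borel) (\<lambda>A. emeasure (jordan_pos \<phi>) A + emeasure (jordan_neg \<phi>) A)"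

definition signed_integral :: "('a::topological_space set \<Rightarrow> real) \<Rightarrow> ('a \<Rightarrow> real) \<Rightarrow> real" where
  "signed_integral \<phi> f = (\<integral>x. f x \<partial>jordan_pos \<phi>) - (\<integral>x. f x \<partial>jordan_neg \<phi>)"

definition M1 :: "('a::euclidean_space set \<Rightarrow> real) set" where
  "M1 = {\<phi>. signed_measure \<phi> \<and> emeasure (total_variation \<phi>) UNIV < \<infinity>}"

text \<open>
  The quotient is taken in \<^typ>\<open>ennreal\<close>, where \<open>1 / 0 = \<infinity>\<close>: measures with atoms have
  infinite energy.
\<close>

definition Malpha :: "real \<Rightarrow> ('a::euclidean_space set \<Rightarrow> real) set" where
  "Malpha \<alpha> = {\<phi> \<in> M1.
     (\<integral>\<^sup>+x. \<integral>\<^sup>+y. 1 / ennreal (norm (x - y) powr ((1 - \<alpha>) * real DIM('a)))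
        \<partial>total_variation \<phi> \<partial>total_variation \<phi>) < \<infinity>}"

text \<open>The space \<open>L\<^sup>p\<close>, consisting of functions rather than of classes of functions.\<close>

definition Lp :: "real \<Rightarrow> ('a::euclidean_space \<Rightarrow> real) set" where
  "Lp p = {f \<in> borel_measurable borel. integrable lborel (\<lambda>x. \<bar>f x\<bar> powr p)}"

definition Lp_norm :: "real \<Rightarrow> ('a::euclidean_space \<Rightarrow> real) \<Rightarrow> real" where
  "Lp_norm p f = (\<integral>x. \<bar>f x\<bar> powr p \<partial>lborel) powr (1 / p)"

definition signed_density :: "('a::euclidean_space \<Rightarrow> real) \<Rightarrow> ('a set \<Rightarrow> real)" where
  "signed_density f = (\<lambda>A. if A \<in> sets borel then (LINT x:A|lborel. f x) else 0)"

definition dilate :: "real \<Rightarrow> ('a::euclidean_space set \<Rightarrow> real) \<Rightarrow> ('a set \<Rightarrow> real)" where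
  "dilate \<sigma> \<phi> = (\<lambda>A. \<phi> ((\<lambda>x. \<sigma> *\<^sub>R x) ` A))"


subsection \<open>Random functionals\<close>

text \<open>
  The index set \<open>T\<close> is a linear space of real-valued functions on \<^typ>\<open>'b\<close>. With \<open>'b = 'a set\<close>
  this covers spaces of signed measures.
\<close>

definition random_linear_functional ::
    "'w measure \<Rightarrow> ('b \<Rightarrow> real) set \<Rightarrow> (('b \<Rightarrow> real) \<Rightarrow> 'w \<Rightarrow> real) \<Rightarrow> bool" where
  "random_linear_functional P T X \<longleftrightarrow>
     prob_space P \<and> (\<forall>t\<in>T. X t \<in> borel_measurable P) \<and>
     (\<forall>(n::nat) (c :: nat \<Rightarrow> real) t. (\<forall>k<n. t k \<in> T) \<longrightarrow>
        (AE \<omega> in P. X (\<lambda>b. \<Sum>k<n. c k * t k b) \<omega> = (\<Sum>k<n. c k * X (t k) \<omega>)))"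

definition centered_gaussian_rv :: "'w measure \<Rightarrow> ('w \<Rightarrow> real) \<Rightarrow> bool" where
  "centered_gaussian_rv P X \<longleftrightarrow> X \<in> borel_measurable P \<and>
     ((AE \<omega> in P. X \<omega> = 0) \<or> (\<exists>s>0. distributed P lborel X (normal_density 0 s)))"

definition centered_gaussian_functional ::
    "'w measure \<Rightarrow> ('b \<Rightarrow> real) set \<Rightarrow> (('b \<Rightarrow> real) \<Rightarrow> 'w \<Rightarrow> real) \<Rightarrow> bool" where
  "centered_gaussian_functional P T X \<longleftrightarrow> random_linear_functional P T X \<and>
     (\<forall>(n::nat) (c :: nat \<Rightarrow> real) t. (\<forall>k<n. t k \<in> T) \<longrightarrow>
        centered_gaussian_rv P (\<lambda>\<omega>. \<Sum>k<n. c k * X (t k) \<omega>))"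

text \<open>
  Convergence of finite-dimensional distributions. A random vector of length \<open>n\<close> is padded with
  zeros to an element of \<^typ>\<open>nat \<Rightarrow> real\<close> with the product topology, and the test functions are
  the bounded continuous functions on that space; their restrictions to the vectors of length
  \<open>n\<close> are exactly the bounded continuous functions on \<open>\<real>\<^sup>n\<close>.
\<close>

definition fdd_converges ::
    "('i \<Rightarrow> 'w measure) \<Rightarrow> ('i \<Rightarrow> 't \<Rightarrow> 'w \<Rightarrow> real) \<Rightarrow> 'i filter \<Rightarrow> 't set \<Rightarrow>
     'v measure \<Rightarrow> ('t \<Rightarrow> 'v \<Rightarrow> real) \<Rightarrow> bool" where
  "fdd_converges P X F T Q Y \<longleftrightarrow>
     (\<forall>t\<in>T. (\<forall>\<^sub>F i in F. X i t \<in> borel_measurable (P i)) \<and> Y t \<in> borel_measurable Q) \<and>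
     (\<forall>(n::nat) t. (\<forall>k<n. t k \<in> T) \<longrightarrow>
        (\<forall>f :: (nat \<Rightarrow> real) \<Rightarrow> real. continuous_on UNIV f \<longrightarrow> bounded (range f) \<longrightarrow>
           ((\<lambda>i. \<integral>\<omega>. f (\<lambda>k. if k < n then X i (t k) \<omega> else 0) \<partial>P i) \<longlongrightarrow>
            (\<integral>\<omega>. f (\<lambda>k. if k < n then Y (t k) \<omega> else 0) \<partial>Q)) F))"


subsection \<open>Poisson random measures\<close>

definition poisson_random_measure ::
    "'w measure \<Rightarrow> ('w \<Rightarrow> 'z measure) \<Rightarrow> 'z measure \<Rightarrow> bool" where
  "poisson_random_measure P N \<eta> \<longleftrightarrow>
     prob_space P \<and>
     (\<forall>\<omega>\<in>space P. sets (N \<omega>) = sets \<eta>) \<and>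
     (\<forall>A\<in>sets \<eta>. (\<lambda>\<omega>. emeasure (N \<omega>) A) \<in> borel_measurable P) \<and>
     (\<forall>A\<in>sets \<eta>. emeasure \<eta> A < \<infinity> \<longrightarrow>
        (\<forall>k::nat. measure P {\<omega> \<in> space P. emeasure (N \<omega>) A = of_nat k} =
           exp (- measure \<eta> A) * measure \<eta> A ^ k / fact k)) \<and>
     (\<forall>A\<in>sets \<eta>. emeasure \<eta> A = \<infinity> \<longrightarrow> (AE \<omega> in P. emeasure (N \<omega>) A = \<infinity>)) \<and>
     (\<forall>(n::nat) A. (\<forall>i<n. A i \<in> sets \<eta>) \<longrightarrow> disjoint_family_on A {..<n} \<longrightarrow>
        prob_space.indep_vars P (\<lambda>_. borel) (\<lambda>i \<omega>. emeasure (N \<omega>) (A i)) {..<n})"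

text \<open>
  The centered integral \<open>\<integral> f (dN - d\<eta>)\<close> is the limit in probability, as \<open>\<epsilon>\<close> tends to \<open>0\<close>, of
  the centered integrals of \<open>f\<close> restricted to \<open>{\<bar>f\<bar> > \<epsilon>}\<close>. If \<open>\<integral> (\<bar>f\<bar> \<and> f\<^sup>2) d\<eta>\<close> is finite, the
  restricted function is \<open>\<eta>\<close>-integrable, and the limit is unique up to null sets.
\<close>

definition is_centered_integral ::
    "'w measure \<Rightarrow> ('w \<Rightarrow> 'z measure) \<Rightarrow> 'z measure \<Rightarrow> ('z \<Rightarrow> real) \<Rightarrow> ('w \<Rightarrow> real) \<Rightarrow> bool" where
  "is_centered_integral P N \<eta> f X \<longleftrightarrow> X \<in> borel_measurable P \<and>
     (\<forall>\<delta>>0. ((\<lambda>\<epsilon>. measure P {\<omega> \<in> space P.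
         \<bar>(LINT z:{z. \<bar>f z\<bar> > \<epsilon>}|N \<omega>. f z) - (LINT z:{z. \<bar>f z\<bar> > \<epsilon>}|\<eta>. f z) - X \<omega>\<bar> > \<delta>})
       \<longlongrightarrow> 0) (at_right 0))"

definition centered_integral ::
    "'w measure \<Rightarrow> ('w \<Rightarrow> 'z measure) \<Rightarrow> 'z measure \<Rightarrow> ('z \<Rightarrow> real) \<Rightarrow> 'w \<Rightarrow> real" where
  "centered_integral P N \<eta> f = (SOME X. is_centered_integral P N \<eta> f X)"


subsection \<open>The random grain model\<close>

text \<open>\<open>F\<close> is the distribution function of the unscaled grain volume.\<close>

definition Fbar :: "(real \<Rightarrow> real) \<Rightarrow> real \<Rightarrow> real \<Rightarrow> real" where
  "Fbar F \<rho> v = 1 - F (v / \<rho>)"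

definition regularly_varying :: "(real \<Rightarrow> real) \<Rightarrow> real \<Rightarrow> bool" where
  "regularly_varying G \<gamma> \<longleftrightarrow> (\<forall>a>0. ((\<lambda>v. G (a * v) / G v) \<longlongrightarrow> a powr (- \<gamma>)) at_top)"

definition reciprocal_inverse :: "(real \<Rightarrow> real) \<Rightarrow> real \<Rightarrow> real" where
  "reciprocal_inverse G u = Inf {v. 1 / G v \<ge> u}"

definition grain :: "'a::euclidean_space set \<Rightarrow> 'a \<Rightarrow> real \<Rightarrow> 'a set" where
  "grain C x v = (\<lambda>c. x + (v powr (1 / real DIM('a))) *\<^sub>R c) ` C"

definition grain_intensity ::
    "'q measure \<Rightarrow> ('q \<Rightarrow> real) \<Rightarrow> real \<Rightarrow> real \<Rightarrow> ('a::euclidean_space \<times> real) measure" where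
  "grain_intensity Q V lam \<rho> =
     scale_measure (ennreal lam) (lborel \<Otimes>\<^sub>M distr Q borel (\<lambda>q. \<rho> * V q))"

definition grain_functional ::
    "'a::euclidean_space set \<Rightarrow> ('w \<Rightarrow> ('a \<times> real) measure) \<Rightarrow> ('a set \<Rightarrow> real) \<Rightarrow> 'w \<Rightarrow> real" where
  "grain_functional C N \<phi> \<omega> = (\<integral>z. \<phi> (grain C (fst z) (snd z)) \<partial>N \<omega>)"

definition centered_grain_functional ::
    "'a::euclidean_space set \<Rightarrow> 'w measure \<Rightarrow> ('w \<Rightarrow> ('a \<times> real) measure) \<Rightarrow>
     ('a set \<Rightarrow> real) \<Rightarrow> 'w \<Rightarrow> real" where
  "centered_grain_functional C P N \<phi> \<omega> =
     grain_functional C N \<phi> \<omega> - (\<integral>\<omega>'. grain_functional C N \<phi> \<omega>' \<partial>P)"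


subsection \<open>The limits\<close>

text \<open>
  For \<open>x = 0\<close> the integral diverges and \<open>grain_kernel \<gamma> C 0 = 0\<close> by convention. The diagonal is
  a null set for \<open>\<bar>\<phi>\<bar> \<times> \<bar>\<psi>\<bar>\<close> when the energies of \<open>\<phi>\<close> and \<open>\<psi>\<close> are finite, so the covariance is
  not affected.
\<close>

definition grain_kernel :: "real \<Rightarrow> 'a::euclidean_space set \<Rightarrow> 'a \<Rightarrow> real" where
  "grain_kernel \<gamma> C x =
     (LINT v:{0<..}|lborel.
        measure lborel ((\<lambda>c. (v powr (- 1 / real DIM('a))) *\<^sub>R x + c) ` C \<inter> C) * v powr (- \<gamma>))"

definition is_W :: "real \<Rightarrow> 'a::euclidean_space set \<Rightarrow> 'w measure \<Rightarrow>
    (('a set \<Rightarrow> real) \<Rightarrow> 'w \<Rightarrow> real) \<Rightarrow> bool" where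
  "is_W \<gamma> C P W \<longleftrightarrow>
     centered_gaussian_functional P (Malpha (2 - \<gamma>)) W \<and>
     (\<forall>\<phi>\<in>Malpha (2 - \<gamma>). \<forall>\<psi>\<in>Malpha (2 - \<gamma>).
        (\<integral>\<omega>. W \<phi> \<omega> * W \<psi> \<omega> \<partial>P) =
        signed_integral \<phi> (\<lambda>x. signed_integral \<psi> (\<lambda>y. grain_kernel \<gamma> C (x - y))))"

definition limit_intensity :: "real \<Rightarrow> ('a::euclidean_space \<times> real) measure" where
  "limit_intensity \<gamma> =
     lborel \<Otimes>\<^sub>M density lborel (\<lambda>v. ennreal (indicator {0<..} v * v powr (- \<gamma> - 1)))"

definition J_star :: "real \<Rightarrow> 'a::euclidean_space set \<Rightarrow> 'w measure \<Rightarrow>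
    ('w \<Rightarrow> ('a \<times> real) measure) \<Rightarrow> ('a set \<Rightarrow> real) \<Rightarrow> 'w \<Rightarrow> real" where
  "J_star \<gamma> C P N \<phi> =
     centered_integral P N (limit_intensity \<gamma>) (\<lambda>z. \<phi> (grain C (fst z) (snd z)))"

definition stable_skewness :: "real \<Rightarrow> ('a::euclidean_space \<Rightarrow> real) \<Rightarrow> real" where
  "stable_skewness \<gamma> \<phi> = Lp_norm \<gamma> \<phi> powr (- \<gamma>) *
     (Lp_norm \<gamma> (\<lambda>x. max (\<phi> x) 0) powr \<gamma> - Lp_norm \<gamma> (\<lambda>x. - min (\<phi> x) 0) powr \<gamma>)"

definition is_stable_random_measure :: "real \<Rightarrow> 'w measure \<Rightarrow>
    (('a::euclidean_space \<Rightarrow> real) \<Rightarrow> 'w \<Rightarrow> real) \<Rightarrow> bool" where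
  "is_stable_random_measure \<gamma> P \<Lambda> \<longleftrightarrow>
     random_linear_functional P (Lp \<gamma>) \<Lambda> \<and>
     (\<forall>\<phi>\<in>Lp \<gamma>. (CLINT \<omega>|P. iexp (\<Lambda> \<phi> \<omega>)) =
        exp (- complex_of_real (Lp_norm \<gamma> \<phi> powr \<gamma>) *
             (1 - \<i> * complex_of_real (stable_skewness \<gamma> \<phi> * tan (pi * \<gamma> / 2)))))"

definition c_gamma :: "real \<Rightarrow> real" where
  "c_gamma \<gamma> = (- Gamma (2 - \<gamma>) / (\<gamma> * (\<gamma> - 1)) * cos (pi * \<gamma> / 2)) powr (1 / \<gamma>)"

end

theory Submission
  imports Defs
begin

text \<open>
  The characteristic function of a linear combination of the centered functionals, scaled by \<open>b\<close>, is
  \<open>exp (\<integral> \<Psi> (\<phi> (x + v\<^sup>1\<^sup>/\<^sup>d C) / b) d\<eta>)\<close>, so everything reduces to limits of this integral.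
  The quantile transform carries all intensities to \<open>dx ds\<close>: the rescaled quantile converges to
  \<open>s powr (- 1 / \<gamma>)\<close>, and Potter's bound provides a majorant, so that dominated convergence applies.
  In the first two regimes \<open>|\<partial>C| = 0\<close> gives convergence of \<open>\<phi>\<close> on almost every grain, and the finite
  energy gives the domination. In the third regime the averages of \<open>\<phi>\<close> over shrinking grains
  converge in \<open>L\<^sup>1\<close>, and the stable law appears through
  \<open>\<integral> \<Psi> (v) v powr (- \<gamma> - 1) dv = \<Gamma> (2 - \<gamma>) / (\<gamma> (\<gamma> - 1)) exp (- i \<pi> \<gamma> / 2)\<close>.
\<close>

text \<open>The volumes \<open>v\<close> enter the limits through
  \<open>v powr (- \<gamma> - 1)\<close>, which has infinite mass near 0 and, for \<gamma> < 2, too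
  heavy a tail for second moments. Two bounds on the square of \<phi> over a grain, integrated over
  its position, are therefore combined: a multiple of \<open>v\<close> from the finite total
  variation, which serves large grains and needs \<gamma> > 1, and a multiple of
  \<open>v powr (2 - \<alpha>)\<close> from the energy, which serves small grains and needs \<gamma>
  < 2 - \<alpha>. Potter's bound replaces \<gamma> by \<gamma> - d and \<gamma> + d, so d is taken
  small enough to keep both inequalities. In the small-grain regime the L1 and L2 norms play these
  roles with 2 in place of \<open>2 - \<alpha>\<close>. The tail may jump, so its quantile is only
  bracketed, by \<open>G t \<le> \<kappa> \<le> G (\<theta> * t)\<close> for 0 < \<theta> < 1; one
  statement about quantiles then serves all regimes. The factor \<gamma> in the normalizations
  arises because the limit intensity gives volumes above \<open>v\<close> the mass
  \<open>v powr (- \<gamma>) / \<gamma>\<close>, while the tail ratio tends to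
  \<open>v powr (- \<gamma>)\<close>.\<close>

abbreviation grain_at :: "'a::euclidean_space set \<Rightarrow> 'a \<times> real \<Rightarrow> 'a set" where
 "grain_at C z \<equiv> grain C (fst z) (snd z)"

abbreviation borel2 :: "('a::topological_space \<times> 'b::topological_space) measure" where
 "borel2 \<equiv> borel \<Otimes>\<^sub>M borel"

abbreviation lborel2 :: "('a::euclidean_space \<times> 'b::euclidean_space) measure" where
 "lborel2 \<equiv> lborel \<Otimes>\<^sub>M lborel"

subsection \<open>Convergence of random vectors from characteristic functions\<close>

text \<open>The expectation of such a function of a random vector is a finite combination of values
  of its characteristic function, so convergence of characteristic functions carries over to the
  whole class.\<close>

inductive_set trig_sums :: "nat \<Rightarrow> ((nat \<Rightarrow> real) \<Rightarrow> complex) set" for n :: nat where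
 monomial: "(\<lambda>x. c * iexp (\<Sum>k<n. t k * x k)) \<in> trig_sums n"
| add: "f \<in> trig_sums n \<Longrightarrow> g \<in> trig_sums n \<Longrightarrow> (\<lambda>x. f x + g x) \<in> trig_sums n"

lemma trig_sums_const: "(\<lambda>x. c) \<in> trig_sums n"
 using trig_sums.monomial[of c "\<lambda>_. 0" n] by simp

lemma trig_sums_mult_monomial:
 assumes "g \<in> trig_sums n"
 shows "(\<lambda>x. c * iexp (\<Sum>k<n. t k * x k) * g x) \<in> trig_sums n" using assms
proof induction
 case (monomial d u)
 have "(\<lambda>x. c * iexp (\<Sum>k<n. t k * x k) * (d * iexp (\<Sum>k<n. u k * x k))) =
  (\<lambda>x. (c * d) * iexp (\<Sum>k<n. (t k + u k) * x k))"
  by (simp add: fun_eq_iff exp_add[symmetric] distrib_left distrib_right sum.distrib)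
 then show ?case using trig_sums.monomial[of "c * d" "\<lambda>k. t k + u k" n] by simp
next
 case (add f g)
 then show ?case by (simp add: distrib_left trig_sums.add)
qed

lemma trig_sums_mult:
 assumes "f \<in> trig_sums n" "g \<in> trig_sums n"
 shows "(\<lambda>x. f x * g x) \<in> trig_sums n" using assms(1)
proof induction
 case (monomial c t)
 then show ?case using trig_sums_mult_monomial[OF assms(2)] by simp
next
 case (add f g)
 then show ?case by (simp add: distrib_right trig_sums.add)
qed

text \<open>Euler's formula gives two characters along the k-th axis. Together with closure under
  products this makes every polynomial in the sines a member of the class.\<close>

lemma trig_sums_sin:
 assumes "k < n"
 shows "(\<lambda>x. complex_of_real (sin (a * x k))) \<in> trig_sums n"
proof -
 have s: "(\<Sum>j<n. (if j = k then b else 0) * x j) = b * x k" for b :: real and x :: "nat \<Rightarrow> real"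
 proof -
  have "(\<Sum>j<n. (if j = k then b else 0) * x j) = (\<Sum>j<n. if j = k then b * x j else 0)"
   by (rule sum.cong) auto
  also have "\<dots> = b * x k" using assms by simp
  finally show ?thesis .
 qed
 have m: "(\<lambda>x. c * iexp (b * x k)) \<in> trig_sums n" for b :: real and c
  using trig_sums.monomial[of c "\<lambda>j. if j = k then b else 0" n] by (simp only: s)
 have "complex_of_real (sin (a * x k)) =
  (-\<i>/2) * iexp (a * x k) + (\<i>/2) * iexp ((- a) * x k)" for x
  by (simp add: sin_exp_eq sin_of_real[symmetric] field_simps exp_minus)
 then have "(\<lambda>x. complex_of_real (sin (a * x k))) =
  (\<lambda>x. (-\<i>/2) * iexp (a * x k) + (\<i>/2) * iexp ((- a) * x k))" by presburger
 then show ?thesis using trig_sums.add[OF m m] by presburger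
qed

lemma trig_sums_integrable:
 assumes "g \<in> trig_sums n" "prob_space M" "\<And>k. k < n \<Longrightarrow> Z k \<in> borel_measurable M"
 shows "integrable M (\<lambda>w. g (\<lambda>k. Z k w))" using assms(1)
proof induction
 case (monomial c t)
 interpret prob_space M by fact
 have "integrable M (\<lambda>w. iexp (\<Sum>k<n. t k * Z k w))"
  by (rule integrable_const_bound[of _ 1]) (use assms(3) in \<open>auto\<close>)
 then show ?case by simp
qed auto

lemma trig_sums_convergence:
 assumes "g \<in> trig_sums n" and P: "\<And>i. prob_space (P i)" and Q: "prob_space Q"
  and X: "\<And>i k. k < n \<Longrightarrow> X i k \<in> borel_measurable (P i)"
  and Y: "\<And>k. k < n \<Longrightarrow> Y k \<in> borel_measurable Q"
  and cf: "\<And>t. (\<lambda>i::nat. CLINT w|P i. iexp (\<Sum>k<n. t k * X i k w)) \<longlonglongrightarrow>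
   (CLINT w|Q. iexp (\<Sum>k<n. t k * Y k w))"
 shows "(\<lambda>i. CLINT w|P i. g (\<lambda>k. X i k w)) \<longlonglongrightarrow> (CLINT w|Q. g (\<lambda>k. Y k w))"
 using assms(1)
proof induction
 case (monomial c t)
 then show ?case using cf[of t] by (auto intro!: tendsto_intros)
next
 case (add f g)
 have "(CLINT w|P i. f (\<lambda>k. X i k w) + g (\<lambda>k. X i k w)) =
   (CLINT w|P i. f (\<lambda>k. X i k w)) + (CLINT w|P i. g (\<lambda>k. X i k w))" for i
  by (intro Bochner_Integration.integral_add trig_sums_integrable[OF _ P]) (use add.hyps X in simp)+
 moreover have "(CLINT w|Q. f (\<lambda>k. Y k w) + g (\<lambda>k. Y k w)) =
   (CLINT w|Q. f (\<lambda>k. Y k w)) + (CLINT w|Q. g (\<lambda>k. Y k w))"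
  by (intro Bochner_Integration.integral_add trig_sums_integrable[OF _ Q]) (use add.hyps Y in simp)+
 ultimately show ?case using add by (auto intro!: tendsto_intros)
qed

text \<open>
 Through \<open>s\<^sub>k = sin (a x\<^sub>k)\<close> with \<open>a = \<pi> / (2 K)\<close> the box \<open>[-K, K]\<^sup>n\<close> is identified with
 \<open>[-1, 1]\<^sup>n\<close>, and polynomials in \<open>s\<close> are trigonometric sums in \<open>x\<close>. Hence the approximation
 furnished by Stone and Weierstrass is bounded also off the box.
\<close>

lemma trig_sums_approximation:
 fixes f :: "(nat \<Rightarrow> real) \<Rightarrow> real"
 assumes f: "continuous_on UNIV f" and B: "\<And>x. \<bar>f x\<bar> \<le> B" and K: "K > 0" and e: "e > 0"
 shows "\<exists>g\<in>trig_sums n. (\<forall>x. \<bar>Re (g x)\<bar> \<le> B + e) \<and>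
  (\<forall>x. (\<forall>k<n. \<bar>x k\<bar> \<le> K) \<longrightarrow> \<bar>f (\<lambda>k. if k < n then x k else 0) - Re (g x)\<bar> \<le> e)"
proof -
 define a where "a = pi / (2 * K)"
 have a: "a > 0" using K by (simp add: a_def)
 define \<sigma> where "\<sigma> = (\<lambda>(x::nat\<Rightarrow>real) k. if k < n then sin (a * x k) else 0)"
 \<comment> \<open>Freezing the coordinates from \<open>n\<close> on at 0 means that two points of
   \<open>S\<close> always differ in a coordinate below \<open>n\<close>, and such a coordinate
   function belongs to \<open>R\<close>.\<close>
 define S :: "(nat \<Rightarrow> real) set" where "S = PiE UNIV (\<lambda>k. if k < n then {-1..1} else {0})"
 \<comment> \<open>The elements of \<open>R\<close> are functions of the sines, so a trigonometric
   representation is asked for only after composition with \<sigma>.\<close>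
 define R where "R = {p. continuous_on S p \<and> (\<exists>g\<in>trig_sums n. \<forall>x. complex_of_real (p (\<sigma> x)) = g x)}"
 have compS: "compact S"
  unfolding S_def compactin_euclidean_iff[symmetric] euclidean_product_topology[symmetric] compactin_PiE by auto
 have \<sigma>S: "\<sigma> x \<in> S" for x by (auto simp: S_def \<sigma>_def)
 have ring: "function_ring_on R S"
 proof
  show "compact S" by fact
  show "continuous_on S f" if "f \<in> R" for f using that by (simp add: R_def)
  show "(\<lambda>x. f x + g x) \<in> R" if "f \<in> R" "g \<in> R" for f g
  proof -
   from that obtain f' g' where "f' \<in> trig_sums n" "\<forall>x. complex_of_real (f (\<sigma> x)) = f' x"
    "g' \<in> trig_sums n" "\<forall>x. complex_of_real (g (\<sigma> x)) = g' x" by (auto simp: R_def)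
   then show ?thesis using that trig_sums.add[of f' n g']
    by (auto simp: R_def intro!: continuous_intros bexI[of _ "\<lambda>x. f' x + g' x"])
  qed
  show "(\<lambda>x. f x * g x) \<in> R" if "f \<in> R" "g \<in> R" for f g
  proof -
   from that obtain f' g' where "f' \<in> trig_sums n" "\<forall>x. complex_of_real (f (\<sigma> x)) = f' x"
    "g' \<in> trig_sums n" "\<forall>x. complex_of_real (g (\<sigma> x)) = g' x" by (auto simp: R_def)
   then show ?thesis using that trig_sums_mult[of f' n g']
    by (auto simp: R_def intro!: continuous_intros bexI[of _ "\<lambda>x. f' x * g' x"])
  qed
  show "(\<lambda>_. c) \<in> R" for c using trig_sums_const[of "complex_of_real c" n] by (auto simp: R_def)
  show "\<exists>f\<in>R. f x \<noteq> f y" if "x \<in> S" "y \<in> S" "x \<noteq> y" for x y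
  proof -
   obtain k where k: "x k \<noteq> y k" using \<open>x \<noteq> y\<close> by blast
   have kn: "k < n"
   proof (rule ccontr)
    assume "\<not> k < n"
    then have "x k = 0" "y k = 0" using that unfolding S_def PiE_iff by (metis UNIV_I singletonD)+
    then show False using k by simp
   qed
   have "(\<lambda>x. x k) \<in> R" unfolding R_def using trig_sums_sin[OF kn, of a] kn
    by (auto simp: \<sigma>_def intro!: continuous_on_subset[OF continuous_on_product_coordinates])
   then show ?thesis using k by (intro bexI[of _ "\<lambda>x. x k"])
  qed
 qed
 \<comment> \<open>\<open>h\<close> is \<open>f\<close> expressed in the sine coordinates. As arcsin
   has values between \<open>- pi / 2\<close> and \<open>pi / 2\<close>, and
   \<open>a = pi / (2 * K)\<close>, the argument of \<open>f\<close> stays in the box of half-width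
   \<open>K\<close>.\<close>
 define h where "h = (\<lambda>s::nat\<Rightarrow>real. f (\<lambda>k. if k < n then arcsin (s k) / a else 0))"
 have "continuous_on S h" unfolding h_def
 proof (rule continuous_on_compose2[OF f])
  show "continuous_on S (\<lambda>s k. if k < n then arcsin (s k) / a else 0)"
  proof (rule continuous_on_coordinatewise_then_product, goal_cases)
   case (1 k)
   show ?case
   proof (cases "k < n")
    case True
    have "continuous_on S (\<lambda>s. s k)"
     by (rule continuous_on_subset[OF continuous_on_product_coordinates]) simp
    then have "continuous_on S (\<lambda>s. arcsin (s k))"
     by (rule continuous_on_arcsin) (use True in \<open>auto simp: S_def PiE_iff split: if_splits\<close>)
    then show ?thesis using True a by (auto intro!: continuous_intros)
   qed simp
  qed
 qed simp
 then obtain p where p: "p \<in> R" "\<forall>s\<in>S. \<bar>h s - p s\<bar> < e"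
  using function_ring_on.Stone_Weierstrass_basic[OF ring _ e, of h] by blast
 then obtain g where g: "g \<in> trig_sums n" "\<And>x. complex_of_real (p (\<sigma> x)) = g x"
  by (auto simp: R_def)
 have Reg: "Re (g x) = p (\<sigma> x)" for x using g(2)[of x] by (metis Re_complex_of_real)
 show ?thesis
 proof (intro bexI[OF _ g(1)] conjI allI impI)
  fix x :: "nat \<Rightarrow> real"
  let ?t1 = "(\<lambda>k. if k < n then x k else 0)"
  show "\<bar>Re (g x)\<bar> \<le> B + e"
   using bspec[OF p(2) \<sigma>S[of x]] B[of "\<lambda>k. if k < n then arcsin (\<sigma> x k) / a else 0"]
   by (simp add: Reg h_def)
  assume x: "\<forall>k<n. \<bar>x k\<bar> \<le> K"
  have "arcsin (sin (a * x k)) = a * x k" if "k < n" for k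
  proof -
   have "\<bar>a * x k\<bar> \<le> a * K" using x that a by (simp add: abs_mult)
   also have "a * K = pi / 2" using K by (simp add: a_def)
   finally show ?thesis by (intro arcsin_sin) auto
  qed
  then have "(\<lambda>k. if k < n then arcsin (\<sigma> x k) / a else 0) = ?t1"
   using a by (auto simp: fun_eq_iff \<sigma>_def)
  then have "h (\<sigma> x) = f ?t1" unfolding h_def by simp
  then show "\<bar>f ?t1 - Re (g x)\<bar> \<le> e" using bspec[OF p(2) \<sigma>S[of x]] by (simp add: Reg)
 qed
qed

text \<open>Levy's theorem on the line turns the characteristic functions into weak convergence, and
  a continuous ramp squeezed between two tail indicators transfers the tail bound of the limit to
  the sequence. The bounds hold for all larger \<open>K\<close> as well, so that one
  \<open>K\<close> can be shared by several coordinates.\<close>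

lemma eventually_tight_of_char:
 fixes X :: "nat \<Rightarrow> 'w \<Rightarrow> real"
 assumes P: "\<And>i. prob_space (P i)" and Q: "prob_space Q"
  and X: "\<And>i. X i \<in> borel_measurable (P i)" and Y: "Y \<in> borel_measurable Q"
  and cf: "\<And>t. (\<lambda>i::nat. CLINT u|P i. iexp (t * X i u)) \<longlonglongrightarrow> (CLINT u|Q. iexp (t * Y u))"
  and e: "e > 0"
 shows "\<exists>K0>0. \<forall>K\<ge>K0. measure Q {u\<in>space Q. \<bar>Y u\<bar> > K} < e \<and>
  (\<forall>\<^sub>F i in sequentially. measure (P i) {u\<in>space (P i). \<bar>X i u\<bar> > K} < e)"
proof -
 let ?t2 = "(\<Inter>k. {u\<in>space Q. \<bar>Y u\<bar> > real k})"
 let ?t1 = "(\<lambda>k. measure Q {u\<in>space Q. \<bar>Y u\<bar> > real k})"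
 interpret Q: prob_space Q by fact
 have rd: "real_distribution (distr (P i) borel (X i))" for i
  using prob_space.real_distribution_distr[OF P X] .
 have rdQ: "real_distribution (distr Q borel Y)" by (rule Q.real_distribution_distr[OF Y])
 have ch: "(\<lambda>i. char (distr (P i) borel (X i)) t) \<longlonglongrightarrow> char (distr Q borel Y) t" for t
 proof -
  have "char (distr (P i) borel (X i)) t = (CLINT u|P i. iexp (t * X i u))" for i
   unfolding char_def by (subst integral_distr) (use X in auto)
  moreover have "char (distr Q borel Y) t = (CLINT u|Q. iexp (t * Y u))"
   unfolding char_def by (subst integral_distr) (use Y in auto)
  ultimately show ?thesis using cf by simp
 qed
 have wc: "weak_conv_m (\<lambda>i. distr (P i) borel (X i)) (distr Q borel Y)"
  by (rule levy_continuity[OF rd rdQ ch])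
 have "?t1 \<longlonglongrightarrow> measure Q ?t2"
  using Y by (intro Q.finite_Lim_measure_decseq) (auto simp: decseq_def intro: order.strict_trans1 [OF of_nat_mono])
 moreover have "?t2 = {}"
 proof -
  have "\<exists>k. \<not> \<bar>Y x\<bar> > real k" for x
   using real_arch_simple[of "\<bar>Y x\<bar>"] by (simp add: not_less)
  then show ?thesis by blast
 qed
 ultimately have "?t1 \<longlonglongrightarrow> 0" by simp
 then have "\<forall>\<^sub>F k in sequentially. measure Q {u\<in>space Q. \<bar>Y u\<bar> > real k} < e"
  using e by (rule order_tendstoD)
 then obtain k where k: "measure Q {u\<in>space Q. \<bar>Y u\<bar> > real k} < e"
  by (auto simp: eventually_sequentially)
 \<comment> \<open>The ramp vanishes for \<open>\<bar>x\<bar> \<le> k\<close> and equals 1 from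
   \<open>k + 1\<close> on, so it lies between the two tail indicators.\<close>
 define h where "h = (\<lambda>x::real. min 1 (max 0 (\<bar>x\<bar> - real k)))"
 have hc: "isCont h x" for x unfolding h_def by (intro continuous_intros)
 have hb: "\<bar>h x\<bar> \<le> 1" for x by (auto simp: h_def)
 have hm[measurable]: "h \<in> borel_measurable borel" unfolding h_def by measurable
 have "(\<lambda>i. \<integral>x. h x \<partial>distr (P i) borel (X i)) \<longlonglongrightarrow> (\<integral>x. h x \<partial>distr Q borel Y)"
  by (rule weak_conv_imp_bdd_ae_continuous_conv[OF rd rdQ wc]) (use hc hb in auto)
 then have conv: "(\<lambda>i. \<integral>u. h (X i u) \<partial>P i) \<longlonglongrightarrow> (\<integral>u. h (Y u) \<partial>Q)"
  using X Y by (simp add: integral_distr)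
 have "(\<integral>u. h (Y u) \<partial>Q) \<le> (\<integral>u. indicator {u\<in>space Q. \<bar>Y u\<bar> > real k} u \<partial>Q)"
  using Y hb by (intro integral_mono Q.integrable_const_bound[of _ 1]) (auto simp: h_def indicator_def)
 also have "\<dots> = measure Q {u\<in>space Q. \<bar>Y u\<bar> > real k}"
  by (simp add: Int_absorb2 subset_eq)
 also note k
 finally have "\<forall>\<^sub>F i in sequentially. (\<integral>u. h (X i u) \<partial>P i) < e"
  using conv by (intro order_tendstoD(2))
 moreover have "measure (P i) {u\<in>space (P i). \<bar>X i u\<bar> > K} \<le> (\<integral>u. h (X i u) \<partial>P i)"
  if "K \<ge> real k + 1" for K i
 proof -
  interpret Pi: prob_space "P i" by fact
  have "measure (P i) {u\<in>space (P i). \<bar>X i u\<bar> > K} = (\<integral>u. indicator {u\<in>space (P i). \<bar>X i u\<bar> > K} u \<partial>P i)"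
   by (simp add: Int_absorb2 subset_eq)
  also have "\<dots> \<le> (\<integral>u. h (X i u) \<partial>P i)"
   using X[of i] hb that by (intro integral_mono Pi.integrable_const_bound[of _ 1])
    (auto simp: h_def indicator_def)
  finally show ?thesis .
 qed
 ultimately have ev: "\<forall>\<^sub>F i in sequentially. measure (P i) {u\<in>space (P i). \<bar>X i u\<bar> > K} < e"
  if "K \<ge> real k + 1" for K using that by (auto elim!: eventually_mono intro: le_less_trans)
 have "measure Q {u\<in>space Q. \<bar>Y u\<bar> > K} < e" if "K \<ge> real k + 1" for K
  by (rule le_less_trans[OF _ k], rule Q.finite_measure_mono) (use that Y in auto)
 then show ?thesis using ev by (intro exI[of _ "real k + 1"]) auto
qed

lemma borel_measurable_pad:
 fixes f :: "(nat \<Rightarrow> real) \<Rightarrow> real"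
 assumes "continuous_on UNIV f" "\<And>k. k < n \<Longrightarrow> X k \<in> borel_measurable M"
 shows "(\<lambda>w. f (\<lambda>k. if k < n then X k w else 0)) \<in> borel_measurable M"
proof -
 have "(\<lambda>w k. if k < n then X k w else 0) \<in> measurable M borel"
 proof (rule measurable_coordinatewise_then_product)
  show "(\<lambda>w. if k < n then X k w else 0) \<in> borel_measurable M" for k
   using assms(2)[of k] by (cases "k < n") auto
 qed
 from measurable_compose[OF this borel_measurable_continuous_onI[OF assms(1)]] show ?thesis .
qed

text \<open>On the box the error is at most \<open>e\<close>. Off it the two integrands are bounded
  by \<open>B\<close> and \<open>B + e\<close>, and a union bound over the coordinates controls the
  probability of leaving the box.\<close>

lemma integral_trig_approximation:
 fixes f :: "(nat \<Rightarrow> real) \<Rightarrow> real"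
 assumes "prob_space M" and Z[measurable]: "\<And>k. k < n \<Longrightarrow> Z k \<in> borel_measurable M"
  and f: "continuous_on UNIV f" and B: "\<And>x. \<bar>f x\<bar> \<le> B" and e: "e > 0" "e' \<ge> 0"
  and g: "g \<in> trig_sums n" "\<forall>x. \<bar>Re (g x)\<bar> \<le> B + e"
   "\<forall>x. (\<forall>k<n. \<bar>x k\<bar> \<le> K) \<longrightarrow> \<bar>f (\<lambda>k. if k < n then x k else 0) - Re (g x)\<bar> \<le> e"
  and t: "\<And>k. k < n \<Longrightarrow> measure M {w\<in>space M. \<bar>Z k w\<bar> > K} \<le> e'"
 shows "\<bar>(\<integral>w. f (\<lambda>k. if k < n then Z k w else 0) \<partial>M) - Re (CLINT w|M. g (\<lambda>k. Z k w))\<bar>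
  \<le> e + (2 * B + e) * (real n * e')"
proof -
 interpret prob_space M by fact
 let ?f = "\<lambda>w. f (\<lambda>k. if k < n then Z k w else 0)"
 let ?g = "\<lambda>w. Re (g (\<lambda>k. Z k w))"
 define bad where "bad = (\<Union>k<n. {w\<in>space M. \<bar>Z k w\<bar> > K})"
 have bad[measurable]: "bad \<in> sets M" unfolding bad_def by (intro sets.finite_UN) auto
 have fi: "integrable M ?f"
  by (rule integrable_const_bound[of _ B]) (use B borel_measurable_pad[OF f Z] in auto)
 have gi: "integrable M (\<lambda>w. g (\<lambda>k. Z k w))"
  by (rule trig_sums_integrable[OF g(1) assms(1)]) (rule Z)
 have B0: "B \<ge> 0" using B[of "\<lambda>_. 0"] by linarith
 have "measure M bad \<le> (\<Sum>k<n. measure M {w\<in>space M. \<bar>Z k w\<bar> > K})"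
  unfolding bad_def by (rule finite_measure_subadditive_finite) auto
 also have "\<dots> \<le> real n * e'"
  using sum_mono[of "{..<n}" "\<lambda>k. measure M {w\<in>space M. \<bar>Z k w\<bar> > K}" "\<lambda>_. e'"] t by simp
 finally have mb: "measure M bad \<le> real n * e'" .
 have "\<bar>(\<integral>w. ?f w \<partial>M) - Re (CLINT w|M. g (\<lambda>k. Z k w))\<bar> = \<bar>\<integral>w. ?f w - ?g w \<partial>M\<bar>"
  using fi gi by (simp add: Bochner_Integration.integral_diff)
 also have "\<dots> \<le> (\<integral>w. \<bar>?f w - ?g w\<bar> \<partial>M)" by (rule integral_abs_bound)
 also have "\<dots> \<le> (\<integral>w. e + (2 * B + e) * indicator bad w \<partial>M)"
 proof (rule integral_mono)
  show "integrable M (\<lambda>w. \<bar>?f w - ?g w\<bar>)" using fi gi by auto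
  show "integrable M (\<lambda>w. e + (2 * B + e) * indicator bad w)"
   by (intro Bochner_Integration.integrable_add integrable_mult_right integrable_real_indicator) (auto simp: emeasure_eq_measure)
  fix w assume "w \<in> space M"
  show "\<bar>?f w - ?g w\<bar> \<le> e + (2 * B + e) * indicator bad w"
  proof (cases "w \<in> bad")
   case True
   then show ?thesis using B[of "\<lambda>k. if k < n then Z k w else 0"] spec[OF g(2), of "\<lambda>k. Z k w"] e by simp
  next
   case False
   then show ?thesis using spec[OF g(3), of "\<lambda>k. Z k w"] \<open>w \<in> space M\<close> by (auto simp: bad_def not_less)
  qed
 qed
 also have "\<dots> = e + (2 * B + e) * measure M bad" using bad by (simp add: emeasure_eq_measure prob_space)
 also have "\<dots> \<le> e + (2 * B + e) * (real n * e')"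
  using mb B0 e by (intro add_left_mono mult_left_mono) auto
 finally show ?thesis .
qed

text \<open>Coordinatewise tightness confines the vectors to one box up to a small probability, on
  the box \<open>f\<close> is nearly a trigonometric sum, and expectations of trigonometric sums
  converge. The vectors appear in the padded form of \<open>fdd_converges\<close>.\<close>

theorem multivariate_levy_continuity:
 fixes X :: "nat \<Rightarrow> nat \<Rightarrow> 'w \<Rightarrow> real" and f :: "(nat \<Rightarrow> real) \<Rightarrow> real"
 assumes P: "\<And>i. prob_space (P i)" and Q: "prob_space Q"
  and X: "\<And>i k. k < n \<Longrightarrow> X i k \<in> borel_measurable (P i)"
  and Y: "\<And>k. k < n \<Longrightarrow> Y k \<in> borel_measurable Q"
  and cf: "\<And>t. (\<lambda>i::nat. CLINT \<omega>|P i. iexp (\<Sum>k<n. t k * X i k \<omega>)) \<longlonglongrightarrow>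
   (CLINT \<omega>|Q. iexp (\<Sum>k<n. t k * Y k \<omega>))" and f: "continuous_on UNIV f" "bounded (range f)"
 shows "(\<lambda>i. \<integral>\<omega>. f (\<lambda>k. if k < n then X i k \<omega> else 0) \<partial>P i) \<longlonglongrightarrow>
  (\<integral>\<omega>. f (\<lambda>k. if k < n then Y k \<omega> else 0) \<partial>Q)"
proof -
 let ?t2 = "(\<integral>\<omega>. f (\<lambda>k. if k < n then Y k \<omega> else 0) \<partial>Q)"
 obtain B where B: "\<And>x. \<bar>f x\<bar> \<le> B" using f(2) by (auto simp: bounded_iff)
 have B0: "B \<ge> 0" using B[of "\<lambda>_. 0"] by linarith
 show ?thesis
 proof (rule tendstoI)
  fix r :: real assume r: "r > 0"
  \<comment> \<open>Two approximation errors of at most \<open>e + r / 16\<close> and one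
    convergence error below \<open>r / 8\<close> add up to less than \<open>r\<close>. The bound
    \<open>e \<le> 1\<close> keeps \<open>(2 * B + e) * n\<close> below \<open>D\<close>.\<close>
  define e where "e = min 1 (r / 4)"
  define D where "D = (2 * B + 1) * (real n + 1)"
  have D: "D > 0" using B0 by (simp add: D_def)
  define e' where "e' = r / (16 * D)"
  have e: "e > 0" "e \<le> 1" "e \<le> r / 4" using r by (auto simp: e_def)
  have e': "e' > 0" using r D by (simp add: e'_def)
  have small: "(2 * B + e) * (real n * e') \<le> r / 16"
  proof -
   have "(2 * B + e) * (real n * e') \<le> (2 * B + 1) * ((real n + 1) * e')"
    using e e' B0 by (intro mult_mono) auto
   also have "\<dots> = D * e'" by (simp add: D_def)
   also have "\<dots> = r / 16" using D by (simp add: e'_def)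
   finally show ?thesis .
  qed
  have cf1: "(\<lambda>i::nat. CLINT \<omega>|P i. iexp (t * X i k \<omega>)) \<longlonglongrightarrow> (CLINT \<omega>|Q. iexp (t * Y k \<omega>))" if "k < n" for k t
  proof -
   have "(\<Sum>j<n. (if j = k then t else 0) * x j) = t * x k" for x :: "nat \<Rightarrow> real"
   proof -
    have "(\<Sum>j<n. (if j = k then t else 0) * x j) = (\<Sum>j<n. if j = k then t * x j else 0)"
     by (rule sum.cong) auto
    also have "\<dots> = t * x k" using that by simp
    finally show ?thesis .
   qed
   then show ?thesis using cf[of "\<lambda>j. if j = k then t else 0"] by simp
  qed
  have "\<forall>k\<in>{..<n}. \<exists>K0. \<forall>K\<ge>K0. measure Q {\<omega>\<in>space Q. \<bar>Y k \<omega>\<bar> > K} < e' \<and>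
   (\<forall>\<^sub>F i in sequentially. measure (P i) {\<omega>\<in>space (P i). \<bar>X i k \<omega>\<bar> > K} < e')"
  proof
   fix k assume "k \<in> {..<n}"
   then have k: "k < n" by simp
   show "\<exists>K0. \<forall>K\<ge>K0. measure Q {\<omega>\<in>space Q. \<bar>Y k \<omega>\<bar> > K} < e' \<and>
    (\<forall>\<^sub>F i in sequentially. measure (P i) {\<omega>\<in>space (P i). \<bar>X i k \<omega>\<bar> > K} < e')"
    using eventually_tight_of_char[OF P Q X[OF k] Y[OF k] cf1[OF k] e'] by blast
  qed
  from bchoice[OF this] obtain K0 where
   "\<forall>k\<in>{..<n}. \<forall>K\<ge>K0 k. measure Q {\<omega>\<in>space Q. \<bar>Y k \<omega>\<bar> > K} < e' \<and>
   (\<forall>\<^sub>F i in sequentially. measure (P i) {\<omega>\<in>space (P i). \<bar>X i k \<omega>\<bar> > K} < e')" ..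
  then have K0: "measure Q {\<omega>\<in>space Q. \<bar>Y k \<omega>\<bar> > K} < e'"
   "\<forall>\<^sub>F i in sequentially. measure (P i) {\<omega>\<in>space (P i). \<bar>X i k \<omega>\<bar> > K} < e'"
   if "k < n" "K \<ge> K0 k" for k K using that by simp_all
  define K where "K = (\<Sum>k<n. \<bar>K0 k\<bar>) + 1"
  have Kpos: "K > 0" unfolding K_def by (simp add: add_nonneg_pos sum_nonneg)
  have KK: "K \<ge> K0 k" if "k < n" for k
  proof -
   have "\<bar>K0 k\<bar> \<le> (\<Sum>k<n. \<bar>K0 k\<bar>)" using that by (intro member_le_sum) auto
   then show ?thesis by (simp add: K_def)
  qed
  obtain g where g: "g \<in> trig_sums n" "\<forall>x. \<bar>Re (g x)\<bar> \<le> B + e"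
   "\<forall>x. (\<forall>k<n. \<bar>x k\<bar> \<le> K) \<longrightarrow> \<bar>f (\<lambda>k. if k < n then x k else 0) - Re (g x)\<bar> \<le> e"
   using trig_sums_approximation[OF f(1) B Kpos e(1), of n] by blast
  let ?t1 = "(CLINT \<omega>|Q. g (\<lambda>k. Y k \<omega>))"
  have Qa: "\<bar>?t2 - Re ?t1\<bar> \<le> e + r / 16"
  proof (rule order_trans[OF integral_trig_approximation[OF Q Y f(1) B e(1) less_imp_le[OF e'] g(1,2,3)]])
   show "measure Q {\<omega>\<in>space Q. \<bar>Y k \<omega>\<bar> > K} \<le> e'" if "k < n" for k
    by (rule less_imp_le[OF K0(1)[OF that KK[OF that]]])
  qed (use small in simp_all)
  have "\<forall>\<^sub>F i in sequentially. \<forall>k\<in>{..<n}. measure (P i) {\<omega>\<in>space (P i). \<bar>X i k \<omega>\<bar> > K} < e'"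
   by (intro eventually_ball_finite) (use K0(2) KK in auto)
  then have Pa: "\<forall>\<^sub>F i in sequentially. \<bar>(\<integral>\<omega>. f (\<lambda>k. if k < n then X i k \<omega> else 0) \<partial>P i) - Re (CLINT \<omega>|P i. g (\<lambda>k. X i k \<omega>))\<bar> \<le> e + r / 16"
  proof eventually_elim
   case (elim i)
   show ?case
   proof (rule order_trans[OF integral_trig_approximation[OF P X f(1) B e(1) less_imp_le[OF e'] g(1,2,3)]])
    show "measure (P i) {\<omega>\<in>space (P i). \<bar>X i k \<omega>\<bar> > K} \<le> e'" if "k < n" for k
     using elim that by (auto intro: less_imp_le)
   qed (use small in simp_all)
  qed
  have "(\<lambda>i. Re (CLINT \<omega>|P i. g (\<lambda>k. X i k \<omega>))) \<longlonglongrightarrow> Re ?t1"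
   by (intro tendsto_Re trig_sums_convergence[OF g(1) P Q X Y cf])
  then have "\<forall>\<^sub>F i in sequentially. dist (Re (CLINT \<omega>|P i. g (\<lambda>k. X i k \<omega>))) (Re ?t1) < r / 8"
   using r by (intro tendstoD) auto
  with Pa show "\<forall>\<^sub>F i in sequentially. dist (\<integral>\<omega>. f (\<lambda>k. if k < n then X i k \<omega> else 0) \<partial>P i)
    ?t2 < r"
  proof eventually_elim
   case (elim i)
   have chain: "\<bar>u - v\<bar> < r" if "\<bar>u - u'\<bar> \<le> e + r / 16" "\<bar>v - v'\<bar> \<le> e + r / 16" "\<bar>u' - v'\<bar> < r / 8"
    for u v u' v' :: real using that e(3) r by linarith
   show ?case unfolding dist_real_def by (rule chain[OF elim(1) Qa elim(2)[unfolded dist_real_def]])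
  qed
 qed
qed

subsection \<open>Integrals with respect to Poisson random measures\<close>

lemma cmod_iexp_diff_le: "cmod (iexp x - iexp y) \<le> \<bar>x - y\<bar>"
proof -
 have "iexp x - iexp y = iexp y * (iexp (x - y) - 1)" by (simp add: algebra_simps exp_diff)
 then have "cmod (iexp x - iexp y) = cmod (iexp (x - y) - 1)"
  by (simp only: norm_mult norm_exp_i_times mult_1_left)
 also have "\<dots> \<le> \<bar>x - y\<bar>" using iexp_approx1[of "x - y" 0] by simp
 finally show ?thesis .
qed

text \<open>The exponential is bounded and 1-Lipschitz: where the two variables are within
  \<open>e / 3\<close> the Lipschitz bound applies, and elsewhere the difference is at most 2, on an
  event of probability below \<open>e / 6\<close>.\<close>

lemma tendsto_expectation_iexp:
 assumes "prob_space M" "\<And>n. X n \<in> borel_measurable M" "Y \<in> borel_measurable M"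
  and P: "\<And>d. d > 0 \<Longrightarrow> (\<lambda>n::nat. measure M {w\<in>space M. \<bar>X n w - Y w\<bar> > d}) \<longlonglongrightarrow> 0"
 shows "(\<lambda>n. CLINT w|M. iexp (X n w)) \<longlonglongrightarrow> (CLINT w|M. iexp (Y w))" (is "_ \<longlonglongrightarrow> ?r1")
proof (rule LIM_zero_cancel, rule tendsto_norm_zero_cancel, rule tendstoI)
 interpret prob_space M by fact
 note [measurable] = assms(2,3)
 fix e :: real assume e: "e > 0"
 have "\<forall>\<^sub>F n in sequentially. measure M {w\<in>space M. \<bar>X n w - Y w\<bar> > e / 3} < e / 6"
  using P[of "e / 3"] e by (intro order_tendstoD(2)) auto
 then show "\<forall>\<^sub>F n in sequentially. dist (cmod ((CLINT w|M. iexp (X n w)) - ?r1)) 0 < e"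
 proof eventually_elim
  case (elim n)
  define B where "B = {w\<in>space M. \<bar>X n w - Y w\<bar> > e / 3}"
  have [measurable]: "B \<in> sets M" unfolding B_def by measurable
  have i: "integrable M (\<lambda>w. iexp (X n w))" "integrable M (\<lambda>w. iexp (Y w))"
   by (auto intro!: integrable_const_bound[of _ 1])
  have "cmod ((CLINT w|M. iexp (X n w)) - ?r1) =
    cmod (CLINT w|M. iexp (X n w) - iexp (Y w))" using i by simp
  also have "\<dots> \<le> (\<integral>w. cmod (iexp (X n w) - iexp (Y w)) \<partial>M)"
   by (rule integral_norm_bound)
  also have "\<dots> \<le> (\<integral>w. e / 3 + 2 * indicator B w \<partial>M)"
  proof (rule integral_mono)
   fix w assume "w \<in> space M"
   note 1 = cmod_iexp_diff_le[of "X n w" "Y w"]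
   have 2: "cmod (iexp (X n w) - iexp (Y w)) \<le> 2"
    using norm_triangle_ineq4[of "iexp (X n w)" "iexp (Y w)"] by simp
   show "cmod (iexp (X n w) - iexp (Y w)) \<le> e / 3 + 2 * indicator B w"
    using 1 2 e \<open>w \<in> space M\<close> by (auto simp: B_def indicator_def)
  next
   show "integrable M (\<lambda>w. e / 3 + 2 * indicator B w)"
    by (intro Bochner_Integration.integrable_add integrable_mult_right integrable_real_indicator)
     (auto simp: emeasure_eq_measure)
  qed (use i in auto)
  also have "\<dots> = e / 3 + 2 * measure M B" by (simp add: emeasure_eq_measure prob_space)
  also have "\<dots> < e" using elim e by (simp add: B_def)
  finally show ?case by simp
 qed
qed

lemma cmod_iexp_minus_one_le: "cmod (iexp x - 1) \<le> \<bar>x\<bar>" using cmod_iexp_diff_le[of x 0] by simp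

definition Psi :: "real \<Rightarrow> complex" where
 "Psi x = iexp x - 1 - \<i> * complex_of_real x"

text \<open>Quadratic smallness at 0 is what makes \<open>Psi\<close> integrable against an infinite
  intensity of small grains; the linear bound \<open>cmod_Psi_le'\<close> takes over for large
  arguments.\<close>

lemma cmod_Psi_le: "cmod (Psi x) \<le> x\<^sup>2 / 2"
 using iexp_approx1[of x 1] by (simp add: Psi_def numeral_2_eq_2 algebra_simps)

text \<open>In the small-grain regime this bound allows averages of a function over grains to be
  replaced by the function itself.\<close>

lemma cmod_Psi_diff_le: "cmod (Psi x - Psi y) \<le> 2 * \<bar>x - y\<bar>"
proof -
 have "Psi x - Psi y = (iexp x - iexp y) - \<i> * complex_of_real (x - y)"
  by (simp add: Psi_def algebra_simps)
 also have "cmod \<dots> \<le> \<bar>x - y\<bar> + \<bar>x - y\<bar>"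
  by (rule order_trans[OF norm_triangle_ineq4 add_mono[OF cmod_iexp_diff_le]])
   (simp only: norm_mult norm_of_real norm_ii mult_1_left order_refl)
 finally show ?thesis by simp
qed

lemma Psi_0 [simp]: "Psi 0 = 0" by (simp add: Psi_def)

lemma cmod_Psi_le': "cmod (Psi x) \<le> 2 * \<bar>x\<bar>" using cmod_Psi_diff_le[of x 0] by simp

lemma isCont_Psi: "isCont Psi x" unfolding Psi_def by (intro continuous_intros)

lemma Psi_measurable [measurable]: "Psi \<in> borel_measurable borel" unfolding Psi_def by measurable

lemma Re_Psi_le: "Re (Psi x) \<le> 0" by (simp add: Psi_def Re_exp)

section \<open>Counts, Campbell's formula and characteristic functions\<close>

locale poisson_rm =
 fixes P :: "'w measure" and N :: "'w \<Rightarrow> 'z measure" and \<eta> :: "'z measure"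
 assumes poisson: "poisson_random_measure P N \<eta>"

sublocale poisson_rm \<subseteq> prob_space P using poisson by (simp add: poisson_random_measure_def)

context poisson_rm
begin

lemma sets_N: "w \<in> space P \<Longrightarrow> sets (N w) = sets \<eta>"
 using poisson by (simp add: poisson_random_measure_def)

lemma space_N: "w \<in> space P \<Longrightarrow> space (N w) = space \<eta>"
 using sets_N sets_eq_imp_space_eq by blast

lemma measurable_N: "f \<in> measurable \<eta> M \<Longrightarrow> w \<in> space P \<Longrightarrow> f \<in> measurable (N w) M"
 using measurable_cong_sets[OF sets_N refl] by blast

lemma emeasure_N_measurable: "A \<in> sets \<eta> \<Longrightarrow> (\<lambda>w. emeasure (N w) A) \<in> borel_measurable P"
 using poisson by (simp add: poisson_random_measure_def)

text \<open>The definition prescribes only the probabilities of the values 0, 1, 2 and so on. They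
  sum to 1, so the count is almost surely a natural number and has an integer-valued version
  \<open>K\<close> with the Poisson law.\<close>

lemma N_distribution:
 assumes A: "A \<in> sets \<eta>" "emeasure \<eta> A < \<infinity>"
 defines "p \<equiv> \<lambda>k. exp (- measure \<eta> A) * measure \<eta> A ^ k / fact k"
 shows "\<exists>K. K \<in> measurable P (count_space UNIV) \<and>
  (AE w in P. emeasure (N w) A = of_nat (K w)) \<and>
  distr P (count_space UNIV) K = density (count_space UNIV) (\<lambda>k. ennreal (p k))"
proof -
 let ?t20 = "(count_space UNIV)"
 define T where "T = (\<lambda>w. emeasure (N w) A)"
 have [measurable]: "T \<in> borel_measurable P" unfolding T_def using emeasure_N_measurable[OF A(1)] .
 define B where "B = (\<lambda>k::nat. {w\<in>space P. T w = of_nat k})"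
 have [measurable]: "B k \<in> sets P" for k unfolding B_def by measurable
 have pB: "measure P (B k) = p k" for k
  using poisson A by (simp add: poisson_random_measure_def B_def T_def p_def)
 have "(\<lambda>k. measure P (B k)) sums measure P (\<Union>k. B k)"
  by (rule finite_measure_UNION) (auto simp: B_def disjoint_family_on_def)
 moreover have "p sums (exp (- measure \<eta> A) * exp (measure \<eta> A))"
  using sums_mult[OF exp_converges[of "measure \<eta> A"], of "exp (- measure \<eta> A)"]
  by (simp add: p_def divide_inverse ac_simps)
 ultimately have "measure P (\<Union>k. B k) = 1" unfolding pB by (simp add: sums_iff exp_minus)
 then have ae: "AE w in P. w \<in> (\<Union>k. B k)" by (subst prob_eq_1[symmetric]) auto
 define K where "K = (\<lambda>w. nat \<lfloor>enn2real (T w)\<rfloor>)"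
 have Km[measurable]: "K \<in> measurable P ?t20" unfolding K_def by measurable
 have K: "K w = k" if "w \<in> B k" for w k using that by (simp add: K_def B_def)
 have "distr P ?t20 K = density ?t20 (\<lambda>k. ennreal (p k))"
 proof (rule measure_eqI_countable[of _ UNIV])
  fix k
  have "emeasure (distr P ?t20 K) {k} = emeasure P {w\<in>space P. K w = k}"
   by (subst emeasure_distr) (auto intro!: arg_cong[where f="emeasure P"])
  also have "\<dots> = emeasure P (B k)"
  proof (rule emeasure_eq_AE)
   show "AE x in P. (x \<in> {w \<in> space P. K w = k}) = (x \<in> B k)" using ae
   proof eventually_elim
    case (elim w)
    then obtain j where j: "w \<in> B j" by auto
    then show ?case using K[OF j] K[of w k] by (auto simp: B_def)
   qed
  qed auto
  also have "\<dots> = ennreal (p k)" using pB by (simp add: emeasure_eq_measure)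
  finally show "emeasure (distr P ?t20 K) {k} = emeasure (density ?t20 (\<lambda>k. ennreal (p k))) {k}"
   by (simp add: emeasure_density)
 qed auto
 moreover have "AE w in P. emeasure (N w) A = of_nat (K w)" using ae
 proof eventually_elim
  case (elim w)
  then obtain j where j: "w \<in> B j" by auto
  then show ?case using K[OF j] by (simp add: B_def T_def)
 qed
 ultimately show ?thesis using Km by blast
qed

text \<open>For finite intensity this is the mean of the Poisson law, obtained by shifting the
  summation index; for infinite intensity both sides are infinite because the count almost surely
  is.\<close>

lemma nn_integral_emeasure_N:
 assumes A: "A \<in> sets \<eta>"
 shows "(\<integral>\<^sup>+w. emeasure (N w) A \<partial>P) = emeasure \<eta> A" (is "?l1 = _")
proof (cases "emeasure \<eta> A < \<infinity>")
 case True
 define p where "p = (\<lambda>k. exp (- measure \<eta> A) * measure \<eta> A ^ k / fact k)"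
 have p0: "p k \<ge> 0" for k by (simp add: p_def)
 obtain K where K[measurable]: "K \<in> measurable P (count_space UNIV)"
  and ae: "AE w in P. emeasure (N w) A = of_nat (K w)"
  and d: "distr P (count_space UNIV) K = density (count_space UNIV) (\<lambda>k. ennreal (p k))"
  using N_distribution[OF A True] unfolding p_def by blast
 have "?l1 = (\<integral>\<^sup>+w. of_nat (K w) \<partial>P)" by (rule nn_integral_cong_AE[OF ae])
 also have "\<dots> = (\<integral>\<^sup>+k. of_nat k \<partial>distr P (count_space UNIV) K)"
  by (subst nn_integral_distr) auto
 also have "\<dots> = (\<integral>\<^sup>+k. ennreal (p k) * of_nat k \<partial>count_space UNIV)"
  unfolding d by (subst nn_integral_density) auto
 also have "\<dots> = (\<Sum>k. ennreal (p k * real k))"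
  by (subst nn_integral_count_space_nat) (simp add: ennreal_mult' p0 ennreal_of_nat_eq_real_of_nat)
 also have "\<dots> = ennreal (measure \<eta> A)"
 proof -
  have "(\<lambda>k. p (Suc k) * real (Suc k)) sums measure \<eta> A"
  proof -
   have "p (Suc k) * real (Suc k) = measure \<eta> A * exp (- measure \<eta> A) * (measure \<eta> A ^ k /\<^sub>R fact k)" for k
    unfolding p_def by (simp add: field_simps del: of_nat_Suc)
   moreover have "measure \<eta> A * exp (- measure \<eta> A) * exp (measure \<eta> A) = measure \<eta> A"
    by (simp add: exp_minus field_simps)
   ultimately show ?thesis
    using sums_mult[OF exp_converges[of "measure \<eta> A"], of "measure \<eta> A * exp (- measure \<eta> A)"]
    by presburger
  qed
  then have "(\<lambda>k. p k * real k) sums measure \<eta> A" by (subst (asm) sums_Suc_iff) simp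
  then show ?thesis using p0 by (intro suminf_ennreal_eq) auto
 qed
 also have "\<dots> = emeasure \<eta> A" using True by (simp add: emeasure_eq_ennreal_measure less_top)
 finally show ?thesis .
next
 case False
 then have inf: "emeasure \<eta> A = \<infinity>" by (metis infinity_ennreal_def less_top)
 have "AE w in P. emeasure (N w) A = \<infinity>"
  using poisson A inf by (simp add: poisson_random_measure_def)
 then have "?l1 = (\<integral>\<^sup>+w. \<infinity> \<partial>P)" by (rule nn_integral_cong_AE)
 then show ?thesis using inf by (simp add: emeasure_space_1)
qed

text \<open>Measurability of the inner integral is proved in the same induction as the formula,
  because the steps for sums and suprema use it for the smaller functions.\<close>

lemma Campbell_nn_integral:
 assumes "f \<in> borel_measurable \<eta>"
 shows "(\<lambda>w. \<integral>\<^sup>+z. f z \<partial>N w) \<in> borel_measurable P \<and>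
  (\<integral>\<^sup>+w. (\<integral>\<^sup>+z. f z \<partial>N w) \<partial>P) = (\<integral>\<^sup>+z. f z \<partial>\<eta>)"
 using assms
proof (induction rule: borel_measurable_induct)
 case (cong f g)
 have "(\<integral>\<^sup>+z. f z \<partial>N w) = (\<integral>\<^sup>+z. g z \<partial>N w)" if "w \<in> space P" for w
  using cong(3) space_N[OF that] by (intro nn_integral_cong) auto
 moreover have "(\<integral>\<^sup>+z. f z \<partial>\<eta>) = (\<integral>\<^sup>+z. g z \<partial>\<eta>)"
  using cong(3) by (intro nn_integral_cong) auto
 ultimately show ?case using cong(4) by (simp cong: measurable_cong nn_integral_cong)
next
 case (set A)
 have "(\<integral>\<^sup>+z. indicator A z \<partial>N w) = emeasure (N w) A" if "w \<in> space P" for w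
  using set sets_N[OF that] by simp
 then show ?case using set emeasure_N_measurable[OF set] nn_integral_emeasure_N[OF set]
  by (simp cong: measurable_cong nn_integral_cong)
next
 case (mult u c)
 have "(\<integral>\<^sup>+z. c * u z \<partial>N w) = c * (\<integral>\<^sup>+z. u z \<partial>N w)" if "w \<in> space P" for w
  using that by (intro nn_integral_cmult measurable_N[OF mult(2)])
 moreover have [measurable]: "(\<lambda>w. \<integral>\<^sup>+z. u z \<partial>N w) \<in> borel_measurable P"
  using mult by blast
 ultimately show ?case using mult by (simp add: nn_integral_cmult cong: measurable_cong nn_integral_cong)
next
 case (add u v)
 have "(\<integral>\<^sup>+z. v z + u z \<partial>N w) = (\<integral>\<^sup>+z. v z \<partial>N w) + (\<integral>\<^sup>+z. u z \<partial>N w)" if "w \<in> space P" for w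
  using that by (intro nn_integral_add measurable_N[OF add(1)] measurable_N[OF add(3)])
 moreover have [measurable]: "(\<lambda>w. \<integral>\<^sup>+z. u z \<partial>N w) \<in> borel_measurable P"
  "(\<lambda>w. \<integral>\<^sup>+z. v z \<partial>N w) \<in> borel_measurable P" using add by blast+
 ultimately show ?case using add by (simp add: nn_integral_add cong: measurable_cong nn_integral_cong)
next
 case (seq U)
 have 1: "(\<integral>\<^sup>+z. (\<Squnion>range U) z \<partial>N w) = (SUP i. \<integral>\<^sup>+z. U i z \<partial>N w)" if "w \<in> space P" for w
 proof -
  have "(\<integral>\<^sup>+z. (\<Squnion>range U) z \<partial>N w) = (\<integral>\<^sup>+z. (SUP i. U i z) \<partial>N w)"
   by (simp add: SUP_apply image_comp)
  also have "\<dots> = (SUP i. \<integral>\<^sup>+z. U i z \<partial>N w)"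
   using seq(3) that by (intro nn_integral_monotone_convergence_SUP measurable_N[OF seq(1)])
  finally show ?thesis .
 qed
 have m: "(\<lambda>w. \<integral>\<^sup>+z. U i z \<partial>N w) \<in> borel_measurable P" for i
  using seq by blast
 have "(\<lambda>w. \<integral>\<^sup>+z. (\<Squnion>range U) z \<partial>N w) \<in> borel_measurable P"
 proof (subst measurable_cong)
  show "(\<lambda>w. SUP i. \<integral>\<^sup>+z. U i z \<partial>N w) \<in> borel_measurable P"
   using m by (intro borel_measurable_SUP) auto
 qed (rule 1)
 moreover have "(\<integral>\<^sup>+w. (\<integral>\<^sup>+z. (\<Squnion>range U) z \<partial>N w) \<partial>P) = (\<integral>\<^sup>+w. (SUP i. \<integral>\<^sup>+z. U i z \<partial>N w) \<partial>P)"
  by (rule nn_integral_cong) (rule 1)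
 moreover have "\<dots> = (SUP i. \<integral>\<^sup>+w. (\<integral>\<^sup>+z. U i z \<partial>N w) \<partial>P)"
  using seq(3) m by (intro nn_integral_monotone_convergence_SUP)
   (auto simp: incseq_def le_fun_def intro!: nn_integral_mono)
 moreover have "\<dots> = (SUP i. \<integral>\<^sup>+z. U i z \<partial>\<eta>)" using seq by simp
 moreover have "\<dots> = (\<integral>\<^sup>+z. (SUP i. U i z) \<partial>\<eta>)"
  using seq by (intro nn_integral_monotone_convergence_SUP[symmetric]) auto
 moreover have "\<dots> = (\<integral>\<^sup>+z. (\<Squnion>range U) z \<partial>\<eta>)"
  by (simp add: SUP_apply image_comp)
 ultimately show ?case by metis
qed

lemma AE_integrable_N:
 fixes f :: "'z \<Rightarrow> 'b::{banach, second_countable_topology}"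
 assumes f: "integrable \<eta> f"
 shows "AE w in P. integrable (N w) f"
proof -
 have m: "(\<lambda>z. ennreal (norm (f z))) \<in> borel_measurable \<eta>" using f by measurable
 have "(\<integral>\<^sup>+w. (\<integral>\<^sup>+z. norm (f z) \<partial>N w) \<partial>P) < \<infinity>"
  using Campbell_nn_integral[OF m] f by (simp add: integrable_iff_bounded)
 then have "AE w in P. (\<integral>\<^sup>+z. norm (f z) \<partial>N w) \<noteq> \<infinity>"
  using Campbell_nn_integral[OF m] by (intro nn_integral_PInf_AE) auto
 then show ?thesis using AE_space
 proof eventually_elim
  case (elim w)
  have "f \<in> borel_measurable (N w)" using measurable_N[OF borel_measurable_integrable[OF f] elim(2)] .
  then show ?case using elim by (simp add: integrable_iff_bounded less_top)
 qed
qed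

text \<open>The Bochner integral is 0 where \<open>f\<close> is not integrable. It is therefore a
  case distinction on the finiteness of a nonnegative integral, which Campbell's formula shows to be
  measurable.\<close>

lemma integral_N_measurable:
 fixes f :: "'z \<Rightarrow> real"
 assumes f[measurable]: "f \<in> borel_measurable \<eta>"
 shows "(\<lambda>w. \<integral>z. f z \<partial>N w) \<in> borel_measurable P"
proof -
 have m[measurable]: "(\<lambda>w. \<integral>\<^sup>+z. ennreal \<bar>f z\<bar> \<partial>N w) \<in> borel_measurable P"
  "(\<lambda>w. \<integral>\<^sup>+z. ennreal (f z) \<partial>N w) \<in> borel_measurable P"
  "(\<lambda>w. \<integral>\<^sup>+z. ennreal (- f z) \<partial>N w) \<in> borel_measurable P"
  using Campbell_nn_integral[of "\<lambda>z. ennreal \<bar>f z\<bar>"] Campbell_nn_integral[of "\<lambda>z. ennreal (f z)"]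
   Campbell_nn_integral[of "\<lambda>z. ennreal (- f z)"] by auto
 have "(\<integral>z. f z \<partial>N w) = (if (\<integral>\<^sup>+z. ennreal \<bar>f z\<bar> \<partial>N w) < \<infinity>
   then enn2real (\<integral>\<^sup>+z. ennreal (f z) \<partial>N w) - enn2real (\<integral>\<^sup>+z. ennreal (- f z) \<partial>N w) else 0)"
  if "w \<in> space P" for w
 proof -
  have "f \<in> borel_measurable (N w)" using measurable_N[OF f that] .
  then show ?thesis
   by (auto simp: real_lebesgue_integral_def integrable_iff_bounded not_integrable_integral_eq)
 qed
 then show ?thesis by (simp cong: measurable_cong)
qed

text \<open>Where \<open>f\<close> is not integrable under \<open>N w\<close> the integral on the
  left is 0 by convention, so the pointwise bound holds for every \<open>w\<close> and Campbell's
  formula can be applied to it.\<close>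

lemma nn_integral_abs_integral_N_le:
 fixes f :: "'z \<Rightarrow> real"
 assumes f[measurable]: "f \<in> borel_measurable \<eta>"
 shows "(\<integral>\<^sup>+w. ennreal \<bar>\<integral>z. f z \<partial>N w\<bar> \<partial>P) \<le> (\<integral>\<^sup>+z. ennreal \<bar>f z\<bar> \<partial>\<eta>)" (is "?l1 \<le> ?r1")
proof -
 have "ennreal \<bar>\<integral>z. f z \<partial>N w\<bar> \<le> (\<integral>\<^sup>+z. ennreal \<bar>f z\<bar> \<partial>N w)" for w
 proof (cases "integrable (N w) f")
  case True
  then show ?thesis using integral_norm_bound_ennreal[of "N w" f] by simp
 qed (simp add: not_integrable_integral_eq)
 then have "?l1 \<le> (\<integral>\<^sup>+w. (\<integral>\<^sup>+z. ennreal \<bar>f z\<bar> \<partial>N w) \<partial>P)"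
  by (intro nn_integral_mono)
 also have "\<dots> = ?r1" using Campbell_nn_integral[of "\<lambda>z. ennreal \<bar>f z\<bar>"] by simp
 finally show ?thesis .
qed

lemma integrable_integral_N:
 fixes f :: "'z \<Rightarrow> real"
 assumes f: "integrable \<eta> f"
 shows "integrable P (\<lambda>w. \<integral>z. f z \<partial>N w)"
proof -
 have "f \<in> borel_measurable \<eta>" using f by simp
 note m = integral_N_measurable[OF this] nn_integral_abs_integral_N_le[OF this]
 have "(\<integral>\<^sup>+z. ennreal \<bar>f z\<bar> \<partial>\<eta>) < \<infinity>" using f by (simp add: integrable_iff_bounded)
 then show ?thesis using m by (simp add: integrable_iff_bounded le_less_trans)
qed

lemma Campbell_integral:
 fixes f :: "'z \<Rightarrow> real"
 assumes f: "integrable \<eta> f"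
 shows "(\<integral>w. (\<integral>z. f z \<partial>N w) \<partial>P) = (\<integral>z. f z \<partial>\<eta>)" (is "?l1 = _")
proof -
 have nonneg: "(\<integral>w. (\<integral>z. g z \<partial>N w) \<partial>P) = (\<integral>z. g z \<partial>\<eta>)"
  if g: "integrable \<eta> g" and g0: "\<And>z. g z \<ge> 0" for g :: "'z \<Rightarrow> real"
 proof -
  have gm: "g \<in> borel_measurable \<eta>" using g by simp
  note m = integral_N_measurable[OF gm]
  have "ennreal (\<integral>w. (\<integral>z. g z \<partial>N w) \<partial>P) = (\<integral>\<^sup>+w. ennreal (\<integral>z. g z \<partial>N w) \<partial>P)"
   using integrable_integral_N[OF g] g0 by (intro nn_integral_eq_integral[symmetric]) auto
  also have "\<dots> = (\<integral>\<^sup>+w. (\<integral>\<^sup>+z. ennreal (g z) \<partial>N w) \<partial>P)"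
   using AE_integrable_N[OF g] g0
   by (intro nn_integral_cong_AE) (auto elim!: eventually_mono simp: nn_integral_eq_integral)
  also have "\<dots> = (\<integral>\<^sup>+z. ennreal (g z) \<partial>\<eta>)"
   using Campbell_nn_integral[of "\<lambda>z. ennreal (g z)"] gm by simp
  also have "\<dots> = ennreal (\<integral>z. g z \<partial>\<eta>)"
   using g g0 by (intro nn_integral_eq_integral) auto
  finally show ?thesis using g0 by (subst (asm) ennreal_inj) (auto intro!: integral_nonneg_AE)
 qed
 let ?p = "\<lambda>z. max 0 (f z)" and ?n = "\<lambda>z. max 0 (- f z)"
 have i: "integrable \<eta> ?p" "integrable \<eta> ?n" using f by auto
 have "?l1 = (\<integral>w. (\<integral>z. ?p z \<partial>N w) - (\<integral>z. ?n z \<partial>N w) \<partial>P)"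
 proof (rule integral_cong_AE)
  show "AE w in P. (\<integral>z. f z \<partial>N w) = (\<integral>z. ?p z \<partial>N w) - (\<integral>z. ?n z \<partial>N w)"
   using AE_integrable_N[OF i(1)] AE_integrable_N[OF i(2)]
  proof eventually_elim
   case (elim w)
   then have "(\<integral>z. ?p z \<partial>N w) - (\<integral>z. ?n z \<partial>N w) = (\<integral>z. ?p z - ?n z \<partial>N w)" by simp
   also have "(\<lambda>z. ?p z - ?n z) = f" by (auto simp: fun_eq_iff max_def)
   finally show ?case by simp
  qed
  show "(\<lambda>w. \<integral>z. f z \<partial>N w) \<in> borel_measurable P" by (rule integral_N_measurable) (use f in simp)
  show "(\<lambda>w. (\<integral>z. ?p z \<partial>N w) - (\<integral>z. ?n z \<partial>N w)) \<in> borel_measurable P"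
   by (intro borel_measurable_diff integral_N_measurable) (use i in simp_all)
 qed
 also have "\<dots> = (\<integral>z. ?p z \<partial>\<eta>) - (\<integral>z. ?n z \<partial>\<eta>)"
  using i by (simp add: integrable_integral_N nonneg)
 also have "\<dots> = (\<integral>z. ?p z - ?n z \<partial>\<eta>)" using i by simp
 also have "(\<lambda>z. ?p z - ?n z) = f" by (auto simp: fun_eq_iff max_def)
 finally show ?thesis .
qed

text \<open>The Poisson weights summed against \<open>iexp (t * k)\<close> form the exponential
  series at \<open>m * iexp t\<close>, where \<open>m\<close> is the intensity of
  \<open>A\<close>.\<close>

lemma char_emeasure_N:
 assumes A: "A \<in> sets \<eta>" "emeasure \<eta> A < \<infinity>"
 shows "(CLINT w|P. iexp (t * enn2real (emeasure (N w) A))) =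
  exp (complex_of_real (measure \<eta> A) * (iexp t - 1))"
proof -
 let ?t21 = "(count_space UNIV)"
 define m where "m = measure \<eta> A"
 let ?t20 = "(- complex_of_real m)"
 let ?t2 = "(complex_of_real m * iexp t)"
 define p where "p = (\<lambda>k. exp (- m) * m ^ k / fact k)"
 let ?t1 = "(CLINT k|count_space UNIV. p k *\<^sub>R iexp (t * real k))"
 have p0: "p k \<ge> 0" for k by (simp add: p_def m_def)
 obtain K where K[measurable]: "K \<in> measurable P ?t21"
  and ae: "AE w in P. emeasure (N w) A = of_nat (K w)"
  and d: "distr P ?t21 K = density ?t21 (\<lambda>k. ennreal (p k))"
  using N_distribution[OF A] unfolding p_def m_def by blast
 note emeasure_N_measurable[OF A(1), measurable]
 have "(CLINT w|P. iexp (t * enn2real (emeasure (N w) A))) = (CLINT w|P. iexp (t * real (K w)))"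
  using ae by (intro integral_cong_AE) (auto elim!: eventually_mono)
 also have "\<dots> = (CLINT k|distr P ?t21 K. iexp (t * real k))" by (subst integral_distr) auto
 also have "\<dots> = ?t1" unfolding d using p0 by (subst integral_density) auto
 also have "\<dots> = exp (complex_of_real m * (iexp t - 1))"
 proof -
  have pc: "complex_of_real (p k) = exp ?t20 * (complex_of_real m ^ k /\<^sub>R fact k)" for k
   by (simp add: p_def scaleR_conv_of_real exp_of_real[symmetric] divide_inverse)
  have eq: "p k *\<^sub>R iexp (t * real k) =
   exp ?t20 * (?t2 ^ k /\<^sub>R fact k)" for k
  proof -
   have "iexp (t * real k) = iexp t ^ k" by (simp add: exp_of_nat_mult[symmetric] ac_simps)
   then show ?thesis unfolding scaleR_conv_of_real[of "p k"] pc by (simp add: power_mult_distrib)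
  qed
  have "(\<lambda>k. p k *\<^sub>R iexp (t * real k)) sums (exp ?t20 * exp ?t2)"
   unfolding eq by (intro sums_mult exp_converges)
  moreover have "summable (\<lambda>k. norm (p k *\<^sub>R iexp (t * real k)))"
  proof -
   have "norm (p k *\<^sub>R iexp (t * real k)) = exp (- m) * (m ^ k /\<^sub>R fact k)" for k
    using p0[of k] by (simp add: p_def divide_inverse)
   moreover have "summable (\<lambda>k. exp (- m) * (m ^ k /\<^sub>R fact k))"
    by (intro summable_mult summable_exp_generic)
   ultimately show ?thesis by simp
  qed
  ultimately have "?t1 = exp ?t20 * exp ?t2"
   by (subst integral_count_space_nat) (auto simp: integrable_count_space_nat_iff sums_iff)
  then show ?thesis by (simp add: exp_add[symmetric] algebra_simps)
 qed
 finally show ?thesis by (simp add: m_def)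
qed

end

text \<open>Mean value inequality on the left half-plane, which is convex and on which the
  derivative of exp has modulus at most 1.\<close>

lemma cmod_one_minus_exp_le:
 assumes "Re w \<le> 0"
 shows "cmod (1 - exp w) \<le> cmod w"
proof -
 have "cmod (exp 0 - exp w) \<le> 1 * cmod (0 - w)"
 proof (rule field_differentiable_bound[of "{z. Re z \<le> 0}" exp exp])
  show "convex {z. Re z \<le> 0}" by (rule convex_halfspace_Re_le)
  show "(exp has_field_derivative exp z) (at z within {z. Re z \<le> 0})" for z
   by (intro DERIV_subset[OF DERIV_exp]) simp
 qed (use assms in auto)
 then show ?thesis by simp
qed

context poisson_rm
begin

text \<open>The nonzero level sets are disjoint and have finite intensity, so the counts on them are
  independent Poisson variables. In the product of their characteristic functions the exponents add
  up to the integral.\<close>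

lemma char_simple_integral_N:
 fixes s :: "'z \<Rightarrow> real"
 assumes s: "simple_function \<eta> s" "integrable \<eta> s"
 shows "(CLINT w|P. iexp (\<integral>z. s z \<partial>N w)) = exp (CLINT z|\<eta>. iexp (s z) - 1)" (is "?l1 = _")
proof -
 \<comment> \<open>The value 0 is left out because its level set may have infinite
   intensity.\<close>
 define V where "V = s ` space \<eta> - {0}"
 have "finite V" using s(1) by (auto simp: V_def simple_function_def)
 then obtain h where h: "bij_betw h {0..<card V} V" using ex_bij_betw_nat_finite by blast
 define n where "n = card V"
 define A where "A = (\<lambda>j. s -` {h j} \<inter> space \<eta>)"
 have hV: "h j \<in> V" if "j < n" for j using h that by (auto simp: bij_betw_def n_def)
 let ?t1 = "(\<Sum>j<n. complex_of_real (measure \<eta> (A j)) * (iexp (h j) - 1))"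
 have h_inj: "h i \<noteq> h j" if "i < n" "j < n" "i \<noteq> j" for i j
  using h that by (auto simp: bij_betw_def n_def inj_on_def)
 have A: "A j \<in> sets \<eta>" for j
  unfolding A_def using s(2) by (intro measurable_sets[OF borel_measurable_integrable]) auto
 \<comment> \<open>Stated for an arbitrary \<open>q\<close> with \<open>q 0 = 0\<close> because it
   is used for the identity as well as for \<open>\<lambda>x. iexp x - 1\<close>.\<close>
 have decomp: "q (s x) = (\<Sum>j<n. indicator (A j) x *\<^sub>R q (h j))" if "x \<in> space \<eta>" "q 0 = 0"
  for q :: "real \<Rightarrow> 'c::real_normed_vector" and x
 proof (cases "s x = 0")
  case True
  then have "(\<Sum>j<n. indicator (A j) x *\<^sub>R q (h j)) = 0"
   using hV by (intro sum.neutral) (auto simp: A_def V_def indicator_def)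
  then show ?thesis using True that by simp
 next
  case False
  then have "s x \<in> V" using that by (auto simp: V_def)
  then have "s x \<in> h ` {0..<n}" using h by (simp add: bij_betw_def n_def)
  then obtain k where k: "k < n" "h k = s x" by auto
  have "(\<Sum>j<n. indicator (A j) x *\<^sub>R q (h j)) = (\<Sum>j<n. if j = k then q (h j) else 0)"
   using k that h_inj by (intro sum.cong) (auto simp: A_def indicator_def)
  also have "\<dots> = q (s x)" using k by simp
  finally show ?thesis ..
 qed
 have Afin: "emeasure \<eta> (A j) < \<infinity>" if "j < n" for j
 proof -
  have "integrable \<eta> (\<lambda>x. (1 / \<bar>h j\<bar>) * \<bar>s x\<bar>)" using s(2) by simp
  then have "integrable \<eta> (indicator (A j) :: _ \<Rightarrow> real)"
   by (rule Bochner_Integration.integrable_bound) (use A hV[OF that] in \<open>auto simp: A_def indicator_def V_def\<close>)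
  then show ?thesis using A by (subst (asm) integrable_indicator_iff) (simp add: A_def)
 qed
 have AE1: "AE w in P. (\<integral>z. s z \<partial>N w) = (\<Sum>j<n. h j * enn2real (emeasure (N w) (A j)))"
 proof -
  have "AE w in P. \<forall>j\<in>{..<n}. integrable (N w) (indicator (A j) :: _ \<Rightarrow> real)"
   using Afin A by (intro AE_finite_allI AE_integrable_N) (auto simp: integrable_indicator_iff)
  then show ?thesis using AE_space
  proof eventually_elim
   case (elim w)
   have sp: "space (N w) = space \<eta>" by (rule space_N[OF elim(2)])
   have "(\<integral>z. s z \<partial>N w) = (\<integral>z. (\<Sum>j<n. indicator (A j) z *\<^sub>R h j) \<partial>N w)"
    using decomp[of _ "\<lambda>x. x"] sp by (intro Bochner_Integration.integral_cong) auto
   also have "\<dots> = (\<Sum>j<n. (\<integral>z. indicator (A j) z *\<^sub>R h j \<partial>N w))"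
    using elim by (intro Bochner_Integration.integral_sum) auto
   also have "\<dots> = (\<Sum>j<n. h j * enn2real (emeasure (N w) (A j)))"
    using elim A sets_N[OF elim(2)] by (intro sum.cong) (auto simp: measure_def sp sets.Int_space_eq2 A_def)
   finally show ?case .
  qed
 qed
 note emeasure_N_measurable[OF A, measurable]
 have "?l1 = (CLINT w|P. (\<Prod>j<n. iexp (h j * enn2real (emeasure (N w) (A j)))))"
 proof (rule integral_cong_AE)
  show "AE w in P. iexp (\<integral>z. s z \<partial>N w) = (\<Prod>j<n. iexp (h j * enn2real (emeasure (N w) (A j))))"
   using AE1 by eventually_elim (simp add: exp_sum[symmetric] sum_distrib_left)
  have "s \<in> borel_measurable \<eta>" using s(2) by simp
  note integral_N_measurable[OF this, measurable]
  show "(\<lambda>w. iexp (\<integral>z. s z \<partial>N w)) \<in> borel_measurable P" by measurable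
  show "(\<lambda>w. \<Prod>j<n. iexp (h j * enn2real (emeasure (N w) (A j)))) \<in> borel_measurable P" by measurable
 qed
 also have "\<dots> = (\<Prod>j<n. (CLINT w|P. iexp (h j * enn2real (emeasure (N w) (A j)))))"
 proof (rule indep_vars_lebesgue_integral)
  have "disjoint_family_on A {..<n}" using h_inj by (auto simp: disjoint_family_on_def A_def)
  then have "indep_vars (\<lambda>_. borel) (\<lambda>i w. emeasure (N w) (A i)) {..<n}"
   using poisson A by (auto simp: poisson_random_measure_def)
  then show "indep_vars (\<lambda>_. borel) (\<lambda>j w. iexp (h j * enn2real (emeasure (N w) (A j)))) {..<n}"
   by (rule indep_vars_compose2[where Y = "\<lambda>j t. iexp (h j * enn2real t)"]) auto
  show "integrable P (\<lambda>w. iexp (h j * enn2real (emeasure (N w) (A j))))" for j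
   by (rule integrable_const_bound[of _ 1]) auto
 qed auto
 also have "\<dots> = (\<Prod>j<n. exp (complex_of_real (measure \<eta> (A j)) * (iexp (h j) - 1)))"
  using char_emeasure_N[OF A Afin] by (intro prod.cong) auto
 also have "\<dots> = exp ?t1" by (simp add: exp_sum)
 also have "?t1 =
   (CLINT z|\<eta>. (\<Sum>j<n. indicator (A j) z *\<^sub>R (iexp (h j) - 1)))"
 proof (subst Bochner_Integration.integral_sum)
  show "complex_integrable \<eta> (\<lambda>z. indicator (A j) z *\<^sub>R (iexp (h j) - 1))" if "j \<in> {..<n}" for j
   using Afin that A by (intro integrable_scaleR_left) (auto simp: integrable_indicator_iff)
  show "?t1 =
   (\<Sum>j<n. CLINT z|\<eta>. indicator (A j) z *\<^sub>R (iexp (h j) - 1))"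
  proof (rule sum.cong)
   fix j assume "j \<in> {..<n}"
   then have "integrable \<eta> (indicator (A j) :: _ \<Rightarrow> real)"
    using Afin A by (auto simp: integrable_indicator_iff)
   then show "complex_of_real (measure \<eta> (A j)) * (iexp (h j) - 1) = (CLINT z|\<eta>. indicator (A j) z *\<^sub>R (iexp (h j) - 1))"
    using A by (subst integral_scaleR_left) (auto simp: scaleR_conv_of_real)
  qed simp
 qed
 also have "\<dots> = (CLINT z|\<eta>. iexp (s z) - 1)"
  using decomp[of _ "\<lambda>x. iexp x - 1"] by (intro Bochner_Integration.integral_cong) auto
 finally show ?thesis .
qed

text \<open>Simple functions dominated by \<open>2 * \<bar>g\<bar>\<close> converge to
  \<open>g\<close> in L1 of the intensity. On the left the exponential is 1-Lipschitz and the mean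
  absolute Poisson integral is at most the L1 norm; on the right dominated convergence
  applies.\<close>

lemma char_integral_N:
 fixes g :: "'z \<Rightarrow> real"
 assumes g: "integrable \<eta> g"
 shows "(CLINT u|P. iexp (\<integral>z. g z \<partial>N u)) = exp (CLINT z|\<eta>. iexp (g z) - 1)" (is "?l1 = _")
proof -
 have gm[measurable]: "g \<in> borel_measurable \<eta>" using g by simp
 obtain s where s: "\<And>i. simple_function \<eta> (s i)" "\<And>x. x \<in> space \<eta> \<Longrightarrow> (\<lambda>i. s i x) \<longlonglongrightarrow> g x"
  "\<And>i x. x \<in> space \<eta> \<Longrightarrow> dist (s i x) 0 \<le> 2 * dist (g x) 0"
  using borel_measurable_implies_sequence_metric[OF gm, of 0] by blast
 have sm[measurable]: "s i \<in> borel_measurable \<eta>" for i using s(1) borel_measurable_simple_function by blast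
 have si: "integrable \<eta> (s i)" for i
  by (rule Bochner_Integration.integrable_bound[of _ "\<lambda>x. 2 * \<bar>g x\<bar>"]) (use g s(3) in \<open>auto simp: dist_real_def\<close>)
 have L1: "(\<lambda>i. \<integral>x. \<bar>s i x - g x\<bar> \<partial>\<eta>) \<longlonglongrightarrow> (\<integral>x. 0 \<partial>\<eta>)"
 proof (rule integral_dominated_convergence[where w="\<lambda>x. 3 * \<bar>g x\<bar>"])
  show "AE x in \<eta>. (\<lambda>i. \<bar>s i x - g x\<bar>) \<longlonglongrightarrow> 0"
  proof (rule AE_I2)
   fix x assume "x \<in> space \<eta>"
   from tendsto_rabs[OF tendsto_diff[OF s(2)[OF this] tendsto_const[of "g x"]]]
   show "(\<lambda>i. \<bar>s i x - g x\<bar>) \<longlonglongrightarrow> 0" by simp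
  qed
  show "AE x in \<eta>. norm \<bar>s i x - g x\<bar> \<le> 3 * \<bar>g x\<bar>" for i
  proof (rule AE_I2)
   fix x assume "x \<in> space \<eta>"
   from s(3)[OF this, of i] show "norm \<bar>s i x - g x\<bar> \<le> 3 * \<bar>g x\<bar>" by (simp add: dist_real_def)
  qed
 qed (use g in auto)
 note integral_N_measurable[OF gm, measurable] integral_N_measurable[OF sm, measurable]
 have "(\<lambda>i. CLINT u|P. iexp (\<integral>z. s i z \<partial>N u)) \<longlonglongrightarrow> ?l1"
 proof (rule LIM_zero_cancel, rule Lim_null_comparison)
  show "(\<lambda>i. \<integral>x. \<bar>s i x - g x\<bar> \<partial>\<eta>) \<longlonglongrightarrow> 0" using L1 by simp
  show "\<forall>\<^sub>F i in sequentially. norm ((CLINT u|P. iexp (\<integral>z. s i z \<partial>N u)) - ?l1)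
   \<le> (\<integral>x. \<bar>s i x - g x\<bar> \<partial>\<eta>)"
  proof (rule always_eventually, rule allI, goal_cases)
   case (1 i)
   let ?t1 = "(\<integral>x. \<bar>s i x - g x\<bar> \<partial>\<eta>)"
   have i1: "integrable P (\<lambda>u. iexp (\<integral>z. s i z \<partial>N u))" "integrable P (\<lambda>u. iexp (\<integral>z. g z \<partial>N u))"
    by (auto intro!: integrable_const_bound[of _ 1])
   have d: "integrable \<eta> (\<lambda>x. s i x - g x)" using si g by simp
   have "norm ((CLINT u|P. iexp (\<integral>z. s i z \<partial>N u)) - ?l1) =
    norm (CLINT u|P. iexp (\<integral>z. s i z \<partial>N u) - iexp (\<integral>z. g z \<partial>N u))"
    using i1 by simp
   also have "\<dots> \<le> (\<integral>u. norm (iexp (\<integral>z. s i z \<partial>N u) - iexp (\<integral>z. g z \<partial>N u)) \<partial>P)"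
    by (rule integral_norm_bound)
   also have "\<dots> \<le> (\<integral>u. \<bar>\<integral>z. s i z - g z \<partial>N u\<bar> \<partial>P)"
   proof (rule integral_mono_AE)
    show "AE u in P. norm (iexp (\<integral>z. s i z \<partial>N u) - iexp (\<integral>z. g z \<partial>N u)) \<le> \<bar>\<integral>z. s i z - g z \<partial>N u\<bar>"
     using AE_integrable_N[OF si[of i]] AE_integrable_N[OF g]
    proof eventually_elim
     case (elim u)
     then have "(\<integral>z. s i z - g z \<partial>N u) = (\<integral>z. s i z \<partial>N u) - (\<integral>z. g z \<partial>N u)"
      by (rule Bochner_Integration.integral_diff)
     then show ?case by (simp only: cmod_iexp_diff_le)
    qed
    show "integrable P (\<lambda>u. \<bar>\<integral>z. s i z - g z \<partial>N u\<bar>)"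
     using integrable_integral_N[OF d] by simp
   qed (use i1 in auto)
   also have "\<dots> \<le> ?t1" (is "_ \<le> ?r2")
   proof -
    have "ennreal (\<integral>u. \<bar>\<integral>z. s i z - g z \<partial>N u\<bar> \<partial>P) = (\<integral>\<^sup>+u. ennreal \<bar>\<integral>z. s i z - g z \<partial>N u\<bar> \<partial>P)"
     using integrable_integral_N[OF d] by (intro nn_integral_eq_integral[symmetric]) auto
    also have "\<dots> \<le> (\<integral>\<^sup>+z. ennreal \<bar>s i z - g z\<bar> \<partial>\<eta>)"
     by (rule nn_integral_abs_integral_N_le) simp
    also have "\<dots> = ennreal ?r2" using d by (intro nn_integral_eq_integral) auto
    finally show ?thesis by (subst (asm) ennreal_le_iff) auto
   qed
   finally show ?case .
  qed
 qed
 moreover have "(\<lambda>i. exp (CLINT z|\<eta>. iexp (s i z) - 1)) \<longlonglongrightarrow> exp (CLINT z|\<eta>. iexp (g z) - 1)"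
 proof (intro tendsto_exp integral_dominated_convergence[where w="\<lambda>x. 2 * \<bar>g x\<bar>"])
  show "AE x in \<eta>. (\<lambda>i. iexp (s i x) - 1) \<longlonglongrightarrow> iexp (g x) - 1"
   using s(2) by (intro AE_I2 tendsto_intros)
  show "AE x in \<eta>. norm (iexp (s i x) - 1) \<le> 2 * \<bar>g x\<bar>" for i
  proof (rule AE_I2)
   fix x assume "x \<in> space \<eta>"
   from s(3)[OF this, of i] cmod_iexp_minus_one_le[of "s i x"]
   show "norm (iexp (s i x) - 1) \<le> 2 * \<bar>g x\<bar>" by (simp add: dist_real_def)
  qed
 qed (use g in auto)
 ultimately show ?thesis unfolding char_simple_integral_N[OF s(1) si] using LIMSEQ_unique by blast
qed

lemma integrable_iexp_minus_one:
 fixes g :: "'z \<Rightarrow> real"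
 assumes g: "integrable \<eta> g"
 shows "integrable \<eta> (\<lambda>z. iexp (g z) - 1)" by (rule Bochner_Integration.integrable_bound[of _ g])
  (use g cmod_iexp_minus_one_le in \<open>auto simp: real_norm_def\<close>)

text \<open>Subtracting the mean multiplies the characteristic function by \<open>iexp\<close> of
  its negative, and this supplies the linear term of \<open>Psi\<close> in the exponent.\<close>

lemma char_centered:
 fixes g :: "'z \<Rightarrow> real"
 assumes g: "integrable \<eta> g"
 shows "(CLINT w|P. iexp ((\<integral>z. g z \<partial>N w) - (\<integral>z. g z \<partial>\<eta>))) = exp (CLINT z|\<eta>. Psi (g z))" (is "?l1 = _")
proof -
 let ?t2 = "(CLINT z|\<eta>. iexp (g z) - 1)"
 let ?t1 = "(\<integral>z. g z \<partial>\<eta>)"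
 have "?l1 =
   (CLINT w|P. iexp (- ?t1) * iexp (\<integral>z. g z \<partial>N w))"
  by (intro Bochner_Integration.integral_cong refl) (simp add: exp_add[symmetric] algebra_simps)
 also have "\<dots> = iexp (- ?t1) * exp ?t2" unfolding char_integral_N[OF g, symmetric] by simp
 also have "\<dots> = exp (?t2 - \<i> * complex_of_real ?t1)" by (simp add: exp_add[symmetric] algebra_simps)
 also have "?t2 - \<i> * complex_of_real ?t1 = (CLINT z|\<eta>. Psi (g z))"
 proof -
  have "integrable \<eta> (\<lambda>z. \<i> * complex_of_real (g z))" using g by simp
  moreover have "\<i> * complex_of_real ?t1 = (CLINT z|\<eta>. \<i> * complex_of_real (g z))" by simp
  ultimately show ?thesis
   unfolding Psi_def using integrable_iexp_minus_one[OF g] by (simp only: Bochner_Integration.integral_diff)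
 qed
 finally show ?thesis .
qed

text \<open>
 Only the upper bound is needed; it follows from Fatou's lemma, since
 \<open>2 (1 - cos (t Z)) / t\<^sup>2\<close> tends to \<open>Z\<^sup>2\<close> as \<open>t\<close> tends to \<open>0\<close>.
\<close>

lemma variance_centered_le:
 fixes g :: "'z \<Rightarrow> real"
 assumes g: "integrable \<eta> g" "integrable \<eta> (\<lambda>z. (g z)\<^sup>2)"
 shows "(\<integral>\<^sup>+u. ennreal (((\<integral>z. g z \<partial>N u) - (\<integral>z. g z \<partial>\<eta>))\<^sup>2) \<partial>P) \<le> ennreal (\<integral>z. (g z)\<^sup>2 \<partial>\<eta>)" (is "_ \<le> ?r2")
proof -
 define Z where "Z = (\<lambda>u. (\<integral>z. g z \<partial>N u) - (\<integral>z. g z \<partial>\<eta>))"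
 have gm[measurable]: "g \<in> borel_measurable \<eta>" using g by simp
 have Zm[measurable]: "Z \<in> borel_measurable P"
  unfolding Z_def using integral_N_measurable[OF gm] by measurable
 define t where "t = (\<lambda>n::nat. 1 / real (Suc n))"
 have t: "t n > 0" for n by (simp add: t_def)
 \<comment> \<open>Since \<open>1 - cos\<close> is twice the squared sine of half the argument, the
   limit reduces to \<open>sin y / y\<close> at 0.\<close>
 have lim: "(\<lambda>n. 2 * (1 - cos (t n * x)) / (t n)\<^sup>2) \<longlonglongrightarrow> x\<^sup>2" for x :: real
 proof (cases "x = 0")
  case False
  have "(\<lambda>n. t n * x / 2) \<longlonglongrightarrow> 0 * x / 2"
   unfolding t_def by (intro tendsto_intros LIMSEQ_Suc[OF lim_1_over_n]) simp
  moreover have "t n * x / 2 \<noteq> 0" for n :: nat using t[of n] False by simp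
  ultimately have "filterlim (\<lambda>n. t n * x / 2) (at 0) sequentially" by (intro filterlim_atI) auto
  moreover have "((\<lambda>y::real. sin y / y) \<longlongrightarrow> 1) (at 0)"
   using DERIV_sin[of 0] by (simp add: DERIV_def)
  ultimately have "(\<lambda>n. sin (t n * x / 2) / (t n * x / 2)) \<longlonglongrightarrow> 1"
   by (rule filterlim_compose[rotated])
  then have "(\<lambda>n. x\<^sup>2 * (sin (t n * x / 2) / (t n * x / 2))\<^sup>2) \<longlonglongrightarrow> x\<^sup>2 * 1\<^sup>2"
   by (intro tendsto_intros)
  moreover have "x\<^sup>2 * (sin (t n * x / 2) / (t n * x / 2))\<^sup>2 = 2 * (1 - cos (t n * x)) / (t n)\<^sup>2" for n
  proof -
   have "cos (t n * x) = 1 - 2 * (sin (t n * x / 2))\<^sup>2" using cos_double_sin[of "t n * x / 2"] by simp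
   then show ?thesis using False t[of n] by (simp add: field_simps power2_eq_square)
  qed
  ultimately show ?thesis by simp
 qed simp
 have bound: "(\<integral>\<^sup>+u. ennreal (2 * (1 - cos (t n * Z u)) / (t n)\<^sup>2) \<partial>P) \<le> ?r2" for n
 proof -
  let ?t5 = "(\<lambda>u. 2 * (1 - cos (t n * Z u)) / (t n)\<^sup>2)"
  let ?t3 = "(\<integral>u. 2 * (1 - cos (t n * Z u)) / (t n)\<^sup>2 \<partial>P)"
  let ?t2 = "(CLINT u|P. iexp (t n * Z u))"
  let ?t1 = "(\<integral>u. 1 - cos (t n * Z u) \<partial>P)"
  define w where "w = (CLINT z|\<eta>. Psi (t n * g z))"
  have Pi: "integrable \<eta> (\<lambda>z. Psi (t n * g z))"
  proof (rule Bochner_Integration.integrable_bound[of _ "\<lambda>z. (t n)\<^sup>2 / 2 * (g z)\<^sup>2"])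
   show "integrable \<eta> (\<lambda>z. (t n)\<^sup>2 / 2 * (g z)\<^sup>2)" using g by simp
   show "AE x in \<eta>. cmod (Psi (t n * g x)) \<le> norm ((t n)\<^sup>2 / 2 * (g x)\<^sup>2)"
    using cmod_Psi_le[of "t n * g x" for x] by (intro AE_I2) (simp add: power_mult_distrib)
  qed auto
  \<comment> \<open>The sign of the real part puts \<open>w\<close> into the half-plane where
    \<open>cmod (1 - exp w) \<le> cmod w\<close>.\<close>
  have "Re w \<le> 0"
  proof -
   have "(\<integral>z. Re (Psi (t n * g z)) \<partial>\<eta>) \<le> (\<integral>z. 0 \<partial>\<eta>)"
    using Pi by (intro integral_mono) (auto intro: Re_Psi_le)
   then show ?thesis unfolding w_def integral_Re[OF Pi, symmetric] by simp
  qed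
  have "cmod w \<le> (\<integral>z. cmod (Psi (t n * g z)) \<partial>\<eta>)"
   unfolding w_def by (rule integral_norm_bound)
  also have "\<dots> \<le> (\<integral>z. (t n)\<^sup>2 / 2 * (g z)\<^sup>2 \<partial>\<eta>)"
   using Pi g cmod_Psi_le[of "t n * g x" for x] by (intro integral_mono) (auto simp: power_mult_distrib)
  finally have w: "cmod w \<le> (t n)\<^sup>2 / 2 * (\<integral>z. (g z)\<^sup>2 \<partial>\<eta>)" by simp
  have Zi: "integrable P (\<lambda>u. iexp (t n * Z u))" by (rule integrable_const_bound[of _ 1]) auto
  have ex: "?t2 = exp w"
  proof -
   have "integrable \<eta> (\<lambda>z. t n * g z)" using g by simp
   from char_centered[OF this] show ?thesis by (simp add: w_def Z_def right_diff_distrib)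
  qed
  have "?t1 = 1 - Re ?t2"
  proof -
   have "cos (t n * Z u) = Re (iexp (t n * Z u))" for u by (simp add: Re_exp)
   moreover have "integrable P (\<lambda>u. Re (iexp (t n * Z u)))" using Zi by (rule integrable_Re)
   moreover have "(\<integral>u. Re (iexp (t n * Z u)) \<partial>P) = Re ?t2" by (rule integral_Re[OF Zi])
   ultimately show ?thesis by (simp only: Bochner_Integration.integral_diff integrable_const lebesgue_integral_const prob_space real_scaleR_def mult_1_left)
  qed
  also have "\<dots> = Re (1 - exp w)" unfolding ex by simp
  also have "\<dots> \<le> cmod (1 - exp w)" by (rule complex_Re_le_cmod)
  also have "\<dots> \<le> cmod w" by (rule cmod_one_minus_exp_le) fact
  also note w
  finally have fin0: "?t1 \<le> (t n)\<^sup>2 / 2 * (\<integral>z. (g z)\<^sup>2 \<partial>\<eta>)" .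
  have fin: "?t3 \<le> (\<integral>z. (g z)\<^sup>2 \<partial>\<eta>)" (is "?l1 \<le> ?r1")
  proof -
   have "?t5 = (\<lambda>u. (2 / (t n)\<^sup>2) * (1 - cos (t n * Z u)))" by (simp add: fun_eq_iff)
   then have "?l1 = (2 / (t n)\<^sup>2) * ?t1" by (simp only: integral_mult_right_zero)
   also have "\<dots> \<le> (2 / (t n)\<^sup>2) * ((t n)\<^sup>2 / 2 * ?r1)"
    by (rule mult_left_mono[OF fin0]) simp
   also have "\<dots> = ?r1" using t[of n] by simp
   finally show ?thesis .
  qed
  have "(\<integral>\<^sup>+u. ennreal (2 * (1 - cos (t n * Z u)) / (t n)\<^sup>2) \<partial>P) = ennreal ?t3"
  proof (rule nn_integral_eq_integral)
   have "integrable P (\<lambda>u. cos (t n * Z u))" by (rule integrable_const_bound[of _ 1]) auto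
   then show "integrable P ?t5" by simp
  qed auto
  then show ?thesis using fin by (simp add: ennreal_leI)
 qed
 have "(\<integral>\<^sup>+u. ennreal ((Z u)\<^sup>2) \<partial>P) = (\<integral>\<^sup>+u. liminf (\<lambda>n. ennreal (2 * (1 - cos (t n * Z u)) / (t n)\<^sup>2)) \<partial>P)"
 proof (rule nn_integral_cong)
  fix u
  let ?t4 = "(\<lambda>n. ennreal (2 * (1 - cos (t n * Z u)) / (t n)\<^sup>2))"
  have "?t4 \<longlonglongrightarrow> ennreal ((Z u)\<^sup>2)" by (intro tendsto_ennrealI lim)
  then show "ennreal ((Z u)\<^sup>2) = liminf ?t4" by (intro lim_imp_Liminf[symmetric]) auto
 qed
 also have "\<dots> \<le> liminf (\<lambda>n. \<integral>\<^sup>+u. ennreal (2 * (1 - cos (t n * Z u)) / (t n)\<^sup>2) \<partial>P)"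
  by (rule nn_integral_liminf) auto
 also have "\<dots> \<le> ?r2" by (rule Liminf_le) (use bound in auto)
 finally show ?thesis by (simp add: Z_def)
qed

end

section \<open>Truncation and the construction of centered integrals\<close>

definition truncation :: "real \<Rightarrow> ('z \<Rightarrow> real) \<Rightarrow> 'z \<Rightarrow> real" where
 "truncation e f z = indicator {z. \<bar>f z\<bar> > e} z *\<^sub>R f z"

lemma truncation_measurable:
 assumes [measurable]: "f \<in> borel_measurable M"
 shows "truncation e f \<in> borel_measurable M"
proof -
 have "truncation e f = (\<lambda>z. if \<bar>f z\<bar> > e then f z else 0)"
  by (auto simp: truncation_def indicator_def)
 then show ?thesis by simp
qed

lemma abs_truncation_le: "\<bar>truncation e f z\<bar> \<le> \<bar>f z\<bar>"
 by (auto simp: truncation_def indicator_def)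

lemma truncation_square_le: "(truncation e f z)\<^sup>2 \<le> (f z)\<^sup>2"
 using abs_truncation_le[of e f z] by (simp add: abs_le_square_iff)

text \<open>Where \<open>\<bar>f z\<bar>\<close> exceeds \<epsilon>, it is at most
  \<open>(f z)\<^sup>2 / \<epsilon>\<close>.\<close>

lemma integrable_truncation:
 assumes f: "f \<in> borel_measurable M" "integrable M (\<lambda>z. (f z)\<^sup>2)" and e: "\<epsilon> > 0"
 shows "integrable M (truncation \<epsilon> f)"
proof (rule Bochner_Integration.integrable_bound[of _ "\<lambda>z. (1 / \<epsilon>) * (f z)\<^sup>2"])
 show "AE z in M. norm (truncation \<epsilon> f z) \<le> norm ((1 / \<epsilon>) * (f z)\<^sup>2)"
 proof (rule AE_I2, goal_cases)
  case (1 z)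
  show ?case
  proof (cases "\<bar>f z\<bar> > \<epsilon>")
   case True
   have "\<epsilon> * \<bar>f z\<bar> \<le> \<bar>f z\<bar> * \<bar>f z\<bar>" using True by (intro mult_right_mono) auto
   then show ?thesis using True e
    by (simp add: truncation_def field_simps power2_eq_square abs_mult[symmetric])
  qed (simp add: truncation_def)
 qed
qed (use f truncation_measurable in auto)

lemma truncation_tendsto: "((\<lambda>e. truncation e f z) \<longlongrightarrow> f z) (at_right 0)"
proof (cases "f z = 0")
 case True
 then show ?thesis by (simp add: truncation_def)
next
 case False
 have "\<forall>\<^sub>F e in at_right 0. e < \<bar>f z\<bar>"
  using False by (intro order_tendstoD(2)[OF tendsto_ident_at]) auto
 then have "\<forall>\<^sub>F e in at_right 0. truncation e f z = f z"
  by eventually_elim (simp add: truncation_def)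
 then show ?thesis by (rule tendsto_eventually)
qed

lemma sum_square_le: "(\<Sum>k<n. a k)\<^sup>2 \<le> real n * (\<Sum>k<n. (a k :: real)\<^sup>2)"
 using sum_squared_le_sum_of_squares[of a "{..<n}"] by (simp add: mult.commute)

context poisson_rm
begin

definition centered_truncation :: "('z \<Rightarrow> real) \<Rightarrow> real \<Rightarrow> 'w \<Rightarrow> real" where
 "centered_truncation f e u = (\<integral>z. truncation e f z \<partial>N u) - (\<integral>z. truncation e f z \<partial>\<eta>)"

lemma is_centered_integral_iff:
 "is_centered_integral P N \<eta> f X \<longleftrightarrow> X \<in> borel_measurable P \<and>
  (\<forall>d>0. ((\<lambda>e. measure P {w \<in> space P. \<bar>centered_truncation f e w - X w\<bar> > d}) \<longlongrightarrow> 0) (at_right 0))"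
 unfolding is_centered_integral_def centered_truncation_def truncation_def set_lebesgue_integral_def ..

lemma centered_truncation_measurable:
 assumes "f \<in> borel_measurable \<eta>"
 shows "centered_truncation f e \<in> borel_measurable P" unfolding centered_truncation_def
 by (intro borel_measurable_diff integral_N_measurable truncation_measurable assms) simp

text \<open>The difference is almost surely the centered integral of \<open>f\<close> over the band
  where \<open>\<bar>f\<bar>\<close> lies between \<epsilon> and \<epsilon>', so the variance bound
  applies. The right side does not depend on \<epsilon>, which makes the approximants Cauchy in mean
  square.\<close>

lemma centered_truncation_diff:
 assumes f: "f \<in> borel_measurable \<eta>" "integrable \<eta> (\<lambda>z. (f z)\<^sup>2)" and e: "0 < \<epsilon>" "\<epsilon> \<le> \<epsilon>'"
 shows "(\<integral>\<^sup>+w. ennreal ((centered_truncation f \<epsilon> w - centered_truncation f \<epsilon>' w)\<^sup>2) \<partial>P) \<le>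
  ennreal (\<integral>z. (f z - truncation \<epsilon>' f z)\<^sup>2 \<partial>\<eta>)"
proof -
 let ?g = "\<lambda>z. truncation \<epsilon> f z - truncation \<epsilon>' f z"
 note [measurable] = f(1) truncation_measurable[OF f(1)]
 have i: "integrable \<eta> (truncation \<epsilon> f)" "integrable \<eta> (truncation \<epsilon>' f)"
  using integrable_truncation[OF f] e by auto
 have gi: "integrable \<eta> ?g" using i by simp
 have g_le: "(?g z)\<^sup>2 \<le> (f z - truncation \<epsilon>' f z)\<^sup>2" "(f z - truncation \<epsilon>' f z)\<^sup>2 \<le> (f z)\<^sup>2" for z
  using e by (auto simp: truncation_def indicator_def)
 have fi: "integrable \<eta> (\<lambda>z. (f z - truncation \<epsilon>' f z)\<^sup>2)"
  by (rule Bochner_Integration.integrable_bound[OF f(2)]) (use g_le(2) in auto)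
 have gi2: "integrable \<eta> (\<lambda>z. (?g z)\<^sup>2)"
  by (rule Bochner_Integration.integrable_bound[OF fi]) (use g_le(1) in auto)
 have "(\<integral>\<^sup>+w. ennreal ((centered_truncation f \<epsilon> w - centered_truncation f \<epsilon>' w)\<^sup>2) \<partial>P) =
   (\<integral>\<^sup>+w. ennreal (((\<integral>z. ?g z \<partial>N w) - (\<integral>z. ?g z \<partial>\<eta>))\<^sup>2) \<partial>P)"
 proof (rule nn_integral_cong_AE)
  show "AE w in P. ennreal ((centered_truncation f \<epsilon> w - centered_truncation f \<epsilon>' w)\<^sup>2) =
   ennreal (((\<integral>z. ?g z \<partial>N w) - (\<integral>z. ?g z \<partial>\<eta>))\<^sup>2)"
   using AE_integrable_N[OF i(1)] AE_integrable_N[OF i(2)]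
  proof eventually_elim
   case (elim w)
   have "centered_truncation f \<epsilon> w - centered_truncation f \<epsilon>' w = (\<integral>z. ?g z \<partial>N w) - (\<integral>z. ?g z \<partial>\<eta>)"
    using elim i by (simp add: centered_truncation_def)
   then show ?case by simp
  qed
 qed
 also have "\<dots> \<le> ennreal (\<integral>z. (?g z)\<^sup>2 \<partial>\<eta>)"
  by (rule variance_centered_le[OF gi gi2])
 also have "\<dots> \<le> ennreal (\<integral>z. (f z - truncation \<epsilon>' f z)\<^sup>2 \<partial>\<eta>)"
  by (intro ennreal_leI integral_mono gi2 fi g_le)
 finally show ?thesis .
qed

lemma truncation_error_tendsto:
 assumes f: "f \<in> borel_measurable \<eta>" "integrable \<eta> (\<lambda>z. (f z)\<^sup>2)"
 shows "((\<lambda>e. \<integral>z. (f z - truncation e f z)\<^sup>2 \<partial>\<eta>) \<longlongrightarrow> 0) (at_right 0)"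
proof -
 note [measurable] = f(1) truncation_measurable[OF f(1)]
 show ?thesis
 proof (rule tendsto_at_right_sequentially[of 0 1])
  fix S :: "nat \<Rightarrow> real" assume S: "\<And>n. 0 < S n" "S \<longlonglongrightarrow> 0"
  have fS: "filterlim S (at_right 0) sequentially"
   using S by (intro filterlim_at_withinI) (auto intro: always_eventually)
  have "(\<lambda>n. \<integral>z. (f z - truncation (S n) f z)\<^sup>2 \<partial>\<eta>) \<longlonglongrightarrow> (\<integral>z. 0 \<partial>\<eta>)"
  proof (rule integral_dominated_convergence[where w="\<lambda>z. (f z)\<^sup>2"])
   show "AE z in \<eta>. (\<lambda>n. (f z - truncation (S n) f z)\<^sup>2) \<longlonglongrightarrow> 0"
   proof (rule AE_I2, goal_cases)
    case (1 z)
    have "(\<lambda>n. (f z - truncation (S n) f z)\<^sup>2) \<longlonglongrightarrow> (f z - f z)\<^sup>2"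
     by (intro tendsto_intros filterlim_compose[OF truncation_tendsto fS])
    then show ?case by simp
   qed
   show "AE z in \<eta>. norm ((f z - truncation (S n) f z)\<^sup>2) \<le> (f z)\<^sup>2" for n
    by (rule AE_I2) (auto simp: truncation_def indicator_def)
  qed (use f in auto)
  then show "(\<lambda>n. \<integral>z. (f z - truncation (S n) f z)\<^sup>2 \<partial>\<eta>) \<longlonglongrightarrow> 0" by simp
 qed simp
qed

lemma Chebyshev:
 fixes D :: "'w \<Rightarrow> real"
 assumes [measurable]: "D \<in> borel_measurable P"
  and D: "(\<integral>\<^sup>+u. ennreal ((D u)\<^sup>2) \<partial>P) \<le> ennreal c" "c \<ge> 0" and d: "d > 0"
 shows "measure P {u\<in>space P. \<bar>D u\<bar> > d} \<le> c / d\<^sup>2"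
proof -
 let ?t3 = "(\<integral>\<^sup>+u. ennreal ((D u)\<^sup>2) \<partial>P)"
 let ?t2 = "(\<integral>\<^sup>+u. ennreal ((D u)\<^sup>2) * indicator (space P) u \<partial>P)"
 let ?t1 = "(1 / d\<^sup>2)"
 have "emeasure P {u\<in>space P. \<bar>D u\<bar> > d} \<le> emeasure P {u\<in>space P. 1 \<le> ennreal ?t1 * ennreal ((D u)\<^sup>2)}"
 proof (rule emeasure_mono)
  show "{u\<in>space P. \<bar>D u\<bar> > d} \<subseteq> {u\<in>space P. 1 \<le> ennreal ?t1 * ennreal ((D u)\<^sup>2)}"
  proof safe
   fix u assume "\<bar>D u\<bar> > d"
   then have "d\<^sup>2 \<le> (D u)\<^sup>2" using d by (simp add: abs_le_square_iff[symmetric])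
   then have "1 \<le> ?t1 * (D u)\<^sup>2" using d by simp
   then show "1 \<le> ennreal ?t1 * ennreal ((D u)\<^sup>2)"
    by (subst ennreal_mult[symmetric]) (auto simp: ennreal_ge_1)
  qed
 qed measurable
 also have "\<dots> \<le> ennreal ?t1 * ?t2" by (rule nn_integral_Markov_inequality) auto
 also have "?t2 = ?t3" by (intro nn_integral_cong) simp
 also have "ennreal ?t1 * ?t3 \<le> ennreal ?t1 * ennreal c" by (rule mult_left_mono[OF D(1)]) simp
 also have "\<dots> = ennreal (c / d\<^sup>2)" using D by (simp add: ennreal_mult[symmetric])
 finally show ?thesis using D by (simp add: emeasure_eq_measure)
qed

text \<open>Integration of \<open>\<bar>D u\<bar> \<le> a / 2 + (D u)\<^sup>2 / (2 * a)\<close>, the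
  inequality of arithmetic and geometric means.\<close>

lemma nn_integral_abs_le:
 fixes D :: "'w \<Rightarrow> real"
 assumes [measurable]: "D \<in> borel_measurable P"
  and D: "(\<integral>\<^sup>+u. ennreal ((D u)\<^sup>2) \<partial>P) \<le> ennreal (a\<^sup>2)" and a: "a > 0"
 shows "(\<integral>\<^sup>+u. ennreal \<bar>D u\<bar> \<partial>P) \<le> ennreal a" (is "?l1 \<le> _")
proof -
 have "?l1 \<le> (\<integral>\<^sup>+u. ennreal (a / 2) + ennreal (1 / (2 * a)) * ennreal ((D u)\<^sup>2) \<partial>P)"
 proof (rule nn_integral_mono, goal_cases)
  case (1 u)
  have "0 \<le> (\<bar>D u\<bar> - a)\<^sup>2" by simp
  then have "2 * a * \<bar>D u\<bar> \<le> a\<^sup>2 + (D u)\<^sup>2" by (simp add: power2_diff algebra_simps)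
  then have "\<bar>D u\<bar> \<le> a / 2 + 1 / (2 * a) * (D u)\<^sup>2" using a by (simp add: field_simps power2_eq_square)
  then have "ennreal \<bar>D u\<bar> \<le> ennreal (a / 2 + 1 / (2 * a) * (D u)\<^sup>2)" by (rule ennreal_leI)
  also have "\<dots> = ennreal (a / 2) + ennreal (1 / (2 * a)) * ennreal ((D u)\<^sup>2)"
   using a by (simp add: ennreal_plus ennreal_mult[symmetric] del: ennreal_plus[symmetric])
  finally show ?case .
 qed
 also have "\<dots> = ennreal (a / 2) + ennreal (1 / (2 * a)) * (\<integral>\<^sup>+u. ennreal ((D u)\<^sup>2) \<partial>P)"
  by (simp add: nn_integral_add nn_integral_cmult emeasure_space_1)
 also have "\<dots> \<le> ennreal (a / 2) + ennreal (1 / (2 * a)) * ennreal (a\<^sup>2)"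
  by (intro add_left_mono mult_left_mono D) simp
 also have "\<dots> = ennreal (a / 2 + 1 / (2 * a) * a\<^sup>2)"
  using a by (simp add: ennreal_plus ennreal_mult[symmetric] del: ennreal_plus[symmetric])
 also have "a / 2 + 1 / (2 * a) * a\<^sup>2 = a" using a by (simp add: field_simps power2_eq_square)
 finally show ?thesis .
qed

text \<open>Along levels \<open>E n\<close> whose remaining second moment is below
  \<open>(1/4) ^ n\<close>, consecutive approximants differ in mean by at most
  \<open>(1/2) ^ n\<close>, so they converge almost surely. Fatou's lemma bounds the mean square
  distance to the limit, and Chebyshev's inequality extends the convergence from the levels
  \<open>E n\<close> to every \<epsilon> tending to 0.\<close>

lemma centered_integral_exists:
 assumes f: "f \<in> borel_measurable \<eta>" "integrable \<eta> (\<lambda>z. (f z)\<^sup>2)"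
 shows "\<exists>X. is_centered_integral P N \<eta> f X"
proof -
 define \<tau> where "\<tau> = (\<lambda>\<epsilon>. \<integral>z. (f z - truncation \<epsilon> f z)\<^sup>2 \<partial>\<eta>)"
 define Z where "Z = centered_truncation f"
 have Zm[measurable]: "Z \<epsilon> \<in> borel_measurable P" for \<epsilon>
  unfolding Z_def by (rule centered_truncation_measurable[OF f(1)])
 have \<tau>0: "\<tau> \<epsilon> \<ge> 0" for \<epsilon> by (simp add: \<tau>_def)
 have Zd: "(\<integral>\<^sup>+w. ennreal ((Z \<epsilon> w - Z \<epsilon>' w)\<^sup>2) \<partial>P) \<le> ennreal (\<tau> \<epsilon>')" if "0 < \<epsilon>" "\<epsilon> \<le> \<epsilon>'" for \<epsilon> \<epsilon>'
  unfolding Z_def \<tau>_def by (rule centered_truncation_diff[OF f that])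
 have "\<exists>b>0. \<forall>\<epsilon>>0. \<epsilon> < b \<longrightarrow> \<tau> \<epsilon> < (1/4) ^ n" for n :: nat
  using order_tendstoD(2)[OF truncation_error_tendsto[OF f], of "(1/4)^n"]
  by (simp add: eventually_at_right_field \<tau>_def)
 then obtain b where b: "b n > 0" "\<And>\<epsilon>. 0 < \<epsilon> \<Longrightarrow> \<epsilon> < b n \<Longrightarrow> \<tau> \<epsilon> < (1/4) ^ n" for n by metis
 \<comment> \<open>The minimum over all earlier bounds makes \<open>E\<close> decreasing, and the
   factor 1/2 puts \<open>E n\<close> strictly below \<open>b n\<close>.\<close>
 define E where "E = (\<lambda>n. Min (b ` {..n}) / 2)"
 have E0: "E n > 0" for n using b(1) by (simp add: E_def)
 have E_dec: "E m \<le> E n" if "n \<le> m" for n m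
  unfolding E_def using that by (intro divide_right_mono Min_antimono) auto
 have \<tau>E: "\<tau> (E n) < (1/4) ^ n" for n
 proof (rule b(2)[OF E0])
  have "Min (b ` {..n}) \<le> b n" by (rule Min_le) auto
  then show "E n < b n" using b(1)[of n] unfolding E_def by linarith
 qed
 define D where "D = (\<lambda>n w. Z (E (Suc n)) w - Z (E n) w)"
 have [measurable]: "D n \<in> borel_measurable P" for n unfolding D_def by measurable
 have D: "(\<integral>\<^sup>+w. ennreal \<bar>D n w\<bar> \<partial>P) \<le> ennreal ((1/2) ^ n)" for n
 proof (rule nn_integral_abs_le)
  let ?t4 = "(\<integral>\<^sup>+w. ennreal ((D n w)\<^sup>2) \<partial>P)"
  have "?t4 \<le> ennreal (\<tau> (E n))" unfolding D_def by (rule Zd) (auto intro: E0 E_dec)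
  also have "\<dots> \<le> ennreal (((1/2) ^ n)\<^sup>2)"
   using less_imp_le[OF \<tau>E[of n]] by (intro ennreal_leI) (simp add: power2_eq_square power_mult_distrib[symmetric])
  finally show "?t4 \<le> ennreal (((1/2) ^ n)\<^sup>2)" .
 qed auto
 have "(\<integral>\<^sup>+w. (\<Sum>n. ennreal \<bar>D n w\<bar>) \<partial>P) = (\<Sum>n. \<integral>\<^sup>+w. ennreal \<bar>D n w\<bar> \<partial>P)"
  by (rule nn_integral_suminf) simp
 also have "\<dots> \<le> (\<Sum>n. ennreal ((1/2) ^ n))" by (intro suminf_le D) auto
 also have "\<dots> < \<infinity>" using summable_geometric[of "1/2::real"] by (subst suminf_ennreal2) auto
 finally have "AE w in P. (\<Sum>n. ennreal \<bar>D n w\<bar>) \<noteq> \<infinity>"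
  by (intro nn_integral_PInf_AE) auto
 then have conv: "AE w in P. convergent (\<lambda>n. Z (E n) w)"
 proof eventually_elim
  case (elim w)
  then have "summable (\<lambda>n. \<bar>D n w\<bar>)" by (intro summable_suminf_not_top) auto
  then have "summable (\<lambda>n. D n w)" by (rule summable_rabs_cancel)
  then have "convergent (\<lambda>m. \<Sum>n<m. D n w)" by (simp add: summable_iff_convergent)
  then have "convergent (\<lambda>m. Z (E m) w - Z (E 0) w)"
   unfolding D_def by (subst (asm) sum_lessThan_telescope)
  from convergent_add[OF this convergent_const[of "Z (E 0) w"]] show ?case by simp
 qed
 define X where "X = (\<lambda>w. lim (\<lambda>n. Z (E n) w))"
 have Xm[measurable]: "X \<in> borel_measurable P" unfolding X_def by measurable
 \<comment> \<open>Fatou's lemma in \<open>m\<close>: for \<open>m \<ge> n\<close> the distance to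
   \<open>Z (E m)\<close> is bounded by the remaining second moment at level \<open>E n\<close>,
   uniformly in \<open>m\<close>.\<close>
 have ZX: "(\<integral>\<^sup>+w. ennreal ((Z (E n) w - X w)\<^sup>2) \<partial>P) \<le> ennreal ((1/4) ^ n)" for n
 proof -
  have "(\<integral>\<^sup>+w. ennreal ((Z (E n) w - X w)\<^sup>2) \<partial>P) = (\<integral>\<^sup>+w. liminf (\<lambda>m. ennreal ((Z (E n) w - Z (E m) w)\<^sup>2)) \<partial>P)"
  proof (rule nn_integral_cong_AE)
   show "AE w in P. ennreal ((Z (E n) w - X w)\<^sup>2) = liminf (\<lambda>m. ennreal ((Z (E n) w - Z (E m) w)\<^sup>2))"
    using conv
   proof eventually_elim
    case (elim w)
    then have "(\<lambda>m. Z (E m) w) \<longlonglongrightarrow> X w" by (simp add: X_def convergent_LIMSEQ_iff)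
    then have "(\<lambda>m. ennreal ((Z (E n) w - Z (E m) w)\<^sup>2)) \<longlonglongrightarrow> ennreal ((Z (E n) w - X w)\<^sup>2)"
     by (intro tendsto_ennrealI tendsto_intros)
    then show ?case by (intro lim_imp_Liminf[symmetric]) auto
   qed
  qed
  also have "\<dots> \<le> liminf (\<lambda>m. \<integral>\<^sup>+w. ennreal ((Z (E n) w - Z (E m) w)\<^sup>2) \<partial>P)"
   by (rule nn_integral_liminf) auto
  also have "\<dots> \<le> ennreal ((1/4) ^ n)"
  proof (rule Liminf_le)
   show "\<forall>\<^sub>F m in sequentially. (\<integral>\<^sup>+w. ennreal ((Z (E n) w - Z (E m) w)\<^sup>2) \<partial>P) \<le> ennreal ((1/4) ^ n)"
    using eventually_ge_at_top[of n]
   proof eventually_elim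
    case (elim m)
    have "(\<integral>\<^sup>+w. ennreal ((Z (E n) w - Z (E m) w)\<^sup>2) \<partial>P) = (\<integral>\<^sup>+w. ennreal ((Z (E m) w - Z (E n) w)\<^sup>2) \<partial>P)"
     by (simp add: power2_commute)
    also have "\<dots> \<le> ennreal (\<tau> (E n))" by (intro Zd E0 E_dec elim)
    also have "\<dots> \<le> ennreal ((1/4) ^ n)" using \<tau>E[of n] by (intro ennreal_leI) simp
    finally show ?case .
   qed
  qed simp
  finally show ?thesis .
 qed
 have "((\<lambda>\<epsilon>. measure P {w \<in> space P. \<bar>Z \<epsilon> w - X w\<bar> > d}) \<longlongrightarrow> 0) (at_right 0)" if d: "d > 0" for d
 proof (rule tendstoI)
  fix r :: real assume r: "r > 0"
  have "(\<lambda>n. 4 * (1/4) ^ n / d\<^sup>2) \<longlonglongrightarrow> 4 * 0 / d\<^sup>2"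
   using d by (intro tendsto_intros LIMSEQ_power_zero) auto
  then have "\<forall>\<^sub>F n in sequentially. 4 * (1/4) ^ n / d\<^sup>2 < r"
   using r by (intro order_tendstoD(2)) auto
  then obtain n where n: "4 * (1/4) ^ n / d\<^sup>2 < r" by (auto simp: eventually_sequentially)
  have "\<forall>\<^sub>F \<epsilon> in at_right 0. 0 < \<epsilon> \<and> \<epsilon> \<le> E n"
   using E0[of n] by (auto simp: eventually_at_right_field intro!: exI[of _ "E n"])
  then show "\<forall>\<^sub>F \<epsilon> in at_right 0. dist (measure P {w \<in> space P. \<bar>Z \<epsilon> w - X w\<bar> > d}) 0 < r"
  proof eventually_elim
   case (elim \<epsilon>)
   have "(\<integral>\<^sup>+w. ennreal ((Z \<epsilon> w - X w)\<^sup>2) \<partial>P) \<le>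
    (\<integral>\<^sup>+w. 2 * ennreal ((Z \<epsilon> w - Z (E n) w)\<^sup>2) + 2 * ennreal ((Z (E n) w - X w)\<^sup>2) \<partial>P)"
   proof (rule nn_integral_mono)
    fix w
    let ?t5 = "(Z \<epsilon> w - X w)"
    let ?t3 = "(Z (E n) w - X w)"
    let ?t1 = "(Z \<epsilon> w - Z (E n) w)"
    have "?t5\<^sup>2 \<le> 2 * ?t1\<^sup>2 + 2 * ?t3\<^sup>2" using sum_squares_ge_zero[of "?t1 - ?t3" 0]
     by (simp add: power2_eq_square algebra_simps)
    then have "ennreal (?t5\<^sup>2) \<le> ennreal (2 * ?t1\<^sup>2 + 2 * ?t3\<^sup>2)" by (rule ennreal_leI)
    also have "\<dots> = 2 * ennreal (?t1\<^sup>2) + 2 * ennreal (?t3\<^sup>2)"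
     by (simp add: ennreal_plus ennreal_mult del: ennreal_plus[symmetric])
    finally show "ennreal (?t5\<^sup>2) \<le> \<dots>" .
   qed
   also have "\<dots> = 2 * (\<integral>\<^sup>+w. ennreal ((Z \<epsilon> w - Z (E n) w)\<^sup>2) \<partial>P) + 2 * (\<integral>\<^sup>+w. ennreal ((Z (E n) w - X w)\<^sup>2) \<partial>P)"
    by (simp add: nn_integral_add nn_integral_cmult)
   also have "\<dots> \<le> 2 * ennreal ((1/4) ^ n) + 2 * ennreal ((1/4) ^ n)"
   proof (intro add_mono mult_left_mono ZX)
    let ?t2 = "(\<integral>\<^sup>+w. ennreal ((Z \<epsilon> w - Z (E n) w)\<^sup>2) \<partial>P)"
    have "?t2 \<le> ennreal (\<tau> (E n))" using elim by (intro Zd) auto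
    also have "\<dots> \<le> ennreal ((1/4) ^ n)" using \<tau>E[of n] by (intro ennreal_leI) simp
    finally show "?t2 \<le> ennreal ((1/4) ^ n)" .
   qed auto
   also have "\<dots> = ennreal (2 * (1/4) ^ n + 2 * (1/4) ^ n)"
   proof -
    have "2 * ennreal ((1/4) ^ n) = ennreal (2 * (1/4) ^ n)" by (simp add: ennreal_mult)
    then show ?thesis by (simp only:) (rule ennreal_plus[symmetric], simp_all)
   qed
   finally have "measure P {w\<in>space P. \<bar>Z \<epsilon> w - X w\<bar> > d} \<le> (2 * (1/4) ^ n + 2 * (1/4) ^ n) / d\<^sup>2"
    by (rule Chebyshev[rotated]) (use d in auto)
   also have "\<dots> < r" using n by simp
   finally show ?case by simp
  qed
 qed
 then have "is_centered_integral P N \<eta> f X" unfolding is_centered_integral_iff Z_def by simp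
 then show ?thesis by (rule exI[of _ X])
qed

lemma is_centered_integral_centered_integral:
 assumes f: "f \<in> borel_measurable \<eta>" "integrable \<eta> (\<lambda>z. (f z)\<^sup>2)"
 shows "is_centered_integral P N \<eta> f (centered_integral P N \<eta> f)"
 unfolding centered_integral_def by (rule someI_ex[OF centered_integral_exists[OF f]])

text \<open>The functions are truncated one at a time, since each \<open>X k\<close> is
  characterized by the truncations of \<open>f k\<close> alone. Convergence in probability passes to
  the weighted sum on the left; on the right the quadratic bound on \<open>Psi\<close> provides the
  majorant.\<close>

lemma char_centered_integrals:
 fixes f :: "nat \<Rightarrow> 'z \<Rightarrow> real"
 assumes f: "\<And>k. k < n \<Longrightarrow> f k \<in> borel_measurable \<eta>" "\<And>k. k < n \<Longrightarrow> integrable \<eta> (\<lambda>z. (f k z)\<^sup>2)"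
  and X: "\<And>k. k < n \<Longrightarrow> is_centered_integral P N \<eta> (f k) (X k)"
 shows "(CLINT u|P. iexp (\<Sum>k<n. t k * X k u)) = exp (CLINT z|\<eta>. Psi (\<Sum>k<n. t k * f k z))" (is "?l1 = _")
proof -
 define \<epsilon> where "\<epsilon> = (\<lambda>m::nat. 1 / real (Suc m))"
 have \<epsilon>: "\<epsilon> m > 0" for m by (simp add: \<epsilon>_def)
 have f\<epsilon>: "filterlim \<epsilon> (at_right 0) sequentially"
  using \<epsilon> LIMSEQ_Suc[OF lim_1_over_n] by (intro filterlim_at_withinI) (auto simp: \<epsilon>_def)
 define g where "g = (\<lambda>m z. \<Sum>k<n. t k * truncation (\<epsilon> m) (f k) z)"
 define S where "S = (\<lambda>m u. \<Sum>k<n. t k * centered_truncation (f k) (\<epsilon> m) u)"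
 have Xm[measurable]: "X k \<in> borel_measurable P" if "k < n" for k
  using X[OF that] by (simp add: is_centered_integral_iff)
 have Zm[measurable]: "centered_truncation (f k) e \<in> borel_measurable P" if "k < n" for k e
  by (rule centered_truncation_measurable[OF f(1)[OF that]])
 have fm[measurable]: "f k \<in> borel_measurable \<eta>" if "k < n" for k using f(1)[OF that] .
 have tm[measurable]: "truncation e (f k) \<in> borel_measurable \<eta>" if "k < n" for k e
  by (rule truncation_measurable[OF f(1)[OF that]])
 have Sm[measurable]: "S m \<in> borel_measurable P" for m unfolding S_def by measurable
 have ti: "integrable \<eta> (truncation (\<epsilon> m) (f k))" if "k < n" for k m
  by (rule integrable_truncation[OF f(1)[OF that] f(2)[OF that] \<epsilon>])
 have gi: "integrable \<eta> (g m)" for m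
  unfolding g_def using ti by (intro Bochner_Integration.integrable_sum integrable_mult_right) auto
 have "(CLINT u|P. iexp (S m u)) = exp (CLINT z|\<eta>. Psi (g m z))" for m
 proof -
  let ?t3 = "(\<integral>z. g m z \<partial>\<eta>)"
  have "AE u in P. \<forall>k\<in>{..<n}. integrable (N u) (truncation (\<epsilon> m) (f k))"
   using ti by (intro AE_finite_allI AE_integrable_N) auto
  then have "AE u in P. S m u = (\<integral>z. g m z \<partial>N u) - ?t3"
  proof eventually_elim
   case (elim u)
   have "(\<integral>z. g m z \<partial>N u) = (\<Sum>k<n. t k * (\<integral>z. truncation (\<epsilon> m) (f k) z \<partial>N u))"
    unfolding g_def using elim by (subst Bochner_Integration.integral_sum) auto
   moreover have "?t3 = (\<Sum>k<n. t k * (\<integral>z. truncation (\<epsilon> m) (f k) z \<partial>\<eta>))"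
    unfolding g_def using ti by (subst Bochner_Integration.integral_sum) auto
   ultimately show ?case by (simp add: S_def centered_truncation_def right_diff_distrib sum_subtractf)
  qed
  moreover have "(\<lambda>u. \<integral>z. g m z \<partial>N u) \<in> borel_measurable P"
   by (rule integral_N_measurable) (use gi in simp)
  ultimately have "(CLINT u|P. iexp (S m u)) = (CLINT u|P. iexp ((\<integral>z. g m z \<partial>N u) - ?t3))"
   by (intro integral_cong_AE) (auto elim!: eventually_mono)
  then show ?thesis using char_centered[OF gi] by simp
 qed
 moreover have "(\<lambda>m. CLINT u|P. iexp (S m u)) \<longlonglongrightarrow> ?l1"
 proof (rule tendsto_expectation_iexp)
  fix d :: real assume d: "d > 0"
  \<comment> \<open>If every approximant is within \<open>d / T\<close> of its limit, the weighted
    sum is within \<open>d\<close> of its own; adding 1 keeps \<open>T\<close> positive when all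
    weights vanish.\<close>
  define T where "T = (\<Sum>k<n. \<bar>t k\<bar>) + 1"
  have T: "T > 0" by (simp add: T_def add_nonneg_pos sum_nonneg)
  have "(\<lambda>m. \<Sum>k<n. measure P {u\<in>space P. \<bar>centered_truncation (f k) (\<epsilon> m) u - X k u\<bar> > d / T}) \<longlonglongrightarrow> (\<Sum>k<n. 0)"
  proof (rule tendsto_sum)
   fix k assume "k \<in> {..<n}"
   then have "((\<lambda>\<epsilon>. measure P {u \<in> space P. \<bar>centered_truncation (f k) \<epsilon> u - X k u\<bar> > d / T}) \<longlongrightarrow> 0) (at_right 0)"
    using X[of k] d T by (simp add: is_centered_integral_iff)
   from filterlim_compose[OF this f\<epsilon>]
   show "(\<lambda>m. measure P {u\<in>space P. \<bar>centered_truncation (f k) (\<epsilon> m) u - X k u\<bar> > d / T}) \<longlonglongrightarrow> 0" .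
  qed
  then have lim: "(\<lambda>m. \<Sum>k<n. measure P {u\<in>space P. \<bar>centered_truncation (f k) (\<epsilon> m) u - X k u\<bar> > d / T}) \<longlonglongrightarrow> 0" by simp
  show "(\<lambda>m. measure P {u\<in>space P. \<bar>S m u - (\<Sum>k<n. t k * X k u)\<bar> > d}) \<longlonglongrightarrow> 0"
  proof (rule tendsto_sandwich[OF _ _ tendsto_const lim])
   show "\<forall>\<^sub>F m in sequentially. measure P {u\<in>space P. \<bar>S m u - (\<Sum>k<n. t k * X k u)\<bar> > d} \<le>
    (\<Sum>k<n. measure P {u\<in>space P. \<bar>centered_truncation (f k) (\<epsilon> m) u - X k u\<bar> > d / T})"
   proof (rule always_eventually, rule allI, goal_cases)
    case (1 m)
    let ?t2 = "(\<Sum>k<n. measure P {u\<in>space P. \<bar>centered_truncation (f k) (\<epsilon> m) u - X k u\<bar> > d / T})"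
    let ?t1 = "(\<Union>k<n. {u\<in>space P. \<bar>centered_truncation (f k) (\<epsilon> m) u - X k u\<bar> > d / T})"
    have "measure P {u\<in>space P. \<bar>S m u - (\<Sum>k<n. t k * X k u)\<bar> > d} \<le>
      measure P ?t1"
    proof (rule finite_measure_mono)
     show "?t1 \<in> events" by (intro sets.finite_UN) auto
     show "{u\<in>space P. \<bar>S m u - (\<Sum>k<n. t k * X k u)\<bar> > d} \<subseteq>
      ?t1"
     proof (rule subsetI, rule ccontr)
      fix u assume u: "u \<in> {u\<in>space P. \<bar>S m u - (\<Sum>k<n. t k * X k u)\<bar> > d}"
       "u \<notin> ?t1"
      have "\<bar>S m u - (\<Sum>k<n. t k * X k u)\<bar> = \<bar>\<Sum>k<n. t k * (centered_truncation (f k) (\<epsilon> m) u - X k u)\<bar>"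
       by (simp add: S_def right_diff_distrib sum_subtractf)
      also have "\<dots> \<le> (\<Sum>k<n. \<bar>t k\<bar> * (d / T))"
      proof (rule order_trans[OF sum_abs], rule sum_mono)
       fix k assume "k \<in> {..<n}"
       then show "\<bar>t k * (centered_truncation (f k) (\<epsilon> m) u - X k u)\<bar> \<le> \<bar>t k\<bar> * (d / T)"
        using u unfolding abs_mult by (intro mult_left_mono) (auto simp: not_less)
      qed
      also have "\<dots> = (\<Sum>k<n. \<bar>t k\<bar>) * (d / T)" by (rule sum_distrib_right[symmetric])
      also have "\<dots> \<le> T * (d / T)" using d T by (intro mult_right_mono) (auto simp: T_def)
      also have "\<dots> = d" using T by simp
      finally show False using u by simp
     qed
    qed
    also have "\<dots> \<le> ?t2" by (rule finite_measure_subadditive_finite) auto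
    finally show ?case .
   qed
  qed simp
 qed (use prob_space_axioms in auto)
 moreover have "(\<lambda>m. exp (CLINT z|\<eta>. Psi (g m z))) \<longlonglongrightarrow> exp (CLINT z|\<eta>. Psi (\<Sum>k<n. t k * f k z))"
 proof (intro tendsto_exp integral_dominated_convergence[where w="\<lambda>z. real n * (\<Sum>k<n. (t k * f k z)\<^sup>2)"])
  show "AE z in \<eta>. (\<lambda>m. Psi (g m z)) \<longlonglongrightarrow> Psi (\<Sum>k<n. t k * f k z)"
   unfolding g_def
   by (intro AE_I2 isCont_tendsto_compose[OF isCont_Psi] tendsto_intros filterlim_compose[OF truncation_tendsto f\<epsilon>])
  show "AE z in \<eta>. cmod (Psi (g m z)) \<le> real n * (\<Sum>k<n. (t k * f k z)\<^sup>2)" for m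
  proof (rule AE_I2, goal_cases)
   case (1 z)
   have "cmod (Psi (g m z)) \<le> (g m z)\<^sup>2"
    using cmod_Psi_le[of "g m z"] zero_le_power2[of "g m z"] by linarith
   also have "\<dots> \<le> real n * (\<Sum>k<n. (t k * truncation (\<epsilon> m) (f k) z)\<^sup>2)"
    unfolding g_def by (rule sum_square_le)
   also have "\<dots> \<le> real n * (\<Sum>k<n. (t k * f k z)\<^sup>2)"
    using truncation_square_le[of "\<epsilon> m" "f k" z for k]
    by (intro mult_left_mono sum_mono) (auto simp: power_mult_distrib intro!: mult_left_mono)
   finally show ?case .
  qed
  show "integrable \<eta> (\<lambda>z. real n * (\<Sum>k<n. (t k * f k z)\<^sup>2))"
   using f(2) by (intro integrable_mult_right Bochner_Integration.integrable_sum) (auto simp: power_mult_distrib)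
  show "(\<lambda>z. Psi (\<Sum>k<n. t k * f k z)) \<in> borel_measurable \<eta>" by measurable
  show "(\<lambda>z. Psi (g m z)) \<in> borel_measurable \<eta>" for m unfolding g_def by measurable
 qed
 ultimately show ?thesis using LIMSEQ_unique by simp
qed

end

subsection \<open>The Jordan decomposition\<close>

lemma signed_measure_sums:
 assumes "signed_measure f" "\<And>i::nat. A i \<in> sets borel" "disjoint_family A"
 shows "(\<lambda>i. f (A i)) sums f (\<Union>i. A i)"
proof -
 have "range A \<subseteq> sets borel" using assms(2) by blast
 then show ?thesis using assms(1,3) unfolding signed_measure_def by blast
qed

lemma signed_measure_Un:
 assumes "signed_measure f" "A \<in> sets borel" "B \<in> sets borel" "A \<inter> B = {}"
 shows "f (A \<union> B) = f A + f B"
proof -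
 let ?t1 = "(\<lambda>i. f (binaryset A B i))"
 have e: "f {} = 0" using assms(1) by (simp add: signed_measure_def)
 have "?t1 sums f (\<Union>i. binaryset A B i)"
 proof (rule signed_measure_sums[OF assms(1)])
  show "binaryset A B i \<in> sets borel" for i using assms by (simp add: binaryset_def)
  show "disjoint_family (binaryset A B)" using assms by (auto simp: disjoint_family_on_def binaryset_def)
 qed
 then have "?t1 sums f (A \<union> B)" by (simp add: UN_binaryset_eq)
 moreover have "?t1 sums (f A + f B)" by (rule binaryset_sums[of f, OF e])
 ultimately show ?thesis by (rule sums_unique2)
qed

lemma signed_measure_Diff:
 assumes "signed_measure f" "A \<in> sets borel" "B \<in> sets borel" "B \<subseteq> A"
 shows "f (A - B) = f A - f B" using signed_measure_Un[of f B "A - B"] assms by (auto simp: Un_absorb1)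

lemma signed_measure_uminus: "signed_measure f \<Longrightarrow> signed_measure (\<lambda>A. - f A)"
 by (auto simp: signed_measure_def intro!: sums_minus)

lemma sets_jordan_pos [simp, measurable_cong]: "sets (jordan_pos f) = sets borel"
proof -
 have "sets (jordan_pos f) = sigma_sets UNIV (sets borel)"
  unfolding jordan_pos_def by (rule sets_measure_of) simp
 also have "\<dots> = sets borel" using sets.sigma_sets_eq[of borel] by simp
 finally show ?thesis .
qed

lemma space_jordan_pos [simp]: "space (jordan_pos f) = UNIV"
 unfolding jordan_pos_def by (rule space_measure_of) simp

lemma sets_jordan_neg [simp, measurable_cong]: "sets (jordan_neg f) = sets borel"
 by (simp add: jordan_neg_def)

lemma space_jordan_neg [simp]: "space (jordan_neg f) = UNIV" by (simp add: jordan_neg_def)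

text \<open>The set function inside \<open>jordan_pos\<close>, studied on its own because
  \<open>measure_of\<close> reproduces a set function only once its countable additivity is
  known.\<close>

definition upper_variation :: "('a::topological_space set \<Rightarrow> real) \<Rightarrow> 'a set \<Rightarrow> ennreal" where
 "upper_variation \<phi> A = (SUP B\<in>{B \<in> sets borel. B \<subseteq> A}. ennreal (\<phi> B))"

lemma upper_variation_ge: "B \<in> sets borel \<Longrightarrow> B \<subseteq> A \<Longrightarrow> ennreal (f B) \<le> upper_variation f A"
 unfolding upper_variation_def by (intro SUP_upper) auto

lemma upper_variation_empty: "signed_measure f \<Longrightarrow> upper_variation f {} = 0"
proof -
 assume "signed_measure f"
 moreover have "{B \<in> sets borel. B \<subseteq> ({}::'a set)} = {{}}" by auto
 ultimately show ?thesis unfolding upper_variation_def by (simp add: signed_measure_def)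
qed

lemma upper_variation_Un_ge:
 assumes f: "signed_measure f" and A: "A \<in> sets borel" "B \<in> sets borel" "A \<inter> B = {}"
 shows "upper_variation f A + upper_variation f B \<le> upper_variation f (A \<union> B)" (is "?l1 \<le> ?r1")
proof -
 let ?t1 = "(SUP X\<in>{X \<in> sets borel. X \<subseteq> A}. (SUP Y\<in>{Y \<in> sets borel. Y \<subseteq> B}. ennreal (f X) + ennreal (f Y)))"
 have "ennreal (f X) + ennreal (f Y) \<le> ?r1"
  if "X \<in> sets borel" "X \<subseteq> A" "Y \<in> sets borel" "Y \<subseteq> B" for X Y
 proof -
  have ge: "ennreal (f U) \<le> ?r1" if "U \<in> sets borel" "U \<subseteq> A \<union> B" for U
   using that by (rule upper_variation_ge)
  have XY: "f (X \<union> Y) = f X + f Y" using that A by (intro signed_measure_Un[OF f]) auto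
  show ?thesis
  \<comment> \<open>Two nonnegative values are added up by the union. A negative value is truncated
    to 0 by \<open>ennreal\<close>, and then the other set alone is a competitor in the
    supremum.\<close>
  proof (cases "f X \<ge> 0 \<and> f Y \<ge> 0")
   case True
   then have "ennreal (f X) + ennreal (f Y) = ennreal (f (X \<union> Y))"
    by (simp add: XY ennreal_plus del: ennreal_plus[symmetric])
   also have "\<dots> \<le> ?r1" using that by (intro ge) auto
   finally show ?thesis .
  next
   case False
   have le: "ennreal (f X) \<le> ?r1" "ennreal (f Y) \<le> ?r1" using that by (intro ge; blast)+
   from False have "ennreal (f X) = 0 \<or> ennreal (f Y) = 0"
    using ennreal_neg[of "f X"] ennreal_neg[of "f Y"] by linarith
   then show ?thesis using le by (elim disjE) simp_all
  qed
 qed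
 then have "?t1 \<le> ?r1" by (intro SUP_least) auto
 moreover have "?t1 =
  upper_variation f A + upper_variation f B"
 proof -
  have ne: "{X \<in> sets borel. X \<subseteq> A} \<noteq> {}" "{Y \<in> sets borel. Y \<subseteq> B} \<noteq> {}" by auto
  have "(SUP Y\<in>{Y \<in> sets borel. Y \<subseteq> B}. ennreal (f X) + ennreal (f Y)) = ennreal (f X) + upper_variation f B" for X
   unfolding upper_variation_def by (rule ennreal_SUP_add_right[OF ne(2), symmetric])
  moreover have "(SUP X\<in>{X \<in> sets borel. X \<subseteq> A}. ennreal (f X) + upper_variation f B) = ?l1"
   unfolding upper_variation_def[of f A] by (rule ennreal_SUP_add_left[OF ne(1)])
  ultimately show ?thesis by simp
 qed
 ultimately show ?thesis by simp
qed

lemma ennreal_add_le: "ennreal (a + b) \<le> ennreal a + ennreal b"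
proof -
 have "ennreal (a + b) \<le> ennreal (max 0 a + max 0 b)" by (intro ennreal_leI) auto
 also have "\<dots> = ennreal (max 0 a) + ennreal (max 0 b)" by (rule ennreal_plus) auto
 also have "\<dots> = ennreal a + ennreal b" by (auto simp: max_def ennreal_neg)
 finally show ?thesis .
qed

text \<open>Finite superadditivity gives one inequality. For the other, a competitor
  \<open>B\<close> is cut into the pieces \<open>A i \<inter> B\<close>, whose values sum to that of
  \<open>B\<close>.\<close>

lemma countably_additive_upper_variation:
 assumes \<phi>: "signed_measure \<phi>"
 shows "countably_additive (sets borel) (upper_variation \<phi>)"
 unfolding countably_additive_def
proof (intro allI impI)
 fix A :: "nat \<Rightarrow> 'a set"
 assume A: "range A \<subseteq> sets borel" "disjoint_family A" "(\<Union>i. A i) \<in> sets borel"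
 have Ai: "A i \<in> sets borel" for i using A by auto
 show "(\<Sum>i. upper_variation \<phi> (A i)) = upper_variation \<phi> (\<Union>i. A i)"
 proof (rule antisym)
  have "(\<Sum>i<n. upper_variation \<phi> (A i)) \<le> upper_variation \<phi> (\<Union>i<n. A i)" for n
  proof (induction n)
   case 0
   then show ?case using upper_variation_empty[OF \<phi>] by simp
  next
   case (Suc n)
   have "(\<Sum>i<Suc n. upper_variation \<phi> (A i)) \<le> upper_variation \<phi> (\<Union>i<n. A i) + upper_variation \<phi> (A n)"
    using Suc by (simp add: add_right_mono)
   also have "\<dots> \<le> upper_variation \<phi> ((\<Union>i<n. A i) \<union> A n)"
   proof (rule upper_variation_Un_ge[OF \<phi>])
    have "A i \<inter> A n = {}" if "i < n" for i
     using A(2) that unfolding disjoint_family_on_def by (metis UNIV_I less_irrefl)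
    then show "(\<Union>i<n. A i) \<inter> A n = {}" by blast
    show "(\<Union>i<n. A i) \<in> sets borel" using Ai by (intro sets.finite_UN) auto
   qed (rule Ai)
   also have "(\<Union>i<n. A i) \<union> A n = (\<Union>i<Suc n. A i)" by (auto simp: less_Suc_eq)
   finally show ?case .
  qed
  also have "upper_variation \<phi> (\<Union>i<n. A i) \<le> upper_variation \<phi> (\<Union>i. A i)" for n
   unfolding upper_variation_def by (intro SUP_subset_mono) auto
  finally show "(\<Sum>i. upper_variation \<phi> (A i)) \<le> upper_variation \<phi> (\<Union>i. A i)"
   by (intro suminf_le_const) auto
  show "upper_variation \<phi> (\<Union>i. A i) \<le> (\<Sum>i. upper_variation \<phi> (A i))"
   unfolding upper_variation_def[of \<phi> "\<Union>i. A i"]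
  proof (rule SUP_least, clarify)
   fix B :: "'a set" assume B: "B \<in> sets borel" "B \<subseteq> (\<Union>i. A i)"
   have "(\<lambda>i. \<phi> (A i \<inter> B)) sums \<phi> (\<Union>i. A i \<inter> B)"
   proof (rule signed_measure_sums[OF \<phi>])
    show "A i \<inter> B \<in> sets borel" for i using Ai B(1) by simp
    show "disjoint_family (\<lambda>i. A i \<inter> B)" using A(2) unfolding disjoint_family_on_def by blast
   qed
   also have "(\<Union>i. A i \<inter> B) = B" using B by auto
   finally have s: "(\<lambda>i. \<phi> (A i \<inter> B)) sums \<phi> B" .
   have "ennreal (\<phi> B) \<le> (\<Sum>i. ennreal (\<phi> (A i \<inter> B)))"
   proof (rule tendsto_le)
    show "(\<lambda>n. \<Sum>i<n. ennreal (\<phi> (A i \<inter> B))) \<longlonglongrightarrow> (\<Sum>i. ennreal (\<phi> (A i \<inter> B)))"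
     by (rule summable_LIMSEQ) simp
    show "(\<lambda>n. ennreal (\<Sum>i<n. \<phi> (A i \<inter> B))) \<longlonglongrightarrow> ennreal (\<phi> B)"
     using s by (intro tendsto_ennrealI) (simp add: sums_def)
    show "\<forall>\<^sub>F n in sequentially. ennreal (\<Sum>i<n. \<phi> (A i \<inter> B)) \<le> (\<Sum>i<n. ennreal (\<phi> (A i \<inter> B)))"
    proof (rule always_eventually, rule allI)
     fix n
     show "ennreal (\<Sum>i<n. \<phi> (A i \<inter> B)) \<le> (\<Sum>i<n. ennreal (\<phi> (A i \<inter> B)))"
     proof (induction n)
      case (Suc n)
      have "ennreal (\<Sum>i<Suc n. \<phi> (A i \<inter> B)) \<le> ennreal (\<Sum>i<n. \<phi> (A i \<inter> B)) + ennreal (\<phi> (A n \<inter> B))"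
       using ennreal_add_le[of "\<Sum>i<n. \<phi> (A i \<inter> B)" "\<phi> (A n \<inter> B)"] by simp
      also have "\<dots> \<le> (\<Sum>i<n. ennreal (\<phi> (A i \<inter> B))) + ennreal (\<phi> (A n \<inter> B))"
       by (rule add_right_mono[OF Suc])
      finally show ?case by simp
     qed simp
    qed
   qed simp
   also have "\<dots> \<le> (\<Sum>i. upper_variation \<phi> (A i))"
    using Ai B by (intro suminf_le upper_variation_ge) auto
   finally show "ennreal (\<phi> B) \<le> (\<Sum>i. upper_variation \<phi> (A i))" .
  qed
 qed
qed

lemma emeasure_jordan_pos:
 assumes "signed_measure f" "A \<in> sets borel"
 shows "emeasure (jordan_pos f) A = upper_variation f A"
proof (rule emeasure_measure_of[OF jordan_pos_def[folded upper_variation_def]])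
 show "positive (sets (jordan_pos f)) (upper_variation f)"
  using upper_variation_empty[OF assms(1)] by (simp add: positive_def)
 show "countably_additive (sets (jordan_pos f)) (upper_variation f)"
  using countably_additive_upper_variation[OF assms(1)] by simp
qed (use assms in auto)

lemma emeasure_jordan_neg:
 assumes "signed_measure f" "A \<in> sets borel"
 shows "emeasure (jordan_neg f) A = upper_variation (\<lambda>A. - f A) A"
 unfolding jordan_neg_def by (rule emeasure_jordan_pos[OF signed_measure_uminus[OF assms(1)] assms(2)])

lemma sets_total_variation [simp, measurable_cong]: "sets (total_variation f) = sets borel"
proof -
 have "sets (total_variation f) = sigma_sets UNIV (sets borel)"
  unfolding total_variation_def by (rule sets_measure_of) simp
 also have "\<dots> = sets borel" using sets.sigma_sets_eq[of borel] by simp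
 finally show ?thesis .
qed

lemma space_total_variation [simp]: "space (total_variation f) = UNIV"
 unfolding total_variation_def by (rule space_measure_of) simp

lemma emeasure_total_variation:
 assumes "A \<in> sets borel"
 shows "emeasure (total_variation f) A = emeasure (jordan_pos f) A + emeasure (jordan_neg f) A"
proof (rule emeasure_measure_of[OF total_variation_def])
 let ?t2 = "(\<lambda>A. emeasure (jordan_pos f) A + emeasure (jordan_neg f) A)"
 show "positive (sets (total_variation f)) ?t2" by (simp add: positive_def)
 show "countably_additive (sets (total_variation f)) ?t2" unfolding countably_additive_def
 proof (intro allI impI)
  fix A :: "nat \<Rightarrow> 'a set"
  let ?t1 = "(\<Sum>i. emeasure (jordan_pos f) (A i) + emeasure (jordan_neg f) (A i))"
  assume A: "range A \<subseteq> sets (total_variation f)" "disjoint_family A"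
  have "?t1 =
   (\<Sum>i. emeasure (jordan_pos f) (A i)) + (\<Sum>i. emeasure (jordan_neg f) (A i))"
   by (rule suminf_add[symmetric]) auto
  also have "\<dots> = emeasure (jordan_pos f) (\<Union>i. A i) + emeasure (jordan_neg f) (\<Union>i. A i)"
   using A by (simp add: suminf_emeasure)
  finally show "?t1 =
   emeasure (jordan_pos f) (\<Union>i. A i) + emeasure (jordan_neg f) (\<Union>i. A i)" .
 qed
qed (use assms in auto)

lemma
 assumes "\<phi> \<in> M1"
 shows finite_measure_jordan_pos: "finite_measure (jordan_pos \<phi>)"
  and finite_measure_jordan_neg: "finite_measure (jordan_neg \<phi>)"
  and finite_measure_total_variation: "finite_measure (total_variation \<phi>)"
proof -
 have f: "emeasure (total_variation \<phi>) UNIV < \<infinity>" using assms by (simp add: M1_def)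
 then show "finite_measure (total_variation \<phi>)" by (intro finite_measureI) simp
 show "finite_measure (jordan_pos \<phi>)" "finite_measure (jordan_neg \<phi>)"
  using f by (auto intro!: finite_measureI simp: emeasure_total_variation)
qed

text \<open>Complements take the place of a Hahn set: \<open>f B = f A - f (A - B)\<close> for
  \<open>B \<subseteq> A\<close>, so the suprema of \<open>f\<close> and of \<open>- f\<close> over
  subsets of \<open>A\<close> differ by exactly \<open>f A\<close>. Membership in \<open>M1\<close>
  keeps both suprema finite.\<close>

lemma jordan_decomposition:
 assumes "f \<in> M1" "A \<in> sets borel"
 shows "f A = measure (jordan_pos f) A - measure (jordan_neg f) A"
proof -
 have f: "signed_measure f" using assms by (simp add: M1_def)
 interpret p: finite_measure "jordan_pos f" by (rule finite_measure_jordan_pos[OF assms(1)])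
 interpret n: finite_measure "jordan_neg f" by (rule finite_measure_jordan_neg[OF assms(1)])
 have e: "f {} = 0" using f by (simp add: signed_measure_def)
 have p_ge: "f B \<le> measure (jordan_pos f) A" if "B \<in> sets borel" "B \<subseteq> A" for B
 proof -
  have "ennreal (f B) \<le> ennreal (measure (jordan_pos f) A)" using upper_variation_ge[OF that, of f]
   unfolding emeasure_jordan_pos[OF f assms(2), symmetric] p.emeasure_eq_measure .
  then show ?thesis by (simp add: ennreal_le_iff)
 qed
 have n_ge: "- f B \<le> measure (jordan_neg f) A" if "B \<in> sets borel" "B \<subseteq> A" for B
 proof -
  have "ennreal (- f B) \<le> ennreal (measure (jordan_neg f) A)"
   using upper_variation_ge[OF that, of "\<lambda>A. - f A"]
   unfolding emeasure_jordan_neg[OF f assms(2), symmetric] n.emeasure_eq_measure .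
  then show ?thesis by (simp add: ennreal_le_iff)
 qed
 have p_le: "measure (jordan_pos f) A \<le> c" if "\<And>B. B \<in> sets borel \<Longrightarrow> B \<subseteq> A \<Longrightarrow> f B \<le> c" for c
 proof -
  have c: "c \<ge> 0" using that[of "{}"] e by simp
  have "ennreal (measure (jordan_pos f) A) = upper_variation f A"
   using emeasure_jordan_pos[OF f assms(2)] by (simp add: p.emeasure_eq_measure)
  also have "\<dots> \<le> ennreal c"
   unfolding upper_variation_def by (intro SUP_least ennreal_leI) (use that in auto)
  finally show ?thesis using c by (simp add: ennreal_le_iff)
 qed
 have n_le: "measure (jordan_neg f) A \<le> c" if "\<And>B. B \<in> sets borel \<Longrightarrow> B \<subseteq> A \<Longrightarrow> - f B \<le> c" for c
 proof -
  have c: "c \<ge> 0" using that[of "{}"] e by simp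
  have "ennreal (measure (jordan_neg f) A) = upper_variation (\<lambda>A. - f A) A"
   using emeasure_jordan_neg[OF f assms(2)] by (simp add: n.emeasure_eq_measure)
  also have "\<dots> \<le> ennreal c"
   unfolding upper_variation_def by (intro SUP_least ennreal_leI) (use that in auto)
  finally show ?thesis using c by (simp add: ennreal_le_iff)
 qed
 have "measure (jordan_neg f) A \<le> measure (jordan_pos f) A - f A"
 proof (rule n_le)
  fix B assume B: "B \<in> sets borel" "B \<subseteq> A"
  show "- f B \<le> measure (jordan_pos f) A - f A"
   using p_ge[of "A - B"] signed_measure_Diff[OF f assms(2) B] B assms(2) by auto
 qed
 moreover have "measure (jordan_pos f) A \<le> measure (jordan_neg f) A + f A"
 proof (rule p_le)
  fix B assume B: "B \<in> sets borel" "B \<subseteq> A"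
  show "f B \<le> measure (jordan_neg f) A + f A"
   using n_ge[of "A - B"] signed_measure_Diff[OF f assms(2) B] B assms(2) by auto
 qed
 ultimately show ?thesis by simp
qed

lemma abs_le_total_variation:
 assumes "f \<in> M1" "A \<in> sets borel"
 shows "\<bar>f A\<bar> \<le> measure (total_variation f) A"
proof -
 interpret p: finite_measure "jordan_pos f" by (rule finite_measure_jordan_pos[OF assms(1)])
 interpret n: finite_measure "jordan_neg f" by (rule finite_measure_jordan_neg[OF assms(1)])
 have "measure (total_variation f) A = measure (jordan_pos f) A + measure (jordan_neg f) A"
  using emeasure_total_variation[OF assms(2), of f]
  by (simp add: measure_def enn2real_plus less_top[symmetric])
 then show ?thesis unfolding jordan_decomposition[OF assms]
  using measure_nonneg[of "jordan_pos f" A] measure_nonneg[of "jordan_neg f" A] by linarith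
qed

subsection \<open>Regularly varying tails and quantiles\<close>

lemma powr_divide_eq:
 fixes x y e :: real
 assumes "x > 0" "y > 0"
 shows "(x / y) powr e = x powr e * y powr (- e)"
 using assms by (simp add: powr_divide powr_minus field_simps)

lemma nn_integral_powr_finite:
 fixes f :: "real \<Rightarrow> real"
 assumes "(f has_integral I) S" "f \<in> borel_measurable borel" "S \<in> sets borel" "\<And>x. f x \<ge> 0"
 shows "(\<integral>\<^sup>+s. ennreal (indicator S s * f s) \<partial>lborel) < \<infinity>"
proof -
 have "(\<lambda>s. indicator S s * f s) = (\<lambda>s. if s \<in> S then f s else 0)"
  by (auto simp: indicator_def)
 then have "((\<lambda>s. indicator S s * f s) has_integral I) UNIV"
  using assms(1) by (simp add: has_integral_restrict_UNIV)
 from nn_integral_has_integral_lborel[OF _ _ this] show ?thesis using assms by simp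
qed

section \<open>Positivity of the tail and Potter's bound\<close>

locale rv_tail = real_distribution \<mu> for \<mu> :: "real measure" +
 fixes \<gamma> :: real
 assumes \<gamma>_gt_1: "\<gamma> > 1" and positive: "AE v in \<mu>. v > 0"
  and regular: "regularly_varying (\<lambda>v. 1 - cdf \<mu> v) \<gamma>"
begin

definition G :: "real \<Rightarrow> real" where "G v = 1 - cdf \<mu> v"

lemma G_antimono: "x \<le> y \<Longrightarrow> G y \<le> G x"
 using cdf_nondecreasing[of x y] by (simp add: G_def)

lemma G_le_1: "G x \<le> 1" by (simp add: G_def cdf_nonneg)

lemma G_nonneg: "G x \<ge> 0" using cdf_bounded_prob[of x] by (simp add: G_def)

lemma G_ratio: "a > 0 \<Longrightarrow> ((\<lambda>v. G (a * v) / G v) \<longlongrightarrow> a powr (- \<gamma>)) at_top"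
 using regular by (simp add: regularly_varying_def G_def)

text \<open>Division by 0 gives 0, whereas regular variation at ratio 1 forces
  \<open>G v / G v\<close> to tend to 1. So \<open>G\<close> is positive arbitrarily far out and,
  being nonincreasing, everywhere.\<close>

lemma G_pos: "G x > 0"
proof -
 have "((\<lambda>v. G (1 * v) / G v) \<longlongrightarrow> 1 powr (- \<gamma>)) at_top" by (rule G_ratio) simp
 then have "((\<lambda>v. G v / G v) \<longlongrightarrow> 1) at_top" by simp
 then have "\<forall>\<^sub>F v in at_top. G v / G v > 0" by (rule order_tendstoD) simp
 then have "\<forall>\<^sub>F v in at_top. G v / G v > 0 \<and> v \<ge> x" by (intro eventually_conj eventually_ge_at_top)
 then obtain v where v: "G v / G v > 0" "v \<ge> x"
  using eventually_happens'[OF trivial_limit_at_top_linorder] by blast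
 then have "G v > 0" using G_nonneg[of v] by (cases "G v = 0") auto
 then show ?thesis using G_antimono[OF v(2)] by simp
qed

lemma G_at_top: "(G \<longlongrightarrow> 0) at_top"
 using tendsto_diff[OF tendsto_const[of 1] cdf_lim_at_top_prob] by (simp add: G_def[abs_def])

lemma G_eq_1: "x \<le> 0 \<Longrightarrow> G x = 1"
proof -
 assume x: "x \<le> 0"
 have "AE v in \<mu>. v \<notin> {..x}" using positive by eventually_elim (use x in auto)
 then have "emeasure \<mu> {..x} = 0" by (subst AE_iff_measurable[symmetric, of _ _ "\<lambda>v. v \<notin> {..x}"]) auto
 then show ?thesis by (simp add: G_def cdf_def measure_def)
qed

text \<open>The limit at ratio 2 is the one that Potter's bound iterates; the slack \<open>d\<close>
  turns it into inequalities valid beyond some \<open>x0\<close>.\<close>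

lemma G_doubling:
 assumes d: "d > 0"
 shows "\<exists>x0\<ge>1. \<forall>v\<ge>x0. 2 powr (- (\<gamma> + d)) * G v \<le> G (2 * v) \<and> G (2 * v) \<le> 2 powr (- (\<gamma> - d)) * G v"
proof -
 have l: "((\<lambda>v. G (2 * v) / G v) \<longlongrightarrow> 2 powr (- \<gamma>)) at_top" by (rule G_ratio) simp
 have "\<forall>\<^sub>F v in at_top. 2 powr (- (\<gamma> + d)) < G (2 * v) / G v"
  using d by (intro order_tendstoD(1)[OF l]) simp
 moreover have "\<forall>\<^sub>F v in at_top. G (2 * v) / G v < 2 powr (- (\<gamma> - d))"
  using d by (intro order_tendstoD(2)[OF l]) simp
 ultimately have "\<forall>\<^sub>F v in at_top. 2 powr (- (\<gamma> + d)) * G v \<le> G (2 * v) \<and> G (2 * v) \<le> 2 powr (- (\<gamma> - d)) * G v"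
 proof eventually_elim
  case (elim v)
  then show ?case using G_pos[of v] by (simp add: field_simps)
 qed
 then obtain x where x: "\<And>v. v \<ge> x \<Longrightarrow> 2 powr (- (\<gamma> + d)) * G v \<le> G (2 * v) \<and> G (2 * v) \<le> 2 powr (- (\<gamma> - d)) * G v"
  unfolding eventually_at_top_linorder by blast
 show ?thesis by (rule exI[of _ "max 1 x"]) (use x in auto)
qed

lemma dyadic_bracket:
 assumes "a \<ge> (1::real)"
 obtains n :: nat where "2 ^ n \<le> a" "a < 2 * 2 ^ n"
proof -
 define n where "n = nat \<lfloor>log 2 a\<rfloor>"
 have l: "log 2 a \<ge> 0" using assms by simp
 have "2 ^ n = 2 powr real n" by (simp add: powr_realpow)
 also have "real n = of_int \<lfloor>log 2 a\<rfloor>" using l by (simp add: n_def)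
 finally have n: "(2::real) ^ n = 2 powr of_int \<lfloor>log 2 a\<rfloor>" .
 have "2 powr of_int \<lfloor>log 2 a\<rfloor> \<le> 2 powr (log 2 a)" by (intro powr_mono) auto
 then have "2 ^ n \<le> a" using n assms by simp
 moreover have "2 powr (log 2 a) < 2 powr (of_int \<lfloor>log 2 a\<rfloor> + 1)" by (intro powr_less_mono) linarith+
 then have "a < 2 * 2 ^ n" using n assms by (simp add: powr_add)
 ultimately show ?thesis by (rule that)
qed

text \<open>Iterated doubling compares \<open>G\<close> at dyadic multiples, and monotonicity
  interpolates between them at the cost of a factor \<open>2 powr (\<gamma> + d)\<close>. The ratio
  \<open>a\<close> ranges over all positive reals, so the case \<open>a * t < x0\<close>, out of
  reach of doubling, is included.\<close>

lemma Potter: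
 assumes d: "0 < d" "d < \<gamma>"
 shows "\<exists>A>0. \<exists>t0>0. \<forall>t\<ge>t0. \<forall>a>0. G (a * t) \<le> A * max (a powr (- (\<gamma> + d))) (a powr (- (\<gamma> - d))) * G t"
proof -
 let ?t2 = "(- (\<gamma> + d))"
 let ?t1 = "(- (\<gamma> - d))"
 obtain x0 where x0: "x0 \<ge> 1" "\<And>v. v \<ge> x0 \<Longrightarrow> 2 powr ?t2 * G v \<le> G (2 * v)"
  "\<And>v. v \<ge> x0 \<Longrightarrow> G (2 * v) \<le> 2 powr ?t1 * G v" using G_doubling[OF d(1)] by blast
 have up: "G (2 ^ n * v) \<le> (2 ^ n) powr ?t1 * G v" if "v \<ge> x0" for n v
 proof (induction n)
  case (Suc n)
  have "v * 1 \<le> v * 2 ^ n" using that x0(1) by (intro mult_left_mono) auto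
  then have "2 ^ n * v \<ge> x0" using that by (simp add: mult.commute)
  then have "G (2 * (2 ^ n * v)) \<le> 2 powr ?t1 * G (2 ^ n * v)" by (rule x0(3))
  also have "\<dots> \<le> 2 powr ?t1 * ((2 ^ n) powr ?t1 * G v)" by (intro mult_left_mono Suc) simp
  also have "\<dots> = (2 ^ Suc n) powr ?t1 * G v" by (simp add: powr_mult)
  finally show ?case by (simp add: mult.assoc)
 qed simp
 have down: "G v \<le> (2 ^ n) powr (\<gamma> + d) * G (2 ^ n * v)" if "v \<ge> x0" for n v
 proof (induction n)
  case (Suc n)
  have "v * 1 \<le> v * 2 ^ n" using that x0(1) by (intro mult_left_mono) auto
  then have "2 ^ n * v \<ge> x0" using that by (simp add: mult.commute)
  then have "2 powr ?t2 * G (2 ^ n * v) \<le> G (2 * (2 ^ n * v))" by (rule x0(2))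
  then have "2 powr (\<gamma> + d) * (2 powr ?t2 * G (2 ^ n * v)) \<le> 2 powr (\<gamma> + d) * G (2 * (2 ^ n * v))"
   by (intro mult_left_mono) auto
  then have le: "G (2 ^ n * v) \<le> 2 powr (\<gamma> + d) * G (2 * (2 ^ n * v))"
   by (simp add: mult.assoc[symmetric] powr_add[symmetric])
  have "G v \<le> (2 ^ n) powr (\<gamma> + d) * G (2 ^ n * v)" by (rule Suc)
  also have "\<dots> \<le> (2 ^ n) powr (\<gamma> + d) * (2 powr (\<gamma> + d) * G (2 * (2 ^ n * v)))"
   by (intro mult_left_mono le) simp
  also have "\<dots> = (2 ^ Suc n) powr (\<gamma> + d) * G (2 ^ Suc n * v)"
   by (simp add: powr_mult mult.assoc)
  finally show ?case .
 qed simp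
 have big: "G (a * t) \<le> 2 powr (\<gamma> + d) * a powr ?t1 * G t" if "t \<ge> x0" "a \<ge> 1" for a t
 proof -
  obtain n where n: "2 ^ n \<le> a" "a < 2 * 2 ^ n" using dyadic_bracket[OF \<open>a \<ge> 1\<close>] by blast
  have "G (a * t) \<le> G (2 ^ n * t)" using n that x0(1) by (intro G_antimono mult_right_mono) auto
  also have "\<dots> \<le> (2 ^ n) powr ?t1 * G t" by (rule up) fact
  also have "(2 ^ n) powr ?t1 \<le> (a / 2) powr ?t1" using n that d by (intro powr_mono2') auto
  also have "(a / 2) powr ?t1 = 2 powr (\<gamma> - d) * a powr ?t1"
   using powr_divide_eq[of a 2 "- (\<gamma> - d)"] that by simp
  also have "\<dots> \<le> 2 powr (\<gamma> + d) * a powr ?t1"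
   using d by (intro mult_right_mono powr_mono) auto
  finally show ?thesis using G_nonneg by (simp add: mult_right_mono)
 qed
 \<comment> \<open>The roles are exchanged: \<open>t\<close> is approached from \<open>a * t\<close>
   by doublings, one more than the lower bracket of \<open>1 / a\<close> gives, so that
   \<open>2 ^ Suc n * (a * t)\<close> is at least \<open>t\<close>.\<close>
 have small: "G (a * t) \<le> 2 powr (\<gamma> + d) * a powr ?t2 * G t" if "a * t \<ge> x0" "a > 0" "a \<le> 1" for a t
 proof -
  have "1 / a \<ge> 1" using that by simp
  then obtain n where n: "2 ^ n \<le> 1 / a" "1 / a < 2 * 2 ^ n" using dyadic_bracket[of "1 / a"] by blast
  have t: "t > 0" using that x0(1) by (smt (verit) mult_nonneg_nonpos)
  have "1 < 2 * 2 ^ n * a" using n(2) that by (simp add: field_simps)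
  then have ge: "t \<le> 2 ^ Suc n * (a * t)" using t mult_right_mono[of 1 "2 * 2 ^ n * a" t] by (simp add: ac_simps)
  have "G (a * t) \<le> (2 ^ Suc n) powr (\<gamma> + d) * G (2 ^ Suc n * (a * t))" by (rule down) fact
  also have "\<dots> \<le> (2 / a) powr (\<gamma> + d) * G t"
   using n that d ge by (intro mult_mono powr_mono2 G_antimono G_nonneg) auto
  also have "(2 / a) powr (\<gamma> + d) = 2 powr (\<gamma> + d) * a powr ?t2"
   using powr_divide_eq[of 2 a "\<gamma> + d"] that by simp
  finally show ?thesis .
 qed
 \<comment> \<open>Dividing by \<open>G x0\<close> pays for the arguments \<open>a * t\<close> below
   \<open>x0\<close>, where only \<open>G \<le> 1\<close> is available.\<close>
 define A where "A = 2 powr (\<gamma> + d) / G x0"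
 have A: "A > 0" "A \<ge> 2 powr (\<gamma> + d)"
  using G_pos[of x0] G_le_1[of x0] by (auto simp: A_def field_simps)
 have main: "G (a * t) \<le> A * max (a powr ?t2) (a powr ?t1) * G t" if t: "t \<ge> x0" and a: "a > 0" for a t
 proof (cases "a \<ge> 1")
  case True
  have "G (a * t) \<le> 2 powr (\<gamma> + d) * a powr ?t1 * G t" by (rule big) fact+
  also have "\<dots> \<le> A * max (a powr ?t2) (a powr ?t1) * G t"
   using A G_nonneg by (intro mult_right_mono mult_mono) auto
  finally show ?thesis .
 next
  case False
  have "G (a * t) \<le> A * a powr ?t2 * G t" (is "_ \<le> ?r1")
  proof (cases "a * t \<ge> x0")
   case True
   have "G (a * t) \<le> 2 powr (\<gamma> + d) * a powr ?t2 * G t" using False a True by (intro small) auto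
   also have "\<dots> \<le> ?r1" using A G_nonneg by (intro mult_right_mono) auto
   finally show ?thesis .
  next
   case F2: False
   \<comment> \<open>\<open>b\<close> is the smallest ratio that the doubling argument reaches. The
     estimate at \<open>b\<close>, relaxed to the smaller \<open>a\<close>, shows that the right
     side is already at least 1.\<close>
   define b where "b = x0 / t"
   have b: "b > 0" "b \<le> 1" "b * t = x0" "a \<le> b" using t x0(1) F2 by (auto simp: b_def field_simps)
   have "G x0 \<le> 2 powr (\<gamma> + d) * b powr ?t2 * G t" using small[of b t] b by simp
   also have "\<dots> \<le> 2 powr (\<gamma> + d) * a powr ?t2 * G t"
    using a b d G_nonneg by (intro mult_right_mono mult_left_mono powr_mono2') auto
   finally have "1 \<le> ?r1" using G_pos[of x0] by (simp add: A_def field_simps)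
   then show ?thesis using G_le_1[of "a * t"] by simp
  qed
  also have "\<dots> \<le> A * max (a powr ?t2) (a powr ?t1) * G t"
   using A G_nonneg by (intro mult_right_mono mult_left_mono) auto
  finally show ?thesis .
 qed
 show ?thesis using A(1) x0(1) main by (intro exI[of _ A] exI[of _ x0] conjI allI impI) auto
qed

text \<open>The argument is measured from the upper end: small \<open>u\<close> corresponds to large
  volumes, where regular variation has a hold on \<open>G\<close>. The value 0 outside the unit
  interval keeps the function nonnegative and measurable.\<close>

definition quantile :: "real \<Rightarrow> real" where
 "quantile u = (if 0 < u \<and> u < 1 then Inf {v. 1 - u \<le> cdf \<mu> v} else 0)"

text \<open>A Galois connection, valid at jumps of \<open>G\<close> as well, through which every
  comparison of \<open>G\<close> with its quantile goes.\<close>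

lemma quantile_le_iff:
 assumes "0 < u" "u < 1"
 shows "quantile u \<le> x \<longleftrightarrow> G x \<le> u"
proof -
 interpret cdf_distribution \<mu> by unfold_locales
 have "1 - u \<le> cdf \<mu> x \<longleftrightarrow> Inf {v. 1 - u \<le> cdf \<mu> v} \<le> x"
  by (rule pseudoinverse) (use assms in auto)
 then show ?thesis using assms by (auto simp: quantile_def G_def)
qed

lemma quantile_pos: "0 < u \<Longrightarrow> u < 1 \<Longrightarrow> quantile u > 0"
 using quantile_le_iff[of u 0] G_eq_1[of 0] by (simp add: not_le[symmetric])

lemma quantile_nonneg: "quantile u \<ge> 0"
 using quantile_pos[of u] by (cases "0 < u \<and> u < 1") (auto simp: quantile_def)

lemma quantile_measurable [measurable]: "quantile \<in> borel_measurable borel"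
proof (rule borel_measurableI_le, goal_cases)
 case (1 x)
 have "{u \<in> space borel. quantile u \<le> x} = ({0<..<1} \<inter> {G x..}) \<union> (if 0 \<le> x then - {0<..<1} else {})"
  using quantile_le_iff[of _ x] by (auto simp: quantile_def)
 also have "\<dots> \<in> sets borel" by auto
 finally show ?case .
qed

text \<open>Inverse transform sampling: within the unit interval \<open>quantile u \<le> x\<close>
  holds from \<open>G x\<close> on, and the length of this part is
  \<open>cdf \<mu> x\<close>.\<close>

lemma distr_quantile: "distr (density lborel (indicator {0<..<1})) borel quantile = \<mu>"
proof (intro cdf_unique ext)
 let ?U = "density lborel (indicator {0<..<1::real})"
 have eU: "emeasure ?U A = emeasure lborel (A \<inter> {0<..<1})" if "A \<in> sets borel" for A
 proof -
  have "emeasure ?U A = (\<integral>\<^sup>+x. indicator {0<..<1} x * indicator A x \<partial>lborel)"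
   using that by (subst emeasure_density) auto
  also have "\<dots> = (\<integral>\<^sup>+x. indicator (A \<inter> {0<..<1}) x \<partial>lborel)"
   by (intro nn_integral_cong) (auto split: split_indicator)
  also have "\<dots> = emeasure lborel (A \<inter> {0<..<1})" using that by (intro nn_integral_indicator) auto
  finally show ?thesis .
 qed
 interpret U: prob_space ?U by (rule prob_spaceI) (subst eU, auto)
 show "real_distribution (distr ?U borel quantile)" by (intro U.real_distribution_distr) simp
 show "real_distribution \<mu>" by unfold_locales
 show "cdf (distr ?U borel quantile) x = cdf \<mu> x" for x
 proof -
  have "cdf (distr ?U borel quantile) x = measure ?U {u. quantile u \<le> x}"
   unfolding cdf_def by (subst measure_distr) (auto simp: vimage_def)
  also have "\<dots> = enn2real (emeasure lborel ({u. quantile u \<le> x} \<inter> {0<..<1}))"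
   unfolding measure_def by (subst eU) auto
  also have "{u. quantile u \<le> x} \<inter> {0<..<1} = {0<..<1} \<inter> {G x..}"
   using quantile_le_iff[of _ x] by auto
  also have "{0<..<1} \<inter> {G x..} = {G x..<1}" using G_pos[of x] by auto
  also have "enn2real (emeasure lborel {G x..<1}) = cdf \<mu> x"
   using G_le_1[of x] by (simp add: G_def cdf_nonneg)
  finally show ?thesis .
 qed
qed

text \<open>The volume, in units of \<open>t\<close>, at the tail probability \<open>s\<close>
  measured in units of \<open>k\<close>. A limit arises when \<open>k\<close> is close to
  \<open>G t\<close>.\<close>

definition scaled_quantile :: "real \<Rightarrow> real \<Rightarrow> real \<Rightarrow> real" where
 "scaled_quantile k t s = quantile (s * k) / t"

lemma scaled_quantile_measurable [measurable]: "scaled_quantile k t \<in> borel_measurable borel"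
 unfolding scaled_quantile_def by measurable

text \<open>The tail is asymptotically a power, and its inverse is the limit. Bracketing \<kappa>
  instead of equating it with \<open>G t\<close> covers the choice \<open>\<kappa> = G t\<close> as
  well as \<open>t = quantile \<kappa>\<close>, where \<open>G t\<close> can be smaller than
  \<kappa> at a jump.\<close>

lemma scaled_quantile_tendsto:
 fixes t \<kappa> :: "nat \<Rightarrow> real"
 assumes t: "filterlim t at_top sequentially"
  and \<kappa>: "\<forall>\<^sub>F n in sequentially. G (t n) \<le> \<kappa> n"
   "\<And>\<theta>. 0 < \<theta> \<Longrightarrow> \<theta> < 1 \<Longrightarrow> \<forall>\<^sub>F n in sequentially. \<kappa> n \<le> G (\<theta> * t n)"
  and s: "s > 0"
 shows "(\<lambda>n. scaled_quantile (\<kappa> n) (t n) s) \<longlonglongrightarrow> s powr (- 1 / \<gamma>)"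
proof -
 have t0: "\<forall>\<^sub>F n in sequentially. t n > 0" using t by (simp add: filterlim_at_top_dense)
 have \<kappa>pos: "\<forall>\<^sub>F n in sequentially. \<kappa> n > 0"
  using \<kappa>(1) by eventually_elim (use G_pos in \<open>auto intro: less_le_trans\<close>)
 have \<theta>t: "filterlim (\<lambda>n. \<theta> * t n) at_top sequentially" if "\<theta> > 0" for \<theta>
  by (rule filterlim_tendsto_pos_mult_at_top[OF tendsto_const that t])
 have "(\<lambda>n. G ((1/2) * t n)) \<longlonglongrightarrow> 0"
  by (rule filterlim_compose[OF G_at_top \<theta>t]) simp
 then have "\<forall>\<^sub>F n in sequentially. G ((1/2) * t n) < 1 / s"
  using s by (intro order_tendstoD(2)) auto
 moreover have "\<forall>\<^sub>F n in sequentially. \<kappa> n \<le> G ((1/2) * t n)"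
  by (rule \<kappa>(2)) auto
 ultimately have \<kappa>1: "\<forall>\<^sub>F n in sequentially. s * \<kappa> n < 1"
 proof eventually_elim
  case (elim n)
  then have "s * \<kappa> n < s * (1 / s)" using s by (intro mult_strict_left_mono) auto
  then show ?case using s by simp
 qed
 let ?t20 = "(s powr (- 1 / \<gamma>))"
 have sp: "?t20 powr (- \<gamma>) = s" using \<gamma>_gt_1 s by (simp add: powr_powr)
 show ?thesis
 proof (rule order_tendstoI)
  fix a assume a: "a < s powr (- 1 / \<gamma>)"
  show "\<forall>\<^sub>F n in sequentially. a < scaled_quantile (\<kappa> n) (t n) s"
  proof (cases "a \<le> 0")
   case True
   show ?thesis using t0 \<kappa>pos \<kappa>1
   proof eventually_elim
    case (elim n)
    have "0 < quantile (s * \<kappa> n) / t n" using elim s by (intro divide_pos_pos quantile_pos) auto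
    then show ?case using True by (simp add: scaled_quantile_def)
   qed
  next
   case False
   \<comment> \<open>For the lower bound only \<open>\<kappa> \<le> G (\<theta> * t)\<close> with
     \<theta> < 1 is at hand. The midpoint \<open>b\<close> leaves room for it: with
     \<open>\<theta> = a / b\<close> the product \<open>a * t\<close> is \<open>b\<close> times
     \<open>\<theta> * t\<close>.\<close>
   define b where "b = (a + s powr (- 1 / \<gamma>)) / 2"
   have b: "a < b" "b < s powr (- 1 / \<gamma>)" "b > 0" using a False by (auto simp: b_def)
   define \<theta> where "\<theta> = a / b"
   have \<theta>: "0 < \<theta>" "\<theta> < 1" "b * \<theta> = a" using b False by (auto simp: \<theta>_def)
   have "?t20 powr (- \<gamma>) < b powr (- \<gamma>)"
    using b \<gamma>_gt_1 by (intro powr_less_mono2_neg) auto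
   then have "s < b powr (- \<gamma>)" using sp by simp
   moreover have "(\<lambda>n. G (b * (\<theta> * t n)) / G (\<theta> * t n)) \<longlonglongrightarrow> b powr (- \<gamma>)"
    by (rule filterlim_compose[OF G_ratio[OF b(3)] \<theta>t[OF \<theta>(1)]])
   ultimately have "\<forall>\<^sub>F n in sequentially. s < G (b * (\<theta> * t n)) / G (\<theta> * t n)"
    by (intro order_tendstoD(1))
   then show ?thesis using \<kappa>(2)[OF \<theta>(1,2)] t0 \<kappa>pos \<kappa>1
   proof eventually_elim
    case (elim n)
    have "b * (\<theta> * t n) = a * t n" using \<theta>(3) by (simp add: mult.assoc[symmetric])
    moreover have "s * G (\<theta> * t n) < G (b * (\<theta> * t n))"
     using elim(1) G_pos[of "\<theta> * t n"] by (simp only: pos_less_divide_eq)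
    ultimately have "s * G (\<theta> * t n) < G (a * t n)" by (simp only:)
    moreover have "s * \<kappa> n \<le> s * G (\<theta> * t n)" using elim(2) s by (intro mult_left_mono) auto
    ultimately have "\<not> G (a * t n) \<le> s * \<kappa> n" by linarith
    then have "\<not> quantile (s * \<kappa> n) \<le> a * t n"
     using quantile_le_iff[of "s * \<kappa> n" "a * t n"] elim s by simp
    then show ?case using elim(3) by (simp add: scaled_quantile_def field_simps not_le)
   qed
  qed
 next
  fix a assume a: "s powr (- 1 / \<gamma>) < a"
  define b where "b = (a + s powr (- 1 / \<gamma>)) / 2"
  have b: "b < a" "s powr (- 1 / \<gamma>) < b" using a by (auto simp: b_def)
  have b0: "b > 0" using b(2) by (rule le_less_trans[rotated]) simp
  have "b powr (- \<gamma>) < ?t20 powr (- \<gamma>)"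
   using b \<gamma>_gt_1 s by (intro powr_less_mono2_neg) auto
  then have "b powr (- \<gamma>) < s" using sp by simp
  moreover have "(\<lambda>n. G (b * t n) / G (t n)) \<longlonglongrightarrow> b powr (- \<gamma>)"
   by (rule filterlim_compose[OF G_ratio[OF b0] t])
  ultimately have "\<forall>\<^sub>F n in sequentially. G (b * t n) / G (t n) < s"
   by (intro order_tendstoD(2))
  then show "\<forall>\<^sub>F n in sequentially. scaled_quantile (\<kappa> n) (t n) s < a"
   using \<kappa>(1) t0 \<kappa>pos \<kappa>1
  proof eventually_elim
   case (elim n)
   have "G (b * t n) < s * G (t n)" using elim(1) G_pos[of "t n"] by (simp add: field_simps)
   also have "\<dots> \<le> s * \<kappa> n" using elim(2) s by (intro mult_left_mono) auto
   finally have "quantile (s * \<kappa> n) \<le> b * t n"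
    using quantile_le_iff[of "s * \<kappa> n" "b * t n"] elim s by simp
   then have "scaled_quantile (\<kappa> n) (t n) s \<le> b" using elim(3) by (simp add: scaled_quantile_def field_simps)
   then show ?case using b by simp
  qed
 qed
qed

text \<open>Inverse of Potter's bound: for positive \<open>A\<close>, \<open>s\<close> and
  \<open>d < \<gamma>\<close> this value \<open>a\<close> solves \<open>A * max (a powr (- (\<gamma>
  + d))) (a powr (- (\<gamma> - d))) = s\<close>.\<close>

definition majorant :: "real \<Rightarrow> real \<Rightarrow> real \<Rightarrow> real" where
 "majorant A d s = max ((A / s) powr (1 / (\<gamma> + d))) ((A / s) powr (1 / (\<gamma> - d)))"

lemma majorant_measurable [measurable]: "majorant A d \<in> borel_measurable borel"
 unfolding majorant_def by measurable

lemma majorant_nonneg: "majorant A d s \<ge> 0" by (simp add: majorant_def le_max_iff_disj)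

lemma scaled_quantile_le:
 assumes d: "0 < d" "d < \<gamma>"
 shows "\<exists>A>0. \<exists>t0>0. \<forall>t\<ge>t0. \<forall>k\<ge>G t. \<forall>s>0. scaled_quantile k t s \<le> majorant A d s"
proof -
 let ?t4 = "(1 / (\<gamma> - d))"
 let ?t3 = "(1 / (\<gamma> + d))"
 let ?t2 = "(- (\<gamma> - d))"
 let ?t1 = "(- (\<gamma> + d))"
 obtain A t0 where A: "A > 0" "t0 > 0"
  "\<And>t a. t \<ge> t0 \<Longrightarrow> a > 0 \<Longrightarrow> G (a * t) \<le> A * max (a powr ?t1) (a powr ?t2) * G t"
  using Potter[OF d] by blast
 have "scaled_quantile k t s \<le> majorant A d s" if t: "t \<ge> t0" and k: "k \<ge> G t" and s: "s > 0" for t k s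
 proof (cases "s * k < 1")
  case True
  define a where "a = majorant A d s"
  have As: "A / s > 0" using A s by simp
  have a1: "a \<ge> (A / s) powr ?t3" "a \<ge> (A / s) powr ?t4" by (auto simp: a_def majorant_def)
  have a0: "a > 0" using A s by (intro less_le_trans[OF _ a1(1)]) simp
  have "a powr ?t1 \<le> ((A / s) powr ?t3) powr ?t1" using a1(1) As d by (intro powr_mono2') auto
  also have "((A / s) powr ?t3) powr ?t1 = (A / s) powr (?t3 * ?t1)" by (simp only: powr_powr)
  also have "?t3 * ?t1 = -1" using d by (simp add: field_simps)
  also have "(A / s) powr (-1) = s / A" using As A s by (simp add: powr_minus)
  finally have 1: "a powr ?t1 \<le> s / A" .
  have "a powr ?t2 \<le> ((A / s) powr ?t4) powr ?t2" using a1(2) As d by (intro powr_mono2') auto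
  also have "((A / s) powr ?t4) powr ?t2 = (A / s) powr (?t4 * ?t2)" by (simp only: powr_powr)
  also have "?t4 * ?t2 = -1" using d by (simp add: field_simps)
  also have "(A / s) powr (-1) = s / A" using As A s by (simp add: powr_minus)
  finally have 2: "a powr ?t2 \<le> s / A" .
  have "G (a * t) \<le> A * max (a powr ?t1) (a powr ?t2) * G t" by (rule A(3)[OF t a0])
  also have "\<dots> \<le> A * (s / A) * G t"
   using 1 2 A(1) G_nonneg by (intro mult_right_mono mult_left_mono) auto
  also have "\<dots> = s * G t" using A(1) by simp
  also have "\<dots> \<le> s * k" using k s by (intro mult_left_mono) auto
  finally have "quantile (s * k) \<le> a * t"
   using True s k G_pos[of t] quantile_le_iff[of "s * k" "a * t"] by (simp add: mult_pos_pos less_le_trans)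
  then show ?thesis using t A(2) by (simp add: scaled_quantile_def a_def field_simps)
 next
  \<comment> \<open>From \<open>s * k = 1\<close> on the quantile is 0 by definition.\<close>
  case False
  then show ?thesis using majorant_nonneg[of A d s] by (simp add: scaled_quantile_def quantile_def)
 qed
 then show ?thesis using A(1,2) by blast
qed

text \<open>For \<open>s \<le> A\<close>, that is for large volumes, the first argument of
  \<open>min\<close> is integrable because \<open>\<gamma> - d > 1\<close>; for \<open>s > A\<close>
  the second one is because \<open>\<beta> > \<gamma> + d\<close>. The exponent \<beta> is
  \<open>2 - \<alpha>\<close> for measures of finite energy and 2 for densities.\<close>

lemma majorant_integrable:
 assumes A: "A > 0" and d: "0 < d" "1 < \<gamma> - d" "\<gamma> + d < \<beta>"
 shows "(\<integral>\<^sup>+s. ennreal (min (majorant A d s) (majorant A d s powr \<beta>)) * indicator {0<..} s \<partial>lborel) < \<infinity>" (is "?l1 < _")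
proof -
 define p where "p = 1 / (\<gamma> - d)"
 define q where "q = \<beta> / (\<gamma> + d)"
 let ?t1 = "(\<integral>\<^sup>+s. ennreal (indicator {A..} s * (A powr q * s powr (- q))) \<partial>lborel)"
 have p: "0 < p" "p < 1" using d by (auto simp: p_def)
 have q: "q > 1" using d \<gamma>_gt_1 by (simp add: q_def)
 have 1: "(\<integral>\<^sup>+s. ennreal (indicator {0..A} s * (A powr p * s powr (- p))) \<partial>lborel) < \<infinity>"
 proof -
  have "((\<lambda>s. s powr (- p)) has_integral (A powr (- p + 1) / (- p + 1))) {0..A}"
   by (rule has_integral_powr_from_0) (use p A in auto)
  then have "((\<lambda>s. A powr p * s powr (- p)) has_integral (A powr p * (A powr (- p + 1) / (- p + 1)))) {0..A}"
   by (rule has_integral_mult_right)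
  then show ?thesis by (rule nn_integral_powr_finite) auto
 qed
 have 2: "?t1 < \<infinity>"
 proof -
  have "((\<lambda>s. s powr (- q)) has_integral (- (A powr (- q + 1)) / (- q + 1))) {A..}"
   by (rule has_integral_powr_to_inf) (use q A in auto)
  then have "((\<lambda>s. A powr q * s powr (- q)) has_integral (A powr q * (- (A powr (- q + 1)) / (- q + 1)))) {A..}"
   by (rule has_integral_mult_right)
  then show ?thesis by (rule nn_integral_powr_finite) auto
 qed
 have "?l1 \<le>
  (\<integral>\<^sup>+s. ennreal (indicator {0..A} s * (A powr p * s powr (- p))) + ennreal (indicator {A..} s * (A powr q * s powr (- q))) \<partial>lborel)"
 proof (rule nn_integral_mono, goal_cases)
  case (1 s)
  show ?case
  proof (cases "s > 0")
   case s: True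
   show ?thesis
   proof (cases "s \<le> A")
    case True
    have "(A / s) powr (1 / (\<gamma> + d)) \<le> (A / s) powr (1 / (\<gamma> - d))"
     using s True d by (intro powr_mono) (auto intro!: divide_left_mono mult_pos_pos)
    then have "majorant A d s = A powr p * s powr (- p)"
     using s A by (simp add: majorant_def p_def powr_divide powr_minus field_simps)
    then have "min (majorant A d s) (majorant A d s powr \<beta>) \<le> indicator {0..A} s * (A powr p * s powr (- p))"
     using s True by simp
    then show ?thesis using s by (auto intro!: order_trans[OF ennreal_leI] simp: add_increasing2)
   next
    case False
    have "(A / s) powr (1 / (\<gamma> - d)) \<le> (A / s) powr (1 / (\<gamma> + d))"
     using s False d A by (intro powr_mono') (auto intro!: divide_left_mono mult_pos_pos)
    then have "majorant A d s = (A / s) powr (1 / (\<gamma> + d))" by (simp add: majorant_def)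
    then have "majorant A d s powr \<beta> = (A / s) powr q" by (simp add: powr_powr q_def)
    also have "\<dots> = A powr q * s powr (- q)" using s A by (simp add: powr_divide powr_minus field_simps)
    finally have "min (majorant A d s) (majorant A d s powr \<beta>) \<le> indicator {A..} s * (A powr q * s powr (- q))"
     using False by simp
    then show ?thesis using s by (auto intro!: order_trans[OF ennreal_leI] simp: add_increasing)
   qed
  qed simp
 qed
 also have "\<dots> = (\<integral>\<^sup>+s. ennreal (indicator {0..A} s * (A powr p * s powr (- p))) \<partial>lborel) +
  ?t1" by (rule nn_integral_add) auto
 also have "\<dots> < \<infinity>" using 1 2 by simp
 finally show ?thesis .
qed

end

subsection \<open>Grains\<close>

lemma nn_integral_lborel_affine:
 fixes f :: "'a::euclidean_space \<Rightarrow> ennreal"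
 assumes [measurable]: "f \<in> borel_measurable borel" and c: "c \<noteq> 0"
 shows "(\<integral>\<^sup>+x. f x \<partial>lborel) = ennreal (\<bar>c\<bar> ^ DIM('a)) * (\<integral>\<^sup>+x. f (t + c *\<^sub>R x) \<partial>lborel)" (is "?l1 = ?r1")
proof -
 let ?t20 = "(\<bar>c\<bar> ^ DIM('a))"
 have "?l1 = (\<integral>\<^sup>+x. f x \<partial>density (distr lborel borel (\<lambda>x. t + c *\<^sub>R x)) (\<lambda>_. ennreal ?t20))"
  using lborel_affine[OF c, of t] by simp
 also have "\<dots> = (\<integral>\<^sup>+x. ennreal ?t20 * f x \<partial>distr lborel borel (\<lambda>x. t + c *\<^sub>R x))"
  by (subst nn_integral_density) auto
 also have "\<dots> = (\<integral>\<^sup>+x. ennreal ?t20 * f (t + c *\<^sub>R x) \<partial>lborel)"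
  by (subst nn_integral_distr) auto
 also have "\<dots> = ?r1" by (rule nn_integral_cmult) auto
 finally show ?thesis .
qed

lemma powr_inverse_DIM:
 assumes "v > 0"
 shows "(v powr (1 / real DIM('a::euclidean_space))) ^ DIM('a) = v"
 using assms by (simp add: powr_realpow[symmetric] powr_powr)

lemma grain_mem_iff:
 fixes y :: "'a::euclidean_space"
 assumes "v \<noteq> 0"
 shows "y \<in> grain B x v \<longleftrightarrow> (1 / (v powr (1 / real DIM('a)))) *\<^sub>R (y - x) \<in> B"
proof -
 define r where "r = v powr (1 / real DIM('a))"
 have r: "r \<noteq> 0" using assms by (simp add: r_def)
 show ?thesis unfolding grain_def r_def[symmetric]
 proof
  assume "y \<in> (\<lambda>c. x + r *\<^sub>R c) ` B"
  then show "(1 / r) *\<^sub>R (y - x) \<in> B" using r by auto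
 next
  assume "(1 / r) *\<^sub>R (y - x) \<in> B"
  moreover have "y = x + r *\<^sub>R ((1 / r) *\<^sub>R (y - x))" using r by simp
  ultimately show "y \<in> (\<lambda>c. x + r *\<^sub>R c) ` B" by blast
 qed
qed

lemma grain_0: "grain B x 0 = (if B = {} then {} else {x})" by (auto simp: grain_def)

text \<open>At volume 0 the grain degenerates to its centre and cannot be rescaled, so membership is
  a case distinction between two measurable conditions.\<close>

lemma grain_mem_pred [measurable]:
 fixes f g :: "'m \<Rightarrow> 'a::euclidean_space" and h :: "'m \<Rightarrow> real"
 assumes [measurable]: "B \<in> sets borel" "f \<in> borel_measurable M" "g \<in> borel_measurable M" "h \<in> borel_measurable M"
 shows "Measurable.pred M (\<lambda>p. f p \<in> grain B (g p) (h p))"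
proof -
 have "(\<lambda>p. f p \<in> grain B (g p) (h p)) = (\<lambda>p. if h p = 0 then B \<noteq> {} \<and> f p = g p
   else (1 / (h p powr (1 / real DIM('a)))) *\<^sub>R (f p - g p) \<in> B)"
  by (auto simp: fun_eq_iff grain_mem_iff grain_0)
 also have "Measurable.pred M \<dots>" by measurable
 finally show ?thesis .
qed

lemma sets_grain [measurable]:
 fixes B :: "'a::euclidean_space set"
 assumes B[measurable]: "B \<in> sets borel"
 shows "grain B x v \<in> sets borel"
proof -
 have "Measurable.pred borel (\<lambda>y. y \<in> grain B x v)" by measurable
 then show ?thesis by (simp add: pred_def)
qed

lemma indicator_grain_measurable:
 fixes f g :: "'m \<Rightarrow> 'a::euclidean_space" and h :: "'m \<Rightarrow> real"
 assumes "B \<in> sets borel" "f \<in> borel_measurable M" "g \<in> borel_measurable M" "h \<in> borel_measurable M"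
 shows "(\<lambda>p. indicator (grain B (g p) (h p)) (f p) :: ennreal) \<in> borel_measurable M"
proof (rule borel_measurable_indicator')
 show "{p \<in> space M. f p \<in> grain B (g p) (h p)} \<in> sets M"
  using grain_mem_pred[OF assms] by (simp add: pred_def)
qed

text \<open>The grains are the sections of one measurable subset of the product with
  \<open>M\<close>.\<close>

lemma emeasure_grain_measurable:
 fixes B :: "'a::euclidean_space set"
 assumes B: "B \<in> sets borel" and M: "finite_measure M" "sets M = sets borel"
  and [measurable]: "g \<in> borel_measurable L" "h \<in> borel_measurable L"
 shows "(\<lambda>p. emeasure M (grain B (g p) (h p))) \<in> borel_measurable L"
proof -
 let ?t1 = "(L \<Otimes>\<^sub>M M)"
 interpret finite_measure M by fact
 note [measurable_cong] = M(2)
 note [measurable] = B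
 have "{q \<in> space ?t1. snd q \<in> grain B (g (fst q)) (h (fst q))} \<in> sets ?t1" by measurable
 from measurable_emeasure_Pair[OF this] have "(\<lambda>p. emeasure M (Pair p -` {q \<in> space ?t1. snd q \<in> grain B (g (fst q)) (h (fst q))})) \<in> borel_measurable L" .
 moreover have "Pair p -` {q \<in> space ?t1. snd q \<in> grain B (g (fst q)) (h (fst q))} = grain B (g p) (h p)"
  if "p \<in> space L" for p using that sets_eq_imp_space_eq[OF M(2)] by (auto simp: space_pair_measure)
 ultimately show ?thesis by (simp cong: measurable_cong)
qed

lemma measure_grain_measurable:
 fixes B :: "'a::euclidean_space set"
 assumes "B \<in> sets borel" "finite_measure M" "sets M = sets borel"
  and "g \<in> borel_measurable L" "h \<in> borel_measurable L"
 shows "(\<lambda>p. measure M (grain B (g p) (h p))) \<in> borel_measurable L"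
 unfolding measure_def using emeasure_grain_measurable[OF assms] by measurable

lemma emeasure_grain_eq:
 fixes B :: "'a::euclidean_space set"
 assumes "B \<in> sets borel" "sets M = sets borel"
 shows "emeasure M (grain B x v) = (\<integral>\<^sup>+y. indicator (grain B x v) y \<partial>M)"
 using assms by (simp add: nn_integral_indicator)

text \<open>The centres whose grains cover \<open>y\<close> form a reflected and rescaled copy of
  \<open>B\<close> around \<open>y\<close>; hence the substitution with factor
  \<open>- r\<close>.\<close>

lemma nn_integral_indicator_grain:
 fixes B :: "'a::euclidean_space set"
 assumes B[measurable]: "B \<in> sets borel" and v: "v > 0"
 shows "(\<integral>\<^sup>+x. indicator (grain B x v) y \<partial>lborel) = ennreal v * emeasure lborel B" (is "?l1 = _")
proof -
 define r where "r = v powr (1 / real DIM('a))"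
 have r: "r > 0" using v by (simp add: r_def)
 have "?l1 =
  ennreal (\<bar>- r\<bar> ^ DIM('a)) * (\<integral>\<^sup>+x. indicator (grain B (y + (- r) *\<^sub>R x) v) y \<partial>lborel)"
  by (rule nn_integral_lborel_affine) (use r in auto)
 also have "(\<lambda>x. indicator (grain B (y + (- r) *\<^sub>R x) v) y :: ennreal) = indicator B"
  using v r by (auto simp: fun_eq_iff indicator_def grain_mem_iff r_def[symmetric])
 finally show ?thesis using r powr_inverse_DIM[OF v, where 'a='a] by (simp add: r_def)
qed

lemma nn_integral_emeasure_grain:
 fixes B :: "'a::euclidean_space set"
 assumes B[measurable]: "B \<in> sets borel" and M: "finite_measure M" "sets M = sets borel" and v: "v > 0"
 shows "(\<integral>\<^sup>+x. emeasure M (grain B x v) \<partial>lborel) = ennreal v * emeasure lborel B * emeasure M UNIV" (is "?l1 = ?r1")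
proof -
 interpret M: finite_measure M by fact
 interpret pair_sigma_finite lborel M ..
 note [measurable_cong] = M(2)
 have "?l1 = (\<integral>\<^sup>+x. \<integral>\<^sup>+y. indicator (grain B x v) y \<partial>M \<partial>lborel)"
  by (intro nn_integral_cong emeasure_grain_eq B M)
 also have "\<dots> = (\<integral>\<^sup>+y. \<integral>\<^sup>+x. indicator (grain B x v) y \<partial>lborel \<partial>M)"
 proof (rule Fubini'[symmetric])
  have "(\<lambda>p. indicator (grain B (fst p) v) (snd p) :: ennreal) \<in> borel_measurable (lborel \<Otimes>\<^sub>M M)"
   by (intro indicator_grain_measurable B) measurable
  then show "(\<lambda>(x, y). indicator (grain B x v) y :: ennreal) \<in> borel_measurable (lborel \<Otimes>\<^sub>M M)"
   by (simp add: split_beta')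
 qed
 also have "\<dots> = (\<integral>\<^sup>+y. ennreal v * emeasure lborel B \<partial>M)"
  by (simp add: nn_integral_indicator_grain v)
 also have "\<dots> = ?r1" using sets_eq_imp_space_eq[OF M(2)] by simp
 finally show ?thesis .
qed

text \<open>The Riesz energy of a positive measure; \<open>Malpha\<close> requires it to be finite
  for the total variation.\<close>

definition energy :: "real \<Rightarrow> 'a::euclidean_space measure \<Rightarrow> ennreal" where
 "energy \<alpha> M = (\<integral>\<^sup>+x. \<integral>\<^sup>+y. 1 / ennreal (norm (x - y) powr ((1 - \<alpha>) * real DIM('a))) \<partial>M \<partial>M)"

text \<open>
 Two points of a grain of volume \<open>v\<close> are at distance at most \<open>2 R v\<^sup>1\<^sup>/\<^sup>d\<close>; this is where the
 energy of the measure enters.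
\<close>

lemma nn_integral_emeasure_ball_grain_square:
 fixes M :: "'a::euclidean_space measure"
 assumes M: "finite_measure M" "sets M = sets borel" and v: "v > 0" and R: "R > 0" and \<alpha>: "\<alpha> < 1"
 shows "(\<integral>\<^sup>+x. (emeasure M (grain (cball 0 R) x v))\<^sup>2 \<partial>lborel) \<le>
  ennreal ((2 * R) powr ((1 - \<alpha>) * real DIM('a)) * v powr (2 - \<alpha>)) * emeasure lborel (cball (0::'a) R) * energy \<alpha> M"
proof -
 let ?t1 = "(lborel \<Otimes>\<^sub>M M)"
 interpret M: finite_measure M by fact
 interpret pair_sigma_finite lborel M ..
 interpret MM: pair_sigma_finite M M ..
 note [measurable_cong] = M(2)
 define r where "r = v powr (1 / real DIM('a))"
 have r: "r > 0" using v by (simp add: r_def)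
 define e where "e = (1 - \<alpha>) * real DIM('a)"
 let ?t21 = "((2 * R) powr e * v powr (2 - \<alpha>))"
 let ?t20 = "((2 * R * r) powr e)"
 have e: "e > 0" using \<alpha> by (simp add: e_def)
 let ?B = "cball (0::'a) R"
 have gM[simp]: "grain ?B x v \<in> sets M" for x using sets_grain[of ?B x v] M(2) by simp
 have close: "norm (y - y') \<le> 2 * R * r" if "y \<in> grain ?B x v" "y' \<in> grain ?B x v" for x y y' :: 'a
 proof -
  have *: "norm (z - x) \<le> R * r" if "z \<in> grain ?B x v" for z
  proof -
   have "(1 / r) *\<^sub>R (z - x) \<in> ?B" using that v by (simp only: grain_mem_iff[OF less_imp_neq[OF v, symmetric]] r_def)
   then have "norm ((1 / r) *\<^sub>R (z - x)) \<le> R" by (simp only: mem_cball_0)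
   then have "norm (z - x) / r \<le> R" using r by (simp only: norm_scaleR) simp
   then show ?thesis using r by (simp add: field_simps)
  qed
  have "norm (y - y') \<le> norm (y - x) + norm (y' - x)"
   using norm_triangle_ineq4[of "y - x" "y' - x"] by simp
  then show ?thesis using *[OF that(1)] *[OF that(2)] by simp
 qed
 have "(\<integral>\<^sup>+x. (emeasure M (grain ?B x v))\<^sup>2 \<partial>lborel) =
  (\<integral>\<^sup>+x. \<integral>\<^sup>+y. \<integral>\<^sup>+y'. indicator (grain ?B x v) y * indicator (grain ?B x v) y' \<partial>M \<partial>M \<partial>lborel)"
 proof (rule nn_integral_cong, goal_cases)
  case (1 x)
  have "(\<integral>\<^sup>+y. \<integral>\<^sup>+y'. indicator (grain ?B x v) y * indicator (grain ?B x v) y' \<partial>M \<partial>M) =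
   (\<integral>\<^sup>+y. indicator (grain ?B x v) y * emeasure M (grain ?B x v) \<partial>M)"
   by (intro nn_integral_cong) (simp add: nn_integral_cmult)
  also have "\<dots> = emeasure M (grain ?B x v) * emeasure M (grain ?B x v)" by (simp add: nn_integral_multc)
  finally show ?case by (simp add: power2_eq_square)
 qed
 also have "\<dots> = (\<integral>\<^sup>+y. \<integral>\<^sup>+x. \<integral>\<^sup>+y'. indicator (grain ?B x v) y * indicator (grain ?B x v) y' \<partial>M \<partial>lborel \<partial>M)"
 proof (rule Fubini'[symmetric])
  have "(\<lambda>q. indicator (grain ?B (fst (fst q)) v) (snd (fst q)) * indicator (grain ?B (fst (fst q)) v) (snd q) :: ennreal)
    \<in> borel_measurable (?t1 \<Otimes>\<^sub>M M)"
   by (intro borel_measurable_times_ennreal indicator_grain_measurable) auto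
  then have "(\<lambda>p. \<integral>\<^sup>+y'. indicator (grain ?B (fst p) v) (snd p) * indicator (grain ?B (fst p) v) y' \<partial>M)
    \<in> borel_measurable ?t1" by (intro M.borel_measurable_nn_integral) (simp add: split_beta')
  then show "(\<lambda>(x, y). \<integral>\<^sup>+y'. indicator (grain ?B x v) y * indicator (grain ?B x v) y' \<partial>M)
    \<in> borel_measurable ?t1" by (simp add: split_beta')
 qed
 also have "\<dots> = (\<integral>\<^sup>+y. \<integral>\<^sup>+y'. \<integral>\<^sup>+x. indicator (grain ?B x v) y * indicator (grain ?B x v) y' \<partial>lborel \<partial>M \<partial>M)"
 proof (intro nn_integral_cong Fubini'[symmetric], goal_cases)
  case (1 y)
  have "(\<lambda>p. indicator (grain ?B (fst p) v) y * indicator (grain ?B (fst p) v) (snd p) :: ennreal)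
    \<in> borel_measurable ?t1" by (intro borel_measurable_times_ennreal indicator_grain_measurable) auto
  then show ?case by (simp add: split_beta')
 qed
 \<comment> \<open>When both points lie in the grain, the factor that replaces the second indicator
   is at least 1, by the bound on their distance.\<close>
 also have "\<dots> \<le> (\<integral>\<^sup>+y. \<integral>\<^sup>+y'. \<integral>\<^sup>+x. indicator (grain ?B x v) y * (ennreal ?t20 * (1 / ennreal (norm (y - y') powr e))) \<partial>lborel \<partial>M \<partial>M)"
 proof (intro nn_integral_mono, goal_cases)
  case (1 y y' x)
  let ?t2 = "(norm (y - y') powr e)"
  show ?case
  proof (cases "y \<in> grain ?B x v \<and> y' \<in> grain ?B x v")
   case True
   then have "norm (y - y') powr e \<le> (2 * R * r) powr e"
    using close[of y x y'] e by (intro powr_mono2) auto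
   have "1 \<le> ennreal ?t20 * (1 / ennreal ?t2)" (is "_ \<le> ?r1")
   \<comment> \<open>For equal points the quotient is \<open>1 / 0\<close>, which is infinite in
     \<open>ennreal\<close>.\<close>
   proof (cases "y = y'")
    case True
    then show ?thesis using R r e by (simp add: ennreal_mult_top ennreal_divide_zero)
   next
    case False
    have "1 \<le> (2 * R * r) powr e * (1 / ?t2)"
     using \<open>norm (y - y') powr e \<le> (2 * R * r) powr e\<close> False by (simp add: field_simps)
    then have "ennreal 1 \<le> ennreal ((2 * R * r) powr e * (1 / ?t2))" by (rule ennreal_leI)
    also have "\<dots> = ?r1"
    proof -
     have "1 / ennreal ?t2 = ennreal (1 / norm (y - y') powr e)"
      using divide_ennreal[of 1 "norm (y - y') powr e"] False by simp
     then show ?thesis by (simp only:) (rule ennreal_mult, auto)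
    qed
    finally show ?thesis by simp
   qed
   then show ?thesis using True by simp
  qed (auto simp: indicator_def)
 qed
 also have "\<dots> = (\<integral>\<^sup>+y. \<integral>\<^sup>+y'. (ennreal v * emeasure lborel ?B) * (ennreal ?t20 * (1 / ennreal (norm (y - y') powr e))) \<partial>M \<partial>M)"
 proof (intro nn_integral_cong, goal_cases)
  case (1 y y')
  let ?t3 = "(ennreal ?t20 * (1 / ennreal (norm (y - y') powr e)))"
  have "(\<lambda>x. indicator (grain ?B x v) y :: ennreal) \<in> borel_measurable lborel"
   by (intro indicator_grain_measurable) auto
  then show ?case by (subst nn_integral_multc) (simp_all add: nn_integral_indicator_grain[OF _ v])
 qed
 also have "\<dots> = (ennreal v * emeasure lborel ?B) * (ennreal ?t20 * energy \<alpha> M)"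
  by (simp add: nn_integral_cmult energy_def e_def)
 also have "\<dots> = ennreal ?t21 * emeasure lborel ?B * energy \<alpha> M"
 proof -
  have "r powr e = v powr (1 - \<alpha>)" by (simp add: r_def e_def powr_powr)
  then have "(2 * R * r) powr e = (2 * R) powr e * v powr (1 - \<alpha>)" using R r by (simp add: powr_mult)
  moreover have "v * v powr (1 - \<alpha>) = v powr (2 - \<alpha>)"
   using v powr_add[of v 1 "1 - \<alpha>"] by simp
  ultimately have "v * (2 * R * r) powr e = (2 * R) powr e * v powr (2 - \<alpha>)" by (simp add: ac_simps)
  then have eq: "ennreal v * ennreal ?t20 = ennreal ?t21" using v by (simp flip: ennreal_mult)
  show ?thesis unfolding eq[symmetric] by (simp only: ac_simps)
 qed
 finally show ?thesis by (simp add: e_def)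
qed

text \<open>Grains of shape \<open>C\<close> need not grow with the volume, as \<open>C\<close> need
  not be star-shaped about 0. Grains of the enclosing ball do, so domination passes through
  them.\<close>

lemma grain_subset_ball_grain:
 fixes C :: "'a::euclidean_space set"
 assumes "C \<subseteq> cball 0 R" "0 < v" "v \<le> w" "0 \<le> R"
 shows "grain C x v \<subseteq> grain (cball 0 R) x w"
proof
 fix y assume y: "y \<in> grain C x v"
 let ?r = "\<lambda>v. v powr (1 / real DIM('a))"
 have r: "0 < ?r v" "?r v \<le> ?r w" using assms by (auto intro!: powr_mono2)
 have "(1 / ?r v) *\<^sub>R (y - x) \<in> cball 0 R"
  using y assms(1,2) by (auto simp only: grain_mem_iff[OF less_imp_neq[OF assms(2), symmetric]])
 then have "norm ((1 / ?r v) *\<^sub>R (y - x)) \<le> R" by (simp only: mem_cball_0)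
 then have "norm (y - x) / ?r v \<le> R" using r by (simp only: norm_scaleR) simp
 then have "norm (y - x) \<le> R * ?r v" using r by (simp add: field_simps)
 also have "\<dots> \<le> R * ?r w" using r assms by (intro mult_left_mono) auto
 finally have "norm (y - x) \<le> R * ?r w" .
 then have "norm (y - x) / ?r w \<le> R" using r assms by (simp add: field_simps)
 then have "norm ((1 / ?r w) *\<^sub>R (y - x)) \<le> R" using r by (simp only: norm_scaleR) simp
 then have "(1 / ?r w) *\<^sub>R (y - x) \<in> cball 0 R" by (simp only: mem_cball_0)
 then show "y \<in> grain (cball 0 R) x w" using assms by (simp only: grain_mem_iff[of w])
qed

text \<open>The rescaled position of \<open>y\<close> converges to a point off the frontier, hence
  in the interior of \<open>C\<close> or in the exterior. Both are open, so membership is eventually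
  constant.\<close>

lemma indicator_grain_tendsto:
 fixes C :: "'a::euclidean_space set"
 assumes v: "v \<longlonglongrightarrow> v0" "v0 > 0" and y: "y \<notin> grain (frontier C) x v0"
 shows "(\<lambda>n. indicator (grain C x (v n)) y :: real) \<longlonglongrightarrow> indicator (grain C x v0) y"
proof -
 define z where "z = (\<lambda>v. (1 / (v powr (1 / real DIM('a)))) *\<^sub>R (y - x))"
 have lim: "(\<lambda>n. z (v n)) \<longlonglongrightarrow> z v0"
  unfolding z_def using v by (intro tendsto_intros) auto
 have pos: "\<forall>\<^sub>F n in sequentially. v n > 0" using v by (intro order_tendstoD(1))
 have nf: "z v0 \<notin> frontier C" using y v(2) by (simp add: grain_mem_iff z_def)
 have "\<forall>\<^sub>F n in sequentially. (z (v n) \<in> C) = (z v0 \<in> C)"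
 proof (cases "z v0 \<in> C")
  case True
  then have "z v0 \<in> interior C" using nf closure_subset[of C] by (auto simp: frontier_def)
  then have "\<forall>\<^sub>F n in sequentially. z (v n) \<in> interior C"
   using lim by (intro topological_tendstoD) auto
  then show ?thesis by eventually_elim (use True interior_subset[of C] in blast)
 next
  case False
  then have "z v0 \<in> - closure C" using nf interior_subset[of C] by (auto simp: frontier_def)
  then have "\<forall>\<^sub>F n in sequentially. z (v n) \<in> - closure C"
   using lim by (intro topological_tendstoD) auto
  then show ?thesis by eventually_elim (use False closure_subset[of C] in blast)
 qed
 then have "\<forall>\<^sub>F n in sequentially. indicator (grain C x (v n)) y = (indicator (grain C x v0) y :: real)"
  using pos by eventually_elim (use v(2) in \<open>auto simp: indicator_def grain_mem_iff z_def\<close>)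
 then show ?thesis by (rule tendsto_eventually)
qed

lemma measure_grain_tendsto:
 fixes C :: "'a::euclidean_space set"
 assumes C[measurable]: "C \<in> sets borel" and M: "finite_measure M" "sets M = sets borel"
  and v: "v \<longlonglongrightarrow> v0" "v0 > 0" and 0: "emeasure M (grain (frontier C) x v0) = 0"
 shows "(\<lambda>n. measure M (grain C x (v n))) \<longlonglongrightarrow> measure M (grain C x v0)"
proof -
 interpret finite_measure M by fact
 note [measurable_cong] = M(2)
 have eq: "measure M (grain C x w) = (\<integral>y. indicator (grain C x w) y \<partial>M)" for w
  using sets_eq_imp_space_eq[OF M(2)] by simp
 show ?thesis unfolding eq
 proof (rule integral_dominated_convergence[where w="\<lambda>_. 1"])
  have "grain (frontier C) x v0 \<in> null_sets M"
   using 0 M(2) by (auto simp: null_sets_def intro!: sets_grain borel_closed)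
  then have "AE y in M. y \<notin> grain (frontier C) x v0" by (rule AE_not_in)
  then show "AE y in M. (\<lambda>n. indicator (grain C x (v n)) y :: real) \<longlonglongrightarrow> indicator (grain C x v0) y"
   by eventually_elim (rule indicator_grain_tendsto[OF v])
 qed (auto simp: indicator_def)
qed

subsection \<open>Intensity measures in a common coordinate\<close>

text \<open>
 Both intensities are images of a measure with density \<open>c (s)\<close> with respect to \<open>dx ds\<close> under a map
 \<open>(x, s) \<mapsto> (x, w (s))\<close>. Limits of integrals then become an instance of dominated convergence, in
 which only \<open>w\<close> varies.
\<close>

definition volume_measure :: "(real \<Rightarrow> real) \<Rightarrow> (real \<Rightarrow> real) \<Rightarrow> ('a::euclidean_space \<times> real) measure" where
 "volume_measure c w = distr (density lborel2 (\<lambda>p. ennreal (c (snd p))))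
  borel2 (\<lambda>p. (fst p, w (snd p)))"

lemma sets_volume_measure [simp, measurable_cong]: "sets (volume_measure c w) = sets borel2"
 by (simp add: volume_measure_def)

lemma nn_integral_volume_measure:
 fixes h :: "'a::euclidean_space \<times> real \<Rightarrow> ennreal"
 assumes [measurable]: "c \<in> borel_measurable borel" "w \<in> borel_measurable borel" "h \<in> borel_measurable borel2"
 shows "(\<integral>\<^sup>+z. h z \<partial>volume_measure c w) =
  (\<integral>\<^sup>+p. ennreal (c (snd p)) * h (fst p, w (snd p)) \<partial>lborel2)"
 unfolding volume_measure_def by (subst nn_integral_distr, measurable) (subst nn_integral_density, measurable)

lemma integral_volume_measure:
 fixes h :: "'a::euclidean_space \<times> real \<Rightarrow> 'b::{banach, second_countable_topology}"
 assumes [measurable]: "c \<in> borel_measurable borel" "w \<in> borel_measurable borel" "h \<in> borel_measurable borel2"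
  and c: "\<And>s. c s \<ge> 0"
 shows "(\<integral>z. h z \<partial>volume_measure c w) = (\<integral>p. c (snd p) *\<^sub>R h (fst p, w (snd p)) \<partial>lborel2)" (is "?l1 = ?r1")
proof -
 have m: "(\<lambda>p::'a \<times> real. h (fst p, w (snd p))) \<in> borel_measurable lborel2" by measurable
 have "?l1 =
  (\<integral>p. h (fst p, w (snd p)) \<partial>density lborel2 (\<lambda>p. ennreal (c (snd p))))"
  unfolding volume_measure_def by (subst integral_distr) measurable
 also have "\<dots> = ?r1" by (rule integral_density[OF m]) (use c in auto)
 finally show ?thesis .
qed

lemma integrable_volume_measure:
 fixes h :: "'a::euclidean_space \<times> real \<Rightarrow> 'b::{banach, second_countable_topology}"
 assumes [measurable]: "c \<in> borel_measurable borel" "w \<in> borel_measurable borel" "h \<in> borel_measurable borel2"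
  and c: "\<And>s. c s \<ge> 0"
 shows "integrable (volume_measure c w) h \<longleftrightarrow> integrable lborel2 (\<lambda>p. c (snd p) *\<^sub>R h (fst p, w (snd p)))"
proof -
 let ?t1 = "lborel2"
 have m: "(\<lambda>p::'a \<times> real. h (fst p, w (snd p))) \<in> borel_measurable ?t1" by measurable
 have "integrable (volume_measure c w) h \<longleftrightarrow>
  integrable (density ?t1 (\<lambda>p. ennreal (c (snd p)))) (\<lambda>p. h (fst p, w (snd p)))"
  unfolding volume_measure_def by (subst integrable_distr_eq) measurable
 also have "\<dots> \<longleftrightarrow> integrable ?t1 (\<lambda>p. c (snd p) *\<^sub>R h (fst p, w (snd p)))"
  by (rule integrable_density[OF m]) (use c in auto)
 finally show ?thesis .
qed

lemma volume_measure_eqI: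
 fixes \<nu> :: "real measure"
 assumes [measurable]: "c \<in> borel_measurable borel" "w \<in> borel_measurable borel"
  and \<nu>: "sigma_finite_measure \<nu>" "sets \<nu> = sets borel"
  and e: "\<And>B. B \<in> sets borel \<Longrightarrow> emeasure \<nu> B = (\<integral>\<^sup>+s. ennreal (c s) * indicator B (w s) \<partial>lborel)"
 shows "lborel \<Otimes>\<^sub>M \<nu> = (volume_measure c w :: ('a::euclidean_space \<times> real) measure)"
proof (rule measure_eqI)
 let ?t1 = "(lborel \<Otimes>\<^sub>M \<nu>)"
 note [measurable_cong] = \<nu>(2)
 have s: "sets ?t1 = sets (borel \<Otimes>\<^sub>M borel :: ('a \<times> real) measure)"
  using \<nu>(2) by (intro sets_pair_measure_cong) auto
 then show "sets ?t1 = sets (volume_measure c w :: ('a \<times> real) measure)" by simp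
 interpret \<nu>: sigma_finite_measure \<nu> by fact
 fix A :: "('a \<times> real) set" assume "A \<in> sets ?t1"
 then have A[measurable]: "A \<in> sets borel2" and A': "A \<in> sets ?t1" using s by auto
 have "emeasure ?t1 A = (\<integral>\<^sup>+x. emeasure \<nu> (Pair x -` A) \<partial>lborel)"
  by (rule \<nu>.emeasure_pair_measure_alt[OF A'])
 also have "\<dots> = (\<integral>\<^sup>+x. \<integral>\<^sup>+s. ennreal (c s) * indicator A (x, w s) \<partial>lborel \<partial>lborel)"
 proof (rule nn_integral_cong, goal_cases)
  case (1 x)
  have "Pair x -` A \<in> sets borel" by (rule sets_Pair1[OF A])
  then show ?case by (subst e) (auto simp: indicator_def)
 qed
 also have "\<dots> = (\<integral>\<^sup>+p. ennreal (c (snd p)) * indicator A (fst p, w (snd p)) \<partial>lborel2)"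
 proof -
  have "(\<lambda>p. ennreal (c (snd p)) * indicator A (fst p, w (snd p))) \<in> borel_measurable lborel2"
   by measurable
  from lborel.nn_integral_fst[OF this] show ?thesis by simp
 qed
 also have "\<dots> = (\<integral>\<^sup>+z. indicator A z \<partial>volume_measure c w)"
  by (rule nn_integral_volume_measure[symmetric]) auto
 finally show "emeasure ?t1 A = emeasure (volume_measure c w) A" by simp
qed

lemma emeasure_powr_half_line:
 assumes a: "a > 0" and p: "p > (0::real)"
 shows "(\<integral>\<^sup>+v. ennreal (indicator {0<..} v * v powr (- p - 1)) * indicator {a<..} v \<partial>lborel) = ennreal (a powr (- p) / p)"
  and "(\<integral>\<^sup>+s. ennreal (1 / p * indicator {0<..} s) * indicator {a<..} (s powr (- 1 / p)) \<partial>lborel) = ennreal (a powr (- p) / p)"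
proof -
 let ?t1 = "(\<lambda>v. indicator {a..} v * v powr (- p - 1))"
 have i: "((\<lambda>v. v powr (- p - 1)) has_integral (- (a powr ((- p - 1) + 1)) / ((- p - 1) + 1))) {a..}"
  by (rule has_integral_powr_to_inf) (use a p in auto)
 have eq: "?t1 = (\<lambda>s. if s \<in> {a..} then s powr (- p - 1) else 0)" by (auto simp: indicator_def)
 have "(?t1 has_integral (a powr (- p) / p)) UNIV" unfolding eq has_integral_restrict_UNIV using i by simp
 from nn_integral_has_integral_lborel[OF _ _ this]
 have "(\<integral>\<^sup>+v. ennreal (indicator {a..} v * v powr (- p - 1)) \<partial>lborel) = ennreal (a powr (- p) / p)"
  by simp
 moreover have "(\<integral>\<^sup>+v. ennreal (indicator {0<..} v * v powr (- p - 1)) * indicator {a<..} v \<partial>lborel) =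
  (\<integral>\<^sup>+v. ennreal (indicator {a..} v * v powr (- p - 1)) \<partial>lborel)"
 proof (rule nn_integral_cong_AE)
  show "AE v in lborel. ennreal (indicator {0<..} v * v powr (- p - 1)) * indicator {a<..} v =
    ennreal (indicator {a..} v * v powr (- p - 1))"
   using AE_lborel_singleton[of a] by eventually_elim (use a in \<open>auto simp: indicator_def\<close>)
 qed
 ultimately show "(\<integral>\<^sup>+v. ennreal (indicator {0<..} v * v powr (- p - 1)) * indicator {a<..} v \<partial>lborel) = ennreal (a powr (- p) / p)"
  by simp
 have iff: "a < s powr (- 1 / p) \<longleftrightarrow> s < a powr (- p)" if "s > 0" for s
 proof
  assume "a < s powr (- 1 / p)"
  then have "(s powr (- 1 / p)) powr (- p) < a powr (- p)" using a p by (intro powr_less_mono2_neg) auto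
  then show "s < a powr (- p)" using that p by (simp add: powr_powr)
 next
  assume "s < a powr (- p)"
  then have "(a powr (- p)) powr (- 1 / p) < s powr (- 1 / p)" using that p by (intro powr_less_mono2_neg) auto
  then show "a < s powr (- 1 / p)" using a p by (simp add: powr_powr)
 qed
 have "(\<integral>\<^sup>+s. ennreal (1 / p * indicator {0<..} s) * indicator {a<..} (s powr (- 1 / p)) \<partial>lborel) =
  (\<integral>\<^sup>+s. ennreal (1 / p) * indicator {0<..<a powr (- p)} s \<partial>lborel)"
  by (intro nn_integral_cong) (auto simp: indicator_def iff[simplified])
 also have "\<dots> = ennreal (1 / p) * ennreal (a powr (- p))" by (simp add: nn_integral_cmult)
 also have "\<dots> = ennreal (a powr (- p) / p)" using p by (simp flip: ennreal_mult)
 finally show "(\<integral>\<^sup>+s. ennreal (1 / p * indicator {0<..} s) * indicator {a<..} (s powr (- 1 / p)) \<partial>lborel) = ennreal (a powr (- p) / p)" .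
qed

text \<open>Both sides define measures of infinite mass near 0, so equality on half-lines determines
  them only after restriction to \<open>v > 1 / Suc n\<close>. Monotone convergence removes the
  restriction.\<close>

lemma emeasure_powr_density:
 assumes p: "p > (0::real)" and B[measurable]: "B \<in> sets borel"
 shows "(\<integral>\<^sup>+v. ennreal (indicator {0<..} v * v powr (- p - 1)) * indicator B v \<partial>lborel) =
  (\<integral>\<^sup>+s. ennreal (1 / p * indicator {0<..} s) * indicator B (s powr (- 1 / p)) \<partial>lborel)"
proof -
 let ?t1 = "(\<lambda>s. s powr (- 1 / p))"
 define M1 where "M1 = (\<lambda>n::nat. density lborel (\<lambda>v::real. ennreal (indicator {0<..} v * v powr (- p - 1)) * indicator {1 / Suc n<..} v))"
 define M2 where "M2 = (\<lambda>n::nat. distr (density lborel (\<lambda>s::real. ennreal (1 / p * indicator {0<..} s) * indicator {1 / Suc n<..} (s powr (- 1 / p)))) borel ?t1)"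
 have e1: "emeasure (M1 n) A = (\<integral>\<^sup>+v. ennreal (indicator {0<..} v * v powr (- p - 1)) * indicator ({1 / Suc n<..} \<inter> A) v \<partial>lborel)"
  if "A \<in> sets borel" for A n
  unfolding M1_def using that by (subst emeasure_density) (auto intro!: nn_integral_cong simp: indicator_def)
 have e2: "emeasure (M2 n) A = (\<integral>\<^sup>+s. ennreal (1 / p * indicator {0<..} s) * indicator ({1 / Suc n<..} \<inter> A) (s powr (- 1 / p)) \<partial>lborel)"
  if [measurable]: "A \<in> sets borel" for A n
 proof -
  have "(\<lambda>s::real. s powr (- 1 / p)) \<in> borel_measurable borel" by measurable
  from measurable_sets[OF this that] have pre: "?t1 -` A \<in> sets borel" by simp
  have "emeasure (M2 n) A = (\<integral>\<^sup>+s. ennreal (1 / p * indicator {0<..} s) * indicator {1 / Suc n<..} (s powr (- 1 / p)) * indicator (?t1 -` A) s \<partial>lborel)"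
   unfolding M2_def by (subst emeasure_distr, measurable) (subst emeasure_density, insert pre, auto)
  also have "\<dots> = (\<integral>\<^sup>+s. ennreal (1 / p * indicator {0<..} s) * indicator ({1 / Suc n<..} \<inter> A) (s powr (- 1 / p)) \<partial>lborel)"
   by (intro nn_integral_cong) (auto simp: indicator_def)
  finally show ?thesis .
 qed
 have hl: "{1 / real (Suc n)<..} \<inter> {x<..} = {max x (1 / real (Suc n))<..}" for x n by auto
 have "M1 n = M2 n" for n
 proof (rule measure_eqI_lessThan)
  show "sets (M1 n) = sets borel" "sets (M2 n) = sets borel" by (simp_all add: M1_def M2_def)
  fix x
  have "max x (1 / real (Suc n)) > 0" by (simp add: less_max_iff_disj)
  from emeasure_powr_half_line[OF this p]
  show "emeasure (M1 n) {x<..} < \<infinity>" "emeasure (M1 n) {x<..} = emeasure (M2 n) {x<..}"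
   by (simp_all add: e1 e2 hl del: of_nat_Suc)
 qed
 then have M12: "emeasure (M1 n) B = emeasure (M2 n) B" for n by simp
 have mono: "1 / real (Suc n) < v \<Longrightarrow> n \<le> m \<Longrightarrow> 1 / real (Suc m) < v" for n m and v :: real
  by (rule le_less_trans[of _ "1 / real (Suc n)"]) (auto intro!: divide_left_mono mult_pos_pos simp del: of_nat_Suc)
 have sup: "(SUP n. a * indicator ({1 / real (Suc n)<..} \<inter> B) v) = a * indicator B v" if "v > 0 \<or> a = 0" for a :: ennreal and v :: real
 proof (cases "a = 0")
  case False
  then have v: "v > 0" using that by simp
  then obtain n where n: "1 / real (Suc n) < v" using nat_approx_posE by blast
  show ?thesis
  proof (rule antisym)
   let ?t2 = "(SUP n. a * indicator ({1 / real (Suc n)<..} \<inter> B) v)"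
   show "?t2 \<le> a * indicator B v" by (intro SUP_least mult_left_mono) (auto simp: indicator_def)
   show "a * indicator B v \<le> ?t2"
    by (rule SUP_upper2[of n]) (use n in \<open>auto simp: indicator_def\<close>)
  qed
 qed simp
 have inc: "incseq (\<lambda>n. a * indicator ({1 / real (Suc n)<..} \<inter> B) v)" for a :: ennreal and v :: real
  unfolding incseq_def using mono by (intro allI impI mult_left_mono) (auto simp: indicator_def simp del: of_nat_Suc)
 have "(\<integral>\<^sup>+v. ennreal (indicator {0<..} v * v powr (- p - 1)) * indicator B v \<partial>lborel) =
  (\<integral>\<^sup>+v. (SUP n. ennreal (indicator {0<..} v * v powr (- p - 1)) * indicator ({1 / Suc n<..} \<inter> B) v) \<partial>lborel)"
  by (intro nn_integral_cong sup[symmetric]) (auto simp: indicator_def)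
 also have "\<dots> = (SUP n. emeasure (M1 n) B)" unfolding e1[OF B] using inc
  by (intro nn_integral_monotone_convergence_SUP) (auto simp: incseq_def le_fun_def)
 also have "\<dots> = (SUP n. emeasure (M2 n) B)" by (simp add: M12)
 also have "\<dots> = (\<integral>\<^sup>+s. (SUP n. ennreal (1 / p * indicator {0<..} s) * indicator ({1 / Suc n<..} \<inter> B) (s powr (- 1 / p))) \<partial>lborel)"
  unfolding e2[OF B] using inc
  by (intro nn_integral_monotone_convergence_SUP[symmetric]) (auto simp: incseq_def le_fun_def)
 also have "\<dots> = (\<integral>\<^sup>+s. ennreal (1 / p * indicator {0<..} s) * indicator B (s powr (- 1 / p)) \<partial>lborel)"
  by (intro nn_integral_cong sup) (auto simp: indicator_def)
 finally show ?thesis .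
qed

text \<open>Under the substitution \<open>v = s powr (- 1 / p)\<close> the element \<open>ds\<close>
  becomes, up to sign, \<open>p * v powr (- p - 1)\<close> times \<open>dv\<close>; hence the
  constant \<open>1 / p\<close>.\<close>

lemma limit_intensity_eq:
 assumes "p > (0::real)"
 shows "limit_intensity p = volume_measure (\<lambda>s. 1 / p * indicator {0<..} s) (\<lambda>s. s powr (- 1 / p))"
 unfolding limit_intensity_def
proof (rule volume_measure_eqI)
 let ?t1 = "(density lborel (\<lambda>v::real. ennreal (indicator {0<..} v * v powr (- p - 1))))"
 show "sigma_finite_measure ?t1"
  by (subst sigma_finite_measure.sigma_finite_iff_density_finite[OF sigma_finite_lborel]) auto
 fix B :: "real set" assume [measurable]: "B \<in> sets borel"
 show "emeasure ?t1 B =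
  (\<integral>\<^sup>+s. ennreal (1 / p * indicator {0<..} s) * indicator B (s powr (- 1 / p)) \<partial>lborel)"
  using emeasure_powr_density[OF assms, of B] by (subst emeasure_density) auto
qed auto

lemma scale_volume_measure:
 assumes [measurable]: "c \<in> borel_measurable borel" "w \<in> borel_measurable borel" and "l \<ge> 0" "\<And>s. c s \<ge> 0"
 shows "scale_measure (ennreal l) (volume_measure c w) = (volume_measure (\<lambda>s. l * c s) w :: ('a::euclidean_space \<times> real) measure)"
proof (rule measure_eqI)
 let ?t21 = "(volume_measure (\<lambda>s. l * c s) w)"
 let ?t20 = "(scale_measure (ennreal l) (volume_measure c w))"
 let ?t1 = "lborel2"
 fix A assume "A \<in> sets (scale_measure (ennreal l) (volume_measure c w :: ('a \<times> real) measure))"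
 then have A[measurable]: "A \<in> sets borel2" by simp
 have "emeasure ?t21 A = (\<integral>\<^sup>+z. indicator A z \<partial>volume_measure (\<lambda>s. l * c s) w)"
  by simp
 also have "\<dots> = (\<integral>\<^sup>+p. ennreal (l * c (snd p)) * indicator A (fst p, w (snd p)) \<partial>?t1)"
  by (rule nn_integral_volume_measure) auto
 also have "\<dots> = (\<integral>\<^sup>+p. ennreal l * (ennreal (c (snd p)) * indicator A (fst p, w (snd p))) \<partial>?t1)"
  using assms by (simp add: ennreal_mult mult.assoc)
 also have "\<dots> = ennreal l * (\<integral>\<^sup>+p. ennreal (c (snd p)) * indicator A (fst p, w (snd p)) \<partial>?t1)"
  by (rule nn_integral_cmult) measurable
 also have "\<dots> = ennreal l * (\<integral>\<^sup>+z. indicator A z \<partial>volume_measure c w)"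
  by (subst nn_integral_volume_measure) auto
 also have "\<dots> = emeasure ?t20 A" by simp
 finally show "emeasure ?t20 A = emeasure ?t21 A" ..
qed simp

context rv_tail
begin

text \<open>Inverse transform sampling followed by the change of variable \<open>u = s * k\<close>.
  The scale \<open>k\<close> stays free: it is \<open>G (1 / \<rho>)\<close> in the first two
  regimes and \<open>1 / (\<gamma> * l)\<close> in the third.\<close>

lemma grain_intensity_eq:
 fixes Q :: "'q measure"
 assumes V: "V \<in> borel_measurable Q" "\<mu> = distr Q borel V" and k: "k > 0" and l: "l > 0"
 shows "(grain_intensity Q V l \<rho> :: ('a::euclidean_space \<times> real) measure) =
  volume_measure (\<lambda>s. l * k * indicator {0<..<1 / k} s) (\<lambda>s. \<rho> * quantile (s * k))"
proof -
 let ?t20 = "(\<lambda>v. \<rho> * v)"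
 let ?t2 = "(\<lambda>q. \<rho> * V q)"
 have d: "distr Q borel ?t2 = distr \<mu> borel ?t20"
  unfolding V(2) using V(1) by (subst distr_distr) (auto simp: comp_def)
 have "lborel \<Otimes>\<^sub>M distr Q borel ?t2 =
  (volume_measure (\<lambda>s. k * indicator {0<..<1 / k} s) (\<lambda>s. \<rho> * quantile (s * k)) :: ('a \<times> real) measure)"
 proof (rule volume_measure_eqI)
  have "prob_space (distr \<mu> borel ?t20)" by (rule prob_space_distr) simp
  then interpret d: prob_space "distr Q borel ?t2" unfolding d .
  show "sigma_finite_measure (distr Q borel ?t2)" ..
  fix B :: "real set" assume B[measurable]: "B \<in> sets borel"
  let ?t1 = "(\<integral>\<^sup>+s. ennreal (k * indicator {0<..<1 / k} s) * indicator B (\<rho> * quantile (s * k)) \<partial>lborel)"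
  have "emeasure (distr Q borel ?t2) B = (\<integral>\<^sup>+v. indicator B (\<rho> * v) \<partial>\<mu>)" (is "?l1 = ?r1")
  proof -
   have "?l1 = (\<integral>\<^sup>+v. indicator B v \<partial>distr \<mu> borel ?t20)" unfolding d by simp
   also have "\<dots> = ?r1" by (subst nn_integral_distr) auto
   finally show ?thesis .
  qed
  also have "\<dots> = (\<integral>\<^sup>+v. indicator B (\<rho> * v) \<partial>distr (density lborel (indicator {0<..<1})) borel quantile)"
   by (simp add: distr_quantile)
  also have "\<dots> = (\<integral>\<^sup>+u. indicator {0<..<1} u * indicator B (\<rho> * quantile u) \<partial>lborel)"
   by (subst nn_integral_distr, measurable) (subst nn_integral_density, auto)
  also have "\<dots> = ennreal (\<bar>k\<bar> ^ DIM(real)) * (\<integral>\<^sup>+s. indicator {0<..<1} (0 + k *\<^sub>R s) * indicator B (\<rho> * quantile (0 + k *\<^sub>R s)) \<partial>lborel)"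
   by (rule nn_integral_lborel_affine) (use k in auto)
  also have "\<dots> = (\<integral>\<^sup>+s. ennreal k * (indicator {0<..<1} (k * s) * indicator B (\<rho> * quantile (k * s))) \<partial>lborel)"
   using k by (subst nn_integral_cmult) auto
  also have "\<dots> = ?t1"
   using k by (intro nn_integral_cong) (auto simp: indicator_def field_simps zero_less_mult_iff)
  finally show "emeasure (distr Q borel ?t2) B =
   ?t1" .
 qed auto
 then show ?thesis unfolding grain_intensity_def using k l by (simp add: scale_volume_measure mult.assoc)
qed

end

text \<open>With \<open>b = \<sigma> ^ DIM('a)\<close> the dilation of space contributes the
  Jacobian \<open>b\<close> and the rescaling of volumes contributes \<open>b powr (- q)\<close>;
  the product is the stated power of \<sigma>.\<close>

lemma nn_integral_limit_intensity_scale: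
 fixes h :: "'a::euclidean_space \<times> real \<Rightarrow> ennreal"
 assumes [measurable]: "h \<in> borel_measurable borel2" and q: "q > 0" and \<sigma>: "\<sigma> > 0"
 shows "(\<integral>\<^sup>+z. h z \<partial>limit_intensity q) =
  ennreal (\<sigma> powr (- ((q - 1) * real DIM('a)))) * (\<integral>\<^sup>+z. h (\<sigma> *\<^sub>R fst z, \<sigma> ^ DIM('a) * snd z) \<partial>limit_intensity q)"
proof -
 let ?c = "\<lambda>s::real. ennreal (1 / q * indicator {0<..} s)"
 define b where "b = \<sigma> ^ DIM('a)"
 let ?t1 = "(\<integral>\<^sup>+z. h (\<sigma> *\<^sub>R fst z, b * snd z) \<partial>limit_intensity q)"
 have b: "b > 0" using \<sigma> by (simp add: b_def)
 have int: "(\<integral>\<^sup>+z. g z \<partial>limit_intensity q) = (\<integral>\<^sup>+x. \<integral>\<^sup>+s. ?c s * g (x, s powr (- 1 / q)) \<partial>lborel \<partial>lborel)"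
  if [measurable]: "g \<in> borel_measurable borel2" for g :: "'a \<times> real \<Rightarrow> ennreal"
 proof -
  have "(\<lambda>p::'a \<times> real. ?c (snd p) * g (fst p, snd p powr (- 1 / q))) \<in> borel_measurable lborel2"
   by measurable
  from lborel.nn_integral_fst[OF this] show ?thesis
   unfolding limit_intensity_eq[OF q] by (subst nn_integral_volume_measure) auto
 qed
 have inner: "(\<integral>\<^sup>+s. ?c s * h (x, s powr (- 1 / q)) \<partial>lborel) =
  ennreal (b powr (- q)) * (\<integral>\<^sup>+s. ?c s * h (x, b * s powr (- 1 / q)) \<partial>lborel)" for x
 proof -
  define a where "a = b powr (- q)"
  have a: "a > 0" using b by (simp add: a_def)
  have "(\<integral>\<^sup>+s. ?c s * h (x, s powr (- 1 / q)) \<partial>lborel) =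
   ennreal (\<bar>a\<bar> ^ DIM(real)) * (\<integral>\<^sup>+s. ?c (0 + a *\<^sub>R s) * h (x, (0 + a *\<^sub>R s) powr (- 1 / q)) \<partial>lborel)"
   by (rule nn_integral_lborel_affine) (use a in auto)
  also have "(\<integral>\<^sup>+s. ?c (0 + a *\<^sub>R s) * h (x, (0 + a *\<^sub>R s) powr (- 1 / q)) \<partial>lborel) =
   (\<integral>\<^sup>+s. ?c s * h (x, b * s powr (- 1 / q)) \<partial>lborel)"
  proof (intro nn_integral_cong, goal_cases)
   case (1 s)
   have "(a * s) powr (- 1 / q) = b * s powr (- 1 / q)" if "s > 0"
   proof -
    have "a powr (- 1 / q) = b" using b q by (simp add: a_def powr_powr)
    then show ?thesis using a that by (simp add: powr_mult)
   qed
   then show ?case using a by (auto simp: indicator_def zero_less_mult_iff)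
  qed
  finally show ?thesis using a by (simp add: a_def)
 qed
 have "(\<integral>\<^sup>+z. h z \<partial>limit_intensity q) = (\<integral>\<^sup>+x. ennreal (b powr (- q)) * (\<integral>\<^sup>+s. ?c s * h (x, b * s powr (- 1 / q)) \<partial>lborel) \<partial>lborel)"
  by (simp only: int[OF assms(1)] inner)
 also have "\<dots> = ennreal (b powr (- q)) * (\<integral>\<^sup>+x. \<integral>\<^sup>+s. ?c s * h (x, b * s powr (- 1 / q)) \<partial>lborel \<partial>lborel)"
  by (rule nn_integral_cmult) measurable
 also have "(\<integral>\<^sup>+x. \<integral>\<^sup>+s. ?c s * h (x, b * s powr (- 1 / q)) \<partial>lborel \<partial>lborel) =
  ennreal (\<bar>\<sigma>\<bar> ^ DIM('a)) * (\<integral>\<^sup>+x. \<integral>\<^sup>+s. ?c s * h (0 + \<sigma> *\<^sub>R x, b * s powr (- 1 / q)) \<partial>lborel \<partial>lborel)"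
  by (rule nn_integral_lborel_affine) (use \<sigma> in auto)
 also have "(\<integral>\<^sup>+x. \<integral>\<^sup>+s. ?c s * h (0 + \<sigma> *\<^sub>R x, b * s powr (- 1 / q)) \<partial>lborel \<partial>lborel) =
  ?t1" by (subst int) auto
 also have "ennreal (b powr (- q)) * (ennreal (\<bar>\<sigma>\<bar> ^ DIM('a)) * ?t1) =
  ennreal (b powr (- q) * b) * ?t1" using \<sigma> b by (simp add: b_def ennreal_mult mult.assoc)
 also have "b powr (- q) * b = \<sigma> powr (- ((q - 1) * real DIM('a)))"
 proof -
  have bd: "b = \<sigma> powr real DIM('a)" using \<sigma> by (simp add: b_def powr_realpow)
  have "b powr (- q) * b = b powr (1 - q)" using powr_add[of b "- q" 1] b by simp
  also have "\<dots> = (\<sigma> powr real DIM('a)) powr (1 - q)" using bd by simp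
  also have "\<dots> = \<sigma> powr (real DIM('a) * (1 - q))" by (simp add: powr_powr)
  also have "real DIM('a) * (1 - q) = - ((q - 1) * real DIM('a))" by (simp add: algebra_simps)
  finally show ?thesis .
 qed
 finally show ?thesis by (simp add: b_def)
qed

lemma sets_limit_intensity [simp, measurable_cong]:
 "sets (limit_intensity p :: ('a::euclidean_space \<times> real) measure) = sets borel2"
 unfolding limit_intensity_def by (intro sets_pair_measure_cong) auto

subsection \<open>Dominated convergence for grain functionals\<close>

lemma energy_total_variation:
 assumes "f \<in> Malpha a"
 shows "energy a (total_variation f) < \<infinity>" using assms by (simp add: Malpha_def energy_def)

lemma Malpha_M1: "f \<in> Malpha a \<Longrightarrow> f \<in> M1" by (simp add: Malpha_def)

lemma M1_grain_measurable:
 fixes f :: "'a::euclidean_space set \<Rightarrow> real"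
 assumes f: "f \<in> M1" and C: "C \<in> sets borel"
 shows "(\<lambda>z. f (grain_at C z)) \<in> borel_measurable borel2"
proof -
 have "(\<lambda>z. measure (jordan_pos f) (grain_at C z) - measure (jordan_neg f) (grain_at C z))
   \<in> borel_measurable borel2"
  by (intro borel_measurable_diff measure_grain_measurable C finite_measure_jordan_pos[OF f] finite_measure_jordan_neg[OF f]) auto
 then show ?thesis by (simp add: jordan_decomposition[OF f] sets_grain C)
qed

lemma powr_le_majorant:
 fixes s d p :: real
 assumes "s > 0" "0 < d" "d < p"
 shows "s powr (- 1 / p) \<le> max ((1 / s) powr (1 / (p + d))) ((1 / s) powr (1 / (p - d)))"
proof -
 have eq: "s powr (- 1 / p) = (1 / s) powr (1 / p)"
  using assms by (simp add: powr_divide powr_minus field_simps)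
 show ?thesis
 proof (cases "s \<le> 1")
  case True
  have "(1 / s) powr (1 / p) \<le> (1 / s) powr (1 / (p - d))"
   using True assms by (intro powr_mono) (auto intro!: divide_left_mono mult_pos_pos)
  then show ?thesis unfolding eq by (simp only: le_max_iff_disj simp_thms)
 next
  case False
  have "(1 / s) powr (1 / p) \<le> (1 / s) powr (1 / (p + d))"
   using False assms by (intro powr_mono') (auto intro!: divide_left_mono mult_pos_pos)
  then show ?thesis unfolding eq by (simp only: le_max_iff_disj simp_thms)
 qed
qed

section \<open>Conditions for dominated convergence over grains\<close>

locale grain_model = rv_tail \<mu> \<gamma> for \<mu> :: "real measure" and \<gamma> :: real +
 fixes C :: "'a::euclidean_space set" and R :: real
 assumes \<gamma>_less_2: "\<gamma> < 2" and C_borel [measurable]: "C \<in> sets borel"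
  and C_volume: "emeasure lborel C = 1" and C_frontier: "emeasure lborel (frontier C) = 0"
  and C_subset: "C \<subseteq> cball 0 R" and R_pos: "R > 0"
begin

text \<open>These are the demands of dominated convergence with limiting volume
  \<open>s powr (- 1 / \<gamma>)\<close>. The bound \<open>D\<close> serves every volume below the
  majorant at once, as the volumes before the limit change with the index. The property passes to
  finite linear combinations, so the limit theorems can treat a single set function.\<close>

definition dominated :: "real \<Rightarrow> ('a set \<Rightarrow> real) \<Rightarrow> bool" where
 "dominated d \<phi> \<longleftrightarrow>
  (\<lambda>z. \<phi> (grain_at C z)) \<in> borel_measurable borel2 \<and>
  (\<forall>A>0. \<exists>D. integrable lborel2 D \<and>
    (\<forall>x s w. 0 < s \<longrightarrow> 0 < w \<longrightarrow> w \<le> majorant A d s \<longrightarrow> (\<phi> (grain C x w))\<^sup>2 \<le> D (x, s))) \<and>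
  (AE p in lborel \<Otimes>\<^sub>M lborel. 0 < snd p \<longrightarrow>
    (\<forall>v. v \<longlonglongrightarrow> snd p powr (- 1 / \<gamma>) \<longrightarrow>
     (\<lambda>m::nat. \<phi> (grain C (fst p) (v m))) \<longlonglongrightarrow> \<phi> (grain C (fst p) (snd p powr (- 1 / \<gamma>)))))"

text \<open>By Fubini's theorem the integral over the centres of the mass on a scaled frontier is a
  multiple of the volume of the frontier of \<open>C\<close>, which is 0.\<close>

lemma AE_frontier:
 fixes M :: "'a measure"
 assumes M: "finite_measure M" "sets M = sets borel"
 shows "AE p in lborel \<Otimes>\<^sub>M lborel. 0 < snd p \<longrightarrow> emeasure M (grain (frontier C) (fst p) (snd p powr (- 1 / \<gamma>))) = 0"
proof -
 let ?f = "\<lambda>p::'a \<times> real. indicator {0<..} (snd p) * emeasure M (grain (frontier C) (fst p) (snd p powr (- 1 / \<gamma>)))"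
 have fr: "frontier C \<in> sets borel" by (simp add: borel_closed)
 have m: "?f \<in> borel_measurable lborel2"
  by (intro borel_measurable_times_ennreal emeasure_grain_measurable fr M) auto
 have "(\<integral>\<^sup>+p. ?f p \<partial>lborel2) =
  (\<integral>\<^sup>+s. \<integral>\<^sup>+x. ?f (x, s) \<partial>lborel \<partial>lborel)"
  by (rule lborel_pair.nn_integral_snd[symmetric]) (use m in \<open>simp add: split_beta'\<close>)
 also have "\<dots> = (\<integral>\<^sup>+s. 0 \<partial>(lborel :: real measure))"
 proof (rule nn_integral_cong, goal_cases)
  case (1 s)
  show ?case (is "?l1 = _")
  proof (cases "s > 0")
   case True
   then have "?l1 = (\<integral>\<^sup>+x. emeasure M (grain (frontier C) x (s powr (- 1 / \<gamma>))) \<partial>lborel)"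
    by simp
   also have "\<dots> = 0"
    using nn_integral_emeasure_grain[OF fr M, of "s powr (- 1 / \<gamma>)"] True by (simp add: C_frontier)
   finally show ?thesis .
  qed simp
 qed
 also have "\<dots> = 0" by simp
 finally have "AE p in lborel \<Otimes>\<^sub>M lborel. ?f p = 0"
  using m by (subst (asm) nn_integral_0_iff_AE) auto
 then show ?thesis by eventually_elim (auto simp: indicator_def)
qed

text \<open>The integral over the position is at most a constant times
  \<open>min v (v powr (2 - \<alpha>))\<close>: the linear bound uses the finite mass of
  \<open>M\<close>, the other one its energy. Inserting the majorant for \<open>v\<close> leaves the
  integral of \<open>majorant_integrable\<close> with \<open>\<beta> = 2 - \<alpha>\<close>.\<close>

lemma integrable_ball_grain_square:
 fixes M :: "'a measure"
 assumes M: "finite_measure M" "sets M = sets borel" and e: "energy \<alpha> M < \<infinity>"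
  and A: "A > 0" and d: "0 < d" "1 < \<gamma> - d" "\<gamma> + d < 2 - \<alpha>"
 shows "integrable lborel2
  (\<lambda>p. indicator {0<..} (snd p) * (measure M (grain (cball 0 R) (fst p) (majorant A d (snd p))))\<^sup>2)"
proof (rule integrableI_bounded)
 let ?t1 = "lborel2"
 interpret M: finite_measure M by fact
 let ?B = "cball (0::'a) R"
 let ?K = "majorant A d"
 let ?f = "\<lambda>p::'a \<times> real. indicator {0<..} (snd p) * (emeasure M (grain ?B (fst p) (?K (snd p))))\<^sup>2"
 have m: "?f \<in> borel_measurable ?t1"
  by (intro borel_measurable_times_ennreal borel_measurable_power_ennreal emeasure_grain_measurable M) auto
 show "(\<lambda>p. indicator {0<..} (snd p) * (measure M (grain ?B (fst p) (?K (snd p))))\<^sup>2) \<in> borel_measurable ?t1"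
  by (intro borel_measurable_times borel_measurable_power measure_grain_measurable M) auto
 have \<alpha>: "\<alpha> < 1" using d \<gamma>_gt_1 by simp
 define c1 where "c1 = emeasure lborel ?B * emeasure M UNIV * emeasure M UNIV"
 define c2 where "c2 = ennreal ((2 * R) powr ((1 - \<alpha>) * real DIM('a))) * emeasure lborel ?B * energy \<alpha> M"
 have fin: "emeasure lborel ?B < \<infinity>" "emeasure M UNIV < \<infinity>"
  using emeasure_bounded_finite[of ?B] M.emeasure_finite[of UNIV] by (auto simp: less_top[symmetric])
 have c: "max c1 c2 < \<infinity>" using fin e by (auto simp: c1_def c2_def ennreal_mult_less_top)
 have bound: "(\<integral>\<^sup>+x. (emeasure M (grain ?B x v))\<^sup>2 \<partial>lborel) \<le> max c1 c2 * ennreal (min v (v powr (2 - \<alpha>)))"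
  if v: "v > 0" for v
 proof (cases "v \<le> v powr (2 - \<alpha>)")
  case True
  have "(\<integral>\<^sup>+x. (emeasure M (grain ?B x v))\<^sup>2 \<partial>lborel) \<le> (\<integral>\<^sup>+x. emeasure M UNIV * emeasure M (grain ?B x v) \<partial>lborel)"
   unfolding power2_eq_square using sets_eq_imp_space_eq[OF M(2)] emeasure_space[of M]
   by (intro nn_integral_mono mult_right_mono) auto
  also have "\<dots> = emeasure M UNIV * (ennreal v * emeasure lborel ?B * emeasure M UNIV)"
  proof -
   have "(\<lambda>x. emeasure M (grain ?B x v)) \<in> borel_measurable lborel"
    by (intro emeasure_grain_measurable M) auto
   then show ?thesis by (simp add: nn_integral_cmult nn_integral_emeasure_grain[OF _ M v])
  qed
  also have "\<dots> = c1 * ennreal v" by (simp add: c1_def ac_simps)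
  also have "\<dots> \<le> max c1 c2 * ennreal (min v (v powr (2 - \<alpha>)))"
   using True by (intro mult_mono) auto
  finally show ?thesis .
 next
  case False
  have "(\<integral>\<^sup>+x. (emeasure M (grain ?B x v))\<^sup>2 \<partial>lborel) \<le>
   ennreal ((2 * R) powr ((1 - \<alpha>) * real DIM('a)) * v powr (2 - \<alpha>)) * emeasure lborel ?B * energy \<alpha> M"
   by (rule nn_integral_emeasure_ball_grain_square[OF M v R_pos \<alpha>])
  also have "\<dots> = c2 * ennreal (v powr (2 - \<alpha>))" by (simp add: c2_def ennreal_mult ac_simps)
  also have "\<dots> \<le> max c1 c2 * ennreal (min v (v powr (2 - \<alpha>)))"
   using False by (intro mult_mono) auto
  finally show ?thesis .
 qed
 have "(\<integral>\<^sup>+p. ?f p \<partial>?t1) = (\<integral>\<^sup>+s. \<integral>\<^sup>+x. ?f (x, s) \<partial>lborel \<partial>lborel)"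
  by (rule lborel_pair.nn_integral_snd[symmetric]) (use m in \<open>simp add: split_beta'\<close>)
 also have "\<dots> \<le> (\<integral>\<^sup>+s. max c1 c2 * (ennreal (min (?K s) (?K s powr (2 - \<alpha>))) * indicator {0<..} s) \<partial>lborel)"
 proof (rule nn_integral_mono, goal_cases)
  case (1 s)
  show ?case
  proof (cases "s > 0")
   case True
   have "?K s > 0" using True A unfolding majorant_def by (simp add: less_max_iff_disj)
   then show ?thesis using bound[of "?K s"] True by simp
  qed simp
 qed
 also have "\<dots> = max c1 c2 * (\<integral>\<^sup>+s. ennreal (min (?K s) (?K s powr (2 - \<alpha>))) * indicator {0<..} s \<partial>lborel)"
  by (rule nn_integral_cmult) measurable
 also have "\<dots> < \<infinity>"
  using c majorant_integrable[OF A d(1,2) d(3)] by (simp add: ennreal_mult_less_top)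
 finally have "(\<integral>\<^sup>+p. ?f p \<partial>?t1) < \<infinity>" .
 also have "(\<integral>\<^sup>+p. ?f p \<partial>?t1) =
  (\<integral>\<^sup>+p. ennreal (norm (indicator {0<..} (snd p) * (measure M (grain ?B (fst p) (?K (snd p))))\<^sup>2)) \<partial>?t1)"
  by (intro nn_integral_cong) (auto simp: M.emeasure_eq_measure ennreal_power indicator_def)
 finally show "(\<integral>\<^sup>+p. ennreal (norm (indicator {0<..} (snd p) * (measure M (grain ?B (fst p) (?K (snd p))))\<^sup>2)) \<partial>?t1) < \<infinity>" .
qed

lemma dominated_Malpha:
 assumes \<phi>: "\<phi> \<in> Malpha \<alpha>" and d: "0 < d" "1 < \<gamma> - d" "\<gamma> + d < 2 - \<alpha>"
 shows "dominated d \<phi>" unfolding dominated_def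
proof (intro conjI allI impI)
 note \<phi>1 = Malpha_M1[OF \<phi>]
 note TV = finite_measure_total_variation[OF \<phi>1] sets_total_variation[of \<phi>]
 interpret T: finite_measure "total_variation \<phi>" by (rule TV(1))
 interpret p: finite_measure "jordan_pos \<phi>" by (rule finite_measure_jordan_pos[OF \<phi>1])
 interpret n: finite_measure "jordan_neg \<phi>" by (rule finite_measure_jordan_neg[OF \<phi>1])
 show "(\<lambda>z. \<phi> (grain_at C z)) \<in> borel_measurable borel2"
  by (rule M1_grain_measurable[OF \<phi>1 C_borel])
 fix A :: real assume A: "A > 0"
 show "\<exists>D. integrable lborel2 D \<and>
    (\<forall>x s w. 0 < s \<longrightarrow> 0 < w \<longrightarrow> w \<le> majorant A d s \<longrightarrow> (\<phi> (grain C x w))\<^sup>2 \<le> D (x, s))"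
 proof (intro exI conjI allI impI)
  let ?t2 = "(total_variation \<phi>)"
  show "integrable lborel2 (\<lambda>p. indicator {0<..} (snd p) *
   (measure ?t2 (grain (cball 0 R) (fst p) (majorant A d (snd p))))\<^sup>2)"
   by (rule integrable_ball_grain_square[OF TV energy_total_variation[OF \<phi>] A d])
  fix x :: 'a and s w :: real assume s: "0 < s" and w: "0 < w" "w \<le> majorant A d s"
  have "\<bar>\<phi> (grain C x w)\<bar> \<le> measure ?t2 (grain C x w)"
   by (rule abs_le_total_variation[OF \<phi>1 sets_grain[OF C_borel]])
  also have "\<dots> \<le> measure ?t2 (grain (cball 0 R) x (majorant A d s))"
   using grain_subset_ball_grain[OF C_subset w] R_pos by (intro T.finite_measure_mono) (auto intro!: sets_grain)
  finally have "\<bar>\<phi> (grain C x w)\<bar>\<^sup>2 \<le> (measure ?t2 (grain (cball 0 R) x (majorant A d s)))\<^sup>2"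
   by (intro power_mono) auto
  then show "(\<phi> (grain C x w))\<^sup>2 \<le> indicator {0<..} (snd (x, s)) *
   (measure ?t2 (grain (cball 0 R) (fst (x, s)) (majorant A d (snd (x, s)))))\<^sup>2" using s by simp
 qed
next
 note \<phi>1 = Malpha_M1[OF \<phi>]
 note TV = finite_measure_total_variation[OF \<phi>1] sets_total_variation[of \<phi>]
 show "AE p in lborel \<Otimes>\<^sub>M lborel. 0 < snd p \<longrightarrow>
    (\<forall>v. v \<longlonglongrightarrow> snd p powr (- 1 / \<gamma>) \<longrightarrow>
     (\<lambda>m::nat. \<phi> (grain C (fst p) (v m))) \<longlonglongrightarrow> \<phi> (grain C (fst p) (snd p powr (- 1 / \<gamma>))))"
  using AE_frontier[OF TV]
 proof eventually_elim
  case (elim p)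
  show ?case
  proof (intro impI allI)
   let ?t1 = "(snd p powr (- 1 / \<gamma>))"
   fix v :: "nat \<Rightarrow> real" assume s: "0 < snd p" and v: "v \<longlonglongrightarrow> snd p powr (- 1 / \<gamma>)"
   have fr: "grain (frontier C) (fst p) ?t1 \<in> sets borel" by (rule sets_grain) (simp add: borel_closed)
   have z: "emeasure (jordan_pos \<phi>) (grain (frontier C) (fst p) ?t1) = 0"
    "emeasure (jordan_neg \<phi>) (grain (frontier C) (fst p) ?t1) = 0"
    using elim s emeasure_total_variation[OF fr, of \<phi>] by simp_all
   have v0: "snd p powr (- 1 / \<gamma>) > 0" using s by simp
   have "(\<lambda>m. measure (jordan_pos \<phi>) (grain C (fst p) (v m)) - measure (jordan_neg \<phi>) (grain C (fst p) (v m))) \<longlonglongrightarrow>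
    measure (jordan_pos \<phi>) (grain C (fst p) ?t1) - measure (jordan_neg \<phi>) (grain C (fst p) ?t1)"
    by (intro tendsto_diff measure_grain_tendsto finite_measure_jordan_pos[OF \<phi>1] finite_measure_jordan_neg[OF \<phi>1] v v0 z) auto
   then show "(\<lambda>m. \<phi> (grain C (fst p) (v m))) \<longlonglongrightarrow> \<phi> (grain C (fst p) ?t1)"
    by (simp only: jordan_decomposition[OF \<phi>1 sets_grain[OF C_borel]])
  qed
 qed
qed

lemma dominated_sum:
 fixes f :: "nat \<Rightarrow> 'a set \<Rightarrow> real"
 assumes f: "\<And>k. k < n \<Longrightarrow> dominated d (f k)"
 shows "dominated d (\<lambda>A. \<Sum>k<n. c k * f k A)" unfolding dominated_def
proof (intro conjI allI impI)
 show "(\<lambda>z. \<Sum>k<n. c k * f k (grain_at C z)) \<in> borel_measurable borel2"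
  using f by (intro borel_measurable_sum borel_measurable_times) (auto simp: dominated_def)
 fix A :: real assume A: "A > 0"
 have "\<forall>k\<in>{..<n}. \<exists>D. integrable lborel2 D \<and>
    (\<forall>x s w. 0 < s \<longrightarrow> 0 < w \<longrightarrow> w \<le> majorant A d s \<longrightarrow> (f k (grain C x w))\<^sup>2 \<le> D (x, s))"
  using f A by (auto simp: dominated_def)
 from bchoice[OF this] obtain D where D: "\<forall>k\<in>{..<n}. integrable lborel2 (D k) \<and>
    (\<forall>x s w. 0 < s \<longrightarrow> 0 < w \<longrightarrow> w \<le> majorant A d s \<longrightarrow> (f k (grain C x w))\<^sup>2 \<le> D k (x, s))" ..
 show "\<exists>D. integrable lborel2 D \<and>
    (\<forall>x s w. 0 < s \<longrightarrow> 0 < w \<longrightarrow> w \<le> majorant A d s \<longrightarrow> (\<Sum>k<n. c k * f k (grain C x w))\<^sup>2 \<le> D (x, s))"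
 proof (intro exI conjI allI impI)
  show "integrable lborel2 (\<lambda>p. real n * (\<Sum>k<n. (c k)\<^sup>2 * D k p))"
   using D by (intro integrable_mult_right Bochner_Integration.integrable_sum) auto
  fix x :: 'a and s w :: real assume sw: "0 < s" "0 < w" "w \<le> majorant A d s"
  have "(\<Sum>k<n. c k * f k (grain C x w))\<^sup>2 \<le> real n * (\<Sum>k<n. (c k * f k (grain C x w))\<^sup>2)"
   using sum_squared_le_sum_of_squares[of "\<lambda>k. c k * f k (grain C x w)" "{..<n}"] by (simp add: mult.commute)
  also have "\<dots> \<le> real n * (\<Sum>k<n. (c k)\<^sup>2 * D k (x, s))"
   unfolding power_mult_distrib using D sw by (intro mult_left_mono sum_mono) auto
  finally show "(\<Sum>k<n. c k * f k (grain C x w))\<^sup>2 \<le> real n * (\<Sum>k<n. (c k)\<^sup>2 * D k (x, s))" .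
 qed
next
 have "AE p in lborel \<Otimes>\<^sub>M lborel. \<forall>k\<in>{..<n}. 0 < snd p \<longrightarrow>
    (\<forall>v. v \<longlonglongrightarrow> snd p powr (- 1 / \<gamma>) \<longrightarrow>
     (\<lambda>m::nat. f k (grain C (fst p) (v m))) \<longlonglongrightarrow> f k (grain C (fst p) (snd p powr (- 1 / \<gamma>))))"
  using f by (intro AE_finite_allI) (auto simp: dominated_def)
 then show "AE p in lborel \<Otimes>\<^sub>M lborel. 0 < snd p \<longrightarrow>
    (\<forall>v. v \<longlonglongrightarrow> snd p powr (- 1 / \<gamma>) \<longrightarrow>
     (\<lambda>m::nat. \<Sum>k<n. c k * f k (grain C (fst p) (v m))) \<longlonglongrightarrow> (\<Sum>k<n. c k * f k (grain C (fst p) (snd p powr (- 1 / \<gamma>)))))"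
 proof eventually_elim
  case (elim p)
  show ?case by (intro impI allI tendsto_sum tendsto_mult tendsto_const) (use elim in blast)
 qed
qed

text \<open>The limiting volume lies below the majorant with \<open>A = 1\<close>, because
  \<open>1 / \<gamma>\<close> lies between the two exponents of the majorant.\<close>

lemma dominated_square_integrable:
 assumes f: "dominated d f" and d: "0 < d" "d < \<gamma>"
 shows "integrable (limit_intensity \<gamma>) (\<lambda>z. (f (grain_at C z))\<^sup>2)"
proof -
 let ?t2 = "(\<lambda>p. (1 / \<gamma> * indicator {0<..} (snd p)) *\<^sub>R (f (grain C (fst p) (snd p powr (- 1 / \<gamma>))))\<^sup>2)"
 let ?t1 = "lborel2"
 have g0: "\<gamma> > 0" using \<gamma>_gt_1 by simp
 have [measurable]: "(\<lambda>z. f (grain_at C z)) \<in> borel_measurable borel2"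
  using f by (simp add: dominated_def)
 have [measurable]: "(\<lambda>p. f (grain C (fst p) (snd p powr (- 1 / \<gamma>)))) \<in> borel_measurable ?t1"
 proof -
  have "(\<lambda>p::'a \<times> real. (fst p, snd p powr (- 1 / \<gamma>))) \<in> measurable ?t1 borel2" by measurable
  from measurable_compose[OF this \<open>(\<lambda>z. f (grain_at C z)) \<in> borel_measurable borel2\<close>]
  show ?thesis by simp
 qed
 have "\<exists>D. integrable ?t1 D \<and>
   (\<forall>x s w. 0 < s \<longrightarrow> 0 < w \<longrightarrow> w \<le> majorant 1 d s \<longrightarrow> (f (grain C x w))\<^sup>2 \<le> D (x, s))"
  using f by (simp add: dominated_def)
 then obtain D where D: "integrable ?t1 D"
  "\<forall>x s w. 0 < s \<longrightarrow> 0 < w \<longrightarrow> w \<le> majorant 1 d s \<longrightarrow> (f (grain C x w))\<^sup>2 \<le> D (x, s)"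
  by blast
 have "integrable ?t1
  ?t2"
 proof (rule Bochner_Integration.integrable_bound)
  show "integrable ?t1 (\<lambda>p. (1 / \<gamma>) * \<bar>D p\<bar>)" using D(1) by simp
  show "AE p in lborel \<Otimes>\<^sub>M lborel. norm ((1 / \<gamma> * indicator {0<..} (snd p)) *\<^sub>R (f (grain C (fst p) (snd p powr (- 1 / \<gamma>))))\<^sup>2)
   \<le> norm ((1 / \<gamma>) * \<bar>D p\<bar>)"
  proof (rule AE_I2, goal_cases)
   case (1 p)
   let ?t3 = "(f (grain C (fst p) (snd p powr (- 1 / \<gamma>))))"
   show ?case
   proof (cases "snd p > 0")
    case True
    have "?t3\<^sup>2 \<le> D (fst p, snd p)"
     using True powr_le_majorant[OF True d] by (intro D(2)[rule_format]) (auto simp: majorant_def)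
    then show ?thesis using True g0 by (simp add: divide_right_mono)
   qed simp
  qed
  show "?t2
   \<in> borel_measurable ?t1" by measurable
 qed
 then show ?thesis unfolding limit_intensity_eq[OF g0] using g0 by (subst integrable_volume_measure) auto
qed

text \<open>The integrand \<open>H n\<close> may vary with \<open>n\<close> and converges
  continuously, which covers the quadratic limit after normalization as well as a converging
  intensity factor. The interval \<open>{0<..<1 / \<kappa> n}\<close> fills the half-line because
  \<kappa> tends to 0.\<close>

lemma grain_integral_limit:
 fixes t \<kappa> :: "nat \<Rightarrow> real" and H :: "nat \<Rightarrow> real \<Rightarrow> complex"
 assumes f: "dominated d f" and d: "0 < d" "d < \<gamma>" and t: "filterlim t at_top sequentially"
  and \<kappa>: "\<forall>\<^sub>F n in sequentially. G (t n) \<le> \<kappa> n"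
   "\<And>q. 0 < q \<Longrightarrow> q < 1 \<Longrightarrow> \<forall>\<^sub>F n in sequentially. \<kappa> n \<le> G (q * t n)"
  and H: "\<And>n. H n \<in> borel_measurable borel" "H' \<in> borel_measurable borel"
   "\<And>y y'. y \<longlonglongrightarrow> y' \<Longrightarrow> (\<lambda>n. H n (y n)) \<longlonglongrightarrow> H' y'"
   "\<forall>\<^sub>F n in sequentially. \<forall>y. cmod (H n y) \<le> L * y\<^sup>2"
 shows "(\<lambda>n. CLINT p|lborel \<Otimes>\<^sub>M lborel. indicator {0<..<1 / \<kappa> n} (snd p) *\<^sub>R
    H n (f (grain C (fst p) (scaled_quantile (\<kappa> n) (t n) (snd p))))) \<longlonglongrightarrow>
  (CLINT p|lborel \<Otimes>\<^sub>M lborel. indicator {0<..} (snd p) *\<^sub>R H' (f (grain C (fst p) (snd p powr (- 1 / \<gamma>)))))"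
proof -
 let ?t1 = "lborel2"
 have m: "(\<lambda>z. f (grain_at C z)) \<in> borel_measurable borel2" using f by (simp add: dominated_def)
 have mw: "(\<lambda>p. f (grain C (fst p) (w (snd p)))) \<in> borel_measurable ?t1"
  if [measurable]: "w \<in> borel_measurable borel" for w :: "real \<Rightarrow> real"
 proof -
  have "(\<lambda>p::'a \<times> real. (fst p, w (snd p))) \<in> measurable ?t1 borel2" by measurable
  from measurable_compose[OF this m] show ?thesis by simp
 qed
 obtain A t0 where A: "A > 0" "\<forall>t\<ge>t0. \<forall>\<kappa>\<ge>G t. \<forall>s>0. scaled_quantile \<kappa> t s \<le> majorant A d s"
  using scaled_quantile_le[OF d] by blast
 have "\<exists>D. integrable ?t1 D \<and>
   (\<forall>x s w. 0 < s \<longrightarrow> 0 < w \<longrightarrow> w \<le> majorant A d s \<longrightarrow> (f (grain C x w))\<^sup>2 \<le> D (x, s))"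
  using f A(1) by (simp add: dominated_def)
 then obtain D where D: "integrable ?t1 D"
  "\<forall>x s w. 0 < s \<longrightarrow> 0 < w \<longrightarrow> w \<le> majorant A d s \<longrightarrow> (f (grain C x w))\<^sup>2 \<le> D (x, s)"
  by blast
 have "\<forall>\<^sub>F n in sequentially. t n \<ge> max t0 1" using t unfolding filterlim_at_top by blast
 then have "\<forall>\<^sub>F n in sequentially. t n \<ge> max t0 1 \<and> G (t n) \<le> \<kappa> n \<and> (\<forall>y. cmod (H n y) \<le> L * y\<^sup>2)"
  using \<kappa>(1) H(4) by (auto elim: eventually_elim2 intro: eventually_conj)
 then obtain n0 where n0: "\<And>n. n \<ge> n0 \<Longrightarrow> t n \<ge> t0 \<and> t n \<ge> 1 \<and> G (t n) \<le> \<kappa> n \<and> (\<forall>y. cmod (H n y) \<le> L * y\<^sup>2)"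
  unfolding eventually_sequentially by auto
 have L: "L \<ge> 0"
 proof -
  have "0 \<le> cmod (H n0 1)" by simp
  also have "cmod (H n0 1) \<le> L * 1\<^sup>2" using n0[of n0] by blast
  finally show ?thesis by simp
 qed
 have \<kappa>0: "(\<lambda>n. \<kappa> n) \<longlonglongrightarrow> 0"
 proof (rule tendsto_sandwich)
  show "\<forall>\<^sub>F n in sequentially. 0 \<le> \<kappa> n" using \<kappa>(1) by eventually_elim (use G_nonneg in \<open>auto intro: order_trans\<close>)
  show "\<forall>\<^sub>F n in sequentially. \<kappa> n \<le> G (1 / 2 * t n)" by (rule \<kappa>(2)) auto
  have "filterlim (\<lambda>n. 1 / 2 * t n) at_top sequentially"
   by (rule filterlim_tendsto_pos_mult_at_top[OF tendsto_const _ t]) simp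
  then show "(\<lambda>n. G (1 / 2 * t n)) \<longlonglongrightarrow> 0" by (rule filterlim_compose[OF G_at_top])
 qed simp
 define I where "I = (\<lambda>n. CLINT p|lborel \<Otimes>\<^sub>M lborel. indicator {0<..<1 / \<kappa> n} (snd p) *\<^sub>R
    H n (f (grain C (fst p) (scaled_quantile (\<kappa> n) (t n) (snd p)))))"
 \<comment> \<open>The majorant is available only from \<open>n0\<close> on, so dominated
   convergence is applied to the shifted sequence.\<close>
 have "(\<lambda>n. I (n + n0)) \<longlonglongrightarrow>
  (CLINT p|lborel \<Otimes>\<^sub>M lborel. indicator {0<..} (snd p) *\<^sub>R H' (f (grain C (fst p) (snd p powr (- 1 / \<gamma>)))))"
  unfolding I_def
 proof (rule integral_dominated_convergence[where w="\<lambda>p. L * \<bar>D p\<bar>"])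
  show "(\<lambda>p. indicator {0<..} (snd p) *\<^sub>R H' (f (grain C (fst p) (snd p powr (- 1 / \<gamma>))))) \<in> borel_measurable ?t1"
   by (intro borel_measurable_scaleR measurable_compose[OF _ H(2)] mw) measurable
  show "(\<lambda>p. indicator {0<..<1 / \<kappa> (n + n0)} (snd p) *\<^sub>R
    H (n + n0) (f (grain C (fst p) (scaled_quantile (\<kappa> (n + n0)) (t (n + n0)) (snd p))))) \<in> borel_measurable ?t1" for n
   by (intro borel_measurable_scaleR measurable_compose[OF _ H(1)] mw) measurable
  show "integrable ?t1 (\<lambda>p. L * \<bar>D p\<bar>)" using D(1) by simp
  show "AE p in lborel \<Otimes>\<^sub>M lborel. (\<lambda>n. indicator {0<..<1 / \<kappa> (n + n0)} (snd p) *\<^sub>R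
    H (n + n0) (f (grain C (fst p) (scaled_quantile (\<kappa> (n + n0)) (t (n + n0)) (snd p))))) \<longlonglongrightarrow>
   indicator {0<..} (snd p) *\<^sub>R H' (f (grain C (fst p) (snd p powr (- 1 / \<gamma>))))"
  proof -
   have "AE p in lborel \<Otimes>\<^sub>M lborel. 0 < snd p \<longrightarrow>
    (\<forall>v. v \<longlonglongrightarrow> snd p powr (- 1 / \<gamma>) \<longrightarrow>
     (\<lambda>m::nat. f (grain C (fst p) (v m))) \<longlonglongrightarrow> f (grain C (fst p) (snd p powr (- 1 / \<gamma>))))"
    using f by (simp add: dominated_def)
   then show ?thesis
   proof eventually_elim
    case (elim p)
    show ?case
    proof (cases "0 < snd p")
     case True
     have "(\<lambda>n. scaled_quantile (\<kappa> n) (t n) (snd p)) \<longlonglongrightarrow> snd p powr (- 1 / \<gamma>)"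
      by (rule scaled_quantile_tendsto[OF t \<kappa> True])
     then have "(\<lambda>n. f (grain C (fst p) (scaled_quantile (\<kappa> n) (t n) (snd p)))) \<longlonglongrightarrow> f (grain C (fst p) (snd p powr (- 1 / \<gamma>)))"
      using elim True by blast
     then have 1: "(\<lambda>n. H n (f (grain C (fst p) (scaled_quantile (\<kappa> n) (t n) (snd p))))) \<longlonglongrightarrow> H' (f (grain C (fst p) (snd p powr (- 1 / \<gamma>))))"
      by (rule H(3))
     have "\<forall>\<^sub>F n in sequentially. \<kappa> n < 1 / snd p"
      using True by (intro order_tendstoD(2)[OF \<kappa>0]) simp
     then have "\<forall>\<^sub>F n in sequentially. indicator {0<..<1 / \<kappa> n} (snd p) = (indicator {0<..} (snd p) :: real)"
      using eventually_ge_at_top[of n0]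
     proof eventually_elim
      case (elim n)
      have "\<kappa> n > 0" using n0[OF elim(2)] G_pos[of "t n"] by linarith
      then show ?case using elim True by (simp add: indicator_def field_simps)
     qed
     then have "(\<lambda>n. indicator {0<..<1 / \<kappa> n} (snd p) :: real) \<longlonglongrightarrow> indicator {0<..} (snd p)"
      by (rule tendsto_eventually)
     from LIMSEQ_ignore_initial_segment[OF tendsto_scaleR[OF this 1], of n0] show ?thesis .
    qed simp
   qed
  qed
  show "AE p in lborel \<Otimes>\<^sub>M lborel. cmod (indicator {0<..<1 / \<kappa> (n + n0)} (snd p) *\<^sub>R
    H (n + n0) (f (grain C (fst p) (scaled_quantile (\<kappa> (n + n0)) (t (n + n0)) (snd p))))) \<le> L * \<bar>D p\<bar>" for n
  proof (rule AE_I2, goal_cases)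
   case (1 p)
   let ?n = "n + n0"
   let ?w = "scaled_quantile (\<kappa> ?n) (t ?n) (snd p)"
   have n: "t ?n \<ge> t0" "t ?n \<ge> 1" "G (t ?n) \<le> \<kappa> ?n" "\<And>y. cmod (H ?n y) \<le> L * y\<^sup>2"
    using n0[of ?n] by auto
   show ?case
   proof (cases "snd p \<in> {0<..<1 / \<kappa> ?n}")
    case True
    have "\<kappa> ?n > 0" using n(3) G_pos[of "t ?n"] by linarith
    then have "0 < snd p * \<kappa> ?n" "snd p * \<kappa> ?n < 1" using True by (auto simp: field_simps)
    then have "?w > 0" using n(2) unfolding scaled_quantile_def by (intro divide_pos_pos quantile_pos) auto
    moreover have "?w \<le> majorant A d (snd p)" using True n by (intro A(2)[rule_format]) auto
    ultimately have "(f (grain C (fst p) ?w))\<^sup>2 \<le> D (fst p, snd p)"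
     using True by (intro D(2)[rule_format]) auto
    then have "L * (f (grain C (fst p) ?w))\<^sup>2 \<le> L * \<bar>D p\<bar>"
     using L by (intro mult_left_mono) auto
    then show ?thesis using n(4)[of "f (grain C (fst p) ?w)"] True by simp
   next
    case False
    then show ?thesis using L by simp
   qed
  qed
 qed
 then show ?thesis unfolding I_def by (rule LIMSEQ_offset)
qed

end

subsection \<open>The covariance kernel\<close>

text \<open>The volume of the intersection in \<open>grain_kernel\<close>, written as an integral so
  that joint measurability in \<open>z\<close> and \<open>v\<close> is at hand.\<close>

definition overlap :: "'a::euclidean_space set \<Rightarrow> 'a \<Rightarrow> real \<Rightarrow> ennreal" where
 "overlap C z v = (\<integral>\<^sup>+c. indicator C c * indicator C (c - (v powr (- 1 / real DIM('a))) *\<^sub>R z) \<partial>lborel)"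

text \<open>Extended-real form of \<open>grain_kernel\<close>, infinite where the integral diverges,
  so that Tonelli's theorem can be used before any finiteness is known.\<close>

definition kernel_nn :: "real \<Rightarrow> 'a::euclidean_space set \<Rightarrow> 'a \<Rightarrow> ennreal" where
 "kernel_nn \<gamma> C z = (\<integral>\<^sup>+v. ennreal (indicator {0<..} v * v powr (- \<gamma>)) * overlap C z v \<partial>lborel)"

lemma overlap_measurable:
 fixes C :: "'a::euclidean_space set"
 assumes C[measurable]: "C \<in> sets borel" and [measurable]: "f \<in> borel_measurable M" "g \<in> borel_measurable M"
 shows "(\<lambda>p. overlap C (f p) (g p)) \<in> borel_measurable M"
proof -
 have "(\<lambda>q. indicator C (snd q) * indicator C (snd q - (g (fst q) powr (- 1 / real DIM('a))) *\<^sub>R f (fst q)) :: ennreal)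
   \<in> borel_measurable (M \<Otimes>\<^sub>M lborel)" by measurable
 then show ?thesis
  unfolding overlap_def by (intro lborel.borel_measurable_nn_integral) (simp add: split_beta')
qed

lemma kernel_nn_measurable:
 fixes C :: "'a::euclidean_space set"
 assumes C: "C \<in> sets borel" and f: "f \<in> borel_measurable M"
 shows "(\<lambda>p. kernel_nn b C (f p)) \<in> borel_measurable M"
proof -
 have "(\<lambda>q. ennreal (indicator {0<..} (snd q) * snd q powr (- b)) * overlap C (f (fst q)) (snd q))
   \<in> borel_measurable (M \<Otimes>\<^sub>M lborel)"
  by (intro borel_measurable_times_ennreal overlap_measurable C measurable_compose[OF measurable_fst f]) auto
 then show ?thesis
  unfolding kernel_nn_def by (intro lborel.borel_measurable_nn_integral) (simp add: split_beta')
qed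

lemma overlap_eq_emeasure:
 fixes C :: "'a::euclidean_space set"
 assumes C[measurable]: "C \<in> sets borel"
 shows "overlap C z v = emeasure lborel ((\<lambda>c. (v powr (- 1 / real DIM('a))) *\<^sub>R z + c) ` C \<inter> C)"
proof -
 let ?a = "(v powr (- 1 / real DIM('a))) *\<^sub>R z"
 have eq: "(\<lambda>c. ?a + c) ` C = {c. c - ?a \<in> C}"
 proof (intro set_eqI iffI)
  fix c assume "c \<in> {c. c - ?a \<in> C}"
  then show "c \<in> (\<lambda>c. ?a + c) ` C" by (intro image_eqI[of _ _ "c - ?a"]) auto
 qed auto
 have [measurable]: "{c. c - ?a \<in> C} \<in> sets borel"
 proof -
  have "Measurable.pred borel (\<lambda>c. c - ?a \<in> C)" by measurable
  then show ?thesis by (simp add: pred_def)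
 qed
 have "overlap C z v = (\<integral>\<^sup>+c. indicator ({c. c - ?a \<in> C} \<inter> C) c \<partial>lborel)"
  unfolding overlap_def by (intro nn_integral_cong) (auto simp: indicator_def)
 then show ?thesis unfolding eq by (subst (asm) nn_integral_indicator) auto
qed

text \<open>A divergent integral yields 0 on both sides, as a non-integrable Bochner integral and as
  \<open>enn2real\<close> of infinity.\<close>

lemma grain_kernel_eq:
 fixes C :: "'a::euclidean_space set"
 assumes C: "C \<in> sets borel" and fin: "emeasure lborel C < \<infinity>"
 shows "grain_kernel p C z = enn2real (kernel_nn p C z)"
proof -
 let ?t1 = "(\<integral>\<^sup>+v. ennreal (indicator {0<..} v *\<^sub>R (enn2real (overlap C z v) * v powr (- p))) \<partial>lborel)"
 have f: "overlap C z v < \<infinity>" for v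
 proof -
  have "overlap C z v \<le> emeasure lborel C"
   unfolding overlap_eq_emeasure[OF C] using C by (intro emeasure_mono) auto
  then show ?thesis using fin by simp
 qed
 have eq: "measure lborel ((\<lambda>c. (v powr (- 1 / real DIM('a))) *\<^sub>R z + c) ` C \<inter> C) = enn2real (overlap C z v)" for v
  by (simp add: overlap_eq_emeasure[OF C] measure_def)
 have om[measurable]: "(\<lambda>v. overlap C z v) \<in> borel_measurable lborel"
  by (rule overlap_measurable[OF C]) auto
 have "grain_kernel p C z = (\<integral>v. indicator {0<..} v *\<^sub>R (enn2real (overlap C z v) * v powr (- p)) \<partial>lborel)"
  unfolding grain_kernel_def set_lebesgue_integral_def eq ..
 also have "\<dots> = enn2real ?t1" by (rule integral_eq_nn_integral) auto
 also have "?t1 = kernel_nn p C z" unfolding kernel_nn_def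
 proof (rule nn_integral_cong, goal_cases)
  case (1 v)
  let ?t3 = "(indicator {0<..} v *\<^sub>R (enn2real (overlap C z v) * v powr (- p)))"
  let ?t2 = "(indicator {0<..} v * v powr (- p))"
  have "ennreal ?t3 =
   ennreal (?t2 * enn2real (overlap C z v))" by (simp add: ac_simps)
  also have "\<dots> = ennreal ?t2 * ennreal (enn2real (overlap C z v))" by (rule ennreal_mult) auto
  also have "ennreal (enn2real (overlap C z v)) = overlap C z v" using f[of v] by simp
  finally show ?case .
 qed
 finally show ?thesis .
qed

text \<open>In the coordinate \<open>c\<close> of the point \<open>y\<close> relative to the grain,
  the point \<open>y'\<close> has the coordinate \<open>c - (1 / r) *\<^sub>R (y - y')\<close>; this
  is the shift in \<open>overlap\<close>.\<close>

lemma nn_integral_two_points: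
 fixes C :: "'a::euclidean_space set"
 assumes C[measurable]: "C \<in> sets borel" and v: "v > 0"
 shows "(\<integral>\<^sup>+x. indicator (grain C x v) y * indicator (grain C x v) y' \<partial>lborel) = ennreal v * overlap C (y - y') v" (is "?l1 = _")
proof -
 define r where "r = v powr (1 / real DIM('a))"
 let ?t1 = "(\<integral>\<^sup>+x. indicator (grain C (y + (- r) *\<^sub>R x) v) y * indicator (grain C (y + (- r) *\<^sub>R x) v) y' \<partial>lborel)"
 have r: "r > 0" using v by (simp add: r_def)
 have ir: "v powr (- 1 / real DIM('a)) = 1 / r" using v by (simp add: r_def powr_minus divide_inverse)
 have "?l1 =
  ennreal (\<bar>- r\<bar> ^ DIM('a)) * ?t1"
  by (rule nn_integral_lborel_affine) (use r in \<open>auto intro!: borel_measurable_times_ennreal indicator_grain_measurable\<close>)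
 also have "?t1 = overlap C (y - y') v" unfolding overlap_def ir
 proof (rule nn_integral_cong, goal_cases)
  case (1 c)
  let ?t2 = "(y + (- r) *\<^sub>R c)"
  have v0: "v \<noteq> 0" using v by simp
  have 1: "(1 / r) *\<^sub>R (y - ?t2) = c" using r by simp
  have 2: "(1 / r) *\<^sub>R (y' - ?t2) = c - (1 / r) *\<^sub>R (y - y')" using r by (simp add: algebra_simps)
  show ?case unfolding indicator_def grain_mem_iff[OF v0] r_def[symmetric] 1 2 ..
 qed
 finally show ?thesis using r powr_inverse_DIM[OF v, where 'a='a] by (simp add: r_def)
qed

lemma nn_integral_grain_product:
 fixes C :: "'a::euclidean_space set"
 assumes C: "C \<in> sets borel" and MA: "finite_measure MA" "sets MA = sets borel"
  and MB: "finite_measure MB" "sets MB = sets borel" and v: "v > 0"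
 shows "(\<integral>\<^sup>+x. emeasure MA (grain C x v) * emeasure MB (grain C x v) \<partial>lborel) =
  (\<integral>\<^sup>+y. \<integral>\<^sup>+y'. ennreal v * overlap C (y - y') v \<partial>MB \<partial>MA)"
proof -
 let ?t2 = "(lborel \<Otimes>\<^sub>M MA)"
 interpret MA: finite_measure MA by fact
 interpret MB: finite_measure MB by fact
 interpret P1: pair_sigma_finite lborel MA ..
 interpret P2: pair_sigma_finite lborel MB ..
 note [measurable_cong] = MA(2) MB(2)
 have g[simp]: "grain C x v \<in> sets MA" "grain C x v \<in> sets MB" for x
  using sets_grain[OF C] MA(2) MB(2) by auto
 have "(\<integral>\<^sup>+x. emeasure MA (grain C x v) * emeasure MB (grain C x v) \<partial>lborel) =
  (\<integral>\<^sup>+x. \<integral>\<^sup>+y. \<integral>\<^sup>+y'. indicator (grain C x v) y * indicator (grain C x v) y' \<partial>MB \<partial>MA \<partial>lborel)"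
 proof (rule nn_integral_cong, goal_cases)
  case (1 x)
  let ?t1 = "(\<integral>\<^sup>+y. \<integral>\<^sup>+y'. indicator (grain C x v) y * indicator (grain C x v) y' \<partial>MB \<partial>MA)"
  have "?t1 =
   (\<integral>\<^sup>+y. indicator (grain C x v) y * emeasure MB (grain C x v) \<partial>MA)"
   by (intro nn_integral_cong nn_integral_cmult_indicator g)
  also have "\<dots> = emeasure MA (grain C x v) * emeasure MB (grain C x v)"
   by (subst nn_integral_multc[OF borel_measurable_indicator[OF g(1)]]) (simp add: g)
  finally show ?case ..
 qed
 also have "\<dots> = (\<integral>\<^sup>+y. \<integral>\<^sup>+x. \<integral>\<^sup>+y'. indicator (grain C x v) y * indicator (grain C x v) y' \<partial>MB \<partial>lborel \<partial>MA)"
 proof (rule P1.Fubini'[symmetric])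
  have "(\<lambda>q. indicator (grain C (fst (fst q)) v) (snd (fst q)) * indicator (grain C (fst (fst q)) v) (snd q) :: ennreal)
    \<in> borel_measurable (?t2 \<Otimes>\<^sub>M MB)"
   by (intro borel_measurable_times_ennreal indicator_grain_measurable C) auto
  then have "(\<lambda>p. \<integral>\<^sup>+y'. indicator (grain C (fst p) v) (snd p) * indicator (grain C (fst p) v) y' \<partial>MB)
    \<in> borel_measurable ?t2" by (intro MB.borel_measurable_nn_integral) (simp add: split_beta')
  then show "(\<lambda>(x, y). \<integral>\<^sup>+y'. indicator (grain C x v) y * indicator (grain C x v) y' \<partial>MB)
    \<in> borel_measurable ?t2" by (simp add: split_beta')
 qed
 also have "\<dots> = (\<integral>\<^sup>+y. \<integral>\<^sup>+y'. \<integral>\<^sup>+x. indicator (grain C x v) y * indicator (grain C x v) y' \<partial>lborel \<partial>MB \<partial>MA)"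
 proof (intro nn_integral_cong P2.Fubini'[symmetric], goal_cases)
  case (1 y)
  have "(\<lambda>p. indicator (grain C (fst p) v) y * indicator (grain C (fst p) v) (snd p) :: ennreal)
    \<in> borel_measurable (lborel \<Otimes>\<^sub>M MB)"
   by (intro borel_measurable_times_ennreal indicator_grain_measurable C) auto
  then show ?case by (simp add: split_beta')
 qed
 also have "\<dots> = (\<integral>\<^sup>+y. \<integral>\<^sup>+y'. ennreal v * overlap C (y - y') v \<partial>MB \<partial>MA)"
  by (simp only: nn_integral_two_points[OF C v])
 finally show ?thesis .
qed

text \<open>Integration over the centres produces \<open>v\<close> times the overlap, which turns
  the density \<open>v powr (- b - 1)\<close> into the weight \<open>v powr (- b)\<close> of the
  kernel. The rest is Tonelli's theorem.\<close>

lemma nn_integral_limit_grain_product: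
 fixes C :: "'a::euclidean_space set"
 assumes C: "C \<in> sets borel" and MA: "finite_measure MA" "sets MA = sets borel"
  and MB: "finite_measure MB" "sets MB = sets borel"
 shows "(\<integral>\<^sup>+z. emeasure MA (grain_at C z) * emeasure MB (grain_at C z) \<partial>limit_intensity b) =
  (\<integral>\<^sup>+y. \<integral>\<^sup>+y'. kernel_nn b C (y - y') \<partial>MB \<partial>MA)"
proof -
 interpret MA: finite_measure MA by fact
 interpret MB: finite_measure MB by fact
 define \<nu> where "\<nu> = density lborel (\<lambda>v::real. ennreal (indicator {0<..} v * v powr (- b - 1)))"
 have "sigma_finite_measure \<nu>"
  unfolding \<nu>_def by (subst sigma_finite_measure.sigma_finite_iff_density_finite[OF sigma_finite_lborel]) auto
 then interpret \<nu>: sigma_finite_measure \<nu> .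
 interpret P: pair_sigma_finite lborel \<nu> ..
 interpret P1: pair_sigma_finite lborel MA ..
 interpret P2: pair_sigma_finite lborel MB ..
 have s\<nu>[measurable_cong]: "sets \<nu> = sets borel" by (simp add: \<nu>_def)
 note [measurable_cong] = MA(2) MB(2)
 let ?c = "\<lambda>v::real. ennreal (indicator {0<..} v * v powr (- b))"
 have m: "(\<lambda>z. emeasure MA (grain_at C z) * emeasure MB (grain_at C z)) \<in> borel_measurable (lborel \<Otimes>\<^sub>M \<nu>)"
  by (intro borel_measurable_times_ennreal emeasure_grain_measurable C MA MB) auto
 let ?f = "\<lambda>z. emeasure MA (grain_at C z) * emeasure MB (grain_at C z)"
 have "(\<integral>\<^sup>+z. ?f z \<partial>limit_intensity b) = (\<integral>\<^sup>+v. \<integral>\<^sup>+x. ?f (x, v) \<partial>lborel \<partial>\<nu>)"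
  unfolding limit_intensity_def \<nu>_def[symmetric]
  by (rule P.nn_integral_snd[symmetric]) (use m in \<open>simp add: split_beta'\<close>)
 also have "\<dots> = (\<integral>\<^sup>+v. \<integral>\<^sup>+x. emeasure MA (grain C x v) * emeasure MB (grain C x v) \<partial>lborel \<partial>\<nu>)"
  by simp
 also have "\<dots> = (\<integral>\<^sup>+v. ennreal (indicator {0<..} v * v powr (- b - 1)) * (\<integral>\<^sup>+x. emeasure MA (grain C x v) * emeasure MB (grain C x v) \<partial>lborel) \<partial>lborel)"
  unfolding \<nu>_def
 proof (rule nn_integral_density)
  have "(\<lambda>q. emeasure MA (grain C (snd q) (fst q)) * emeasure MB (grain C (snd q) (fst q))) \<in> borel_measurable lborel2"
   by (intro borel_measurable_times_ennreal emeasure_grain_measurable C MA MB) auto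
  then show "(\<lambda>v. \<integral>\<^sup>+x. emeasure MA (grain C x v) * emeasure MB (grain C x v) \<partial>lborel) \<in> borel_measurable lborel"
   by (intro lborel.borel_measurable_nn_integral) (simp add: split_beta')
 qed auto
 also have "\<dots> = (\<integral>\<^sup>+v. \<integral>\<^sup>+y. \<integral>\<^sup>+y'. ?c v * overlap C (y - y') v \<partial>MB \<partial>MA \<partial>lborel)"
 proof (rule nn_integral_cong, goal_cases)
  case (1 v)
  let ?t2 = "(v powr (- b - 1))"
  let ?t1 = "(\<integral>\<^sup>+x. emeasure MA (grain C x v) * emeasure MB (grain C x v) \<partial>lborel)"
  have om: "(\<lambda>y'. overlap C (y - y') v) \<in> borel_measurable MB" for y
   by (intro overlap_measurable C) auto
  have om2: "(\<lambda>y. \<integral>\<^sup>+y'. ennreal v * overlap C (y - y') v \<partial>MB) \<in> borel_measurable MA"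
  proof -
   have "(\<lambda>q. ennreal v * overlap C (fst q - snd q) v) \<in> borel_measurable (MA \<Otimes>\<^sub>M MB)"
    by (intro borel_measurable_times_ennreal overlap_measurable C) auto
   then show ?thesis by (intro MB.borel_measurable_nn_integral) (simp add: split_beta')
  qed
  show ?case
  proof (cases "v > 0")
   case True
   have "v powr (- b - 1) * v = v powr (- b)" using powr_add[of v "- b - 1" 1] True by simp
   then have e: "ennreal ?t2 * ennreal v = ennreal (v powr (- b))" using True by (simp flip: ennreal_mult)
   have "ennreal (indicator {0<..} v * v powr (- b - 1)) * ?t1 =
    ennreal ?t2 * (\<integral>\<^sup>+y. \<integral>\<^sup>+y'. ennreal v * overlap C (y - y') v \<partial>MB \<partial>MA)"
    using True by (simp add: nn_integral_grain_product[OF C MA MB True])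
   also have "\<dots> = (\<integral>\<^sup>+y. ennreal ?t2 * (\<integral>\<^sup>+y'. ennreal v * overlap C (y - y') v \<partial>MB) \<partial>MA)"
    by (rule nn_integral_cmult[symmetric, OF om2])
   also have "\<dots> = (\<integral>\<^sup>+y. \<integral>\<^sup>+y'. ennreal ?t2 * (ennreal v * overlap C (y - y') v) \<partial>MB \<partial>MA)"
    by (intro nn_integral_cong nn_integral_cmult[symmetric] borel_measurable_times_ennreal om) auto
   also have "\<dots> = (\<integral>\<^sup>+y. \<integral>\<^sup>+y'. ?c v * overlap C (y - y') v \<partial>MB \<partial>MA)"
    unfolding mult.assoc[symmetric] e using True by simp
   finally show ?thesis .
  qed simp
 qed
 also have "\<dots> = (\<integral>\<^sup>+y. \<integral>\<^sup>+v. \<integral>\<^sup>+y'. ?c v * overlap C (y - y') v \<partial>MB \<partial>lborel \<partial>MA)"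
 proof -
  have "(\<lambda>q. ?c (fst (fst q)) * overlap C (snd (fst q) - snd q) (fst (fst q))) \<in> borel_measurable ((lborel \<Otimes>\<^sub>M MA) \<Otimes>\<^sub>M MB)"
   by (intro borel_measurable_times_ennreal overlap_measurable C) measurable
  then have "(\<lambda>p. \<integral>\<^sup>+y'. ?c (fst p) * overlap C (snd p - y') (fst p) \<partial>MB) \<in> borel_measurable (lborel \<Otimes>\<^sub>M MA)"
   by (intro MB.borel_measurable_nn_integral) (simp add: split_beta')
  then show ?thesis by (intro P1.Fubini'[symmetric]) (simp add: split_beta')
 qed
 also have "\<dots> = (\<integral>\<^sup>+y. \<integral>\<^sup>+y'. \<integral>\<^sup>+v. ?c v * overlap C (y - y') v \<partial>lborel \<partial>MB \<partial>MA)"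
 proof (rule nn_integral_cong, goal_cases)
  case (1 y)
  have "(\<lambda>p. ?c (fst p) * overlap C (y - snd p) (fst p)) \<in> borel_measurable (lborel \<Otimes>\<^sub>M MB)"
   by (intro borel_measurable_times_ennreal overlap_measurable C) measurable
  then show ?case by (intro P2.Fubini'[symmetric]) (simp add: split_beta')
 qed
 finally show ?thesis by (simp add: kernel_nn_def)
qed

text \<open>Integrability of the grain products makes the extended kernel finite for almost every
  pair of points, so the real kernel has the same integral and Fubini's theorem applies to
  it.\<close>

lemma
 fixes C :: "'a::euclidean_space set"
 assumes C: "C \<in> sets borel" "emeasure lborel C < \<infinity>" and MA: "finite_measure MA" "sets MA = sets borel"
  and MB: "finite_measure MB" "sets MB = sets borel"
  and fin: "integrable (limit_intensity b) (\<lambda>z. measure MA (grain_at C z) * measure MB (grain_at C z))"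
 shows integrable_integral_grain_kernel: "integrable MA (\<lambda>y. \<integral>y'. grain_kernel b C (y - y') \<partial>MB)"
  and integral_grain_kernel: "(\<integral>y. \<integral>y'. grain_kernel b C (y - y') \<partial>MB \<partial>MA) =
   (\<integral>z. measure MA (grain_at C z) * measure MB (grain_at C z) \<partial>limit_intensity b)"
proof -
 let ?t1 = "(MA \<Otimes>\<^sub>M MB)"
 interpret MA: finite_measure MA by fact
 interpret MB: finite_measure MB by fact
 interpret P: pair_sigma_finite MA MB ..
 note [measurable_cong] = MA(2) MB(2)
 let ?f = "\<lambda>z. measure MA (grain_at C z) * measure MB (grain_at C z)"
 have ef: "ennreal (?f z) = emeasure MA (grain_at C z) * emeasure MB (grain_at C z)" for z
  by (simp add: MA.emeasure_eq_measure MB.emeasure_eq_measure ennreal_mult)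
 have km: "(\<lambda>p. kernel_nn b C (fst p - snd p)) \<in> borel_measurable ?t1"
  by (intro kernel_nn_measurable C) auto
 have nn: "(\<integral>\<^sup>+p. kernel_nn b C (fst p - snd p) \<partial>?t1) = ennreal (\<integral>z. ?f z \<partial>limit_intensity b)" (is "?l1 = ?r1")
 proof -
  have "?l1 = (\<integral>\<^sup>+y. \<integral>\<^sup>+y'. kernel_nn b C (y - y') \<partial>MB \<partial>MA)"
   using MB.nn_integral_fst[OF km] by simp
  also have "\<dots> = (\<integral>\<^sup>+z. ennreal (?f z) \<partial>limit_intensity b)"
   unfolding ef by (rule nn_integral_limit_grain_product[OF C(1) MA MB, symmetric])
  also have "\<dots> = ?r1" by (rule nn_integral_eq_integral[OF fin]) auto
  finally show ?thesis .
 qed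
 have AEfin: "AE p in MA \<Otimes>\<^sub>M MB. kernel_nn b C (fst p - snd p) \<noteq> \<infinity>"
  by (rule nn_integral_PInf_AE[OF km]) (simp add: nn)
 let ?K = "\<lambda>p. grain_kernel b C (fst p - snd p)"
 have Km: "?K \<in> borel_measurable ?t1" unfolding grain_kernel_eq[OF C] using km by measurable
 have "(\<integral>\<^sup>+p. ennreal (?K p) \<partial>?t1) = (\<integral>\<^sup>+p. kernel_nn b C (fst p - snd p) \<partial>?t1)"
  unfolding grain_kernel_eq[OF C]
  by (intro nn_integral_cong_AE) (use AEfin in eventually_elim, simp add: less_top)
 then have e: "(\<integral>\<^sup>+p. ennreal (?K p) \<partial>?t1) = ennreal (\<integral>z. ?f z \<partial>limit_intensity b)"
  using nn by simp
 have K0: "?K p \<ge> 0" for p by (simp add: grain_kernel_eq[OF C])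
 let ?t2 = "(\<integral>y. \<integral>y'. grain_kernel b C (y - y') \<partial>MB \<partial>MA)"
 have i: "integrable ?t1 ?K" by (rule integrableI_nonneg) (use Km K0 e in auto)
 then have i': "integrable ?t1 (\<lambda>(y, y'). grain_kernel b C (y - y'))" by (simp add: split_beta')
 show "integrable MA (\<lambda>y. \<integral>y'. grain_kernel b C (y - y') \<partial>MB)"
  using P.integrable_fst[OF i'] .
 have "?t2 = (\<integral>p. ?K p \<partial>?t1)" using P.integral_fst[OF i'] by (simp add: split_beta')
 also have "\<dots> = enn2real (\<integral>\<^sup>+p. ennreal (?K p) \<partial>?t1)"
  using Km K0 by (intro integral_eq_nn_integral) auto
 also have "\<dots> = (\<integral>z. ?f z \<partial>limit_intensity b)"
  unfolding e by (simp add: integral_nonneg_AE)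
 finally show "?t2 = (\<integral>z. ?f z \<partial>limit_intensity b)" .
qed

section \<open>Gaussian laws and comparison of energy spaces\<close>

lemma centered_gaussian_char:
 assumes P: "prob_space P" and X: "centered_gaussian_rv P X"
 shows "integrable P (\<lambda>w. (X w)\<^sup>2)"
  and "(CLINT w|P. iexp (X w)) = exp (complex_of_real (- (\<integral>w. (X w)\<^sup>2 \<partial>P) / 2))"
proof -
 let ?t1 = "(\<lambda>w. (X w)\<^sup>2)"
 interpret prob_space P by fact
 have Xm[measurable]: "X \<in> borel_measurable P" using X by (simp add: centered_gaussian_rv_def)
 have "(AE w in P. X w = 0) \<or> (\<exists>s>0. distributed P lborel X (normal_density 0 s))"
  using X by (simp add: centered_gaussian_rv_def)
 then have "integrable P ?t1 \<and>
  (CLINT w|P. iexp (X w)) = exp (complex_of_real (- (\<integral>w. (X w)\<^sup>2 \<partial>P) / 2))"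
 proof
  assume ae: "AE w in P. X w = 0"
  have "integrable P ?t1 \<longleftrightarrow> integrable P (\<lambda>w. 0 :: real)"
   using ae by (intro integrable_cong_AE) auto
  moreover have "(\<integral>w. (X w)\<^sup>2 \<partial>P) = (\<integral>w. 0 \<partial>P)"
   using ae by (intro integral_cong_AE) auto
  moreover have "(CLINT w|P. iexp (X w)) = (CLINT w|P. 1)" using ae by (intro integral_cong_AE) auto
  ultimately show ?thesis by (simp add: prob_space)
 next
  assume "\<exists>s>0. distributed P lborel X (normal_density 0 s)"
  then obtain s where s: "s > 0" and d: "distributed P lborel X (normal_density 0 s)" by blast
  have "integrable lborel (\<lambda>x. normal_density 0 s x * x\<^sup>2)"
   using integrable_normal_moment[OF s, of 0 2] by simp
  then have i: "integrable P ?t1" using distributed_integrable[OF d, of "\<lambda>x. x\<^sup>2"] by simp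
  have "(\<integral>w. (X w)\<^sup>2 \<partial>P) = (\<integral>x. normal_density 0 s x * x\<^sup>2 \<partial>lborel)"
   using distributed_integral[OF d, of "\<lambda>x. x\<^sup>2"] by simp
  also have "\<dots> = s\<^sup>2" using integral_normal_moment_even[OF s, of 0 1] s by simp
  finally have v: "(\<integral>w. (X w)\<^sup>2 \<partial>P) = s\<^sup>2" .
  have dY: "distributed P lborel (\<lambda>w. (X w - 0) / s) std_normal_density"
   using normal_standard_normal_convert[OF s, of X 0] d by blast
  have Y: "distr P lborel (\<lambda>w. X w / s) = std_normal_distribution"
   using distributed_distr_eq_density[OF dY] by simp
  have "(CLINT w|P. iexp (X w)) = (CLINT w|P. iexp (s * (X w / s)))" using s by simp
  also have "\<dots> = (CLINT x|distr P lborel (\<lambda>w. X w / s). iexp (s * x))"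
   by (subst integral_distr) auto
  also have "\<dots> = char std_normal_distribution s" unfolding Y char_def ..
  also have "\<dots> = complex_of_real (exp (- (s\<^sup>2) / 2))" by (simp add: char_std_normal_distribution)
  finally show ?thesis unfolding v exp_of_real using i by simp
 qed
 then show "integrable P ?t1"
  "(CLINT w|P. iexp (X w)) = exp (complex_of_real (- (\<integral>w. (X w)\<^sup>2 \<partial>P) / 2))" by blast+
qed

text \<open>Lowering the exponent can increase the kernel only at distances above 1, and there the
  kernel is at most 1; the extra term is the square of the total mass.\<close>

lemma Malpha_mono:
 fixes \<phi> :: "'a::euclidean_space set \<Rightarrow> real"
 assumes \<phi>: "\<phi> \<in> Malpha \<alpha>" and \<alpha>: "\<alpha> \<le> \<beta>" "\<beta> < 1"
 shows "\<phi> \<in> Malpha \<beta>"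
proof -
 let ?t1 = "(total_variation \<phi>)"
 note \<phi>1 = Malpha_M1[OF \<phi>]
 interpret T: finite_measure "total_variation \<phi>" by (rule finite_measure_total_variation[OF \<phi>1])
 define a b where "a = (1 - \<alpha>) * real DIM('a)" and "b = (1 - \<beta>) * real DIM('a)"
 have ab: "0 < b" "b \<le> a" using \<alpha> by (auto simp: a_def b_def intro!: mult_right_mono)
 have le: "1 / ennreal (r powr b) \<le> 1 / ennreal (r powr a) + 1" if "r \<ge> 0" for r
 proof (cases "r = 0")
  case True
  then show ?thesis using ab by simp
 next
  case False
  have eq: "1 / ennreal (r powr e) = ennreal (1 / r powr e)" for e
   using divide_ennreal[of 1 "r powr e"] False by simp
  have "1 / r powr b \<le> 1 / r powr a + 1"
  proof (cases "r \<le> 1")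
   case True
   have "r powr a \<le> r powr b" using True that False ab by (intro powr_mono') auto
   then have "1 / r powr b \<le> 1 / r powr a" using False by (intro divide_left_mono) auto
   then show ?thesis by simp
  next
   case False
   have "1 \<le> r powr b" using False ab by (intro ge_one_powr_ge_zero) auto
   then have "1 / r powr b \<le> 1 / 1" by (intro divide_left_mono) auto
   then have "1 / r powr b \<le> 1" by simp
   moreover have "0 \<le> 1 / r powr a" by simp
   ultimately show ?thesis by linarith
  qed
  then have "ennreal (1 / r powr b) \<le> ennreal (1 / r powr a + 1)" by (rule ennreal_leI)
  also have "\<dots> = ennreal (1 / r powr a) + 1" by (simp add: ennreal_plus flip: ennreal_1 del: ennreal_plus[symmetric])
  finally show ?thesis by (simp only: eq)
 qed
 have m: "(\<lambda>y. 1 / ennreal (norm (x - y) powr a)) \<in> borel_measurable ?t1" for x :: 'a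
  by measurable
 have m2: "(\<lambda>x. \<integral>\<^sup>+y. 1 / ennreal (norm (x - y) powr a) \<partial>total_variation \<phi>) \<in> borel_measurable ?t1"
  by (rule T.borel_measurable_nn_integral) measurable
 have "(\<integral>\<^sup>+x. \<integral>\<^sup>+y. 1 / ennreal (norm (x - y) powr b) \<partial>total_variation \<phi> \<partial>total_variation \<phi>) \<le>
  (\<integral>\<^sup>+x. \<integral>\<^sup>+y. 1 / ennreal (norm (x - y) powr a) + 1 \<partial>total_variation \<phi> \<partial>total_variation \<phi>)"
  by (intro nn_integral_mono le) simp
 also have "\<dots> = (\<integral>\<^sup>+x. (\<integral>\<^sup>+y. 1 / ennreal (norm (x - y) powr a) \<partial>total_variation \<phi>) + emeasure ?t1 UNIV \<partial>total_variation \<phi>)"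
  by (intro nn_integral_cong) (subst nn_integral_add[OF m], simp_all)
 also have "\<dots> = (\<integral>\<^sup>+x. \<integral>\<^sup>+y. 1 / ennreal (norm (x - y) powr a) \<partial>total_variation \<phi> \<partial>total_variation \<phi>) +
   emeasure ?t1 UNIV * emeasure ?t1 UNIV" by (subst nn_integral_add[OF m2]) simp_all
 also have "\<dots> < \<infinity>"
 proof -
  have "emeasure ?t1 UNIV * emeasure ?t1 UNIV < \<infinity>"
   by (simp add: ennreal_mult_eq_top_iff less_top[symmetric])
  then show ?thesis using \<phi> by (simp add: Malpha_def a_def)
 qed
 finally show ?thesis using \<phi>1 by (simp add: Malpha_def b_def)
qed

lemma integrable_product:
 fixes f g :: "'z \<Rightarrow> real"
 assumes [measurable]: "f \<in> borel_measurable M" "g \<in> borel_measurable M"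
  and i: "integrable M (\<lambda>z. (f z)\<^sup>2)" "integrable M (\<lambda>z. (g z)\<^sup>2)"
 shows "integrable M (\<lambda>z. f z * g z)"
proof (rule Bochner_Integration.integrable_bound[of _ "\<lambda>z. (f z)\<^sup>2 + (g z)\<^sup>2"])
 show "AE z in M. norm (f z * g z) \<le> norm ((f z)\<^sup>2 + (g z)\<^sup>2)"
 proof (rule AE_I2, goal_cases)
  case (1 z)
  have "2 * (\<bar>f z\<bar> * \<bar>g z\<bar>) \<le> (f z)\<^sup>2 + (g z)\<^sup>2"
   using sum_squares_bound[of "\<bar>f z\<bar>" "\<bar>g z\<bar>"] by simp
  moreover have "0 \<le> \<bar>f z\<bar> * \<bar>g z\<bar>" by simp
  ultimately have "\<bar>f z\<bar> * \<bar>g z\<bar> \<le> (f z)\<^sup>2 + (g z)\<^sup>2" by linarith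
  then show ?case by (simp add: abs_mult)
 qed
qed (use i in auto)

lemma integral_square_sum:
 fixes f :: "nat \<Rightarrow> 'z \<Rightarrow> real"
 assumes "\<And>j k. j < n \<Longrightarrow> k < n \<Longrightarrow> integrable M (\<lambda>z. f j z * f k z)"
 shows "(\<integral>z. (\<Sum>k<n. t k * f k z)\<^sup>2 \<partial>M) = (\<Sum>j<n. \<Sum>k<n. t j * t k * (\<integral>z. f j z * f k z \<partial>M))" (is "?l1 = _")
proof -
 have "(\<Sum>k<n. t k * f k z)\<^sup>2 = (\<Sum>j<n. \<Sum>k<n. t j * t k * (f j z * f k z))" for z
  by (simp add: power2_eq_square sum_product ac_simps)
 then have "?l1 = (\<integral>z. (\<Sum>j<n. \<Sum>k<n. t j * t k * (f j z * f k z)) \<partial>M)" by simp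
 also have "\<dots> = (\<Sum>j<n. \<integral>z. (\<Sum>k<n. t j * t k * (f j z * f k z)) \<partial>M)"
  using assms by (intro Bochner_Integration.integral_sum Bochner_Integration.integrable_sum integrable_mult_right) auto
 also have "\<dots> = (\<Sum>j<n. \<Sum>k<n. \<integral>z. t j * t k * (f j z * f k z) \<partial>M)"
  using assms by (intro sum.cong refl Bochner_Integration.integral_sum integrable_mult_right) auto
 finally show ?thesis by simp
qed

section \<open>The covariance of \<open>W\<close> as a second moment\<close>

context grain_model
begin

lemma delta_exists:
 assumes "a < 2 - \<gamma>"
 obtains d where "0 < d" "1 < \<gamma> - d" "\<gamma> + d < 2 - a" "d < \<gamma>"
proof
 let ?d = "min ((\<gamma> - 1) / 2) ((2 - a - \<gamma>) / 2)"
 show "0 < ?d" "1 < \<gamma> - ?d" "\<gamma> + ?d < 2 - a" "?d < \<gamma>"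
  using assms \<gamma>_gt_1 by (auto simp: min_def field_simps)
qed

text \<open>Applied to total variations, this makes the products of their grain masses integrable
  over the limit intensity, and these dominate the products of the Jordan components.\<close>

lemma dominated_measure:
 assumes M: "finite_measure M" "sets M = sets borel" and e: "energy \<alpha> M < \<infinity>"
  and d: "0 < d" "1 < \<gamma> - d" "\<gamma> + d < 2 - \<alpha>"
 shows "dominated d (\<lambda>A. measure M A)" unfolding dominated_def
proof (intro conjI allI impI)
 interpret M: finite_measure M by fact
 show "(\<lambda>z. measure M (grain_at C z)) \<in> borel_measurable borel2"
  by (intro measure_grain_measurable M) auto
 fix A :: real assume A: "A > 0"
 show "\<exists>D. integrable lborel2 D \<and>
    (\<forall>x s w. 0 < s \<longrightarrow> 0 < w \<longrightarrow> w \<le> majorant A d s \<longrightarrow> (measure M (grain C x w))\<^sup>2 \<le> D (x, s))"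
 proof (intro exI conjI allI impI)
  show "integrable lborel2 (\<lambda>p. indicator {0<..} (snd p) *
   (measure M (grain (cball 0 R) (fst p) (majorant A d (snd p))))\<^sup>2)"
   by (rule integrable_ball_grain_square[OF M e A d])
  fix x :: 'a and s w :: real assume s: "0 < s" and w: "0 < w" "w \<le> majorant A d s"
  have "measure M (grain C x w) \<le> measure M (grain (cball 0 R) x (majorant A d s))"
   using grain_subset_ball_grain[OF C_subset w] R_pos M(2)
   by (intro M.finite_measure_mono) (auto intro!: sets_grain)
  then have "(measure M (grain C x w))\<^sup>2 \<le> (measure M (grain (cball 0 R) x (majorant A d s)))\<^sup>2"
   by (intro power_mono) auto
  then show "(measure M (grain C x w))\<^sup>2 \<le> indicator {0<..} (snd (x, s)) *
   (measure M (grain (cball 0 R) (fst (x, s)) (majorant A d (snd (x, s)))))\<^sup>2" using s by simp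
 qed
next
 show "AE p in lborel \<Otimes>\<^sub>M lborel. 0 < snd p \<longrightarrow>
    (\<forall>v. v \<longlonglongrightarrow> snd p powr (- 1 / \<gamma>) \<longrightarrow>
     (\<lambda>m::nat. measure M (grain C (fst p) (v m))) \<longlonglongrightarrow> measure M (grain C (fst p) (snd p powr (- 1 / \<gamma>))))"
  using AE_frontier[OF M]
 proof eventually_elim
  case (elim p)
  show ?case by (intro impI allI measure_grain_tendsto M) (use elim in auto)
 qed
qed

lemma limit_grain_measurable:
 assumes "dominated d f"
 shows "(\<lambda>z. f (grain_at C z)) \<in> borel_measurable (limit_intensity \<gamma>)"
 using assms measurable_cong_sets[OF sets_limit_intensity refl] unfolding dominated_def by blast

text \<open>Expanding both signed integrals gives four pairs of positive Jordan components. Each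
  pair is handled by \<open>integral_grain_kernel\<close>, and all four products of grain masses are
  dominated by that of the total variations.\<close>

lemma covariance_eq:
 assumes \<phi>: "\<phi> \<in> Malpha \<alpha>" and \<psi>: "\<psi> \<in> Malpha \<alpha>" and \<alpha>: "\<alpha> < 2 - \<gamma>"
 shows "signed_integral \<phi> (\<lambda>x. signed_integral \<psi> (\<lambda>y. grain_kernel \<gamma> C (x - y))) =
  (\<integral>z. \<phi> (grain_at C z) * \<psi> (grain_at C z) \<partial>limit_intensity \<gamma>)"
proof -
 let ?t23 = "(jordan_neg \<psi>)"
 let ?t22 = "(jordan_pos \<psi>)"
 let ?t21 = "(jordan_neg \<phi>)"
 let ?t20 = "(jordan_pos \<phi>)"
 let ?t2 = "(total_variation \<psi>)"
 let ?t1 = "(total_variation \<phi>)"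
 obtain \<delta> where \<delta>: "0 < \<delta>" "1 < \<gamma> - \<delta>" "\<gamma> + \<delta> < 2 - \<alpha>" "\<delta> < \<gamma>" using delta_exists[OF \<alpha>] .
 note \<phi>1 = Malpha_M1[OF \<phi>] and \<psi>1 = Malpha_M1[OF \<psi>]
 let ?g = "\<lambda>z::'a \<times> real. grain_at C z"
 have d: "dominated \<delta> (\<lambda>A. measure (total_variation \<xi>) A)" if "\<xi> \<in> Malpha \<alpha>" for \<xi>
  by (intro dominated_measure[OF _ _ energy_total_variation[OF that]] finite_measure_total_variation Malpha_M1[OF that] \<delta>) auto
 have tv: "integrable (limit_intensity \<gamma>) (\<lambda>z. measure ?t1 (?g z) * measure ?t2 (?g z))"
  by (intro integrable_product limit_grain_measurable[OF d[OF \<phi>]] limit_grain_measurable[OF d[OF \<psi>]]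
   dominated_square_integrable[OF d[OF \<phi>] \<delta>(1,4)] dominated_square_integrable[OF d[OF \<psi>] \<delta>(1,4)])
 have le: "measure (jordan_pos \<xi>) A \<le> measure (total_variation \<xi>) A" "measure (jordan_neg \<xi>) A \<le> measure (total_variation \<xi>) A"
  if "\<xi> \<in> M1" "A \<in> sets borel" for \<xi> :: "'a set \<Rightarrow> real" and A
 proof -
  interpret T: finite_measure "total_variation \<xi>" by (rule finite_measure_total_variation[OF that(1)])
  show "measure (jordan_pos \<xi>) A \<le> measure (total_variation \<xi>) A" "measure (jordan_neg \<xi>) A \<le> measure (total_variation \<xi>) A"
   using emeasure_total_variation[OF that(2), of \<xi>] T.emeasure_finite[of A]
   unfolding measure_def by (auto intro!: enn2real_mono simp: less_top[symmetric])
 qed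
 have fin: "integrable (limit_intensity \<gamma>) (\<lambda>z. measure MA (?g z) * measure MB (?g z))"
  if MA: "MA \<in> {jordan_pos \<phi>, jordan_neg \<phi>}" and MB: "MB \<in> {jordan_pos \<psi>, jordan_neg \<psi>}" for MA MB
 proof (rule Bochner_Integration.integrable_bound[OF tv])
  have fm: "finite_measure MA" "finite_measure MB" "sets MA = sets borel" "sets MB = sets borel"
   using MA MB finite_measure_jordan_pos[OF \<phi>1] finite_measure_jordan_neg[OF \<phi>1]
    finite_measure_jordan_pos[OF \<psi>1] finite_measure_jordan_neg[OF \<psi>1] by auto
  have "(\<lambda>z. measure MA (?g z) * measure MB (?g z)) \<in> borel_measurable borel2"
   by (intro borel_measurable_times measure_grain_measurable fm) auto
  then show "(\<lambda>z. measure MA (?g z) * measure MB (?g z)) \<in> borel_measurable (limit_intensity \<gamma>)"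
   using measurable_cong_sets[OF sets_limit_intensity refl] by blast
  show "AE z in limit_intensity \<gamma>. norm (measure MA (?g z) * measure MB (?g z)) \<le>
   norm (measure ?t1 (?g z) * measure ?t2 (?g z))"
  proof (rule AE_I2, goal_cases)
   case (1 z)
   have "measure MA (?g z) \<le> measure ?t1 (?g z)" "measure MB (?g z) \<le> measure ?t2 (?g z)"
    using MA MB le[OF \<phi>1 sets_grain[OF C_borel]] le[OF \<psi>1 sets_grain[OF C_borel]] by auto
   then show ?case by (simp add: mult_mono)
  qed
 qed
 have Cfin: "emeasure lborel C < \<infinity>" by (simp add: C_volume)
 have fm: "finite_measure ?t20" "finite_measure ?t21" "finite_measure ?t22" "finite_measure ?t23"
  using finite_measure_jordan_pos[OF \<phi>1] finite_measure_jordan_neg[OF \<phi>1]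
   finite_measure_jordan_pos[OF \<psi>1] finite_measure_jordan_neg[OF \<psi>1] by auto
 let ?I = "\<lambda>MA MB. \<integral>z. measure MA (?g z) * measure MB (?g z) \<partial>limit_intensity \<gamma>"
 have ik: "integrable MA (\<lambda>y. \<integral>y'. grain_kernel \<gamma> C (y - y') \<partial>MB)"
  and kk: "(\<integral>y. \<integral>y'. grain_kernel \<gamma> C (y - y') \<partial>MB \<partial>MA) = ?I MA MB"
  if "MA \<in> {jordan_pos \<phi>, jordan_neg \<phi>}" "MB \<in> {jordan_pos \<psi>, jordan_neg \<psi>}" for MA MB
 proof -
  have f: "finite_measure MA" "sets MA = sets borel" "finite_measure MB" "sets MB = sets borel"
   using that fm by auto
  show "integrable MA (\<lambda>y. \<integral>y'. grain_kernel \<gamma> C (y - y') \<partial>MB)"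
   by (rule integrable_integral_grain_kernel[OF C_borel Cfin f fin[OF that]])
  show "(\<integral>y. \<integral>y'. grain_kernel \<gamma> C (y - y') \<partial>MB \<partial>MA) = ?I MA MB"
   by (rule integral_grain_kernel[OF C_borel Cfin f fin[OF that]])
 qed
 have "signed_integral \<phi> (\<lambda>x. signed_integral \<psi> (\<lambda>y. grain_kernel \<gamma> C (x - y))) =
  (?I ?t20 ?t22 - ?I ?t20 ?t23) -
  (?I ?t21 ?t22 - ?I ?t21 ?t23)" unfolding signed_integral_def by (simp add: ik kk)
 also have "\<dots> = (\<integral>z. (measure ?t20 (?g z) * measure ?t22 (?g z) - measure ?t20 (?g z) * measure ?t23 (?g z)) -
  (measure ?t21 (?g z) * measure ?t22 (?g z) - measure ?t21 (?g z) * measure ?t23 (?g z)) \<partial>limit_intensity \<gamma>)"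
  by (simp add: fin)
 also have "\<dots> = (\<integral>z. \<phi> (?g z) * \<psi> (?g z) \<partial>limit_intensity \<gamma>)"
  by (intro Bochner_Integration.integral_cong refl)
   (simp add: jordan_decomposition[OF \<phi>1 sets_grain[OF C_borel]] jordan_decomposition[OF \<psi>1 sets_grain[OF C_borel]] algebra_simps)
 finally show ?thesis .
qed

text \<open>A centered Gaussian law is determined by its variance. The double sum of covariances
  collapses to the second moment of the combined set function under the limit intensity, which is
  the form taken by the limit of the exponents.\<close>

lemma char_W:
 fixes \<phi> :: "nat \<Rightarrow> 'a set \<Rightarrow> real"
 assumes W: "is_W \<gamma> C PW W" and \<phi>: "\<And>k. k < n \<Longrightarrow> \<phi> k \<in> Malpha \<alpha>" and \<alpha>: "\<alpha> < 2 - \<gamma>"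
 shows "(CLINT w|PW. iexp (\<Sum>k<n. t k * W (\<phi> k) w)) =
  exp (complex_of_real (- (\<integral>z. (\<Sum>k<n. t k * \<phi> k (grain_at C z))\<^sup>2 \<partial>limit_intensity \<gamma>) / 2))"
proof -
 obtain d where d: "0 < d" "1 < \<gamma> - d" "\<gamma> + d < 2 - \<alpha>" "d < \<gamma>" using delta_exists[OF \<alpha>] .
 have \<phi>': "\<phi> k \<in> Malpha (2 - \<gamma>)" if "k < n" for k
  by (rule Malpha_mono[OF \<phi>[OF that]]) (use \<alpha> \<gamma>_gt_1 in auto)
 have gf: "centered_gaussian_functional PW (Malpha (2 - \<gamma>)) W"
  using W unfolding is_W_def by (rule conjunct1)
 have rl: "random_linear_functional PW (Malpha (2 - \<gamma>)) W"
  using gf unfolding centered_gaussian_functional_def by (rule conjunct1)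
 have P: "prob_space PW" using rl unfolding random_linear_functional_def by (rule conjunct1)
 have "\<forall>t\<in>Malpha (2 - \<gamma>). W t \<in> borel_measurable PW"
  using rl unfolding random_linear_functional_def by (elim conjE)
 then have Wm: "W (\<phi> k) \<in> borel_measurable PW" if "k < n" for k
  using \<phi>'[OF that] by (rule bspec)
 have cov: "\<forall>\<phi>\<in>Malpha (2 - \<gamma>). \<forall>\<psi>\<in>Malpha (2 - \<gamma>). (\<integral>w. W \<phi> w * W \<psi> w \<partial>PW) =
   signed_integral \<phi> (\<lambda>x. signed_integral \<psi> (\<lambda>y. grain_kernel \<gamma> C (x - y)))"
  using W unfolding is_W_def by (rule conjunct2)
 have gf': "\<forall>(n::nat) (c :: nat \<Rightarrow> real) t. (\<forall>k<n. t k \<in> Malpha (2 - \<gamma>)) \<longrightarrow>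
   centered_gaussian_rv PW (\<lambda>w. \<Sum>k<n. c k * W (t k) w)"
  using gf unfolding centered_gaussian_functional_def by (rule conjunct2)
 have g: "centered_gaussian_rv PW (\<lambda>w. \<Sum>k<n. t k * W (\<phi> k) w)"
  by (rule gf'[rule_format]) (rule \<phi>')
 have g1: "integrable PW (\<lambda>w. (W (\<phi> k) w)\<^sup>2)" if "k < n" for k
 proof -
  have "centered_gaussian_rv PW (\<lambda>w. W (\<phi> k) w)"
   using gf'[rule_format, of 1 "\<lambda>_. \<phi> k" "\<lambda>_. 1"] \<phi>'[OF that] by simp
  from centered_gaussian_char(1)[OF P this] show ?thesis .
 qed
 have dk: "dominated d (\<phi> k)" if "k < n" for k by (rule dominated_Malpha[OF \<phi>[OF that] d(1-3)])
 have "(\<integral>w. (\<Sum>k<n. t k * W (\<phi> k) w)\<^sup>2 \<partial>PW) = (\<Sum>j<n. \<Sum>k<n. t j * t k * (\<integral>w. W (\<phi> j) w * W (\<phi> k) w \<partial>PW))"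
  by (intro integral_square_sum integrable_product Wm g1)
 also have "\<dots> = (\<Sum>j<n. \<Sum>k<n. t j * t k * (\<integral>z. \<phi> j (grain_at C z) * \<phi> k (grain_at C z) \<partial>limit_intensity \<gamma>))"
 proof (intro sum.cong refl)
  fix j k assume "j \<in> {..<n}" "k \<in> {..<n}"
  then have jk: "j < n" "k < n" by auto
  let ?t2 = "(\<integral>w. W (\<phi> j) w * W (\<phi> k) w \<partial>PW)"
  let ?t1 = "(\<integral>z. \<phi> j (grain_at C z) * \<phi> k (grain_at C z) \<partial>limit_intensity \<gamma>)"
  have "?t2 =
    signed_integral (\<phi> j) (\<lambda>x. signed_integral (\<phi> k) (\<lambda>y. grain_kernel \<gamma> C (x - y)))"
   by (rule bspec[OF bspec[OF cov \<phi>'[OF jk(1)]] \<phi>'[OF jk(2)]])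
  also have "\<dots> = ?t1" by (rule covariance_eq[OF \<phi>[OF jk(1)] \<phi>[OF jk(2)] \<alpha>])
  finally show "t j * t k * ?t2 =
   t j * t k * ?t1" by simp
 qed
 also have "\<dots> = (\<integral>z. (\<Sum>k<n. t k * \<phi> k (grain_at C z))\<^sup>2 \<partial>limit_intensity \<gamma>)"
  by (intro integral_square_sum[symmetric] integrable_product limit_grain_measurable[OF dk] dominated_square_integrable[OF dk d(1,4)])
 finally show ?thesis using centered_gaussian_char(2)[OF P g] by simp
qed

end

section \<open>Scaling of the limit intensity under dilations\<close>

lemma integral_limit_intensity_scale:
 fixes h :: "'a::euclidean_space \<times> real \<Rightarrow> 'b::{banach, second_countable_topology}"
 assumes h[measurable]: "h \<in> borel_measurable borel2" and p: "p > 0" and s: "s > 0"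
 shows "(\<integral>z. h (s *\<^sub>R fst z, s ^ DIM('a) * snd z) \<partial>limit_intensity p) =
   (s powr ((p - 1) * real DIM('a))) *\<^sub>R (\<integral>z. h z \<partial>limit_intensity p)"
  and "integrable (limit_intensity p) (\<lambda>z. h (s *\<^sub>R fst z, s ^ DIM('a) * snd z)) \<longleftrightarrow> integrable (limit_intensity p) h"
proof -
 let ?t2 = "((p - 1) * real DIM('a))"
 let ?t1 = "borel2"
 let ?L = "limit_intensity p :: ('a \<times> real) measure"
 let ?T = "\<lambda>z::'a \<times> real. (s *\<^sub>R fst z, s ^ DIM('a) * snd z)"
 define c where "c = s powr ?t2"
 let ?t20 = "(\<lambda>z. (1 / c) *\<^sub>R (c *\<^sub>R h z))"
 have c: "c > 0" using s by (simp add: c_def)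
 have hL: "h \<in> borel_measurable ?L" using h measurable_cong_sets[OF sets_limit_intensity refl] by blast
 have T: "?T \<in> measurable ?L ?t1" by measurable
 \<comment> \<open>The pushforward under the dilation is a constant multiple of the measure itself;
   values of integrals and integrability are both read off from this.\<close>
 have d: "distr ?L ?t1 ?T = density ?L (\<lambda>_. ennreal c)"
 proof (rule measure_eqI)
  fix A assume "A \<in> sets (distr ?L ?t1 ?T)"
  then have A[measurable]: "A \<in> sets ?t1" by simp
  have "emeasure ?L A = (\<integral>\<^sup>+z. indicator A z \<partial>?L)" by simp
  also have "\<dots> = ennreal (s powr (- ?t2)) * (\<integral>\<^sup>+z. indicator A (?T z) \<partial>?L)"
   by (rule nn_integral_limit_intensity_scale[OF _ p s]) simp
  also have "(\<integral>\<^sup>+z. indicator A (?T z) \<partial>?L) = (\<integral>\<^sup>+z. indicator A z \<partial>distr ?L ?t1 ?T)"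
   by (subst nn_integral_distr[OF T]) auto
  also have "\<dots> = emeasure (distr ?L ?t1 ?T) A" by simp
  finally have e: "emeasure ?L A = ennreal (s powr (- ?t2)) * emeasure (distr ?L ?t1 ?T) A" .
  have "ennreal c * ennreal (s powr (- ?t2)) = ennreal (c * s powr (- ?t2))"
   using c by (simp add: ennreal_mult)
  also have "c * s powr (- ?t2) = 1" using s by (simp add: c_def powr_add[symmetric])
  finally have "ennreal c * emeasure ?L A = emeasure (distr ?L ?t1 ?T) A"
   unfolding e mult.assoc[symmetric] by simp
  then show "emeasure (distr ?L ?t1 ?T) A = emeasure (density ?L (\<lambda>_. ennreal c)) A"
   by (simp add: emeasure_density_const)
 qed simp
 have "(\<integral>z. h (?T z) \<partial>?L) = (\<integral>z. h z \<partial>distr ?L ?t1 ?T)"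
  by (rule integral_distr[OF T h, symmetric])
 also have "\<dots> = (\<integral>z. c *\<^sub>R h z \<partial>?L)"
  unfolding d by (rule integral_density[OF hL]) (use c in auto)
 finally show "(\<integral>z. h (?T z) \<partial>?L) = (s powr ?t2) *\<^sub>R (\<integral>z. h z \<partial>?L)"
  by (simp add: c_def)
 have "integrable ?L (\<lambda>z. h (?T z)) \<longleftrightarrow> integrable (distr ?L ?t1 ?T) h"
  by (rule integrable_distr_eq[OF T h, symmetric])
 also have "\<dots> \<longleftrightarrow> integrable ?L (\<lambda>z. c *\<^sub>R h z)"
  unfolding d by (rule integrable_density[OF hL]) (use c in auto)
 also have "\<dots> \<longleftrightarrow> integrable ?L h"
 proof
  assume "integrable ?L (\<lambda>z. c *\<^sub>R h z)"
  then have "integrable ?L ?t20" by (rule integrable_scaleR_right)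
  moreover have "?t20 = h" using c by (simp add: fun_eq_iff)
  ultimately show "integrable ?L h" by (simp only:)
 qed (intro integrable_scaleR_right)
 finally show "integrable ?L (\<lambda>z. h (?T z)) \<longleftrightarrow> integrable ?L h" .
qed

lemma AE_limit_intensity_pos:
 "AE z in (limit_intensity p :: ('a::euclidean_space \<times> real) measure). snd z > 0"
proof -
 define \<nu> where "\<nu> = density lborel (\<lambda>v::real. ennreal (indicator {0<..} v * v powr (- p - 1)))"
 have "sigma_finite_measure \<nu>"
  unfolding \<nu>_def by (subst sigma_finite_measure.sigma_finite_iff_density_finite[OF sigma_finite_lborel]) auto
 then interpret \<nu>: sigma_finite_measure \<nu> .
 interpret P: pair_sigma_finite "lborel :: 'a measure" \<nu> ..
 have [measurable_cong]: "sets \<nu> = sets borel" by (simp add: \<nu>_def)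
 have "AE v in \<nu>. v > 0" unfolding \<nu>_def by (subst AE_density) (auto simp: indicator_def)
 then have "AE x in (lborel :: 'a measure). AE v in \<nu>. v > 0" by simp
 moreover have "{z \<in> space (lborel \<Otimes>\<^sub>M \<nu>). snd z > (0::real)} \<in> sets (lborel \<Otimes>\<^sub>M \<nu>)"
  by measurable
 ultimately show ?thesis unfolding limit_intensity_def \<nu>_def[symmetric]
  using P.AE_pair_measure[of "\<lambda>z. snd z > 0"] by simp
qed

text \<open>The volume on the right is kept as a power of
  \<open>s * v powr (1 / real DIM('a))\<close>, so that the identity holds for every
  \<open>v\<close>; for \<open>v > 0\<close> it equals \<open>s ^ DIM('a) * v\<close>.\<close>

lemma dilate_grain:
 fixes C :: "'a::euclidean_space set"
 assumes s: "s > 0"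
 shows "dilate s f (grain C x v) = f (grain C (s *\<^sub>R x) ((s * v powr (1 / real DIM('a))) ^ DIM('a)))"
proof -
 let ?r = "v powr (1 / real DIM('a))"
 have "((s * ?r) ^ DIM('a)) powr (1 / real DIM('a)) = s * ?r"
 proof (cases "v = 0")
  case False
  then have "s * ?r > 0" using s by simp
  then show ?thesis by (simp add: powr_realpow[symmetric] powr_powr)
 qed (simp add: power_0_left)
 then have "(\<lambda>y. s *\<^sub>R y) ` grain C x v = grain C (s *\<^sub>R x) ((s * ?r) ^ DIM('a))"
  unfolding grain_def by (auto simp: image_image scaleR_add_right)
 then show ?thesis by (simp add: dilate_def)
qed

context grain_model
begin

text \<open>A dilation by \<open>s\<close> multiplies the exponent by
  \<open>s powr ((\<gamma> - 1) * DIM('a))\<close>. The choice of \<sigma> in the intermediate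
  regime makes this factor equal to \<open>\<gamma> * \<sigma>\<^sub>0\<close>.\<close>

lemma J_star_char:
 fixes \<phi> :: "nat \<Rightarrow> 'a set \<Rightarrow> real"
 assumes N: "poisson_random_measure P N (limit_intensity \<gamma>)"
  and \<phi>: "\<And>k. k < n \<Longrightarrow> dominated d (\<phi> k)" and d: "0 < d" "d < \<gamma>" and s: "s > 0"
 shows "\<And>k. k < n \<Longrightarrow> J_star \<gamma> C P N (dilate s (\<phi> k)) \<in> borel_measurable P"
  and "(CLINT w|P. iexp (\<Sum>k<n. t k * J_star \<gamma> C P N (dilate s (\<phi> k)) w)) =
   exp ((s powr ((\<gamma> - 1) * real DIM('a))) *\<^sub>R
    (CLINT z|limit_intensity \<gamma>. Psi (\<Sum>k<n. t k * \<phi> k (grain_at C z))))"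
proof -
 let ?t2 = "borel2"
 interpret J: poisson_rm P N "limit_intensity \<gamma>" by unfold_locales (rule N)
 have g0: "\<gamma> > 0" using \<gamma>_gt_1 by simp
 let ?L = "limit_intensity \<gamma> :: ('a \<times> real) measure"
 let ?f = "\<lambda>k z. dilate s (\<phi> k) (grain_at C z)"
 let ?g = "\<lambda>k z. \<phi> k (grain_at C z)"
 let ?T = "\<lambda>z::'a \<times> real. (s *\<^sub>R fst z, s ^ DIM('a) * snd z)"
 have gm: "?g k \<in> borel_measurable ?t2" if "k < n" for k
  using \<phi>[OF that] by (simp add: dominated_def)
 have fm: "?f k \<in> borel_measurable ?L" if "k < n" for k
 proof -
  have "(\<lambda>z::'a \<times> real. (s *\<^sub>R fst z, (s * snd z powr (1 / real DIM('a))) ^ DIM('a))) \<in> measurable ?L ?t2"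
   by measurable
  from measurable_compose[OF this gm[OF that]] show ?thesis by (simp add: dilate_grain[OF s])
 qed
 \<comment> \<open>The simplification of the dilated volume uses \<open>v > 0\<close>, which holds
   almost everywhere for the limit intensity.\<close>
 have fT: "AE z in ?L. \<forall>k. ?f k z = ?g k (?T z)" using AE_limit_intensity_pos
 proof eventually_elim
  case (elim z)
  then have "(s * snd z powr (1 / real DIM('a))) ^ DIM('a) = s ^ DIM('a) * snd z"
   by (simp add: power_mult_distrib powr_inverse_DIM)
  then show ?case by (simp add: dilate_grain[OF s])
 qed
 let ?t20 = "(s powr ((\<gamma> - 1) * real DIM('a)))"
 let ?t1 = "(CLINT w|P. iexp (\<Sum>k<n. t k * J_star \<gamma> C P N (dilate s (\<phi> k)) w))"
 have gT: "(\<lambda>z. ?g k (?T z)) \<in> borel_measurable ?L" if "k < n" for k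
 proof -
  have "?T \<in> measurable ?L ?t2" by measurable
  from measurable_compose[OF this gm[OF that]] show ?thesis by simp
 qed
 have f2: "integrable ?L (\<lambda>z. (?f k z)\<^sup>2)" if "k < n" for k
 proof -
  have "integrable ?L (\<lambda>z. (?g k z)\<^sup>2)" by (rule dominated_square_integrable[OF \<phi>[OF that] d])
  then have "integrable ?L (\<lambda>z. (?g k (?T z))\<^sup>2)"
   using integral_limit_intensity_scale(2)[of "\<lambda>z. (?g k z)\<^sup>2" \<gamma> s] gm[OF that] g0 s by simp
  moreover have "integrable ?L (\<lambda>z. (?f k z)\<^sup>2) \<longleftrightarrow> integrable ?L (\<lambda>z. (?g k (?T z))\<^sup>2)"
   using fT by (intro integrable_cong_AE borel_measurable_power fm gT that) (auto elim!: eventually_mono)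
  ultimately show ?thesis by simp
 qed
 have ci: "is_centered_integral P N ?L (?f k) (J_star \<gamma> C P N (dilate s (\<phi> k)))" if "k < n" for k
  unfolding J_star_def by (rule J.is_centered_integral_centered_integral[OF fm[OF that] f2[OF that]])
 show "\<And>k. k < n \<Longrightarrow> J_star \<gamma> C P N (dilate s (\<phi> k)) \<in> borel_measurable P"
  using ci by (simp add: is_centered_integral_def)
 have hm: "(\<lambda>z. Psi (\<Sum>k<n. t k * ?g k z)) \<in> borel_measurable ?t2"
  using gm by (intro measurable_compose[OF _ Psi_measurable] borel_measurable_sum borel_measurable_times) auto
 have "?t1 = exp (CLINT z|?L. Psi (\<Sum>k<n. t k * ?f k z))" by (rule J.char_centered_integrals[OF fm f2 ci])
 also have "(CLINT z|?L. Psi (\<Sum>k<n. t k * ?f k z)) = (CLINT z|?L. Psi (\<Sum>k<n. t k * ?g k (?T z)))"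
 proof (rule integral_cong_AE)
  show "(\<lambda>z. Psi (\<Sum>k<n. t k * ?f k z)) \<in> borel_measurable ?L"
   using fm by (intro measurable_compose[OF _ Psi_measurable] borel_measurable_sum borel_measurable_times) auto
  show "(\<lambda>z. Psi (\<Sum>k<n. t k * ?g k (?T z))) \<in> borel_measurable ?L"
   using gT by (intro measurable_compose[OF _ Psi_measurable] borel_measurable_sum borel_measurable_times) auto
  show "AE z in ?L. Psi (\<Sum>k<n. t k * ?f k z) = Psi (\<Sum>k<n. t k * ?g k (?T z))"
   using fT by eventually_elim simp
 qed
 also have "\<dots> = ?t20 *\<^sub>R (CLINT z|?L. Psi (\<Sum>k<n. t k * ?g k z))"
  using integral_limit_intensity_scale(1)[OF hm g0 s] by simp
 finally show "?t1 =
   exp (?t20 *\<^sub>R (CLINT z|?L. Psi (\<Sum>k<n. t k * ?g k z)))" .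
qed

end

subsection \<open>Characteristic functions of the grain functional\<close>

text \<open>A right limit is tested along sequences in \<open>(0, r)\<close>, to which the
  continuity theorem applies. Outside this interval \<open>P\<close> and \<open>X\<close> may be
  arbitrary.\<close>

lemma fdd_converges_at_rightI:
 fixes X :: "real \<Rightarrow> 't \<Rightarrow> 'w \<Rightarrow> real"
 assumes r: "r > 0" and P: "\<And>\<rho>. 0 < \<rho> \<Longrightarrow> \<rho> < r \<Longrightarrow> prob_space (P \<rho>)"
  and X: "\<And>\<rho> t. 0 < \<rho> \<Longrightarrow> \<rho> < r \<Longrightarrow> t \<in> T \<Longrightarrow> X \<rho> t \<in> borel_measurable (P \<rho>)"
  and Q: "prob_space Q" and Y: "\<And>t. t \<in> T \<Longrightarrow> Y t \<in> borel_measurable Q"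
  and cf: "\<And>(n::nat) t c S. (\<And>k. k < n \<Longrightarrow> t k \<in> T) \<Longrightarrow> (\<And>i. 0 < S i) \<Longrightarrow> (\<And>i. S i < r) \<Longrightarrow> S \<longlonglongrightarrow> 0 \<Longrightarrow>
   (\<lambda>i::nat. CLINT u|P (S i). iexp (\<Sum>k<n. c k * X (S i) (t k) u)) \<longlonglongrightarrow> (CLINT u|Q. iexp (\<Sum>k<n. c k * Y (t k) u))"
 shows "fdd_converges P X (at_right 0) T Q Y" unfolding fdd_converges_def
proof (intro conjI ballI allI impI)
 fix t assume t: "t \<in> T"
 show "\<forall>\<^sub>F \<rho> in at_right 0. X \<rho> t \<in> borel_measurable (P \<rho>)"
  unfolding eventually_at_right_field using r X[OF _ _ t] by blast
 show "Y t \<in> borel_measurable Q" by (rule Y[OF t])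
next
 fix n :: nat and t :: "nat \<Rightarrow> 't" and f :: "(nat \<Rightarrow> real) \<Rightarrow> real"
 assume t: "\<forall>k<n. t k \<in> T" and f: "continuous_on UNIV f" "bounded (range f)"
 show "((\<lambda>\<rho>. \<integral>u. f (\<lambda>k. if k < n then X \<rho> (t k) u else 0) \<partial>P \<rho>) \<longlongrightarrow>
  (\<integral>u. f (\<lambda>k. if k < n then Y (t k) u else 0) \<partial>Q)) (at_right 0)"
 proof (rule tendsto_at_right_sequentially[OF r])
  fix S :: "nat \<Rightarrow> real"
  assume S: "\<And>n. 0 < S n" "\<And>n. S n < r" "S \<longlonglongrightarrow> 0"
  have t': "t k \<in> T" if "k < n" for k using t that by simp
  show "(\<lambda>i. \<integral>u. f (\<lambda>k. if k < n then X (S i) (t k) u else 0) \<partial>P (S i)) \<longlonglongrightarrow>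
   (\<integral>u. f (\<lambda>k. if k < n then Y (t k) u else 0) \<partial>Q)"
  proof (rule multivariate_levy_continuity[where X = "\<lambda>i k. X (S i) (t k)" and Y = "\<lambda>k. Y (t k)" and P = "\<lambda>i. P (S i)" and Q = Q])
   show "prob_space (P (S i))" for i by (rule P[OF S(1,2)])
   show "prob_space Q" by fact
   show "X (S i) (t k) \<in> borel_measurable (P (S i))" if "k < n" for i k by (rule X[OF S(1,2) t'[OF that]])
   show "Y (t k) \<in> borel_measurable Q" if "k < n" for k by (rule Y[OF t'[OF that]])
   show "(\<lambda>i. CLINT u|P (S i). iexp (\<Sum>k<n. c k * X (S i) (t k) u)) \<longlonglongrightarrow> (CLINT u|Q. iexp (\<Sum>k<n. c k * Y (t k) u))" for c
    by (rule cf[where t = t and S = S and c = c and n = n]) (rule t' S | assumption)+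
   show "continuous_on UNIV f" "bounded (range f)" by (rule f)+
  qed
 qed
qed

text \<open>The integral of \<open>\<bar>h\<bar>\<close> over all grains is at most
  \<open>l * r\<close> times the mean of \<open>V\<close>, the volume of \<open>C\<close> and the
  mass of \<open>M\<close>. So the functional before the limit is an ordinary integral with finite
  expectation.\<close>

lemma integrable_grain_intensity:
 fixes C :: "'a::euclidean_space set" and V :: "'q \<Rightarrow> real"
 assumes C: "C \<in> sets borel" "emeasure lborel C < \<infinity>"
  and V: "prob_space Q" "V \<in> borel_measurable Q" "AE q in Q. V q > 0" "integrable Q V"
  and l: "l > 0" and r: "r > 0" and M: "finite_measure M" "sets M = sets borel"
  and f: "(\<lambda>z. h (grain_at C z)) \<in> borel_measurable borel2"
  and b: "\<And>A. A \<in> sets borel \<Longrightarrow> \<bar>h A\<bar> \<le> measure M A"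
 shows "integrable (grain_intensity Q V l r) (\<lambda>z. h (grain_at C z))"
proof (rule integrableI_bounded)
 let ?t1 = "(emeasure lborel C * emeasure M UNIV)"
 interpret Q: prob_space Q by fact
 interpret M: finite_measure M by fact
 note [measurable] = V(2)
 define D where "D = distr Q borel (\<lambda>q. r * V q)"
 let ?t2 = "(lborel \<Otimes>\<^sub>M D)"
 interpret D: prob_space D unfolding D_def by (rule Q.prob_space_distr) simp
 interpret P: pair_sigma_finite "lborel :: 'a measure" D ..
 have sD[measurable_cong]: "sets D = sets borel" by (simp add: D_def)
 have s: "sets (grain_intensity Q V l r :: ('a \<times> real) measure) = sets borel2"
  unfolding grain_intensity_def D_def[symmetric] sets_scale_measure using sD by (intro sets_pair_measure_cong) auto
 show "(\<lambda>z. h (grain_at C z)) \<in> borel_measurable (grain_intensity Q V l r)"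
  using f measurable_cong_sets[OF s refl] by blast
 let ?e = "\<lambda>z::'a \<times> real. emeasure M (grain_at C z)"
 have em: "?e \<in> borel_measurable ?t2" by (intro emeasure_grain_measurable C M) auto
 have "(\<integral>\<^sup>+z. ennreal (norm (h (grain_at C z))) \<partial>grain_intensity Q V l r) \<le> (\<integral>\<^sup>+z. ?e z \<partial>grain_intensity Q V l r)"
  using b[OF sets_grain[OF C(1)]] by (intro nn_integral_mono) (auto simp: M.emeasure_eq_measure intro!: ennreal_leI)
 also have "\<dots> = ennreal l * (\<integral>\<^sup>+z. ?e z \<partial>?t2)"
  unfolding grain_intensity_def D_def[symmetric] by (rule nn_integral_scale_measure[OF em])
 also have "(\<integral>\<^sup>+z. ?e z \<partial>?t2) = (\<integral>\<^sup>+v. \<integral>\<^sup>+x. ?e (x, v) \<partial>lborel \<partial>D)"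
  by (rule P.nn_integral_snd[symmetric]) (use em in \<open>simp add: split_beta'\<close>)
 also have "\<dots> = (\<integral>\<^sup>+q. (\<integral>\<^sup>+x. ?e (x, r * V q) \<partial>lborel) \<partial>Q)"
 proof -
  have "(\<lambda>q. emeasure M (grain C (snd q) (fst q))) \<in> borel_measurable (borel \<Otimes>\<^sub>M lborel)"
   by (intro emeasure_grain_measurable C M) auto
  then have "(\<lambda>v. \<integral>\<^sup>+x. ?e (x, v) \<partial>lborel) \<in> borel_measurable borel"
   by (intro lborel.borel_measurable_nn_integral) (simp add: split_beta')
  then show ?thesis unfolding D_def by (subst nn_integral_distr) auto
 qed
 also have "\<dots> = (\<integral>\<^sup>+q. ennreal (r * V q) * ?t1 \<partial>Q)"
 proof (rule nn_integral_cong_AE)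
  show "AE q in Q. (\<integral>\<^sup>+x. ?e (x, r * V q) \<partial>lborel) = ennreal (r * V q) * ?t1"
   using V(3)
  proof eventually_elim
   case (elim q)
   then have "r * V q > 0" using r by simp
   from nn_integral_emeasure_grain[OF C(1) M this] show ?case by (simp add: mult.assoc)
  qed
 qed
 also have "\<dots> = (\<integral>\<^sup>+q. ennreal (r * V q) \<partial>Q) * ?t1"
  by (rule nn_integral_multc) simp
 also have "(\<integral>\<^sup>+q. ennreal (r * V q) \<partial>Q) = ennreal (\<integral>q. r * V q \<partial>Q)"
  using V(3,4) r by (intro nn_integral_eq_integral) (auto elim!: eventually_mono)
 also have "ennreal l * (ennreal (\<integral>q. r * V q \<partial>Q) * ?t1) < \<infinity>"
 proof -
  have "emeasure lborel C * emeasure M UNIV < top"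
   using C(2) M.emeasure_finite[of UNIV] by (simp add: ennreal_mult_eq_top_iff less_top[symmetric])
  then show ?thesis by (simp add: ennreal_mult_less_top)
 qed
 finally show "(\<integral>\<^sup>+z. ennreal (norm (h (grain_at C z))) \<partial>grain_intensity Q V l r) < \<infinity>" .
qed

lemma centered_grain_functional_measurable:
 assumes N: "poisson_random_measure P N (grain_intensity Q V l r)"
  and f: "integrable (grain_intensity Q V l r) (\<lambda>z. h (grain_at C z))"
 shows "centered_grain_functional C P N h \<in> borel_measurable P"
proof -
 interpret poisson_rm P N "grain_intensity Q V l r" by unfold_locales (rule N)
 have "(\<lambda>w. \<integral>z. h (grain_at C z) \<partial>N w) \<in> borel_measurable P"
  by (rule integral_N_measurable) (use f in simp)
 then show ?thesis unfolding centered_grain_functional_def[abs_def] grain_functional_def by simp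
qed

text \<open>Campbell's formula identifies the subtracted expectation with the integral over the
  intensity, so the whole combination is one centered Poisson integral.\<close>

lemma char_centered_grain_functional:
 fixes \<phi> :: "nat \<Rightarrow> 'a::euclidean_space set \<Rightarrow> real"
 assumes N: "poisson_random_measure P N (grain_intensity Q V l r)"
  and f: "\<And>k. k < n \<Longrightarrow> integrable (grain_intensity Q V l r) (\<lambda>z. \<phi> k (grain_at C z))"
 shows "(CLINT w|P. iexp (\<Sum>k<n. t k * (centered_grain_functional C P N (\<phi> k) w / b))) =
  exp (CLINT z|grain_intensity Q V l r. Psi ((\<Sum>k<n. t k * \<phi> k (grain_at C z)) / b))"
proof -
 let ?\<eta> = "grain_intensity Q V l r :: ('a \<times> real) measure"
 interpret poisson_rm P N ?\<eta> by unfold_locales (rule N)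
 let ?f = "\<lambda>k z. \<phi> k (grain_at C z)"
 define g where "g = (\<lambda>z. (\<Sum>k<n. t k * ?f k z) / b)"
 have g: "integrable ?\<eta> g"
  unfolding g_def using f by (intro integrable_divide Bochner_Integration.integrable_sum integrable_mult_right) auto
 have c: "centered_grain_functional C P N (\<phi> k) w = (\<integral>z. ?f k z \<partial>N w) - (\<integral>z. ?f k z \<partial>?\<eta>)" if "k < n" for k w
  unfolding centered_grain_functional_def grain_functional_def using Campbell_integral[OF f[OF that]] by simp
 have "AE w in P. \<forall>k\<in>{..<n}. integrable (N w) (?f k)"
  using f by (intro AE_finite_allI AE_integrable_N) auto
 then have ae: "AE w in P. (\<Sum>k<n. t k * (centered_grain_functional C P N (\<phi> k) w / b)) = (\<integral>z. g z \<partial>N w) - (\<integral>z. g z \<partial>?\<eta>)"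
 proof eventually_elim
  case (elim w)
  have "(\<integral>z. (\<Sum>k<n. t k * ?f k z) \<partial>N w) = (\<Sum>k<n. t k * (\<integral>z. ?f k z \<partial>N w))"
   using elim by (subst Bochner_Integration.integral_sum) auto
  moreover have "(\<integral>z. (\<Sum>k<n. t k * ?f k z) \<partial>?\<eta>) = (\<Sum>k<n. t k * (\<integral>z. ?f k z \<partial>?\<eta>))"
   using f by (subst Bochner_Integration.integral_sum) auto
  ultimately have "(\<integral>z. g z \<partial>N w) - (\<integral>z. g z \<partial>?\<eta>) = (\<Sum>k<n. t k * (\<integral>z. ?f k z \<partial>N w)) / b - (\<Sum>k<n. t k * (\<integral>z. ?f k z \<partial>?\<eta>)) / b"
   by (simp add: g_def)
  also have "\<dots> = (\<Sum>k<n. t k * (((\<integral>z. ?f k z \<partial>N w) - (\<integral>z. ?f k z \<partial>?\<eta>)) / b))"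
   by (simp add: sum_divide_distrib sum_subtractf[symmetric] diff_divide_distrib right_diff_distrib)
  also have "\<dots> = (\<Sum>k<n. t k * (centered_grain_functional C P N (\<phi> k) w / b))"
   by (intro sum.cong refl) (simp add: c)
  finally show ?case ..
 qed
 have m: "(\<lambda>w. \<Sum>k<n. t k * (centered_grain_functional C P N (\<phi> k) w / b)) \<in> borel_measurable P"
  using centered_grain_functional_measurable[OF N f]
  by (intro borel_measurable_sum borel_measurable_times borel_measurable_divide) auto
 have m2: "(\<lambda>w. \<integral>z. g z \<partial>N w) \<in> borel_measurable P"
  by (rule integral_N_measurable) (use g in simp)
 have "(CLINT w|P. iexp (\<Sum>k<n. t k * (centered_grain_functional C P N (\<phi> k) w / b))) =
   (CLINT w|P. iexp ((\<integral>z. g z \<partial>N w) - (\<integral>z. g z \<partial>?\<eta>)))"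
 proof (rule integral_cong_AE)
  show "AE w in P. iexp (\<Sum>k<n. t k * (centered_grain_functional C P N (\<phi> k) w / b)) = iexp ((\<integral>z. g z \<partial>N w) - (\<integral>z. g z \<partial>?\<eta>))"
   using ae by eventually_elim simp
  note [measurable] = m m2
  show "(\<lambda>w. iexp (\<Sum>k<n. t k * (centered_grain_functional C P N (\<phi> k) w / b))) \<in> borel_measurable P"
   by measurable
  show "(\<lambda>w. iexp ((\<integral>z. g z \<partial>N w) - (\<integral>z. g z \<partial>?\<eta>))) \<in> borel_measurable P"
   by measurable
 qed
 also have "\<dots> = exp (CLINT z|?\<eta>. Psi (g z))" by (rule char_centered[OF g])
 finally show ?thesis by (simp add: g_def)
qed

lemma Psi_third_order: "cmod (Psi x + complex_of_real (x\<^sup>2 / 2)) \<le> \<bar>x\<bar> ^ 3 / 6"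
 using iexp_approx1[of x 2] by (simp add: Psi_def numeral_eq_Suc algebra_simps power2_eq_square)

section \<open>Exponents in the large-grain and intermediate regimes\<close>

context grain_model
begin

lemma integral_grain_intensity:
 fixes h :: "'a \<times> real \<Rightarrow> complex"
 assumes V: "V \<in> borel_measurable Q" "\<mu> = distr Q borel V" and k: "k > 0" and l: "l > 0" and t: "t > 0"
  and h: "h \<in> borel_measurable borel2"
 shows "(\<integral>z. h z \<partial>grain_intensity Q V l \<rho>) = (\<integral>p. indicator {0<..<1 / k} (snd p) *\<^sub>R
  ((l * k) *\<^sub>R h (fst p, \<rho> * t * scaled_quantile k t (snd p))) \<partial>lborel2)" (is "?l1 = ?r1")
proof -
 have "?l1 = (\<integral>p. (l * k * indicator {0<..<1 / k} (snd p)) *\<^sub>R h (fst p, \<rho> * quantile (snd p * k)) \<partial>lborel2)"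
  unfolding grain_intensity_eq[OF V k l] using h l k by (intro integral_volume_measure) auto
 also have "\<dots> = ?r1"
  using t by (intro Bochner_Integration.integral_cong refl) (simp add: scaled_quantile_def mult.commute)
 finally show ?thesis .
qed

lemma integral_limit_intensity_eq:
 fixes h :: "'a \<times> real \<Rightarrow> 'b::{banach, second_countable_topology}"
 assumes h: "h \<in> borel_measurable borel2"
 shows "(\<integral>z. h z \<partial>limit_intensity \<gamma>) = (1 / \<gamma>) *\<^sub>R (\<integral>p. indicator {0<..} (snd p) *\<^sub>R h (fst p, snd p powr (- 1 / \<gamma>)) \<partial>lborel2)" (is "?l1 = ?r1")
proof -
 have g: "\<gamma> > 0" using \<gamma>_gt_1 by simp
 have "?l1 = (\<integral>p. (1 / \<gamma> * indicator {0<..} (snd p)) *\<^sub>R h (fst p, snd p powr (- 1 / \<gamma>)) \<partial>lborel2)"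
  unfolding limit_intensity_eq[OF g] using h g by (intro integral_volume_measure) auto
 also have "\<dots> = (\<integral>p. (1 / \<gamma>) *\<^sub>R (indicator {0<..} (snd p) *\<^sub>R h (fst p, snd p powr (- 1 / \<gamma>))) \<partial>lborel2)"
  by (simp only: scaleR_scaleR)
 also have "\<dots> = ?r1" by (rule integral_scaleR_right)
 finally show ?thesis .
qed

text \<open>With \<open>t = 1 / r\<close> and \<open>\<kappa> = G (1 / r)\<close> the volumes are
  already in the right unit, since \<open>r * t = 1\<close>, and the intensity contributes the
  factor \<open>l * G (1 / r)\<close>. The factor \<gamma> in the limit compensates the
  \<open>1 / \<gamma>\<close> of \<open>limit_intensity\<close> in the coordinate
  \<open>s\<close>.\<close>

lemma grain_limit_general:
 fixes r l b :: "nat \<Rightarrow> real"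
 assumes V: "V \<in> borel_measurable Q" "\<mu> = distr Q borel V"
  and r: "\<And>n. r n > 0" "r \<longlonglongrightarrow> 0" and l: "\<And>n. l n > 0"
  and f: "dominated d f" and d: "0 < d" "d < \<gamma>" and H: "H' \<in> borel_measurable borel"
   "\<And>y y'. y \<longlonglongrightarrow> y' \<Longrightarrow> (\<lambda>n. (l n * G (1 / r n)) *\<^sub>R Psi (y n / b n)) \<longlonglongrightarrow> H' y'"
   "\<forall>\<^sub>F n in sequentially. \<forall>y. cmod ((l n * G (1 / r n)) *\<^sub>R Psi (y / b n)) \<le> L * y\<^sup>2"
 shows "(\<lambda>n. CLINT z|grain_intensity Q V (l n) (r n). Psi (f (grain_at C z) / b n)) \<longlonglongrightarrow>
  \<gamma> *\<^sub>R (CLINT z|limit_intensity \<gamma>. H' (f (grain_at C z)))"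
proof -
 let ?t1 = "(CLINT p|lborel \<Otimes>\<^sub>M lborel. indicator {0<..} (snd p) *\<^sub>R H' (f (grain C (fst p) (snd p powr (- 1 / \<gamma>)))))"
 have fm[measurable]: "(\<lambda>z. f (grain_at C z)) \<in> borel_measurable borel2"
  using f by (simp add: dominated_def)
 define t where "t = (\<lambda>n. 1 / r n)"
 have t0: "t n > 0" for n using r(1) by (simp add: t_def)
 have t: "filterlim t at_top sequentially"
 proof -
  have "filterlim r (at_right 0) sequentially"
   using r by (intro filterlim_at_withinI) (auto intro: always_eventually)
  from filterlim_compose[OF filterlim_inverse_at_top_right this] show ?thesis
   by (simp add: t_def[abs_def] inverse_eq_divide)
 qed
 have lim: "(\<lambda>n. CLINT p|lborel \<Otimes>\<^sub>M lborel. indicator {0<..<1 / G (t n)} (snd p) *\<^sub>R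
    ((l n * G (1 / r n)) *\<^sub>R Psi (f (grain C (fst p) (scaled_quantile (G (t n)) (t n) (snd p))) / b n))) \<longlonglongrightarrow>
  ?t1"
 proof (rule grain_integral_limit[OF f d t _ _ _ H])
  show "\<forall>\<^sub>F n in sequentially. G (t n) \<le> G (t n)" by simp
  show "\<forall>\<^sub>F n in sequentially. G (t n) \<le> G (q * t n)" if "0 < q" "q < 1" for q
  proof (rule always_eventually, rule allI)
   fix n
   have "q * t n \<le> 1 * t n" using that t0[of n] by (intro mult_right_mono) auto
   then show "G (t n) \<le> G (q * t n)" by (intro G_antimono) simp
  qed
  show "(\<lambda>y. (l n * G (1 / r n)) *\<^sub>R Psi (y / b n)) \<in> borel_measurable borel" for n by measurable
 qed
 have e1: "(CLINT z|grain_intensity Q V (l n) (r n). Psi (f (grain_at C z) / b n)) =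
  (CLINT p|lborel \<Otimes>\<^sub>M lborel. indicator {0<..<1 / G (t n)} (snd p) *\<^sub>R
    ((l n * G (1 / r n)) *\<^sub>R Psi (f (grain C (fst p) (scaled_quantile (G (t n)) (t n) (snd p))) / b n)))" for n
 proof -
  have "r n * t n = 1" using r(1)[of n] by (simp add: t_def)
  then show ?thesis
   using integral_grain_intensity[OF V G_pos[of "t n"] l[of n] t0[of n], of "\<lambda>z. Psi (f (grain_at C z) / b n)" "r n"]
   by (simp add: t_def)
 qed
 have "(\<lambda>z. H' (f (grain_at C z))) \<in> borel_measurable borel2"
  by (rule measurable_compose[OF fm H(1)])
 then have e2: "\<gamma> *\<^sub>R (CLINT z|limit_intensity \<gamma>. H' (f (grain_at C z))) =
  ?t1" using \<gamma>_gt_1 by (subst integral_limit_intensity_eq) auto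
 show ?thesis unfolding e1 e2 by (rule lim)
qed

text \<open>The normalization satisfies \<open>(b n)\<^sup>2 = \<gamma> * a n\<close>, so the
  second-order term of \<open>a n *\<^sub>R Psi (y / b n)\<close> is exactly
  \<open>- y\<^sup>2 / (2 * \<gamma>)\<close>. The third-order remainder is of order
  \<open>1 / b n\<close> and vanishes in the limit.\<close>

lemma large_grain_limit:
 fixes \<rho> l :: "nat \<Rightarrow> real"
 assumes V: "V \<in> borel_measurable Q" "\<mu> = distr Q borel V"
  and \<rho>: "\<And>n. \<rho> n > 0" "\<rho> \<longlonglongrightarrow> 0" and l: "\<And>n. l n > 0"
  and f: "dominated \<delta> f" and \<delta>: "0 < \<delta>" "\<delta> < \<gamma>"
  and lim: "filterlim (\<lambda>n. l n * G (1 / \<rho> n)) at_top sequentially"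
 shows "(\<lambda>n. CLINT z|grain_intensity Q V (l n) (\<rho> n). Psi (f (grain_at C z) / (\<gamma> * l n * G (1 / \<rho> n)) powr (1 / 2))) \<longlonglongrightarrow>
  complex_of_real (- (\<integral>z. (f (grain_at C z))\<^sup>2 \<partial>limit_intensity \<gamma>) / 2)"
proof -
 let ?t3 = "(\<integral>z. - ((f (grain_at C z))\<^sup>2 / (2 * \<gamma>)) \<partial>limit_intensity \<gamma>)"
 let ?t2 = "(CLINT z|limit_intensity \<gamma>. complex_of_real (- ((f (grain_at C z))\<^sup>2 / (2 * \<gamma>))))"
 let ?t1 = "(\<integral>z. (f (grain_at C z))\<^sup>2 \<partial>limit_intensity \<gamma>)"
 define a where "a = (\<lambda>n. l n * G (1 / \<rho> n))"
 define b where "b = (\<lambda>n. (\<gamma> * l n * G (1 / \<rho> n)) powr (1 / 2))"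
 have g: "\<gamma> > 0" using \<gamma>_gt_1 by simp
 have a: "a n > 0" for n using l G_pos by (simp add: a_def)
 have ba: "b n = (\<gamma> * a n) powr (1 / 2)" for n by (simp add: b_def a_def mult.assoc)
 have b: "b n > 0" for n using a[of n] g by (simp add: ba)
 have b2: "(b n)\<^sup>2 = \<gamma> * a n" for n using a[of n] g by (simp add: ba powr_half_sqrt)
 have bsqrt: "b n = sqrt (\<gamma> * a n)" for n using a[of n] g by (simp add: ba powr_half_sqrt)
 have binf: "filterlim b at_top sequentially" unfolding bsqrt
  by (rule filterlim_compose[OF sqrt_at_top filterlim_tendsto_pos_mult_at_top[OF tendsto_const g lim[folded a_def]]])
 have "(\<lambda>n. CLINT z|grain_intensity Q V (l n) (\<rho> n). Psi (f (grain_at C z) / b n)) \<longlonglongrightarrow>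
  \<gamma> *\<^sub>R ?t2"
 proof (rule grain_limit_general[OF V \<rho> l f \<delta>, where H' = "\<lambda>y. complex_of_real (- (y\<^sup>2 / (2 * \<gamma>)))" and L = "1 / (2 * \<gamma>)"])
  show "(\<lambda>y. complex_of_real (- (y\<^sup>2 / (2 * \<gamma>)))) \<in> borel_measurable borel" by measurable
  have bound: "cmod ((l n * G (1 / \<rho> n)) *\<^sub>R Psi (y / b n)) \<le> 1 / (2 * \<gamma>) * y\<^sup>2" for n y
  proof -
   have "cmod ((l n * G (1 / \<rho> n)) *\<^sub>R Psi (y / b n)) = a n * cmod (Psi (y / b n))"
    using a[of n] by (simp add: a_def)
   also have "\<dots> \<le> a n * ((y / b n)\<^sup>2 / 2)" using a[of n] by (intro mult_left_mono cmod_Psi_le) auto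
   also have "\<dots> = 1 / (2 * \<gamma>) * y\<^sup>2" using a[of n] g by (simp add: power_divide b2)
   finally show ?thesis .
  qed
  then show "\<forall>\<^sub>F n in sequentially. \<forall>y. cmod ((l n * G (1 / \<rho> n)) *\<^sub>R Psi (y / b n)) \<le> 1 / (2 * \<gamma>) * y\<^sup>2"
   by simp
  fix y :: "nat \<Rightarrow> real" and y' assume y: "y \<longlonglongrightarrow> y'"
  let ?t6 = "(- (y'\<^sup>2 / (2 * \<gamma>)))"
  have d: "cmod (a n *\<^sub>R Psi (y n / b n) - complex_of_real (- ((y n)\<^sup>2 / (2 * \<gamma>)))) \<le> \<bar>y n\<bar> ^ 3 / (6 * \<gamma>) * (1 / b n)" for n
  proof -
   let ?t5 = "((y n / b n)\<^sup>2 / 2)"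
   let ?t4 = "(- ((y n)\<^sup>2 / (2 * \<gamma>)))"
   have e: "complex_of_real ?t4 = - (a n *\<^sub>R complex_of_real ?t5)"
   proof -
    have "(y n)\<^sup>2 / (2 * \<gamma>) = a n * ?t5" using a[of n] g by (simp add: power_divide b2)
    then show ?thesis by (simp only: scaleR_conv_of_real of_real_minus of_real_mult)
   qed
   have "a n *\<^sub>R Psi (y n / b n) - complex_of_real ?t4 = a n *\<^sub>R (Psi (y n / b n) + complex_of_real ?t5)"
    unfolding e by (simp add: scaleR_add_right)
   then have "cmod (a n *\<^sub>R Psi (y n / b n) - complex_of_real ?t4) = a n * cmod (Psi (y n / b n) + complex_of_real ?t5)"
    using a[of n] by simp
   also have "\<dots> \<le> a n * (\<bar>y n / b n\<bar> ^ 3 / 6)"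
    using a[of n] by (intro mult_left_mono Psi_third_order) auto
   also have "\<dots> = \<bar>y n\<bar> ^ 3 / (6 * \<gamma>) * (1 / b n)" (is "_ = ?r1")
   proof -
    have "\<bar>y n / b n\<bar> ^ 3 = \<bar>y n\<bar> ^ 3 / ((b n)\<^sup>2 * b n)"
     using b[of n] by (simp add: abs_divide power_divide power3_eq_cube power2_eq_square)
    then have "a n * (\<bar>y n / b n\<bar> ^ 3 / 6) = a n * (\<bar>y n\<bar> ^ 3 / (\<gamma> * a n * b n) / 6)" by (simp only: b2)
    also have "\<dots> = ?r1"
    proof -
     have "a n * (X / (\<gamma> * a n * b n) / 6) = X / (6 * \<gamma>) * (1 / b n)" for X :: real
      using a[of n] b[of n] g by simp
     then show ?thesis .
    qed
    finally show ?thesis .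
   qed
   finally show ?thesis .
  qed
  have inv: "(\<lambda>n. 1 / b n) \<longlonglongrightarrow> 0"
   using tendsto_inverse_0_at_top[OF binf] by (simp add: inverse_eq_divide)
  have "(\<lambda>n. \<bar>y n\<bar> ^ 3 / (6 * \<gamma>) * (1 / b n)) \<longlonglongrightarrow> \<bar>y'\<bar> ^ 3 / (6 * \<gamma>) * 0"
   by (rule tendsto_mult[OF tendsto_divide[OF tendsto_power[OF tendsto_rabs[OF y]] tendsto_const] inv]) (use g in simp)
  then have "(\<lambda>n. a n *\<^sub>R Psi (y n / b n) - complex_of_real (- ((y n)\<^sup>2 / (2 * \<gamma>)))) \<longlonglongrightarrow> 0"
   unfolding mult_zero_right by (rule Lim_null_comparison[OF always_eventually[OF allI[OF d]]])
  moreover have "(\<lambda>n. complex_of_real (- ((y n)\<^sup>2 / (2 * \<gamma>)))) \<longlonglongrightarrow> complex_of_real ?t6"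
   using y g by (intro tendsto_intros) auto
  ultimately have "(\<lambda>n. (a n *\<^sub>R Psi (y n / b n) - complex_of_real (- ((y n)\<^sup>2 / (2 * \<gamma>)))) + complex_of_real (- ((y n)\<^sup>2 / (2 * \<gamma>)))) \<longlonglongrightarrow>
   0 + complex_of_real ?t6" by (rule tendsto_add)
  then show "(\<lambda>n. (l n * G (1 / \<rho> n)) *\<^sub>R Psi (y n / b n)) \<longlonglongrightarrow> complex_of_real ?t6"
   by (simp add: a_def)
 qed
 also have "\<gamma> *\<^sub>R ?t2 =
  complex_of_real (\<gamma> * ?t3)"
  unfolding integral_complex_of_real scaleR_conv_of_real of_real_mult by (rule refl)
 also have "?t3 = - (?t1 / (2 * \<gamma>))" by simp
 also have "\<gamma> * (- (?t1 / (2 * \<gamma>))) = - ?t1 / 2" using g by simp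
 finally show ?thesis unfolding b_def .
qed

text \<open>There is no normalization in this regime; the division by 1 keeps the exponent in the
  form of the general limit with \<open>b = 1\<close>.\<close>

lemma intermediate_limit:
 fixes r l :: "nat \<Rightarrow> real"
 assumes V: "V \<in> borel_measurable Q" "\<mu> = distr Q borel V"
  and r: "\<And>n. r n > 0" "r \<longlonglongrightarrow> 0" and l: "\<And>n. l n > 0"
  and f: "dominated d f" and d: "0 < d" "d < \<gamma>"
  and lim: "(\<lambda>n. l n * G (1 / r n)) \<longlonglongrightarrow> \<sigma>0"
 shows "(\<lambda>n. CLINT z|grain_intensity Q V (l n) (r n). Psi (f (grain_at C z) / 1)) \<longlonglongrightarrow>
  (\<gamma> * \<sigma>0) *\<^sub>R (CLINT z|limit_intensity \<gamma>. Psi (f (grain_at C z)))"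
proof -
 have a: "l n * G (1 / r n) > 0" for n using l G_pos by simp
 have "(\<lambda>n. CLINT z|grain_intensity Q V (l n) (r n). Psi (f (grain_at C z) / 1)) \<longlonglongrightarrow>
  \<gamma> *\<^sub>R (CLINT z|limit_intensity \<gamma>. \<sigma>0 *\<^sub>R Psi (f (grain_at C z)))"
 \<comment> \<open>Eventually the intensity factor is below \<open>\<sigma>0 + 1\<close>; the factor
   1/2 in \<open>L\<close> comes from the quadratic bound on \<open>Psi\<close>.\<close>
 proof (rule grain_limit_general[OF V r l f d, where H' = "\<lambda>y. \<sigma>0 *\<^sub>R Psi y" and L = "(\<sigma>0 + 1) / 2"])
  show "(\<lambda>y. \<sigma>0 *\<^sub>R Psi y) \<in> borel_measurable borel" by measurable
  show "(\<lambda>n. (l n * G (1 / r n)) *\<^sub>R Psi (y n / 1)) \<longlonglongrightarrow> \<sigma>0 *\<^sub>R Psi y'" if "y \<longlonglongrightarrow> y'" for y y'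
   using that by (intro tendsto_scaleR lim isCont_tendsto_compose[OF isCont_Psi]) simp
  have "\<forall>\<^sub>F n in sequentially. l n * G (1 / r n) < \<sigma>0 + 1"
   using lim by (intro order_tendstoD(2)) auto
  then show "\<forall>\<^sub>F n in sequentially. \<forall>y. cmod ((l n * G (1 / r n)) *\<^sub>R Psi (y / 1)) \<le> (\<sigma>0 + 1) / 2 * y\<^sup>2"
  proof eventually_elim
   case (elim n)
   show ?case
   proof
    fix y
    have "cmod ((l n * G (1 / r n)) *\<^sub>R Psi (y / 1)) = (l n * G (1 / r n)) * cmod (Psi y)" using a[of n] by simp
    also have "\<dots> \<le> (\<sigma>0 + 1) * (y\<^sup>2 / 2)" using elim a[of n] by (intro mult_mono cmod_Psi_le) auto
    finally show "cmod ((l n * G (1 / r n)) *\<^sub>R Psi (y / 1)) \<le> (\<sigma>0 + 1) / 2 * y\<^sup>2" by simp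
   qed
  qed
 qed
 then show ?thesis by (simp only: integral_scaleR_right scaleR_scaleR)
qed

end

subsection \<open>The stable integral\<close>

lemma Psi_eq_Complex: "Psi x = Complex (cos x - 1) (sin x - x)"
 by (simp add: Psi_def cis_conv_exp[symmetric] complex_eq_iff del: exp_of_real)

section \<open>Gamma and trigonometric integrals\<close>

lemma nn_integral_powr_exp:
 assumes t: "t > 0" and x: "x > (0::real)"
 shows "(\<integral>\<^sup>+v. ennreal (indicator {0<..} v * (v powr (x - 1) * exp (- t * v))) \<partial>lborel) = ennreal (Gamma x * t powr (- x))"
proof -
 let ?f = "\<lambda>v. ennreal (indicator {0<..} v * (v powr (x - 1) * exp (- t * v)))"
 have "(\<integral>\<^sup>+v. ?f v \<partial>lborel) = ennreal (\<bar>1 / t\<bar> ^ DIM(real)) * (\<integral>\<^sup>+v. ?f (0 + (1 / t) *\<^sub>R v) \<partial>lborel)"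
  using t by (intro nn_integral_lborel_affine) auto
 also have "(\<integral>\<^sup>+v. ?f (0 + (1 / t) *\<^sub>R v) \<partial>lborel) = (\<integral>\<^sup>+v. ennreal (t powr (1 - x)) * ennreal (indicator {0..} v * v powr (x - 1) / exp v) \<partial>lborel)"
 proof (rule nn_integral_cong_AE)
  show "AE v in lborel. ?f (0 + (1 / t) *\<^sub>R v) = ennreal (t powr (1 - x)) * ennreal (indicator {0..} v * v powr (x - 1) / exp v)"
   using AE_lborel_singleton[of 0]
  proof eventually_elim
   case (elim v)
   show ?case
   proof (cases "v > 0")
    case True
    have "((1 / t) * v) powr (x - 1) = t powr (1 - x) * v powr (x - 1)"
     using powr_divide_eq[OF True t, of "x - 1"] by (simp add: mult.commute)
    then show ?thesis using True t by (simp add: exp_minus ennreal_mult[symmetric] field_simps)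
   qed (use elim t in \<open>simp add: indicator_def zero_less_divide_iff\<close>)
  qed
 qed
 also have "\<dots> = ennreal (t powr (1 - x)) * ennreal (Gamma x)"
  by (subst nn_integral_cmult) (auto simp: Gamma_conv_nn_integral_real[OF x])
 also have "ennreal (\<bar>1 / t\<bar> ^ DIM(real)) * (ennreal (t powr (1 - x)) * ennreal (Gamma x)) = ennreal (1 / t * t powr (1 - x) * Gamma x)"
 proof -
  have "ennreal p * (ennreal q * ennreal r) = ennreal (p * q * r)" if "p \<ge> 0" "q \<ge> 0" "r \<ge> 0" for p q r :: real
   using that by (simp add: ennreal_mult mult.assoc)
  from this[of "1 / t" "t powr (1 - x)" "Gamma x"] show ?thesis using t Gamma_real_pos[OF x] by simp
 qed
 also have "1 / t * t powr (1 - x) = t powr (- x)" using t by (simp add: powr_diff powr_minus field_simps)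
 finally show ?thesis by (simp add: mult.commute)
qed

lemma nn_integral_powr_substitution:
 fixes h :: "real \<Rightarrow> ennreal"
 assumes p: "p > (0::real)" and [measurable]: "h \<in> borel_measurable borel"
 shows "(\<integral>\<^sup>+v. ennreal (indicator {0<..} v * v powr (- p - 1)) * h v \<partial>lborel) =
  (\<integral>\<^sup>+s. ennreal (1 / p * indicator {0<..} s) * h (s powr (- 1 / p)) \<partial>lborel)"
proof -
 let ?t1 = "(\<lambda>s. ennreal (1 / p * indicator {0<..} s))"
 let ?D = "density lborel (\<lambda>v::real. ennreal (indicator {0<..} v * v powr (- p - 1)))"
 let ?E = "distr (density lborel ?t1) borel (\<lambda>s. s powr (- 1 / p))"
 have DE: "?D = ?E"
 proof (rule measure_eqI)
  fix A assume "A \<in> sets ?D"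
  then have A[measurable]: "A \<in> sets borel" by simp
  have "emeasure ?D A = (\<integral>\<^sup>+v. ennreal (indicator {0<..} v * v powr (- p - 1)) * indicator A v \<partial>lborel)"
   by (rule emeasure_density) auto
  also have "\<dots> = (\<integral>\<^sup>+s. ennreal (1 / p * indicator {0<..} s) * indicator A (s powr (- 1 / p)) \<partial>lborel)"
   by (rule emeasure_powr_density[OF p A])
  also have "\<dots> = (\<integral>\<^sup>+s. indicator A (s powr (- 1 / p)) \<partial>density lborel ?t1)"
   by (rule nn_integral_density[symmetric]) auto
  also have "\<dots> = (\<integral>\<^sup>+s. indicator A s \<partial>?E)"
   by (rule nn_integral_distr[symmetric]) auto
  finally show "emeasure ?D A = emeasure ?E A" by simp
 qed simp
 have "(\<integral>\<^sup>+v. ennreal (indicator {0<..} v * v powr (- p - 1)) * h v \<partial>lborel) = (\<integral>\<^sup>+v. h v \<partial>?D)"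
  by (rule nn_integral_density[symmetric]) auto
 also have "\<dots> = (\<integral>\<^sup>+s. h (s powr (- 1 / p)) \<partial>density lborel ?t1)"
  unfolding DE by (rule nn_integral_distr) auto
 also have "\<dots> = (\<integral>\<^sup>+s. ennreal (1 / p * indicator {0<..} s) * h (s powr (- 1 / p)) \<partial>lborel)"
  by (rule nn_integral_density) auto
 finally show ?thesis .
qed

text \<open>Writing \<open>1 / (1 + u)\<close> as the integral of \<open>exp (- (1 + u) * w)\<close>
  over positive \<open>w\<close>, Tonelli's theorem yields \<open>Gamma b * Gamma (1 - b)\<close>,
  which the reflection formula evaluates.\<close>

lemma nn_integral_powr_over_one_plus:
 assumes b: "0 < b" "b < (1::real)"
 shows "(\<integral>\<^sup>+u. ennreal (indicator {0<..} u * (u powr (b - 1) / (1 + u))) \<partial>lborel) = ennreal (pi / sin (pi * b))"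
proof -
 let ?i = "indicator {0<..} :: real \<Rightarrow> real"
 have e: "ennreal (?i u * (u powr (b - 1) / (1 + u))) =
   (\<integral>\<^sup>+w. ennreal (?i w * exp (- w)) * ennreal (?i u * (u powr (b - 1) * exp (- w * u))) \<partial>lborel)" for u
 proof (cases "u > 0")
  case True
  have "(\<integral>\<^sup>+w. ennreal (?i w * exp (- w)) * ennreal (?i u * (u powr (b - 1) * exp (- w * u))) \<partial>lborel) =
    (\<integral>\<^sup>+w. ennreal (u powr (b - 1)) * ennreal (?i w * (w powr (1 - 1) * exp (- (1 + u) * w))) \<partial>lborel)"
  proof (rule nn_integral_cong, goal_cases)
   case (1 w)
   have "exp (- (1 + u) * w) = exp (- w) * exp (- w * u)" by (simp add: exp_add[symmetric] algebra_simps)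
   then show ?case using True by (cases "w > 0") (simp_all add: ennreal_mult[symmetric] mult_ac)
  qed
  also have "\<dots> = ennreal (u powr (b - 1)) * ennreal (Gamma 1 * (1 + u) powr (- 1))"
  proof -
   have "1 + u > 0" using True by simp
   show ?thesis
    unfolding nn_integral_powr_exp[OF \<open>1 + u > 0\<close> zero_less_one, symmetric] by (rule nn_integral_cmult) measurable
  qed
  also have "\<dots> = ennreal (u powr (b - 1) / (1 + u))"
   using True by (simp add: ennreal_mult[symmetric] powr_minus divide_inverse)
  finally show ?thesis using True by simp
 qed simp
 have "(\<integral>\<^sup>+u. ennreal (?i u * (u powr (b - 1) / (1 + u))) \<partial>lborel) =
   (\<integral>\<^sup>+w. \<integral>\<^sup>+u. ennreal (?i w * exp (- w)) * ennreal (?i u * (u powr (b - 1) * exp (- w * u))) \<partial>lborel \<partial>lborel)"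
  unfolding e by (rule lborel_pair.Fubini') measurable
 also have "\<dots> = (\<integral>\<^sup>+w. ennreal (Gamma b) * ennreal (?i w * (w powr ((1 - b) - 1) * exp (- 1 * w))) \<partial>lborel)"
 proof (intro nn_integral_cong, goal_cases)
  case (1 w)
  show ?case
  proof (cases "w > 0")
   case True
   have "(\<integral>\<^sup>+u. ennreal (?i w * exp (- w)) * ennreal (?i u * (u powr (b - 1) * exp (- w * u))) \<partial>lborel) =
     ennreal (?i w * exp (- w)) * ennreal (Gamma b * w powr (- b))"
    unfolding nn_integral_powr_exp[OF True b(1), symmetric] by (rule nn_integral_cmult) measurable
   then show ?thesis using True Gamma_real_pos[OF b(1)] by (simp add: ennreal_mult[symmetric] mult_ac)
  qed simp
 qed
 also have "\<dots> = ennreal (Gamma b) * ennreal (Gamma (1 - b) * 1 powr (- (1 - b)))"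
 proof -
  have "1 - b > 0" using b by simp
  show ?thesis
   unfolding nn_integral_powr_exp[OF zero_less_one \<open>1 - b > 0\<close>, symmetric] by (rule nn_integral_cmult) measurable
 qed
 also have "\<dots> = ennreal (Gamma b * Gamma (1 - b))"
  using Gamma_real_pos[of b] b by (simp add: ennreal_mult)
 also have "Gamma b * Gamma (1 - b) = pi / sin (pi * b)"
 proof -
  have "complex_of_real (Gamma b * Gamma (1 - b)) = of_real (pi / sin (pi * b))"
   using Gamma_reflection_complex[of "of_real b"]
   by (simp only: of_real_mult of_real_divide Gamma_complex_of_real[symmetric] of_real_diff of_real_1 sin_of_real[symmetric])
  then show ?thesis by (simp only: of_real_eq_iff)
 qed
 finally show ?thesis .
qed

text \<open>The substitution \<open>t = s powr (- 1 / 2)\<close> reduces this to the preceding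
  integral with \<open>b = 1 - a / 2\<close>.\<close>

lemma nn_integral_powr_over_one_plus_square:
 assumes a: "0 < a" "a < (2::real)"
 shows "(\<integral>\<^sup>+t. ennreal (indicator {0<..} t * (t powr (a - 1) / (1 + t\<^sup>2))) \<partial>lborel) = ennreal (pi / (2 * sin (pi * a / 2)))"
proof -
 let ?t20 = "(pi / sin (pi * a / 2))"
 let ?i = "indicator {0<..} :: real \<Rightarrow> real"
 \<comment> \<open>The factor \<open>t powr (- 2 - 1)\<close> is split off because the substitution
   is available for weights \<open>v powr (- p - 1)\<close>; here \<open>p = 2\<close>.\<close>
 have "(\<integral>\<^sup>+t. ennreal (?i t * (t powr (a - 1) / (1 + t\<^sup>2))) \<partial>lborel) =
   (\<integral>\<^sup>+t. ennreal (?i t * t powr (- 2 - 1)) * ennreal (t powr (a + 2) / (1 + t\<^sup>2)) \<partial>lborel)"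
 proof (rule nn_integral_cong, goal_cases)
  case (1 t)
  let ?t2 = "(t powr (a + 2) / (1 + t\<^sup>2))"
  have "t powr (- 2 - 1) * t powr (a + 2) = t powr (- 2 - 1 + (a + 2))" by (rule powr_add[symmetric])
  also have "- 2 - 1 + (a + 2) = a - 1" by simp
  finally have "t powr (a - 1) / (1 + t\<^sup>2) = t powr (- 2 - 1) * ?t2" by (simp only: times_divide_eq_right)
  then have "?i t * (t powr (a - 1) / (1 + t\<^sup>2)) = (?i t * t powr (- 2 - 1)) * ?t2"
   by (simp only: mult.assoc)
  then show ?case by (simp only:) (rule ennreal_mult; simp add: indicator_def)
 qed
 also have "\<dots> = (\<integral>\<^sup>+s. ennreal (1 / 2 * ?i s) * ennreal ((s powr (- 1 / 2)) powr (a + 2) / (1 + (s powr (- 1 / 2))\<^sup>2)) \<partial>lborel)"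
  by (rule nn_integral_powr_substitution) auto
 also have "\<dots> = (\<integral>\<^sup>+s. ennreal (1 / 2) * ennreal (?i s * (s powr ((1 - a / 2) - 1) / (1 + s))) \<partial>lborel)"
 proof (intro nn_integral_cong, goal_cases)
  case (1 s)
  let ?t1 = "((s powr (- 1 / 2)) powr (a + 2) / (1 + (s powr (- 1 / 2))\<^sup>2))"
  show ?case
  proof (cases "s > 0")
   case True
   have 1: "(s powr (- 1 / 2)) powr (a + 2) = s powr (- (a / 2)) / s"
   proof -
    have "(s powr (- 1 / 2)) powr (a + 2) = s powr (- (a / 2) - 1)"
    proof -
     have "- 1 / 2 * (a + 2) = - (a / 2) - 1" by (simp add: field_simps)
     then show ?thesis by (simp only: powr_powr)
    qed
    then show ?thesis using True by (simp add: powr_diff)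
   qed
   have "(s powr (- 1 / 2))\<^sup>2 = s powr (- 1 / 2 + - 1 / 2)" by (simp only: power2_eq_square powr_add)
   also have "- 1 / 2 + - 1 / 2 = (- 1 :: real)" by simp
   also have "s powr - 1 = 1 / s" using True by (simp only: powr_minus_divide powr_one)
   finally have 2: "(s powr (- 1 / 2))\<^sup>2 = 1 / s" .
   have "(s powr (- 1 / 2)) powr (a + 2) / (1 + (s powr (- 1 / 2))\<^sup>2) = s powr ((1 - a / 2) - 1) / (1 + s)"
   proof -
    have "X / s / (1 + 1 / s) = X / (1 + s)" for X
    proof -
     have "X / s / (1 + 1 / s) = X / (s * (1 + 1 / s))" by (rule divide_divide_eq_left)
     also have "s * (1 + 1 / s) = 1 + s" using True by (simp add: distrib_left)
     finally show ?thesis .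
    qed
    moreover have "1 - a / 2 - 1 = - (a / 2)" by simp
    ultimately show ?thesis unfolding 1 2 by (simp only:)
   qed
   then have e: "ennreal ?t1 = ennreal (s powr ((1 - a / 2) - 1) / (1 + s))" by (rule arg_cong)
   have "?i s = 1" using True by simp
   then show ?thesis unfolding e by (simp only: mult_1_left mult_1_right)
  qed simp
 qed
 also have "\<dots> = ennreal (1 / 2) * ennreal (pi / sin (pi * (1 - a / 2)))"
 proof -
  have b: "0 < 1 - a / 2" "1 - a / 2 < 1" using a by auto
  show ?thesis unfolding nn_integral_powr_over_one_plus[OF b, symmetric] by (rule nn_integral_cmult) measurable
 qed
 also have "sin (pi * (1 - a / 2)) = sin (pi * a / 2)"
  using sin_pi_minus[of "pi * a / 2"] by (simp add: algebra_simps)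
 also have "ennreal (1 / 2) * ennreal ?t20 = ennreal (1 / 2 * ?t20)" by (rule ennreal_mult'[symmetric]) simp
 also have "1 / 2 * ?t20 = pi / (2 * sin (pi * a / 2))" by simp
 finally show ?thesis .
qed

text \<open>Both integrands are nonnegative on the half-line, so an explicit antiderivative that
  vanishes at infinity gives the value and finiteness together. These Laplace transforms of
  \<open>1 - cos v\<close> and \<open>v - sin v\<close> serve the real and the imaginary part of
  \<open>Psi\<close>.\<close>

lemma nn_integral_one_minus_cos_exp:
 assumes t: "t > (0::real)"
 shows "(\<integral>\<^sup>+v. ennreal (indicator {0<..} v * ((1 - cos v) * exp (- t * v))) \<partial>lborel) = ennreal (1 / (t * (1 + t\<^sup>2)))"
  and "(\<integral>\<^sup>+v. ennreal (indicator {0<..} v * ((v - sin v) * exp (- t * v))) \<partial>lborel) = ennreal (1 / (t\<^sup>2 * (1 + t\<^sup>2)))"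
proof -
 have nz: "1 + t\<^sup>2 \<noteq> 0" using t by (smt (verit) zero_le_power2)
 have i: "(\<integral>\<^sup>+v. ennreal (indicator {0<..} v * f v) \<partial>lborel) = (\<integral>\<^sup>+v. ennreal (f v) * indicator {0..} v \<partial>lborel)" for f :: "real \<Rightarrow> real"
  by (rule nn_integral_cong_AE) (use AE_lborel_singleton[of 0] in \<open>eventually_elim, auto simp: indicator_def\<close>)
 have e0: "((\<lambda>v. exp (- t * v) * h v) \<longlongrightarrow> 0) at_top" if "\<And>v. \<bar>h v\<bar> \<le> 1" for h
 proof (rule Lim_null_comparison)
  show "\<forall>\<^sub>F v in at_top. norm (exp (- t * v) * h v) \<le> exp (- t * v)"
   using that by (simp add: abs_mult mult_left_le)
 qed (use t in real_asymp)
 have e1: "((\<lambda>v. exp (- t * v)) \<longlongrightarrow> 0) at_top" "((\<lambda>v. exp (- t * v) * v) \<longlongrightarrow> 0) at_top"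
  using t by real_asymp+
 note lim = e0[of cos, OF abs_cos_le_one] e0[of sin, OF abs_sin_le_one] e1
 note lim = lim[THEN tendsto_mult_right_zero]
 define A where "A = (\<lambda>v. exp (- t * v) * ((t * cos v - sin v) / (1 + t\<^sup>2) - 1 / t))"
 have "(\<integral>\<^sup>+v. ennreal ((1 - cos v) * exp (- t * v)) * indicator {0..} v \<partial>lborel) = ennreal (0 - A 0)"
 proof (rule nn_integral_FTC_atLeast)
  show "(\<lambda>v. (1 - cos v) * exp (- t * v)) \<in> borel_measurable borel" by measurable
  show "DERIV A v :> (1 - cos v) * exp (- t * v)" for v
  proof -
   let ?t23 = "((t * (- sin v) - cos v) / (1 + t\<^sup>2))"
   let ?t21 = "((t * cos v - sin v) / (1 + t\<^sup>2) - 1 / t)"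
   have "DERIV A v :> exp (- t * v) * (- t) * ?t21 + exp (- t * v) * ?t23"
    unfolding A_def using nz t by (auto intro!: derivative_eq_intros)
   also have "exp (- t * v) * (- t) * ?t21 + exp (- t * v) * ?t23 =
    exp (- t * v) * (1 - (t\<^sup>2 + 1) * cos v / (1 + t\<^sup>2))"
    using t nz by (simp add: divide_simps) (simp add: algebra_simps power2_eq_square)
   also have "\<dots> = (1 - cos v) * exp (- t * v)" using nz by (simp add: add.commute)
   finally show ?thesis .
  qed
  show "0 \<le> (1 - cos v) * exp (- t * v)" for v by simp
  show "(A \<longlongrightarrow> 0) at_top"
  proof -
   have "A = (\<lambda>v. t / (1 + t\<^sup>2) * (exp (- t * v) * cos v) - 1 / (1 + t\<^sup>2) * (exp (- t * v) * sin v) - 1 / t * exp (- t * v))"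
    by (simp add: A_def fun_eq_iff algebra_simps diff_divide_distrib)
   then show ?thesis by (simp only:) (rule tendsto_eq_rhs[OF tendsto_diff[OF tendsto_diff[OF lim(1,2)] lim(3)]], simp)
  qed
 qed
 also have "0 - A 0 = 1 / (t * (1 + t\<^sup>2))"
  unfolding A_def using t nz by (simp add: divide_simps) (simp add: algebra_simps power2_eq_square)
 finally show "(\<integral>\<^sup>+v. ennreal (indicator {0<..} v * ((1 - cos v) * exp (- t * v))) \<partial>lborel) = ennreal (1 / (t * (1 + t\<^sup>2)))"
  unfolding i .
 define B where "B = (\<lambda>v. exp (- t * v) * ((t * sin v + cos v) / (1 + t\<^sup>2) - (v / t + 1 / t\<^sup>2)))"
 have sn: "0 \<le> v - sin v" if "v \<ge> 0" for v :: real using sin_x_le_x[OF that] by simp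
 have "(\<integral>\<^sup>+v. ennreal ((v - sin v) * exp (- t * v)) * indicator {0..} v \<partial>lborel) = ennreal (0 - B 0)"
 proof (rule nn_integral_FTC_atLeast)
  show "(\<lambda>v. (v - sin v) * exp (- t * v)) \<in> borel_measurable borel" by measurable
  show "DERIV B v :> (v - sin v) * exp (- t * v)" for v
  proof -
   let ?t22 = "((t * cos v - sin v) / (1 + t\<^sup>2) - 1 / t)"
   let ?t20 = "((t * sin v + cos v) / (1 + t\<^sup>2) - (v / t + 1 / t\<^sup>2))"
   have "DERIV B v :> exp (- t * v) * (- t) * ?t20 + exp (- t * v) * ?t22"
    unfolding B_def using nz t by (auto intro!: derivative_eq_intros)
   also have "exp (- t * v) * (- t) * ?t20 + exp (- t * v) * ?t22 =
    exp (- t * v) * (v - (t\<^sup>2 + 1) * sin v / (1 + t\<^sup>2))"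
    using t nz by (simp add: divide_simps) (simp add: algebra_simps power2_eq_square)
   also have "\<dots> = (v - sin v) * exp (- t * v)" using nz by (simp add: add.commute)
   finally show ?thesis .
  qed
  show "0 \<le> (v - sin v) * exp (- t * v)" if "0 \<le> v" for v using sn[OF that] by simp
  show "(B \<longlongrightarrow> 0) at_top"
  proof -
   have "B = (\<lambda>v. t / (1 + t\<^sup>2) * (exp (- t * v) * sin v) + 1 / (1 + t\<^sup>2) * (exp (- t * v) * cos v) - 1 / t * (exp (- t * v) * v) - 1 / t\<^sup>2 * exp (- t * v))"
    by (simp add: B_def fun_eq_iff algebra_simps add_divide_distrib)
   then show ?thesis by (simp only:) (rule tendsto_eq_rhs[OF tendsto_diff[OF tendsto_diff[OF tendsto_add[OF lim(2,1)] lim(4)] lim(3)]], simp)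
  qed
 qed
 also have "0 - B 0 = 1 / (t\<^sup>2 * (1 + t\<^sup>2))"
  unfolding B_def using t nz by (simp add: divide_simps)
 finally show "(\<integral>\<^sup>+v. ennreal (indicator {0<..} v * ((v - sin v) * exp (- t * v))) \<partial>lborel) = ennreal (1 / (t\<^sup>2 * (1 + t\<^sup>2)))"
  unfolding i .
qed

text \<open>The power \<open>v powr (- p - 1)\<close> is itself a Laplace integral, namely
  \<open>1 / Gamma (p + 1)\<close> times that of \<open>t powr p * exp (- t * v)\<close> in
  \<open>t\<close>. Exchanging the integrals trades the singular weight for the Laplace transform
  \<open>k\<close> of \<open>g\<close>.\<close>

lemma nn_integral_powr_laplace:
 fixes g k :: "real \<Rightarrow> real"
 assumes p: "p > 0" and [measurable]: "g \<in> borel_measurable borel" "k \<in> borel_measurable borel" and g: "\<And>v. v > 0 \<Longrightarrow> g v \<ge> 0"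
  and k: "\<And>t. t > 0 \<Longrightarrow> (\<integral>\<^sup>+v. ennreal (indicator {0<..} v * (g v * exp (- t * v))) \<partial>lborel) = ennreal (k t)"
 shows "(\<integral>\<^sup>+v. ennreal (indicator {0<..} v * v powr (- p - 1)) * ennreal (g v) \<partial>lborel) =
  ennreal (1 / Gamma (p + 1)) * (\<integral>\<^sup>+t. ennreal (indicator {0<..} t * t powr p) * ennreal (k t) \<partial>lborel)"
proof -
 let ?t1 = "(1 / Gamma (p + 1))"
 let ?i = "indicator {0<..} :: real \<Rightarrow> real"
 have G: "Gamma (p + 1) > 0" using p by (intro Gamma_real_pos) simp
 have e: "ennreal (?i v * v powr (- p - 1)) * ennreal (g v) =
   (\<integral>\<^sup>+t. ennreal ?t1 * (ennreal (?i t * t powr p) * ennreal (?i v * (g v * exp (- t * v)))) \<partial>lborel)" for v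
 proof (cases "v > 0")
  case True
  have g1: "p + 1 > 0" using p by simp
  have "(\<integral>\<^sup>+t. ennreal ?t1 * (ennreal (?i t * t powr p) * ennreal (?i v * (g v * exp (- t * v)))) \<partial>lborel) =
    (\<integral>\<^sup>+t. ennreal (g v / Gamma (p + 1)) * ennreal (?i t * (t powr (p + 1 - 1) * exp (- v * t))) \<partial>lborel)"
  proof (rule nn_integral_cong, goal_cases)
   case (1 t)
   show ?case using True G g[OF True] by (cases "t > 0") (simp_all add: ennreal_mult[symmetric] mult_ac)
  qed
  also have "\<dots> = ennreal (g v / Gamma (p + 1)) * ennreal (Gamma (p + 1) * v powr (- (p + 1)))"
   unfolding nn_integral_powr_exp[OF True g1, symmetric] by (rule nn_integral_cmult) measurable
  also have "\<dots> = ennreal (v powr (- p - 1) * g v)"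
  proof -
   have "- (p + 1) = - p - 1" by simp
   moreover have "g v / Gamma (p + 1) * (Gamma (p + 1) * X) = X * g v" for X using G by simp
   ultimately show ?thesis using G g[OF True] by (simp only: ennreal_mult[symmetric] divide_nonneg_pos powr_ge_zero zero_le_mult_iff less_imp_le simp_thms)
  qed
  finally show ?thesis using True g[OF True] by (simp add: ennreal_mult)
 qed simp
 have "(\<integral>\<^sup>+v. ennreal (?i v * v powr (- p - 1)) * ennreal (g v) \<partial>lborel) =
   (\<integral>\<^sup>+t. \<integral>\<^sup>+v. ennreal ?t1 * (ennreal (?i t * t powr p) * ennreal (?i v * (g v * exp (- t * v)))) \<partial>lborel \<partial>lborel)"
  unfolding e by (rule lborel_pair.Fubini') measurable
 also have "\<dots> = (\<integral>\<^sup>+t. ennreal ?t1 * (ennreal (?i t * t powr p) * ennreal (k t)) \<partial>lborel)"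
 proof (rule nn_integral_cong, goal_cases)
  case (1 t)
  have "(\<integral>\<^sup>+v. ennreal ?t1 * (ennreal (?i t * t powr p) * ennreal (?i v * (g v * exp (- t * v)))) \<partial>lborel) =
    ennreal ?t1 * (ennreal (?i t * t powr p) * (\<integral>\<^sup>+v. ennreal (?i v * (g v * exp (- t * v))) \<partial>lborel))"
   by (subst nn_integral_cmult, measurable, subst nn_integral_cmult, measurable)
  then show ?case using k[of t] by (cases "t > 0") simp_all
 qed
 also have "\<dots> = ennreal ?t1 * (\<integral>\<^sup>+t. ennreal (?i t * t powr p) * ennreal (k t) \<partial>lborel)"
  by (rule nn_integral_cmult) measurable
 finally show ?thesis .
qed

text \<open>Replacing \<open>s\<close> by \<open>y powr p * s\<close> absorbs the factor
  \<open>y\<close> and leaves the case \<open>y = 1\<close>, which is the integral of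
  \<open>nn_integral_powr_laplace\<close> in the coordinate \<open>s\<close>.\<close>

lemma nn_integral_powr_inverse:
 fixes g k :: "real \<Rightarrow> real"
 assumes p: "p > 0" and [measurable]: "g \<in> borel_measurable borel" "k \<in> borel_measurable borel"
  and g: "\<And>v. v > 0 \<Longrightarrow> g v \<ge> 0"
  and k: "\<And>t. t > 0 \<Longrightarrow> (\<integral>\<^sup>+v. ennreal (indicator {0<..} v * (g v * exp (- t * v))) \<partial>lborel) = ennreal (k t)"
  and R: "(\<integral>\<^sup>+t. ennreal (indicator {0<..} t * t powr p) * ennreal (k t) \<partial>lborel) = ennreal R" "R \<ge> 0" and y: "y > 0"
 shows "(\<integral>\<^sup>+s. ennreal (indicator {0<..} s * g (s powr (- 1 / p) * y)) \<partial>lborel) = ennreal (y powr p * (p * (R / Gamma (p + 1))))" (is "_ = ?r1")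
proof -
 let ?i = "indicator {0<..} :: real \<Rightarrow> real"
 define X where "X = (\<integral>\<^sup>+s. ennreal (?i s * g (s powr (- 1 / p))) \<partial>lborel)"
 have G: "Gamma (p + 1) > 0" using p by (intro Gamma_real_pos) simp
 have "ennreal (1 / p) * X = (\<integral>\<^sup>+s. ennreal (1 / p) * ennreal (?i s * g (s powr (- 1 / p))) \<partial>lborel)"
  unfolding X_def by (rule nn_integral_cmult[symmetric]) measurable
 also have "\<dots> = (\<integral>\<^sup>+s. ennreal (1 / p * ?i s) * ennreal (g (s powr (- 1 / p))) \<partial>lborel)"
  by (intro nn_integral_cong) (auto simp: indicator_def)
 also have "\<dots> = (\<integral>\<^sup>+v. ennreal (?i v * v powr (- p - 1)) * ennreal (g v) \<partial>lborel)"
  by (rule nn_integral_powr_substitution[OF p, symmetric]) measurable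
 also have "\<dots> = ennreal (1 / Gamma (p + 1)) * ennreal R"
  unfolding R(1)[symmetric] by (rule nn_integral_powr_laplace[OF p _ _ g k]) auto
 also have "\<dots> = ennreal (R / Gamma (p + 1))" using G R(2) by (simp flip: ennreal_mult)
 finally have "ennreal p * (ennreal (1 / p) * X) = ennreal p * ennreal (R / Gamma (p + 1))" by (rule arg_cong)
 then have X: "X = ennreal (p * (R / Gamma (p + 1)))"
  using p G R(2) by (simp add: mult.assoc[symmetric] ennreal_mult[symmetric])
 have c: "y powr p > 0" using y by simp
 have "(\<integral>\<^sup>+s. ennreal (?i s * g (s powr (- 1 / p) * y)) \<partial>lborel) =
   ennreal (\<bar>y powr p\<bar> ^ DIM(real)) * (\<integral>\<^sup>+s. ennreal (?i (0 + y powr p *\<^sub>R s) * g ((0 + y powr p *\<^sub>R s) powr (- 1 / p) * y)) \<partial>lborel)"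
  by (rule nn_integral_lborel_affine) (use c in auto)
 also have "(\<integral>\<^sup>+s. ennreal (?i (0 + y powr p *\<^sub>R s) * g ((0 + y powr p *\<^sub>R s) powr (- 1 / p) * y)) \<partial>lborel) = X"
  unfolding X_def
 proof (rule nn_integral_cong, goal_cases)
  case (1 s)
  show ?case
  proof (cases "s > 0")
   case True
   have "(y powr p * s) powr (- 1 / p) = (y powr p) powr (- 1 / p) * s powr (- 1 / p)" by (rule powr_mult)
   also have "(y powr p) powr (- 1 / p) = y powr - 1" using p by (simp add: powr_powr)
   also have "y powr - 1 = 1 / y" using y by (simp only: powr_minus_divide powr_one)
   finally have "(y powr p * s) powr (- 1 / p) * y = s powr (- 1 / p)" using y by simp
   then show ?thesis using True c by (simp add: zero_less_mult_iff)
  next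
   case False
   then have "\<not> y powr p * s > 0" using c by (simp add: zero_less_mult_iff)
   then show ?thesis using False by simp
  qed
 qed
 also have "ennreal (\<bar>y powr p\<bar> ^ DIM(real)) * X = ?r1"
  unfolding X using p G R(2) by (subst ennreal_mult) auto
 finally show ?thesis .
qed

text \<open>The reflection formula at \<open>p - 1\<close> and the double angle formula
  \<open>sin (2 * q - pi) = - 2 * sin q * cos q\<close>, with \<open>q = pi * p / 2\<close>, express
  \<open>Gamma (p - 1)\<close> through \<open>Gamma (2 - p)\<close>; two steps of the functional
  equation lead to \<open>Gamma (p + 1)\<close>.\<close>

lemma stable_constants:
 assumes p: "1 < p" "p < (2::real)"
 defines "K \<equiv> Gamma (2 - p) / (p * (p - 1))"
 shows "pi / (2 * sin (pi * p / 2)) / Gamma (p + 1) = - (K * cos (pi * p / 2))"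
  and "pi / (2 * sin (pi * (p - 1) / 2)) / Gamma (p + 1) = K * sin (pi * p / 2)"
  and "K > 0" "cos (pi * p / 2) < 0" "sin (pi * p / 2) > 0"
proof -
 define q where "q = pi * p / 2"
 have q: "pi / 2 < q" "q < pi" using p by (auto simp: q_def)
 have s: "sin q > 0" using q pi_gt_zero by (intro sin_gt_zero) linarith+
 have "sin (q - pi / 2) > 0" using q by (intro sin_gt_zero) linarith+
 then have c: "cos q < 0" by (simp add: sin_diff)
 have g: "Gamma (p - 1) > 0" "Gamma (2 - p) > 0" using p by (auto intro!: Gamma_real_pos)
 have e1: "Gamma (p + 1) = p * Gamma p" using p by (intro Gamma_plus1) (auto simp: nonpos_Ints_def)
 have "Gamma ((p - 1) + 1) = (p - 1) * Gamma (p - 1)"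
  using p by (intro Gamma_plus1) (auto elim!: nonpos_Ints_cases)
 then have e2: "Gamma (p + 1) = p * ((p - 1) * Gamma (p - 1))" using e1 by simp
 have "complex_of_real (Gamma (p - 1) * Gamma (1 - (p - 1))) = of_real (pi / sin (pi * (p - 1)))"
  using Gamma_reflection_complex[of "of_real (p - 1)"]
  by (simp only: of_real_mult of_real_divide Gamma_complex_of_real[symmetric] of_real_diff of_real_1 sin_of_real[symmetric])
 then have "Gamma (p - 1) * Gamma (1 - (p - 1)) = pi / sin (pi * (p - 1))" by (simp only: of_real_eq_iff)
 also have "1 - (p - 1) = 2 - p" by simp
 also have "pi * (p - 1) = 2 * q - pi" by (simp add: q_def algebra_simps)
 also have "sin (2 * q - pi) = - 2 * sin q * cos q" by (simp add: sin_diff sin_double)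
 finally have r: "Gamma (p - 1) = pi / (- 2 * sin q * cos q) / Gamma (2 - p)"
  using g by (simp only: eq_divide_eq) simp
 have m: "1 / Gamma (p + 1) = K * (- 2 * sin q * cos q) / pi"
  unfolding e2 r K_def using g s c p by (simp add: mult_ac)
 have "pi / (2 * S) / Gamma (p + 1) = pi / (2 * S) * (1 / Gamma (p + 1))" for S by simp
 then have n: "pi / (2 * S) / Gamma (p + 1) = K * (- sin q * cos q) / S" for S unfolding m by simp
 show "pi / (2 * sin (pi * p / 2)) / Gamma (p + 1) = - (K * cos (pi * p / 2))"
  unfolding n q_def[symmetric] using s by simp
 have "pi * (p - 1) / 2 = q - pi / 2" by (simp add: q_def algebra_simps diff_divide_distrib)
 then have "sin (pi * (p - 1) / 2) = - cos q" by (simp only: sin_diff) simp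
 then show "pi / (2 * sin (pi * (p - 1) / 2)) / Gamma (p + 1) = K * sin (pi * p / 2)"
  unfolding n q_def[symmetric] using c by simp
 show "K > 0" unfolding K_def using g p by simp
 show "cos (pi * p / 2) < 0" "sin (pi * p / 2) > 0" using s c by (simp_all only: q_def)
qed

text \<open>For positive arguments the real and the imaginary part of \<open>- Psi\<close> are
  \<open>1 - cos v\<close> and \<open>v - sin v\<close>, both nonnegative. Value and integrability
  thus come together from nonnegative integrals.\<close>

lemma stable_integral_pos:
 assumes b: "1 < b" "b < (2::real)" and y: "y > 0"
 defines "K \<equiv> Gamma (2 - b) / (b * (b - 1))"
 shows "(CLINT s|lborel. indicator {0<..} s *\<^sub>R Psi (s powr (- 1 / b) * y)) =
  complex_of_real (y powr b * b * K) * Complex (cos (pi * b / 2)) (- sin (pi * b / 2))"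
proof -
 let ?t2 = "(2 * sin (pi * b / 2))"
 let ?t1 = "(2 * sin (pi * (b - 1) / 2))"
 let ?i = "indicator {0<..} :: real \<Rightarrow> real"
 note sc = stable_constants[OF b, folded K_def]
 have g0: "b > 0" using b by simp
 define u where "u = (\<lambda>s. ?i s * (1 - cos (s powr (- 1 / b) * y)))"
 let ?t3 = "(\<integral>s. u s \<partial>lborel)"
 define w where "w = (\<lambda>s. ?i s * (s powr (- 1 / b) * y - sin (s powr (- 1 / b) * y)))"
 let ?t4 = "(\<integral>s. w s \<partial>lborel)"
 have [measurable]: "u \<in> borel_measurable lborel" "w \<in> borel_measurable lborel" by (simp_all add: u_def w_def)
 have sn: "0 \<le> v - sin v" if "v > 0" for v :: real using sin_x_le_x[of v] that by simp
 have u0: "u s \<ge> 0" for s by (simp add: u_def)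
 have w0: "w s \<ge> 0" for s
 proof (cases "s > 0")
  case True
  then have "s powr (- 1 / b) * y > 0" using y by simp
  from sn[OF this] show ?thesis by (simp add: w_def)
 qed (simp add: w_def)
 have "(\<integral>\<^sup>+s. ennreal (u s) \<partial>lborel) = ennreal (y powr b * (b * (pi / ?t2 / Gamma (b + 1))))"
  unfolding u_def
 proof (rule nn_integral_powr_inverse[OF g0 _ _ _ nn_integral_one_minus_cos_exp(1) _ _ y])
  have "(\<integral>\<^sup>+t. ennreal (?i t * t powr b) * ennreal (1 / (t * (1 + t\<^sup>2))) \<partial>lborel) =
   (\<integral>\<^sup>+t. ennreal (?i t * (t powr (b - 1) / (1 + t\<^sup>2))) \<partial>lborel)"
  proof (rule nn_integral_cong, goal_cases)
   case (1 t)
   show ?case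
   proof (cases "t > 0")
    case True
    have "t powr b * (1 / (t * (1 + t\<^sup>2))) = t powr (b - 1) / (1 + t\<^sup>2)"
     using True by (simp add: powr_diff)
    then show ?thesis using True by (simp add: ennreal_mult[symmetric])
   qed simp
  qed
  also have "\<dots> = ennreal (pi / ?t2)" by (rule nn_integral_powr_over_one_plus_square) (use b in auto)
  finally show "(\<integral>\<^sup>+t. ennreal (?i t * t powr b) * ennreal (1 / (t * (1 + t\<^sup>2))) \<partial>lborel) = ennreal (pi / ?t2)" .
  show "0 \<le> pi / ?t2" using sc(5) by simp
 qed auto
 then have "integrable lborel u \<and> ?t3 = y powr b * (b * - (K * cos (pi * b / 2)))"
  unfolding sc(1) using u0 b sc(3,4)
  by (subst nn_integral_eq_integrable[symmetric]) (auto intro!: mult_nonneg_nonneg mult_nonneg_nonpos)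
 then have u: "integrable lborel u" "?t3 = y powr b * (b * - (K * cos (pi * b / 2)))" by auto
 have "(\<integral>\<^sup>+s. ennreal (w s) \<partial>lborel) = ennreal (y powr b * (b * (pi / ?t1 / Gamma (b + 1))))"
  unfolding w_def
 proof (rule nn_integral_powr_inverse[OF g0 _ _ sn nn_integral_one_minus_cos_exp(2) _ _ y])
  have "(\<integral>\<^sup>+t. ennreal (?i t * t powr b) * ennreal (1 / (t\<^sup>2 * (1 + t\<^sup>2))) \<partial>lborel) =
   (\<integral>\<^sup>+t. ennreal (?i t * (t powr ((b - 1) - 1) / (1 + t\<^sup>2))) \<partial>lborel)"
  proof (rule nn_integral_cong, goal_cases)
   case (1 t)
   show ?case
   proof (cases "t > 0")
    case True
    have "t powr ((b - 1) - 1) = t powr b / t / t" using True by (simp only: powr_diff powr_one)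
    then have "t powr b * (1 / (t\<^sup>2 * (1 + t\<^sup>2))) = t powr ((b - 1) - 1) / (1 + t\<^sup>2)"
     by (simp add: power2_eq_square)
    then show ?thesis using True by (simp add: ennreal_mult[symmetric])
   qed simp
  qed
  also have "\<dots> = ennreal (pi / ?t1)" by (rule nn_integral_powr_over_one_plus_square) (use b in auto)
  finally show "(\<integral>\<^sup>+t. ennreal (?i t * t powr b) * ennreal (1 / (t\<^sup>2 * (1 + t\<^sup>2))) \<partial>lborel) = ennreal (pi / ?t1)" .
  have "sin (pi * (b - 1) / 2) > 0" using b by (intro sin_gt_zero) (auto simp: field_simps)
  then show "0 \<le> pi / ?t1" by simp
 qed auto
 then have "integrable lborel w \<and> ?t4 = y powr b * (b * (K * sin (pi * b / 2)))"
  unfolding sc(2) using w0 b sc(3,5) by (subst nn_integral_eq_integrable[symmetric]) auto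
 then have w: "integrable lborel w" "?t4 = y powr b * (b * (K * sin (pi * b / 2)))" by auto
 have p: "?i s *\<^sub>R Psi (s powr (- 1 / b) * y) = - complex_of_real (u s) - \<i> * complex_of_real (w s)" for s
  by (simp add: u_def w_def Psi_eq_Complex complex_eq_iff right_diff_distrib)
 have "(CLINT s|lborel. ?i s *\<^sub>R Psi (s powr (- 1 / b) * y)) = - complex_of_real ?t3 - \<i> * complex_of_real ?t4"
  unfolding p using u(1) w(1) by simp
 then show ?thesis unfolding u(2) w(2) by (simp add: complex_eq_iff)
qed

text \<open>The constant is chosen so that
  \<open>c_gamma p powr p = - (K * cos (pi * p / 2))\<close>; dividing by it turns
  \<open>cos - \<i> * sin\<close> into a negative multiple of \<open>1 - \<i> * tan\<close>.
  Negative \<open>y\<close> is reduced to positive \<open>y\<close> by complex conjugation, which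
  reverses the sign of the tangent term.\<close>

lemma stable_integral:
 assumes p: "1 < p" "p < (2::real)"
 shows "(CLINT s|lborel. indicator {0<..} s *\<^sub>R Psi (s powr (- 1 / p) * (y / c_gamma p))) =
  complex_of_real (- (p * \<bar>y\<bar> powr p)) * (1 - \<i> * complex_of_real (sgn y * tan (pi * p / 2)))"
  and "c_gamma p > 0"
proof -
 let ?t2 = "(1 - \<i> * complex_of_real (tan (pi * p / 2)))"
 define K where "K = Gamma (2 - p) / (p * (p - 1))"
 let ?t1 = "(K * cos (pi * p / 2))"
 note sc = stable_constants[OF p, folded K_def]
 have pos: "- ?t1 > 0" using sc(3,4) by (simp add: mult_pos_neg)
 have c: "c_gamma p = (- ?t1) powr (1 / p)" by (simp add: c_gamma_def K_def)
 have nz: "K \<noteq> 0" "cos (pi * p / 2) \<noteq> 0" using sc(3,4) by linarith+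
 show c0: "c_gamma p > 0" unfolding c powr_gt_zero using pos by linarith
 have cp: "c_gamma p powr p = - ?t1" unfolding c using pos p by (simp add: powr_powr)
 have main: "(CLINT s|lborel. indicator {0<..} s *\<^sub>R Psi (s powr (- 1 / p) * (y / c_gamma p))) =
  complex_of_real (- (p * y powr p)) * ?t2" if y: "y > 0" for y
 proof -
  have "(y / c_gamma p) powr p = y powr p / c_gamma p powr p" using y c0 by (simp add: powr_divide)
  also have "\<dots> * p * K = - (p * y powr p) / cos (pi * p / 2)" unfolding cp using nz by simp
  finally have e: "(y / c_gamma p) powr p * p * K = - (p * y powr p) / cos (pi * p / 2)" .
  have "y / c_gamma p > 0" using y c0 by simp
  from stable_integral_pos[OF p this, folded K_def] show ?thesis
   unfolding e using sc(4) by (simp add: complex_eq_iff tan_def)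
 qed
 consider "y > 0" | "y = 0" | "y < 0" by linarith
 then show "(CLINT s|lborel. indicator {0<..} s *\<^sub>R Psi (s powr (- 1 / p) * (y / c_gamma p))) =
  complex_of_real (- (p * \<bar>y\<bar> powr p)) * (1 - \<i> * complex_of_real (sgn y * tan (pi * p / 2)))"
 proof cases
  case 1
  with main[OF 1] show ?thesis by (simp add: sgn_if)
 next
  case 2
  then show ?thesis by (simp add: Psi_def)
 next
  case 3
  have "indicator {0<..} s *\<^sub>R Psi (s powr (- 1 / p) * (y / c_gamma p)) = cnj (indicator {0<..} s *\<^sub>R Psi (s powr (- 1 / p) * (- y / c_gamma p)))" for s :: real
   by (simp add: Psi_eq_Complex complex_eq_iff)
  then have "(CLINT s|lborel. indicator {0<..} s *\<^sub>R Psi (s powr (- 1 / p) * (y / c_gamma p))) =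
   cnj (CLINT s|lborel. indicator {0<..} s *\<^sub>R Psi (s powr (- 1 / p) * (- y / c_gamma p)))"
   by (simp only: Bochner_Integration.integral_cnj)
  also have "\<dots> = cnj (complex_of_real (- (p * (- y) powr p)) * ?t2)" using 3 by (subst main) auto
  finally show ?thesis using 3 by (simp add: sgn_if complex_eq_iff)
 qed
qed

subsection \<open>Averages over small grains\<close>

lemma nn_integral_translate:
 fixes f :: "'a::euclidean_space \<Rightarrow> ennreal"
 assumes "f \<in> borel_measurable borel"
 shows "(\<integral>\<^sup>+x. f (x + h) \<partial>lborel) = (\<integral>\<^sup>+x. f x \<partial>lborel)"
 using nn_integral_lborel_affine[OF assms, of 1 h] by (simp add: add.commute)

text \<open>The indicator of an open set is lower semicontinuous, so its loss
  \<open>max 0 (indicator U x - indicator U (x + h n))\<close> is eventually 0 at every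
  point.\<close>

lemma indicator_translation_tendsto:
 fixes U :: "'a::euclidean_space set" and h :: "nat \<Rightarrow> 'a"
 assumes U: "open U" "emeasure lborel U < \<infinity>" and h: "h \<longlonglongrightarrow> 0"
 shows "(\<lambda>n. \<integral>\<^sup>+x. ennreal \<bar>indicator U (x + h n) - indicator U x\<bar> \<partial>lborel) \<longlonglongrightarrow> 0"
proof -
 have [measurable]: "U \<in> sets borel" using U(1) by simp
 let ?i = "indicator U :: 'a \<Rightarrow> real"
 have fin: "(\<integral>\<^sup>+x. ennreal (?i x) \<partial>lborel) < \<infinity>" using U(2) by (simp add: ennreal_indicator)
 have fin': "(\<integral>\<^sup>+x. ennreal (?i (x + h n)) \<partial>lborel) = (\<integral>\<^sup>+x. ennreal (?i x) \<partial>lborel)" for n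
  by (rule nn_integral_translate) measurable
 have m: "(\<lambda>n. \<integral>\<^sup>+x. ennreal (max 0 (?i x - ?i (x + h n))) \<partial>lborel) \<longlonglongrightarrow> (\<integral>\<^sup>+x. 0 \<partial>(lborel :: 'a measure))"
 proof (rule nn_integral_dominated_convergence[where w = "\<lambda>x. ennreal (?i x)"])
  show "AE x in lborel. (\<lambda>n. ennreal (max 0 (?i x - ?i (x + h n)))) \<longlonglongrightarrow> 0"
  proof (rule AE_I2, goal_cases)
   case (1 x)
   have "\<forall>\<^sub>F n in sequentially. max 0 (?i x - ?i (x + h n)) = 0"
   proof (cases "x \<in> U")
    case True
    have "(\<lambda>n. x + h n) \<longlonglongrightarrow> x + 0" by (intro tendsto_intros h)
    then have "\<forall>\<^sub>F n in sequentially. x + h n \<in> U"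
     using topological_tendstoD[OF _ U(1)] True by fastforce
    then show ?thesis by eventually_elim (simp add: True)
   qed (auto simp: indicator_def)
   then show ?case by (rule tendsto_eventually[OF eventually_mono]) (simp only: ennreal_0)
  qed
 qed (use fin in \<open>auto simp: indicator_def\<close>)
 txt \<open>Both translates of \<open>U\<close> have the same volume, so it suffices to control one of the two
  differences.\<close>
 have d: "(\<integral>\<^sup>+x. ennreal \<bar>?i (x + h n) - ?i x\<bar> \<partial>lborel) = 2 * (\<integral>\<^sup>+x. ennreal (max 0 (?i x - ?i (x + h n))) \<partial>lborel)" for n
 proof -
  let ?p = "\<lambda>x. max 0 (?i (x + h n) - ?i x)" and ?q = "\<lambda>x. max 0 (?i x - ?i (x + h n))"
  have "(\<integral>\<^sup>+x. ennreal (?p x) \<partial>lborel) + (\<integral>\<^sup>+x. ennreal (?i x) \<partial>lborel) = (\<integral>\<^sup>+x. ennreal (?q x) \<partial>lborel) + (\<integral>\<^sup>+x. ennreal (?i (x + h n)) \<partial>lborel)"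
   by (subst (1 2) nn_integral_add[symmetric]) (auto intro!: nn_integral_cong simp: indicator_def ennreal_neg)
  then have "(\<integral>\<^sup>+x. ennreal (?p x) \<partial>lborel) = (\<integral>\<^sup>+x. ennreal (?q x) \<partial>lborel)"
   unfolding fin' using fin by (simp add: ennreal_add_left_cancel add.commute less_top[symmetric])
  moreover have "(\<integral>\<^sup>+x. ennreal \<bar>?i (x + h n) - ?i x\<bar> \<partial>lborel) = (\<integral>\<^sup>+x. ennreal (?p x) \<partial>lborel) + (\<integral>\<^sup>+x. ennreal (?q x) \<partial>lborel)"
   by (subst nn_integral_add[symmetric]) (auto intro!: nn_integral_cong simp: indicator_def ennreal_neg)
  ultimately show ?thesis by (simp add: mult_2)
 qed
 show ?thesis unfolding d using ennreal_tendsto_cmult[OF _ m, of 2] by simp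
qed

text \<open>Continuity of translations in L1, built up from open sets: outer regularity reaches
  Borel sets of finite volume, and the induction over integrable functions reaches the rest.\<close>

lemma translation_tendsto:
 fixes f :: "'a::euclidean_space \<Rightarrow> real" and h :: "nat \<Rightarrow> 'a"
 assumes f: "integrable lborel f" and h: "h \<longlonglongrightarrow> 0"
 shows "(\<lambda>n. \<integral>\<^sup>+x. ennreal \<bar>f (x + h n) - f x\<bar> \<partial>lborel) \<longlonglongrightarrow> 0"
proof -
 let ?T = "\<lambda>f::'a \<Rightarrow> real. \<lambda>n. \<integral>\<^sup>+x. ennreal \<bar>f (x + h n) - f x\<bar> \<partial>lborel"
 txt \<open>The class of functions for which the claim holds is closed in \<open>L\<^sup>1\<close>.\<close>
 have close: "?T f \<longlonglongrightarrow> 0"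
  if [measurable]: "f \<in> borel_measurable borel"
   and g: "\<And>e::real. e > 0 \<Longrightarrow> \<exists>g. g \<in> borel_measurable borel \<and> ?T g \<longlonglongrightarrow> 0 \<and> (\<integral>\<^sup>+x. ennreal \<bar>f x - g x\<bar> \<partial>lborel) \<le> ennreal e" for f
 proof (rule tendsto_zero_ennreal)
  fix e :: real assume e: "0 < e"
  then have "e / 4 > 0" by simp
  from g[OF this] obtain g where [measurable]: "g \<in> borel_measurable borel" and gT: "?T g \<longlonglongrightarrow> 0"
   and gf: "(\<integral>\<^sup>+x. ennreal \<bar>f x - g x\<bar> \<partial>lborel) \<le> ennreal (e / 4)" by blast
  let ?t1 = "(\<integral>\<^sup>+x. ennreal \<bar>f x - g x\<bar> \<partial>lborel)"
  have "\<forall>\<^sub>F n in sequentially. ?T g n < ennreal (e / 4)" using e by (intro order_tendstoD(2)[OF gT]) simp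
  then show "\<forall>\<^sub>F n in sequentially. ?T f n < ennreal e"
  proof eventually_elim
   case (elim n)
   have "?T f n \<le> (\<integral>\<^sup>+x. ennreal \<bar>f (x + h n) - g (x + h n)\<bar> + (ennreal \<bar>g (x + h n) - g x\<bar> + ennreal \<bar>f x - g x\<bar>) \<partial>lborel)"
    by (intro nn_integral_mono) (simp flip: ennreal_plus)
   also have "\<dots> = (\<integral>\<^sup>+x. ennreal \<bar>f (x + h n) - g (x + h n)\<bar> \<partial>lborel) + (?T g n + ?t1)"
    by (subst nn_integral_add, measurable)+
   also have "(\<integral>\<^sup>+x. ennreal \<bar>f (x + h n) - g (x + h n)\<bar> \<partial>lborel) = ?t1"
    by (rule nn_integral_translate) measurable
   also have "?t1 + (?T g n + ?t1) \<le> ennreal (e / 4) + (ennreal (e / 4) + ennreal (e / 4))"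
    using gf elim by (intro add_mono) auto
   also have "\<dots> < ennreal e" using e by (simp add: ennreal_less_iff flip: ennreal_plus)
   finally show ?case .
  qed
 qed
 have plus: "?T (\<lambda>x. f x + g x) \<longlonglongrightarrow> 0" if [measurable]: "f \<in> borel_measurable borel" "g \<in> borel_measurable borel"
   and fg: "?T f \<longlonglongrightarrow> 0" "?T g \<longlonglongrightarrow> 0" for f g
 proof (rule tendsto_sandwich[OF always_eventually always_eventually tendsto_const])
  let ?t20 = "(\<lambda>x. f x + g x)"
  show "\<forall>n. ?T ?t20 n \<le> ?T f n + ?T g n"
  proof
   fix n
   have "?T ?t20 n \<le> (\<integral>\<^sup>+x. ennreal \<bar>f (x + h n) - f x\<bar> + ennreal \<bar>g (x + h n) - g x\<bar> \<partial>lborel)"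
    by (intro nn_integral_mono) (simp flip: ennreal_plus)
   also have "\<dots> = ?T f n + ?T g n" by (rule nn_integral_add) measurable
   finally show "?T ?t20 n \<le> ?T f n + ?T g n" .
  qed
  show "(\<lambda>n. ?T f n + ?T g n) \<longlonglongrightarrow> 0" using tendsto_add[OF fg] by simp
 qed simp
 have scale: "?T (\<lambda>x. g x * c) \<longlonglongrightarrow> 0" if [measurable]: "g \<in> borel_measurable borel" and g: "?T g \<longlonglongrightarrow> 0" for g c
 proof -
  have "?T (\<lambda>x. g x * c) n = ennreal \<bar>c\<bar> * ?T g n" for n
   by (subst nn_integral_cmult[symmetric])
    (auto simp flip: ennreal_mult abs_mult left_diff_distrib simp: mult.commute[of c] intro!: nn_integral_cong)
  then show ?thesis using ennreal_tendsto_cmult[OF _ g, of "ennreal \<bar>c\<bar>"] by simp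
 qed
 have ind: "?T (indicator A) \<longlonglongrightarrow> 0" if A: "A \<in> sets borel" "emeasure lborel A < \<infinity>" for A
 proof (rule close)
  show "(indicator A :: 'a \<Rightarrow> real) \<in> borel_measurable borel" using A by simp
  fix e :: real assume e: "e > 0"
  obtain U where U: "open U" "A \<subseteq> U" "emeasure lborel (U - A) < ennreal e"
   using outer_regular_lborel[OF A(1), of e] e by blast
  have [measurable]: "U \<in> sets borel" "A \<in> sets borel" using U A by auto
  have "emeasure lborel U \<le> emeasure lborel (U - A) + emeasure lborel A"
   using U A by (subst plus_emeasure) (auto simp: Un_absorb2)
  also have "\<dots> < \<infinity>"
   using less_trans[OF U(3) ennreal_less_top] A(2) by (simp add: ennreal_add_less_top)
  finally have "emeasure lborel U < \<infinity>" .
  from indicator_translation_tendsto[OF U(1) this h]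
  have 1: "?T (indicator U) \<longlonglongrightarrow> 0" .
  have "(\<integral>\<^sup>+x. ennreal \<bar>indicator A x - indicator U x\<bar> \<partial>lborel) = (\<integral>\<^sup>+x. indicator (U - A) x \<partial>lborel)"
   using U(2) by (intro nn_integral_cong) (auto simp: indicator_def)
  also have "\<dots> \<le> ennreal e" using U(3) A(1) by simp
  finally show "\<exists>g. g \<in> borel_measurable borel \<and> ?T g \<longlonglongrightarrow> 0 \<and> (\<integral>\<^sup>+x. ennreal \<bar>indicator A x - g x\<bar> \<partial>lborel) \<le> ennreal e"
   using 1 by (intro exI[of _ "indicator U"]) auto
 qed
 show ?thesis using f
 proof (induction rule: integrable_induct)
  case (base A c)
  from scale[OF _ ind[OF _ base(2)], of c] base(1) show ?case by simp
 next
  case (add f g)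
  then show ?case by (intro plus) auto
 next
  case (lim f s)
  have [measurable]: "f \<in> borel_measurable borel" "s i \<in> borel_measurable borel" for i
   using lim.hyps(1,4) borel_measurable_integrable by auto
  have "(\<lambda>i. \<integral>\<^sup>+x. ennreal \<bar>f x - s i x\<bar> \<partial>lborel) \<longlonglongrightarrow> (\<integral>\<^sup>+x. 0 \<partial>(lborel :: 'a measure))"
  proof (rule nn_integral_dominated_convergence[where w = "\<lambda>x. 3 * ennreal \<bar>f x\<bar>"])
   show "AE x in lborel. ennreal \<bar>f x - s j x\<bar> \<le> 3 * ennreal \<bar>f x\<bar>" for j
   proof (rule AE_I2)
    fix x
    have "\<bar>f x - s j x\<bar> \<le> 3 * \<bar>f x\<bar>" using lim.hyps(3)[of x j] by simp
    then show "ennreal \<bar>f x - s j x\<bar> \<le> 3 * ennreal \<bar>f x\<bar>"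
     by (metis ennreal_leI ennreal_mult' ennreal_numeral zero_le_numeral)
   qed
   show "(\<integral>\<^sup>+x. 3 * ennreal \<bar>f x\<bar> \<partial>lborel) < \<infinity>"
    using lim.hyps(4) by (simp add: nn_integral_cmult integrable_iff_bounded ennreal_mult_less_top)
   show "AE x in lborel. (\<lambda>i. ennreal \<bar>f x - s i x\<bar>) \<longlonglongrightarrow> 0"
   proof (rule AE_I2)
    fix x
    let ?t21 = "(\<lambda>i. ennreal \<bar>f x - s i x\<bar>)"
    have "?t21 \<longlonglongrightarrow> ennreal \<bar>f x - f x\<bar>"
     using lim.hyps(2)[of x] by (intro tendsto_intros) auto
    then show "?t21 \<longlonglongrightarrow> 0" by simp
   qed
  qed auto
  then have l: "(\<lambda>i. \<integral>\<^sup>+x. ennreal \<bar>f x - s i x\<bar> \<partial>lborel) \<longlonglongrightarrow> 0" by simp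
  show ?case
  proof (rule close)
   fix e :: real assume "e > 0"
   then have "\<forall>\<^sub>F i in sequentially. (\<integral>\<^sup>+x. ennreal \<bar>f x - s i x\<bar> \<partial>lborel) < ennreal e"
    by (intro order_tendstoD(2)[OF l]) simp
   then obtain i where "(\<integral>\<^sup>+x. ennreal \<bar>f x - s i x\<bar> \<partial>lborel) < ennreal e"
    using eventually_sequentially by auto
   then show "\<exists>g. g \<in> borel_measurable borel \<and> ?T g \<longlonglongrightarrow> 0 \<and> (\<integral>\<^sup>+x. ennreal \<bar>f x - g x\<bar> \<partial>lborel) \<le> ennreal e"
    using lim.IH[of i] by (intro exI[of _ "s i"]) auto
  qed simp
 qed
qed

section \<open>Rescaling grains to the fixed shape\<close>

lemma integral_lborel_affine:
 fixes g :: "'a::euclidean_space \<Rightarrow> 'b::{banach, second_countable_topology}"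
 assumes [measurable]: "g \<in> borel_measurable borel" and c: "c \<noteq> 0"
 shows "(\<integral>x. g x \<partial>lborel) = \<bar>c\<bar> ^ DIM('a) *\<^sub>R (\<integral>x. g (t + c *\<^sub>R x) \<partial>lborel)"
proof -
 have "(\<integral>x. g x \<partial>lborel) = (\<integral>x. g x \<partial>density (distr lborel borel (\<lambda>x. t + c *\<^sub>R x)) (\<lambda>_. ennreal (\<bar>c\<bar> ^ DIM('a))))"
  using lborel_affine[OF c, of t] by simp
 also have "\<dots> = (\<integral>x. \<bar>c\<bar> ^ DIM('a) *\<^sub>R g x \<partial>distr lborel borel (\<lambda>x. t + c *\<^sub>R x))"
  by (rule integral_density) auto
 also have "\<dots> = (\<integral>x. \<bar>c\<bar> ^ DIM('a) *\<^sub>R g (t + c *\<^sub>R x) \<partial>lborel)"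
  by (rule integral_distr) auto
 finally show ?thesis by simp
qed

lemma integrable_lborel_affine:
 fixes g :: "'a::euclidean_space \<Rightarrow> real"
 assumes g: "integrable lborel g" and c: "c \<noteq> 0"
 shows "integrable lborel (\<lambda>x. g (t + c *\<^sub>R x))"
proof (rule integrableI_bounded)
 let ?t1 = "(\<integral>\<^sup>+x. ennreal (norm (g (t + c *\<^sub>R x))) \<partial>lborel)"
 have [measurable]: "g \<in> borel_measurable borel" using borel_measurable_integrable[OF g] by simp
 show "(\<lambda>x. g (t + c *\<^sub>R x)) \<in> borel_measurable lborel" by measurable
 have "ennreal (\<bar>c\<bar> ^ DIM('a)) * ?t1 = (\<integral>\<^sup>+x. ennreal (norm (g x)) \<partial>lborel)"
  by (rule nn_integral_lborel_affine[symmetric]) (use c in auto)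
 also have "\<dots> < \<infinity>" using g by (simp add: integrable_iff_bounded)
 finally have fin: "ennreal (\<bar>c\<bar> ^ DIM('a)) * ?t1 < \<infinity>" .
 show "?t1 < \<infinity>"
 proof -
  define K where "K = \<bar>c\<bar> ^ DIM('a)"
  have "K > 0" using c by (simp add: K_def)
  then show ?thesis using fin unfolding K_def[symmetric] by (auto simp: ennreal_mult_less_top)
 qed
qed

lemma signed_density_grain_measurable:
 fixes C :: "'a::euclidean_space set"
 assumes C: "C \<in> sets borel" and [measurable]: "f \<in> borel_measurable borel"
 shows "(\<lambda>z. signed_density f (grain_at C z)) \<in> borel_measurable borel2"
proof -
 let ?t1 = "(borel2 \<Otimes>\<^sub>M lborel)"
 have [measurable]: "(\<lambda>p. indicator (grain C (fst (fst p)) (snd (fst p))) (snd p) :: real) \<in> borel_measurable ?t1"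
 proof (rule borel_measurable_indicator')
  have "Measurable.pred ?t1 (\<lambda>p. snd p \<in> grain C (fst (fst p)) (snd (fst p)))"
   by (rule grain_mem_pred[OF C]) measurable
  then show "{p \<in> space ?t1. snd p \<in> grain C (fst (fst p)) (snd (fst p))} \<in> sets ?t1"
   by (simp add: pred_def)
 qed
 have "(\<lambda>z. \<integral>y. indicator (grain_at C z) y *\<^sub>R f y \<partial>lborel) \<in> borel_measurable borel2"
  by (rule lborel.borel_measurable_lebesgue_integral) (simp add: split_beta')
 then show ?thesis using sets_grain[OF C] by (simp add: signed_density_def set_lebesgue_integral_def)
qed

lemma signed_density_grain:
 fixes C :: "'a::euclidean_space set"
 assumes C[measurable]: "C \<in> sets borel" and [measurable]: "f \<in> borel_measurable borel" and v: "v > 0"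
 shows "signed_density f (grain C x v) = v * (\<integral>c. indicator C c * f (x + (v powr (1 / real DIM('a))) *\<^sub>R c) \<partial>lborel)"
proof -
 define r where "r = v powr (1 / real DIM('a))"
 have r: "r > 0" using v by (simp add: r_def)
 have [measurable]: "grain C x v \<in> sets borel" by (rule sets_grain[OF C])
 have i: "indicator (grain C x v) (x + r *\<^sub>R c) = (indicator C c :: real)" for c
  using v r by (simp add: indicator_def grain_mem_iff r_def[symmetric])
 have "signed_density f (grain C x v) = (\<integral>y. indicator (grain C x v) y *\<^sub>R f y \<partial>lborel)"
  by (simp add: signed_density_def set_lebesgue_integral_def)
 also have "\<dots> = \<bar>r\<bar> ^ DIM('a) *\<^sub>R (\<integral>c. indicator (grain C x v) (x + r *\<^sub>R c) *\<^sub>R f (x + r *\<^sub>R c) \<partial>lborel)"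
  by (rule integral_lborel_affine) (use r in auto)
 also have "\<bar>r\<bar> ^ DIM('a) = v" using r powr_inverse_DIM[OF v, where 'a='a] by (simp add: r_def)
 finally show ?thesis unfolding i by (simp add: r_def)
qed

locale unit_volume =
 fixes C :: "'a::euclidean_space set"
 assumes C_sets[measurable]: "C \<in> sets borel" and C_unit: "emeasure lborel C = 1"
begin

text \<open>The shape has volume 1, so the divisor is the volume of the grain and the quotient is a
  genuine mean of \<open>f\<close>.\<close>

definition grain_average :: "('a \<Rightarrow> real) \<Rightarrow> real \<Rightarrow> 'a \<Rightarrow> real" where
 "grain_average f v x = signed_density f (grain C x v) / v"

lemma grain_average_measurable:
 assumes "f \<in> borel_measurable borel"
 shows "grain_average f v \<in> borel_measurable borel"
proof -
 let ?t1 = "(\<lambda>z. signed_density f (grain_at C z))"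
 have [measurable]: "?t1 \<in> borel_measurable borel2"
  by (rule signed_density_grain_measurable[OF C_sets assms])
 have "(\<lambda>x. ?t1 (x, v)) \<in> borel_measurable borel" by measurable
 then show ?thesis unfolding grain_average_def[abs_def] by simp
qed

lemma grain_average_eq:
 assumes "f \<in> borel_measurable borel" "v > 0"
 shows "grain_average f v x = (\<integral>c. indicator C c * f (x + (v powr (1 / real DIM('a))) *\<^sub>R c) \<partial>lborel)"
 using signed_density_grain[OF C_sets assms, of x] assms(2) by (simp add: grain_average_def)

lemma integrable_C: "integrable lborel (indicator C :: 'a \<Rightarrow> real)" "(\<integral>c. indicator C c \<partial>lborel) = (1 :: real)"
 using C_unit by (auto simp: measure_def)

lemma nn_integral_C_swap:
 fixes F :: "'a \<Rightarrow> 'a \<Rightarrow> ennreal"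
 assumes [measurable]: "(\<lambda>p. F (fst p) (snd p)) \<in> borel_measurable borel2"
 shows "(\<integral>\<^sup>+x. \<integral>\<^sup>+c. indicator C c * F x c \<partial>lborel \<partial>lborel) = (\<integral>\<^sup>+c. indicator C c * (\<integral>\<^sup>+x. F x c \<partial>lborel) \<partial>lborel)" (is "?l1 = ?r1")
proof -
 have [measurable]: "(\<lambda>p. F (snd p) (fst p)) \<in> borel_measurable borel2"
  using measurable_compose[OF measurable_Pair[OF measurable_snd measurable_fst] assms] by simp
 have m: "F x \<in> borel_measurable borel" "(\<lambda>x. F x c) \<in> borel_measurable borel" for x c
  using measurable_compose[OF measurable_Pair1' assms, of x] measurable_compose[OF measurable_Pair2' assms, of c] by simp_all
 have "?l1 = (\<integral>\<^sup>+c. \<integral>\<^sup>+x. indicator C c * F x c \<partial>lborel \<partial>lborel)"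
  by (rule lborel_pair.Fubini') (simp add: split_beta')
 also have "\<dots> = ?r1" by (intro nn_integral_cong nn_integral_cmult) (use m in simp)
 finally show ?thesis .
qed

lemma nn_integral_C_translate:
 fixes g :: "'a \<Rightarrow> ennreal"
 assumes [measurable]: "g \<in> borel_measurable borel"
 shows "(\<integral>\<^sup>+x. \<integral>\<^sup>+c. indicator C c * g (x + r *\<^sub>R c) \<partial>lborel \<partial>lborel) = (\<integral>\<^sup>+x. g x \<partial>lborel)" (is "?l1 = ?r1")
proof -
 have "?l1 = (\<integral>\<^sup>+c. indicator C c * (\<integral>\<^sup>+x. g (x + r *\<^sub>R c) \<partial>lborel) \<partial>lborel)"
  by (rule nn_integral_C_swap) measurable
 also have "\<dots> = (\<integral>\<^sup>+c. indicator C c * ?r1 \<partial>lborel)"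
  by (simp only: nn_integral_translate[OF assms])
 also have "\<dots> = ?r1" using C_unit by (simp add: nn_integral_multc)
 finally show ?thesis .
qed

text \<open>Rescaled to \<open>C\<close>, the average is a mean of translates of \<open>f\<close>
  under a probability measure. It therefore contracts L1 and, by Jensen's inequality, L2, and its
  distance to \<open>f\<close> is at most the mean L1 distance of the translates.\<close>

lemma
 assumes f: "integrable lborel f" and v: "v > 0"
 shows nn_integral_grain_average_le: "(\<integral>\<^sup>+x. ennreal \<bar>grain_average f v x\<bar> \<partial>lborel) \<le> (\<integral>\<^sup>+x. ennreal \<bar>f x\<bar> \<partial>lborel)"
  and nn_integral_grain_average_square_le:
   "integrable lborel (\<lambda>x. (f x)\<^sup>2) \<Longrightarrow> (\<integral>\<^sup>+x. ennreal ((grain_average f v x)\<^sup>2) \<partial>lborel) \<le> (\<integral>\<^sup>+x. ennreal ((f x)\<^sup>2) \<partial>lborel)"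
  and nn_integral_grain_average_diff_le: "(\<integral>\<^sup>+x. ennreal \<bar>grain_average f v x - f x\<bar> \<partial>lborel) \<le>
   (\<integral>\<^sup>+c. indicator C c * (\<integral>\<^sup>+x. ennreal \<bar>f (x + (v powr (1 / real DIM('a))) *\<^sub>R c) - f x\<bar> \<partial>lborel) \<partial>lborel)"
proof -
 let ?t9 = "(\<integral>\<^sup>+x. ennreal ((f x)\<^sup>2) \<partial>lborel)"
 let ?t8 = "(\<integral>\<^sup>+x. ennreal \<bar>f x\<bar> \<partial>lborel)"
 let ?t7 = "(\<integral>\<^sup>+x. ennreal ((grain_average f v x)\<^sup>2) \<partial>lborel)"
 let ?t6 = "(\<integral>\<^sup>+x. ennreal \<bar>grain_average f v x\<bar> \<partial>lborel)"
 let ?t5 = "(\<integral>\<^sup>+x. ennreal \<bar>grain_average f v x - f x\<bar> \<partial>lborel)"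
 define r where "r = v powr (1 / real DIM('a))"
 have r: "r > 0" using v by (simp add: r_def)
 have fm[measurable]: "f \<in> borel_measurable borel" using borel_measurable_integrable[OF f] by simp
 note eq = grain_average_eq[OF fm v, folded r_def]
 have int: "integrable lborel (\<lambda>c. indicator C c * g (x + r *\<^sub>R c))" if "integrable lborel g" for g :: "'a \<Rightarrow> real" and x
  using integrable_real_mult_indicator[OF _ integrable_lborel_affine[OF that, of r x]] r by (simp add: mult.commute)
 have "?t6 \<le> (\<integral>\<^sup>+x. \<integral>\<^sup>+c. indicator C c * ennreal \<bar>f (x + r *\<^sub>R c)\<bar> \<partial>lborel \<partial>lborel)"
 proof (intro nn_integral_mono, goal_cases)
  case (1 x)
  let ?t3 = "(\<integral>\<^sup>+c. indicator C c * ennreal \<bar>f (x + r *\<^sub>R c)\<bar> \<partial>lborel)"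
  have "ennreal \<bar>grain_average f v x\<bar> \<le> (\<integral>\<^sup>+c. ennreal (norm (indicator C c * f (x + r *\<^sub>R c))) \<partial>lborel)"
   unfolding eq using integral_norm_bound_ennreal[OF int[OF f]] by simp
  also have "\<dots> = ?t3" by (intro nn_integral_cong) (auto simp: indicator_def)
  finally show ?case .
 qed
 also have "\<dots> = ?t8" by (rule nn_integral_C_translate) measurable
 finally show "?t6 \<le> ?t8" .
 have "?t5 \<le> (\<integral>\<^sup>+x. \<integral>\<^sup>+c. indicator C c * ennreal \<bar>f (x + r *\<^sub>R c) - f x\<bar> \<partial>lborel \<partial>lborel)"
 proof (intro nn_integral_mono, goal_cases)
  case (1 x)
  let ?t2 = "(\<integral>\<^sup>+c. indicator C c * ennreal \<bar>f (x + r *\<^sub>R c) - f x\<bar> \<partial>lborel)"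
  have i: "integrable lborel (\<lambda>c. indicator C c * f (x + r *\<^sub>R c) - indicator C c * f x)"
   by (intro Bochner_Integration.integrable_diff int[OF f] integrable_mult_left integrable_C)
  have "grain_average f v x - f x = (\<integral>c. indicator C c * f (x + r *\<^sub>R c) - indicator C c * f x \<partial>lborel)"
   unfolding eq using integrable_C by (subst Bochner_Integration.integral_diff[OF int[OF f]]) auto
  then have "ennreal \<bar>grain_average f v x - f x\<bar> \<le> (\<integral>\<^sup>+c. ennreal (norm (indicator C c * f (x + r *\<^sub>R c) - indicator C c * f x)) \<partial>lborel)"
   using integral_norm_bound_ennreal[OF i] by simp
  also have "\<dots> = ?t2" by (intro nn_integral_cong) (auto simp: indicator_def)
  finally show ?case .
 qed
 also have "\<dots> = (\<integral>\<^sup>+c. indicator C c * (\<integral>\<^sup>+x. ennreal \<bar>f (x + r *\<^sub>R c) - f x\<bar> \<partial>lborel) \<partial>lborel)"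
  by (rule nn_integral_C_swap) measurable
 finally show "?t5 \<le>
   (\<integral>\<^sup>+c. indicator C c * (\<integral>\<^sup>+x. ennreal \<bar>f (x + (v powr (1 / real DIM('a))) *\<^sub>R c) - f x\<bar> \<partial>lborel) \<partial>lborel)"
  by (simp only: r_def)
 assume f2: "integrable lborel (\<lambda>x. (f x)\<^sup>2)"
 have "?t7 \<le> (\<integral>\<^sup>+x. \<integral>\<^sup>+c. indicator C c * ennreal ((f (x + r *\<^sub>R c))\<^sup>2) \<partial>lborel \<partial>lborel)"
 proof (intro nn_integral_mono, goal_cases)
  case (1 x)
  let ?t4 = "(\<integral>\<^sup>+c. indicator C c * ennreal ((f (x + r *\<^sub>R c))\<^sup>2) \<partial>lborel)"
  let ?t1 = "(\<integral>c. indicator C c * (f (x + r *\<^sub>R c))\<^sup>2 \<partial>lborel)"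
  define a where "a = grain_average f v x"
  have i2: "integrable lborel (\<lambda>c. indicator C c * (f (x + r *\<^sub>R c))\<^sup>2)" by (rule int[OF f2])
  \<comment> \<open>Jensen's inequality for the square, as nonnegativity of the variance of
    \<open>f (x + r *\<^sub>R c)\<close> for \<open>c\<close> uniform in \<open>C\<close>.\<close>
  have "0 \<le> (\<integral>c. indicator C c * (f (x + r *\<^sub>R c) - a)\<^sup>2 \<partial>lborel)" by (intro Bochner_Integration.integral_nonneg) simp
  also have "\<dots> = (\<integral>c. indicator C c * (f (x + r *\<^sub>R c))\<^sup>2 - (2 * a) * (indicator C c * f (x + r *\<^sub>R c)) + a\<^sup>2 * indicator C c \<partial>lborel)"
   by (intro Bochner_Integration.integral_cong refl) (simp add: power2_eq_square algebra_simps)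
  also have "\<dots> = ?t1 - (2 * a) * (\<integral>c. indicator C c * f (x + r *\<^sub>R c) \<partial>lborel) + a\<^sup>2 * (\<integral>c. indicator C c \<partial>lborel)"
   using i2 int[OF f] integrable_C by simp
  also have "\<dots> = ?t1 - a\<^sup>2"
   unfolding eq[symmetric] a_def[symmetric] using integrable_C(2) by (simp add: power2_eq_square)
  finally have "a\<^sup>2 \<le> ?t1" by simp
  then have "ennreal (a\<^sup>2) \<le> ennreal ?t1" by (rule ennreal_leI)
  also have "\<dots> = (\<integral>\<^sup>+c. ennreal (indicator C c * (f (x + r *\<^sub>R c))\<^sup>2) \<partial>lborel)"
   by (rule nn_integral_eq_integral[symmetric, OF i2]) simp
  also have "\<dots> = ?t4" by (intro nn_integral_cong) (auto simp: indicator_def)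
  finally show ?case by (simp only: a_def)
 qed
 also have "\<dots> = ?t9" by (rule nn_integral_C_translate) measurable
 finally show "?t7 \<le> ?t9" .
qed

text \<open>For each \<open>c\<close> the translate by \<open>r n *\<^sub>R c\<close> approaches
  \<open>f\<close> in L1, at a distance of at most twice the norm of \<open>f\<close>; dominated
  convergence over the unit volume of \<open>C\<close> concludes.\<close>

lemma grain_average_tendsto:
 assumes f: "integrable lborel f" and v: "\<forall>\<^sub>F n in sequentially. v n > 0" "v \<longlonglongrightarrow> 0"
 shows "(\<lambda>n. \<integral>\<^sup>+x. ennreal \<bar>grain_average f (v n) x - f x\<bar> \<partial>lborel) \<longlonglongrightarrow> 0"
proof -
 have fm[measurable]: "f \<in> borel_measurable borel" using borel_measurable_integrable[OF f] by simp
 define r where "r = (\<lambda>n. v n powr (1 / real DIM('a)))"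
 have r: "r \<longlonglongrightarrow> 0"
 proof -
  have "r \<longlonglongrightarrow> 0 powr (1 / real DIM('a))"
   unfolding r_def by (rule tendsto_powr'[OF v(2) tendsto_const]) (use v(1) in \<open>auto elim: eventually_mono\<close>)
  then show ?thesis by simp
 qed
 define T where "T = (\<lambda>h. \<integral>\<^sup>+x. ennreal \<bar>f (x + h) - f x\<bar> \<partial>lborel)"
 have [measurable]: "T \<in> borel_measurable borel" unfolding T_def by measurable
 define I where "I = (\<integral>\<^sup>+x. ennreal \<bar>f x\<bar> \<partial>lborel)"
 have I: "I < \<infinity>" using f by (simp add: I_def integrable_iff_bounded)
 have T: "T h \<le> I + I" for h
 proof -
  let ?t2 = "(\<integral>\<^sup>+x. ennreal \<bar>f x\<bar> \<partial>lborel)"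
  let ?t1 = "(\<integral>\<^sup>+x. ennreal \<bar>f (x + h)\<bar> \<partial>lborel)"
  have "T h \<le> (\<integral>\<^sup>+x. ennreal \<bar>f (x + h)\<bar> + ennreal \<bar>f x\<bar> \<partial>lborel)"
   unfolding T_def by (intro nn_integral_mono) (simp flip: ennreal_plus)
  also have "\<dots> = ?t1 + ?t2" by (rule nn_integral_add) measurable
  also have "?t1 = ?t2" by (rule nn_integral_translate) measurable
  finally show ?thesis by (simp add: I_def)
 qed
 have "(\<lambda>n. \<integral>\<^sup>+c. indicator C c * T (r n *\<^sub>R c) \<partial>lborel) \<longlonglongrightarrow> (\<integral>\<^sup>+c. 0 \<partial>(lborel :: 'a measure))"
 proof (rule nn_integral_dominated_convergence[where w = "\<lambda>c. indicator C c * (I + I)"])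
  show "AE c in lborel. indicator C c * T (r j *\<^sub>R c) \<le> indicator C c * (I + I)" for j
   by (intro AE_I2 mult_left_mono T) simp
  show "(\<integral>\<^sup>+c. indicator C c * (I + I) \<partial>lborel) < \<infinity>"
   using I C_unit by (simp add: nn_integral_multc ennreal_add_less_top)
  show "AE c in lborel. (\<lambda>n. indicator C c * T (r n *\<^sub>R c)) \<longlonglongrightarrow> 0"
  proof (rule AE_I2, goal_cases)
   case (1 c)
   have "(\<lambda>n. r n *\<^sub>R c) \<longlonglongrightarrow> 0 *\<^sub>R c" by (intro tendsto_intros r)
   then have "(\<lambda>n. T (r n *\<^sub>R c)) \<longlonglongrightarrow> 0" unfolding T_def by (intro translation_tendsto[OF f]) simp
   then show ?case by (cases "c \<in> C") simp_all
  qed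
 qed measurable
 then have lim: "(\<lambda>n. \<integral>\<^sup>+c. indicator C c * T (r n *\<^sub>R c) \<partial>lborel) \<longlonglongrightarrow> 0" by simp
 show ?thesis
 proof (rule tendsto_sandwich[OF _ _ tendsto_const lim])
  show "\<forall>\<^sub>F n in sequentially. (\<integral>\<^sup>+x. ennreal \<bar>grain_average f (v n) x - f x\<bar> \<partial>lborel) \<le> (\<integral>\<^sup>+c. indicator C c * T (r n *\<^sub>R c) \<partial>lborel)"
   using v(1) by eventually_elim (unfold T_def r_def, rule nn_integral_grain_average_diff_le[OF f])
 qed simp
qed

end

text \<open>Dominated convergence in \<open>s\<close> for L1 norms in \<open>x\<close>. It suits the
  small-grain regime, where convergence of the averages is known in L1 of \<open>x\<close> for each
  \<open>s\<close> rather than pointwise.\<close>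

lemma tendsto_integral_pair:
 fixes h :: "nat \<Rightarrow> 'a::euclidean_space \<times> real \<Rightarrow> complex"
 assumes m[measurable]: "\<And>n. h n \<in> borel_measurable borel2" "h' \<in> borel_measurable borel2"
   "g \<in> borel_measurable borel" and g: "(\<integral>\<^sup>+s. g s \<partial>lborel) < \<infinity>"
  and b: "\<forall>\<^sub>F n in sequentially. \<forall>s. (\<integral>\<^sup>+x. ennreal (cmod (h n (x, s))) \<partial>lborel) \<le> g s"
   "\<And>s. (\<integral>\<^sup>+x. ennreal (cmod (h' (x, s))) \<partial>lborel) \<le> g s"
  and lim: "\<And>s. (\<lambda>n. \<integral>\<^sup>+x. ennreal (cmod (h n (x, s) - h' (x, s))) \<partial>lborel) \<longlonglongrightarrow> 0"
 shows "(\<lambda>n. \<integral>p. h n p \<partial>lborel2) \<longlonglongrightarrow> (\<integral>p. h' p \<partial>lborel2) \<and>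
  integrable lborel2 h'"
proof (rule conjI)
 let ?L = "lborel \<Otimes>\<^sub>M lborel :: ('a \<times> real) measure"
 have swap: "(\<integral>\<^sup>+p. ennreal (cmod (k p)) \<partial>?L) = (\<integral>\<^sup>+s. \<integral>\<^sup>+x. ennreal (cmod (k (x, s))) \<partial>lborel \<partial>lborel)"
  if [measurable]: "k \<in> borel_measurable borel2" for k :: "'a \<times> real \<Rightarrow> complex"
  using lborel_pair.nn_integral_snd[of "\<lambda>p. ennreal (cmod (k p))"] that by (simp add: split_beta')
 have int: "integrable ?L k"
  if k[measurable]: "k \<in> borel_measurable borel2" and kg: "\<And>s. (\<integral>\<^sup>+x. ennreal (cmod (k (x, s))) \<partial>lborel) \<le> g s" for k
 proof (rule integrableI_bounded)
  show "k \<in> borel_measurable ?L" by measurable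
  have "(\<integral>\<^sup>+p. ennreal (cmod (k p)) \<partial>?L) \<le> (\<integral>\<^sup>+s. g s \<partial>lborel)"
   unfolding swap[OF k] by (intro nn_integral_mono kg)
  then show "(\<integral>\<^sup>+p. ennreal (cmod (k p)) \<partial>?L) < \<infinity>" using g by (rule le_less_trans)
 qed
 show h': "integrable ?L h'" by (rule int[OF m(2) b(2)])
 obtain N where N: "\<And>n s. n \<ge> N \<Longrightarrow> (\<integral>\<^sup>+x. ennreal (cmod (h n (x, s))) \<partial>lborel) \<le> g s"
  using b(1) unfolding eventually_sequentially by blast
 have hN: "integrable ?L (h (n + N))" for n by (rule int[OF m(1) N]) simp
 define D where "D = (\<lambda>n s. \<integral>\<^sup>+x. ennreal (cmod (h (n + N) (x, s) - h' (x, s))) \<partial>lborel)"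
 have D[measurable]: "D n \<in> borel_measurable borel" for n unfolding D_def by measurable
 have Dg: "D n s \<le> g s + g s" for n s
 proof -
  have "D n s \<le> (\<integral>\<^sup>+x. ennreal (cmod (h (n + N) (x, s))) + ennreal (cmod (h' (x, s))) \<partial>lborel)"
   unfolding D_def by (intro nn_integral_mono) (simp add: norm_triangle_ineq4 flip: ennreal_plus)
  also have "\<dots> = (\<integral>\<^sup>+x. ennreal (cmod (h (n + N) (x, s))) \<partial>lborel) + (\<integral>\<^sup>+x. ennreal (cmod (h' (x, s))) \<partial>lborel)"
   by (rule nn_integral_add) measurable
  also have "\<dots> \<le> g s + g s" by (intro add_mono N b(2)) simp
  finally show ?thesis .
 qed
 have "(\<lambda>n. \<integral>\<^sup>+s. D n s \<partial>lborel) \<longlonglongrightarrow> (\<integral>\<^sup>+s. 0 \<partial>(lborel :: real measure))"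
 proof (rule nn_integral_dominated_convergence[where w = "\<lambda>s. g s + g s"])
  show "AE s in lborel. D j s \<le> g s + g s" for j by (intro AE_I2 Dg)
  show "(\<integral>\<^sup>+s. g s + g s \<partial>lborel) < \<infinity>" using g by (simp add: nn_integral_add ennreal_add_less_top)
  show "AE s in lborel. (\<lambda>n. D n s) \<longlonglongrightarrow> 0"
   unfolding D_def by (intro AE_I2 LIMSEQ_ignore_initial_segment[OF lim])
 qed measurable
 then have D0: "(\<lambda>n. \<integral>\<^sup>+s. D n s \<partial>lborel) \<longlonglongrightarrow> 0" by simp
 have le: "ennreal (cmod ((\<integral>p. h (n + N) p \<partial>?L) - (\<integral>p. h' p \<partial>?L))) \<le> (\<integral>\<^sup>+s. D n s \<partial>lborel)" for n
 proof -
  have "(\<integral>p. h (n + N) p \<partial>?L) - (\<integral>p. h' p \<partial>?L) = (\<integral>p. h (n + N) p - h' p \<partial>?L)"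
   by (rule Bochner_Integration.integral_diff[symmetric, OF hN h'])
  then have "ennreal (cmod ((\<integral>p. h (n + N) p \<partial>?L) - (\<integral>p. h' p \<partial>?L))) \<le> (\<integral>\<^sup>+p. ennreal (cmod (h (n + N) p - h' p)) \<partial>?L)"
   using integral_norm_bound_ennreal[OF Bochner_Integration.integrable_diff[OF hN h']] by simp
  also have "\<dots> = (\<integral>\<^sup>+s. D n s \<partial>lborel)" unfolding D_def by (rule swap) measurable
  finally show ?thesis .
 qed
 have "(\<lambda>n. ennreal (cmod ((\<integral>p. h (n + N) p \<partial>?L) - (\<integral>p. h' p \<partial>?L)))) \<longlonglongrightarrow> 0"
  by (rule tendsto_sandwich[OF always_eventually always_eventually tendsto_const D0]) (simp, rule allI, rule le)
 then have "(\<lambda>n. cmod ((\<integral>p. h (n + N) p \<partial>?L) - (\<integral>p. h' p \<partial>?L))) \<longlonglongrightarrow> 0"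
  by (subst (asm) ennreal_tendsto_0_iff) auto
 then have "(\<lambda>n. \<integral>p. h (n + N) p \<partial>?L) \<longlonglongrightarrow> (\<integral>p. h' p \<partial>?L)"
  by (simp add: Lim_null[of _ "\<integral>p. h' p \<partial>?L"] tendsto_norm_zero_iff)
 then show "(\<lambda>n. \<integral>p. h n p \<partial>?L) \<longlonglongrightarrow> (\<integral>p. h' p \<partial>?L)"
  by (rule LIMSEQ_offset)
qed

text \<open>The linear bound on \<open>Psi\<close> costs the L1 norm and serves large
  \<open>K\<close>, the quadratic one costs the L2 norm and serves small \<open>K\<close>. Their
  minimum is what \<open>majorant_integrable\<close> controls with
  \<open>\<beta> = 2\<close>.\<close>

lemma nn_integral_Psi_le:
 fixes a :: "'a::euclidean_space \<Rightarrow> real"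
 assumes [measurable]: "a \<in> borel_measurable borel" and c: "c > 0" and w: "0 \<le> w" "w \<le> K"
  and i: "(\<integral>\<^sup>+x. ennreal \<bar>a x\<bar> \<partial>lborel) \<le> ennreal i" and q: "(\<integral>\<^sup>+x. ennreal ((a x)\<^sup>2) \<partial>lborel) \<le> ennreal q"
  and nn: "i \<ge> 0" "q \<ge> 0"
 shows "(\<integral>\<^sup>+x. ennreal (cmod (Psi (w * (a x / c)))) \<partial>lborel) \<le> ennreal (max (2 * i / c) (q / (2 * c\<^sup>2)) * min K (K powr 2))" (is "?l1 \<le> _")
proof -
 let ?t1 = "(K\<^sup>2 / (2 * c\<^sup>2))"
 let ?D = "max (2 * i / c) (q / (2 * c\<^sup>2))"
 have "?l1 \<le> (\<integral>\<^sup>+x. ennreal (2 * K / c) * ennreal \<bar>a x\<bar> \<partial>lborel)"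
 proof (intro nn_integral_mono, goal_cases)
  case (1 x)
  have "cmod (Psi (w * (a x / c))) \<le> 2 * (w * (\<bar>a x\<bar> / c))"
   using cmod_Psi_le'[of "w * (a x / c)"] w c by (simp add: abs_mult)
  also have "\<dots> \<le> 2 * (K * (\<bar>a x\<bar> / c))" using w c by (intro mult_left_mono mult_right_mono) auto
  also have "\<dots> = 2 * K / c * \<bar>a x\<bar>" by simp
  finally show ?case using w c by (simp flip: ennreal_mult)
 qed
 also have "\<dots> = ennreal (2 * K / c) * (\<integral>\<^sup>+x. ennreal \<bar>a x\<bar> \<partial>lborel)" by (rule nn_integral_cmult) measurable
 also have "\<dots> \<le> ennreal (2 * K / c) * ennreal i" by (intro mult_left_mono i) simp
 also have "\<dots> = ennreal (2 * i / c * K)" using w c nn by (simp add: mult_ac flip: ennreal_mult)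
 also have "\<dots> \<le> ennreal (?D * K)" using w by (intro ennreal_leI mult_right_mono) auto
 finally have 1: "?l1 \<le> ennreal (?D * K)" .
 have "?l1 \<le> (\<integral>\<^sup>+x. ennreal ?t1 * ennreal ((a x)\<^sup>2) \<partial>lborel)"
 proof (intro nn_integral_mono, goal_cases)
  case (1 x)
  have "cmod (Psi (w * (a x / c))) \<le> w\<^sup>2 * (a x)\<^sup>2 / (2 * c\<^sup>2)"
   using cmod_Psi_le[of "w * (a x / c)"] by (simp add: power_mult_distrib power_divide mult_ac)
  also have "\<dots> \<le> K\<^sup>2 * (a x)\<^sup>2 / (2 * c\<^sup>2)" using w c by (intro divide_right_mono mult_right_mono power_mono) auto
  also have "\<dots> = K\<^sup>2 / (2 * c\<^sup>2) * (a x)\<^sup>2" by simp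
  finally show ?case by (simp flip: ennreal_mult)
 qed
 also have "\<dots> = ennreal ?t1 * (\<integral>\<^sup>+x. ennreal ((a x)\<^sup>2) \<partial>lborel)" by (rule nn_integral_cmult) measurable
 also have "\<dots> \<le> ennreal ?t1 * ennreal q" by (intro mult_left_mono q) simp
 also have "\<dots> = ennreal (q / (2 * c\<^sup>2) * K\<^sup>2)" using nn by (simp add: mult_ac flip: ennreal_mult)
 also have "\<dots> \<le> ennreal (?D * K\<^sup>2)" by (intro ennreal_leI mult_right_mono) auto
 also have "K\<^sup>2 = K powr 2" using w by simp
 finally have 2: "?l1 \<le> ennreal (?D * K powr 2)" .
 show ?thesis using 1 2 by (cases "K \<le> K powr 2") simp_all
qed

section \<open>The exponent in the small-grain regime\<close>

context grain_model
begin

interpretation unit_volume C by unfold_locales (rule C_borel, rule C_volume)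

text \<open>As \<open>t\<close> is the quantile itself, the bracket
  \<open>G t \<le> \<kappa> \<le> G (q * t)\<close> is the Galois connection. The last claim, that
  grains of the relevant size shrink, is where \<open>l * G (1 / \<rho>)\<close> tending to 0
  enters.\<close>

lemma small_grain_scaling:
 fixes \<rho> l :: "nat \<Rightarrow> real"
 assumes \<rho>: "\<And>n. \<rho> n > 0" "\<rho> \<longlonglongrightarrow> 0" and l: "\<And>n. l n > 1" "filterlim l at_top sequentially"
  and lim: "(\<lambda>n. l n * G (1 / \<rho> n)) \<longlonglongrightarrow> 0"
 defines "\<kappa> \<equiv> \<lambda>n. 1 / (\<gamma> * l n)"
 defines "t \<equiv> \<lambda>n. quantile (\<kappa> n)"
 shows "\<And>n. 0 < \<kappa> n" "\<And>n. \<kappa> n < 1" "\<kappa> \<longlonglongrightarrow> 0" "\<And>n. t n > 0" "filterlim t at_top sequentially"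
  "\<And>n. G (t n) \<le> \<kappa> n" "\<And>n q. q < 1 \<Longrightarrow> \<kappa> n \<le> G (q * t n)" "(\<lambda>n. \<rho> n * t n) \<longlonglongrightarrow> 0"
proof -
 have g: "\<gamma> > 0" using \<gamma>_gt_1 by simp
 show k0: "0 < \<kappa> n" for n using g l(1)[of n] by (simp add: \<kappa>_def)
 show k1: "\<kappa> n < 1" for n
 proof -
  have "1 * 1 < \<gamma> * l n" using \<gamma>_gt_1 l(1)[of n] by (intro mult_strict_mono) auto
  then show ?thesis by (simp add: \<kappa>_def)
 qed
 show k: "\<kappa> \<longlonglongrightarrow> 0"
  using tendsto_inverse_0_at_top[OF filterlim_tendsto_pos_mult_at_top[OF tendsto_const g l(2)]]
  by (simp add: \<kappa>_def inverse_eq_divide)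
 show t0: "t n > 0" for n unfolding t_def by (rule quantile_pos[OF k0 k1])
 have le: "t n \<le> x \<longleftrightarrow> G x \<le> \<kappa> n" for n x unfolding t_def by (rule quantile_le_iff[OF k0 k1])
 show "filterlim t at_top sequentially" unfolding filterlim_at_top_dense
 proof
  fix x
  have "\<forall>\<^sub>F n in sequentially. \<kappa> n < G x" by (rule order_tendstoD(2)[OF k G_pos])
  then show "\<forall>\<^sub>F n in sequentially. x < t n"
  proof eventually_elim
   case (elim n)
   then show ?case using le[of n x] by linarith
  qed
 qed
 show "G (t n) \<le> \<kappa> n" for n using le[of n "t n"] by simp
 show "\<kappa> n \<le> G (q * t n)" if "q < 1" for n q
 proof -
  have "q * t n < t n" using that t0[of n] by simp
  then show ?thesis using le[of n "q * t n"] by linarith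
 qed
 show "(\<lambda>n. \<rho> n * t n) \<longlonglongrightarrow> 0"
 proof (rule order_tendstoI)
  fix a :: real assume "a < 0"
  then have "a < \<rho> n * t n" for n using \<rho>(1)[of n] t0[of n] by (meson less_trans mult_pos_pos)
  then show "\<forall>\<^sub>F n in sequentially. a < \<rho> n * t n" by simp
 next
  fix a :: real assume a: "0 < a"
  have r: "filterlim (\<lambda>n. 1 / \<rho> n) at_top sequentially"
  proof -
   have "filterlim \<rho> (at_right 0) sequentially"
    using \<rho> by (intro filterlim_at_withinI) (auto intro: always_eventually)
   from filterlim_compose[OF filterlim_inverse_at_top_right this] show ?thesis
    by (simp add: inverse_eq_divide)
  qed
  \<comment> \<open>The product equals \<open>\<gamma> * l n * G (a / 2 / \<rho> n)\<close>. Once it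
    is below 1, \<open>G (a / 2 / \<rho> n) \<le> \<kappa> n\<close> and hence
    \<open>t n \<le> a / 2 / \<rho> n\<close>; halving \<open>a\<close> yields the strict
    inequality.\<close>
  have "(\<lambda>n. (l n * G (1 / \<rho> n)) * (G ((a / 2) * (1 / \<rho> n)) / G (1 / \<rho> n)) * \<gamma>) \<longlonglongrightarrow> 0 * (a / 2) powr - \<gamma> * \<gamma>"
   by (intro tendsto_mult lim tendsto_const filterlim_compose[OF G_ratio r]) (use a in simp)
  then have "(\<lambda>n. (l n * G (1 / \<rho> n)) * (G ((a / 2) * (1 / \<rho> n)) / G (1 / \<rho> n)) * \<gamma>) \<longlonglongrightarrow> 0" by simp
  then have "\<forall>\<^sub>F n in sequentially. (l n * G (1 / \<rho> n)) * (G ((a / 2) * (1 / \<rho> n)) / G (1 / \<rho> n)) * \<gamma> < 1"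
   by (rule order_tendstoD) simp
  then show "\<forall>\<^sub>F n in sequentially. \<rho> n * t n < a"
  proof eventually_elim
   case (elim n)
   have "(l n * G (1 / \<rho> n)) * (G ((a / 2) * (1 / \<rho> n)) / G (1 / \<rho> n)) * \<gamma> = G (a / 2 / \<rho> n) * (\<gamma> * l n)"
    using less_imp_neq[OF G_pos[of "1 / \<rho> n"]] by simp
   with elim have "G (a / 2 / \<rho> n) * (\<gamma> * l n) < 1" by linarith
   then have "G (a / 2 / \<rho> n) \<le> \<kappa> n"
    using g l(1)[of n] by (simp add: \<kappa>_def pos_le_divide_eq)
   then have "t n \<le> a / 2 / \<rho> n" using le by simp
   then have "\<rho> n * t n \<le> a / 2" using \<rho>(1)[of n] by (simp only: pos_le_divide_eq mult.commute)
   then show ?case using a by linarith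
  qed
 qed
qed

text \<open>A grain of volume \<open>r * t * w\<close> carries, after division by
  \<open>r * t\<close>, the value \<open>w\<close> times an average of \<open>f\<close>, and
  \<open>r * t\<close> tends to 0, so that the average approaches \<open>f\<close>. The choice of
  \<open>k\<close> gives \<open>l * k = 1 / \<gamma>\<close>, the constant in front.\<close>

lemma small_grain_limit:
 fixes r l :: "nat \<Rightarrow> real"
 assumes V: "V \<in> borel_measurable Q" "\<mu> = distr Q borel V"
  and r: "\<And>n. r n > 0" "r \<longlonglongrightarrow> 0" and l: "\<And>n. l n > 1" "filterlim l at_top sequentially"
  and lim: "(\<lambda>n. l n * G (1 / r n)) \<longlonglongrightarrow> 0"
  and f: "integrable lborel f" "integrable lborel (\<lambda>x. (f x)\<^sup>2)" and c: "c > 0"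
 shows "(\<lambda>n. CLINT z|grain_intensity Q V (l n) (r n). Psi (signed_density f (grain_at C z) / (c * (r n * quantile (1 / (\<gamma> * l n)))))) \<longlonglongrightarrow>
  (1 / \<gamma>) *\<^sub>R (CLINT x|lborel. CLINT s|lborel. indicator {0<..} s *\<^sub>R Psi (s powr (- 1 / \<gamma>) * (f x / c)))"
proof -
 let ?t3 = "(\<integral>\<^sup>+x. ennreal \<bar>f x\<bar> \<partial>lborel)"
 let ?t2 = "borel2"
 let ?t1 = "lborel2"
 define k where "k = (\<lambda>n. 1 / (\<gamma> * l n))"
 define t where "t = (\<lambda>n. quantile (k n))"
 have kt: "k n = 1 / (\<gamma> * l n)" "t n = quantile (k n)" for n by (simp_all only: k_def t_def)
 note sc = small_grain_scaling[OF r l lim, folded kt(1), folded kt(2)]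
 define w where "w = (\<lambda>n. scaled_quantile (k n) (t n))"
 have fm[measurable]: "f \<in> borel_measurable borel" using borel_measurable_integrable[OF f(1)] by simp
 have sm[measurable]: "(\<lambda>z. signed_density f (grain_at C z)) \<in> borel_measurable ?t2"
  by (rule signed_density_grain_measurable[OF C_borel fm])
 have wm[measurable]: "w n \<in> borel_measurable borel" for n unfolding w_def by measurable
 define h where "h = (\<lambda>n p. indicator {0<..<1 / k n} (snd p) *\<^sub>R
  Psi (signed_density f (grain C (fst p) (r n * t n * w n (snd p))) / (c * (r n * t n))))"
 define h' where "h' = (\<lambda>p. indicator {0<..} (snd p) *\<^sub>R Psi (snd p powr (- 1 / \<gamma>) * (f (fst p) / c)))"
 \<comment> \<open>The exponent 2 takes the place of \<open>2 - \<alpha>\<close>, so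
   \<open>d\<close> has to leave \<open>\<gamma> + d < 2\<close>.\<close>
 define d where "d = min (\<gamma> - 1) (2 - \<gamma>) / 2"
 have d: "0 < d" "1 < \<gamma> - d" "\<gamma> + d < 2" "d < \<gamma>"
  using \<gamma>_gt_1 \<gamma>_less_2 by (auto simp: d_def min_def field_simps)
 obtain A t0 where A: "A > 0" "t0 > 0" "\<forall>t\<ge>t0. \<forall>k\<ge>G t. \<forall>s>0. scaled_quantile k t s \<le> majorant A d s"
  using scaled_quantile_le[OF d(1,4)] by metis
 define K where "K = majorant A d"
 have [measurable]: "K \<in> borel_measurable borel" unfolding K_def by measurable
 have tt0: "\<forall>\<^sub>F n in sequentially. t n \<ge> t0" using sc(5) by (simp add: filterlim_at_top)
 have wK: "w n s \<le> K s" if "t n \<ge> t0" "s > 0" for n s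
  unfolding w_def K_def by (rule A(3)[rule_format, OF that(1) sc(6) that(2)])
 have wlim: "(\<lambda>n. w n s) \<longlonglongrightarrow> s powr (- 1 / \<gamma>)" if "s > 0" for s
  unfolding w_def by (rule scaled_quantile_tendsto[OF sc(5) always_eventually[OF allI[OF sc(6)]] always_eventually[OF allI[OF sc(7)]] that])
 have w'K: "s powr (- 1 / \<gamma>) \<le> K s" if "s > 0" for s
  by (rule tendsto_upperbound[OF wlim[OF that] eventually_mono[OF tt0 wK[OF _ that]]]) simp_all
 have w0: "w n s \<ge> 0" for n s
  unfolding w_def scaled_quantile_def using quantile_nonneg sc(4)[of n] by (intro divide_nonneg_nonneg) auto
 have wpos: "w n s > 0" if "0 < s" "s < 1 / k n" for n s
  unfolding w_def scaled_quantile_def using that sc(1,4)[of n] by (intro divide_pos_pos quantile_pos) (auto simp: field_simps)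
 define i where "i = (\<integral>x. \<bar>f x\<bar> \<partial>lborel)"
 define q where "q = (\<integral>x. (f x)\<^sup>2 \<partial>lborel)"
 have iq: "?t3 = ennreal i" "(\<integral>\<^sup>+x. ennreal ((f x)\<^sup>2) \<partial>lborel) = ennreal q" "i \<ge> 0" "q \<ge> 0"
  unfolding i_def q_def using f by (auto intro!: nn_integral_eq_integral)
 define D where "D = max (2 * i / c) (q / (2 * c\<^sup>2))"
 define g where "g = (\<lambda>s. ennreal D * (ennreal (min (K s) (K s powr 2)) * indicator {0<..} s))"
 have D: "D \<ge> 0" unfolding D_def using iq(3) c by (intro max.coboundedI1) simp
 have gs: "g s = ennreal (D * min (K s) (K s powr 2))" if "s > 0" for s
  unfolding g_def using that D majorant_nonneg by (simp add: ennreal_mult K_def)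
 have hs: "h n (x, s) = (if s < 1 / k n then Psi (w n s * (grain_average f (r n * t n * w n s) x / c)) else 0)" if "s > 0" for n x s
 proof (cases "s < 1 / k n")
  case True
  have "w n s * (grain_average f (r n * t n * w n s) x / c) = signed_density f (grain C x (r n * t n * w n s)) / (c * (r n * t n))"
   unfolding grain_average_def using r(1)[of n] sc(4)[of n] wpos[OF \<open>s > 0\<close> True] by simp
  then show ?thesis using that True by (simp add: h_def)
 qed (simp add: h_def)
 have pos: "r n * t n * w n s > 0" if "0 < s" "s < 1 / k n" for n s
  using r(1)[of n] sc(4)[of n] wpos[OF that] by simp
 have "(\<lambda>n. \<integral>p. h n p \<partial>?t1) \<longlonglongrightarrow> (\<integral>p. h' p \<partial>?t1) \<and> integrable ?t1 h'"
 proof (rule tendsto_integral_pair[where g = g])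
  show hm: "h n \<in> borel_measurable ?t2" for n
  proof -
   have "(\<lambda>p. signed_density f (grain C (fst (fst p, r n * t n * w n (snd p))) (snd (fst p, r n * t n * w n (snd p))))) \<in> borel_measurable ?t2"
    by (rule measurable_compose[OF _ sm]) measurable
   then have [measurable]: "(\<lambda>p. signed_density f (grain C (fst p) (r n * t n * w n (snd p)))) \<in> borel_measurable ?t2" by simp
   show ?thesis unfolding h_def by measurable
  qed
  show h'm: "h' \<in> borel_measurable ?t2" unfolding h'_def by measurable
  show "g \<in> borel_measurable borel" unfolding g_def by measurable
  show "(\<integral>\<^sup>+s. g s \<partial>lborel) < \<infinity>" unfolding g_def K_def
   using majorant_integrable[OF A(1) d(1-3)] by (subst nn_integral_cmult) (auto simp: ennreal_mult_less_top)
  show "(\<integral>\<^sup>+x. ennreal (cmod (h' (x, s))) \<partial>lborel) \<le> g s" for s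
  proof (cases "s > 0")
   case True
   then have "h' (x, s) = Psi (s powr (- 1 / \<gamma>) * (f x / c))" for x by (simp add: h'_def)
   then show ?thesis unfolding gs[OF True] D_def
    using nn_integral_Psi_le[OF fm c powr_ge_zero w'K[OF True] eq_refl[OF iq(1)] eq_refl[OF iq(2)] iq(3,4)] by simp
  qed (simp add: h'_def)
  show "\<forall>\<^sub>F n in sequentially. \<forall>s. (\<integral>\<^sup>+x. ennreal (cmod (h n (x, s))) \<partial>lborel) \<le> g s"
   using tt0
  proof eventually_elim
   case (elim n)
   show ?case
   proof
    fix s
    consider "s \<le> 0" | "s > 0" "\<not> s < 1 / k n" | "s > 0" "s < 1 / k n" by linarith
    then show "(\<integral>\<^sup>+x. ennreal (cmod (h n (x, s))) \<partial>lborel) \<le> g s"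
    proof cases
     case 3
     have "(\<integral>\<^sup>+x. ennreal (cmod (Psi (w n s * (grain_average f (r n * t n * w n s) x / c)))) \<partial>lborel) \<le>
       ennreal (max (2 * i / c) (q / (2 * c\<^sup>2)) * min (K s) (K s powr 2))"
      by (rule nn_integral_Psi_le[OF grain_average_measurable[OF fm] c w0 wK[OF elim 3(1)] _ _ iq(3,4)])
       (use nn_integral_grain_average_le[OF f(1) pos[OF 3]] nn_integral_grain_average_square_le[OF f(1) pos[OF 3] f(2)] iq in simp_all)
     then show ?thesis using 3 by (simp add: hs gs D_def)
    qed (simp_all add: h_def hs)
   qed
  qed
  show "(\<lambda>n. \<integral>\<^sup>+x. ennreal (cmod (h n (x, s) - h' (x, s))) \<partial>lborel) \<longlonglongrightarrow> 0" for s
  proof (cases "s > 0")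
   case s: True
   define u where "u = s powr (- 1 / \<gamma>)"
   define v where "v = (\<lambda>n. r n * t n * w n s)"
   have ek: "\<forall>\<^sub>F n in sequentially. s < 1 / k n"
   proof -
    have "\<forall>\<^sub>F n in sequentially. k n < 1 / s" by (rule order_tendstoD(2)[OF sc(3)]) (use s in simp)
    then show ?thesis by eventually_elim (use s sc(1) in \<open>simp add: field_simps\<close>)
   qed
   have v: "\<forall>\<^sub>F n in sequentially. v n > 0" using ek by eventually_elim (use pos[OF s] in \<open>simp add: v_def\<close>)
   have "v \<longlonglongrightarrow> 0 * u" unfolding v_def u_def by (intro tendsto_mult sc(8) wlim s)
   then have E: "(\<lambda>n. \<integral>\<^sup>+x. ennreal \<bar>grain_average f (v n) x - f x\<bar> \<partial>lborel) \<longlonglongrightarrow> 0"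
    by (intro grain_average_tendsto[OF f(1) v]) simp
   have 1: "(\<lambda>n. ennreal (2 * K s / c) * (\<integral>\<^sup>+x. ennreal \<bar>grain_average f (v n) x - f x\<bar> \<partial>lborel)) \<longlonglongrightarrow> 0"
    using ennreal_tendsto_cmult[OF _ E, of "ennreal (2 * K s / c)"] by simp
   have "(\<lambda>n. 2 * \<bar>w n s - u\<bar> / c * i) \<longlonglongrightarrow> 2 * \<bar>u - u\<bar> / c * i"
    unfolding u_def by (intro tendsto_intros wlim s) (use c in simp)
   then have 2: "(\<lambda>n. ennreal (2 * \<bar>w n s - u\<bar> / c * i)) \<longlonglongrightarrow> 0"
    using tendsto_ennrealI by fastforce
   \<comment> \<open>Two errors: replacing the average by \<open>f\<close>, weighted by the
     majorant, and replacing \<open>w n s\<close> by its limit, weighted by the L1 norm of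
     \<open>f\<close>.\<close>
   have 3: "(\<lambda>n. ennreal (2 * K s / c) * (\<integral>\<^sup>+x. ennreal \<bar>grain_average f (v n) x - f x\<bar> \<partial>lborel) + ennreal (2 * \<bar>w n s - u\<bar> / c * i)) \<longlonglongrightarrow> 0"
    using tendsto_add[OF 1 2] by simp
   have pl: "ennreal (a * b + a' * b') = ennreal a * ennreal b + ennreal a' * ennreal b'"
    if "0 \<le> a" "0 \<le> b" "0 \<le> a'" "0 \<le> b'" for a b a' b' using that by (simp add: ennreal_mult)
   show ?thesis
   proof (rule tendsto_sandwich[OF _ _ tendsto_const 3])
    show "\<forall>\<^sub>F n in sequentially. (\<integral>\<^sup>+x. ennreal (cmod (h n (x, s) - h' (x, s))) \<partial>lborel) \<le>
      ennreal (2 * K s / c) * (\<integral>\<^sup>+x. ennreal \<bar>grain_average f (v n) x - f x\<bar> \<partial>lborel) + ennreal (2 * \<bar>w n s - u\<bar> / c * i)"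
     using ek tt0
    proof eventually_elim
     case (elim n)
     have [measurable]: "grain_average f (v n) \<in> borel_measurable borel" by (rule grain_average_measurable[OF fm])
     have "(\<integral>\<^sup>+x. ennreal (cmod (h n (x, s) - h' (x, s))) \<partial>lborel) \<le>
       (\<integral>\<^sup>+x. ennreal (2 * K s / c) * ennreal \<bar>grain_average f (v n) x - f x\<bar> + ennreal (2 * \<bar>w n s - u\<bar> / c) * ennreal \<bar>f x\<bar> \<partial>lborel)"
     proof (intro nn_integral_mono, goal_cases)
      case (1 x)
      let ?a = "grain_average f (v n) x"
      have "cmod (h n (x, s) - h' (x, s)) = cmod (Psi (w n s * (?a / c)) - Psi (u * (f x / c)))"
       using elim(1) s by (simp add: hs h'_def u_def v_def)
      also have "\<dots> \<le> 2 * \<bar>w n s * (?a / c) - u * (f x / c)\<bar>" by (rule cmod_Psi_diff_le)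
      also have "w n s * (?a / c) - u * (f x / c) = w n s / c * (?a - f x) + (w n s - u) / c * f x"
       by (simp add: diff_divide_distrib algebra_simps)
      also have "2 * \<bar>w n s / c * (?a - f x) + (w n s - u) / c * f x\<bar> \<le> 2 * (w n s / c * \<bar>?a - f x\<bar> + \<bar>w n s - u\<bar> / c * \<bar>f x\<bar>)"
       using abs_triangle_ineq[of "w n s / c * (?a - f x)" "(w n s - u) / c * f x"] w0[of n s] c
       by (simp add: abs_mult)
      also have "\<dots> \<le> 2 * (K s / c * \<bar>?a - f x\<bar> + \<bar>w n s - u\<bar> / c * \<bar>f x\<bar>)"
       using wK[OF elim(2) s] c by (intro mult_left_mono add_mono mult_right_mono divide_right_mono) auto
      also have "\<dots> = 2 * K s / c * \<bar>?a - f x\<bar> + 2 * \<bar>w n s - u\<bar> / c * \<bar>f x\<bar>" by (simp add: algebra_simps)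
      finally have "ennreal (cmod (h n (x, s) - h' (x, s))) \<le> ennreal (2 * K s / c * \<bar>?a - f x\<bar> + 2 * \<bar>w n s - u\<bar> / c * \<bar>f x\<bar>)"
       by (rule ennreal_leI)
      also have "\<dots> = ennreal (2 * K s / c) * ennreal \<bar>?a - f x\<bar> + ennreal (2 * \<bar>w n s - u\<bar> / c) * ennreal \<bar>f x\<bar>"
       by (rule pl) (use c majorant_nonneg[of A d s] in \<open>simp_all add: K_def\<close>)
      finally show ?case .
     qed
     also have "\<dots> = ennreal (2 * K s / c) * (\<integral>\<^sup>+x. ennreal \<bar>grain_average f (v n) x - f x\<bar> \<partial>lborel) + ennreal (2 * \<bar>w n s - u\<bar> / c) * ?t3"
      by (subst nn_integral_add, measurable, subst (1 2) nn_integral_cmult, measurable)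
     also have "ennreal (2 * \<bar>w n s - u\<bar> / c) * ?t3 = ennreal (2 * \<bar>w n s - u\<bar> / c * i)"
      unfolding iq(1) by (rule ennreal_mult[symmetric]) (use iq(3) c in simp_all)
     finally show ?case .
    qed
   qed simp
  qed (simp add: h_def h'_def)
 qed
 then have limh: "(\<lambda>n. (1 / \<gamma>) *\<^sub>R (\<integral>p. h n p \<partial>?t1)) \<longlonglongrightarrow> (1 / \<gamma>) *\<^sub>R (\<integral>p. h' p \<partial>?t1)"
  and int: "integrable ?t1 h'" by (rule tendsto_scaleR[OF tendsto_const conjunct1], rule conjunct2)
 have e: "(CLINT z|grain_intensity Q V (l n) (r n). Psi (signed_density f (grain_at C z) / (c * (r n * t n)))) =
   (1 / \<gamma>) *\<^sub>R (\<integral>p. h n p \<partial>?t1)" for n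
 proof -
  have l0: "l n > 0" using l(1)[of n] by simp
  have "l n * k n = 1 / \<gamma>" using l0 by (simp add: k_def)
  have "(\<lambda>z. Psi (signed_density f (grain_at C z) / (c * (r n * t n)))) \<in> borel_measurable ?t2"
   by measurable
  from integral_grain_intensity[OF V sc(1)[of n] l0 sc(4)[of n] this, of "r n"]
  have "(CLINT z|grain_intensity Q V (l n) (r n). Psi (signed_density f (grain_at C z) / (c * (r n * t n)))) =
   (\<integral>p. (1 / \<gamma>) *\<^sub>R h n p \<partial>?t1)"
   unfolding \<open>l n * k n = 1 / \<gamma>\<close> h_def w_def fst_conv snd_conv by (simp only: scaleR_left_commute)
  then show ?thesis by (simp only: integral_scaleR_right)
 qed
 have "(\<integral>p. h' p \<partial>?t1) = (\<integral>x. \<integral>s. h' (x, s) \<partial>lborel \<partial>lborel)"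
  by (rule lborel_pair.integral_fst'[symmetric, OF int])
 then show ?thesis using limh unfolding e[symmetric] by (simp only: h'_def fst_conv snd_conv t_def k_def)
qed

end

subsection \<open>The three limits\<close>

lemma Lp_1_2_integrable:
 assumes "f \<in> Lp 1 \<inter> Lp 2"
 shows "integrable lborel f" "integrable lborel (\<lambda>x. (f x)\<^sup>2)"
proof -
 have [measurable]: "f \<in> borel_measurable borel" using assms by (simp add: Lp_def)
 have "integrable lborel (\<lambda>x. \<bar>f x\<bar>)" using assms by (simp add: Lp_def)
 then show "integrable lborel f" by (subst (asm) integrable_abs_iff) auto
 show "integrable lborel (\<lambda>x. (f x)\<^sup>2)" using assms by (simp add: Lp_def)
qed

lemma Lp_1_2_I:
 assumes "f \<in> borel_measurable borel" "integrable lborel f" "integrable lborel (\<lambda>x. (f x)\<^sup>2)"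
 shows "f \<in> Lp 1 \<inter> Lp 2" using assms by (simp add: Lp_def integrable_abs)

lemma Lp_1_2_sum:
 assumes f: "\<And>k. k < n \<Longrightarrow> f k \<in> Lp 1 \<inter> Lp 2"
 shows "(\<lambda>x. \<Sum>k<(n::nat). c k * f k x) \<in> Lp 1 \<inter> Lp 2" using f
proof (induction n)
 case 0
 show ?case by (rule Lp_1_2_I) auto
next
 case (Suc n)
 define g where "g = (\<lambda>x. \<Sum>k<n. c k * f k x)"
 have g: "g \<in> Lp 1 \<inter> Lp 2" unfolding g_def using Suc by auto
 note I = Lp_1_2_integrable[OF g] Lp_1_2_integrable[OF Suc.prems[OF lessI]]
 have [measurable]: "g \<in> borel_measurable borel" "f n \<in> borel_measurable borel"
  using borel_measurable_integrable[OF I(1)] borel_measurable_integrable[OF I(3)] by simp_all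
 have "(\<lambda>x. g x + c n * f n x) \<in> Lp 1 \<inter> Lp 2"
 proof (rule Lp_1_2_I)
  show "integrable lborel (\<lambda>x. g x + c n * f n x)" using I by simp
  show "integrable lborel (\<lambda>x. (g x + c n * f n x)\<^sup>2)"
  proof (rule Bochner_Integration.integrable_bound)
   show "integrable lborel (\<lambda>x. 2 * (g x)\<^sup>2 + 2 * (c n)\<^sup>2 * (f n x)\<^sup>2)" using I by simp
   have "(a + b)\<^sup>2 \<le> 2 * a\<^sup>2 + 2 * b\<^sup>2" for a b :: real
    using zero_le_power2[of "a - b"] by (simp add: power2_eq_square algebra_simps)
   from this[of "g x" "c n * f n x" for x]
   show "AE x in lborel. norm ((g x + c n * f n x)\<^sup>2) \<le> norm (2 * (g x)\<^sup>2 + 2 * (c n)\<^sup>2 * (f n x)\<^sup>2)"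
    by (intro AE_I2) (simp add: power_mult_distrib mult.assoc)
  qed measurable
 qed measurable
 then show ?case by (simp add: g_def)
qed

text \<open>For nonnegative \<open>y\<close> one has \<open>y powr p \<le> y + y\<^sup>2\<close>, by
  comparison with exponent 1 below 1 and with exponent 2 above.\<close>

lemma Lp_interpolation:
 assumes f: "f \<in> Lp 1 \<inter> Lp 2" and p: "1 \<le> p" "p \<le> 2"
 shows "f \<in> Lp p"
proof -
 note I = Lp_1_2_integrable[OF f]
 have m[measurable]: "f \<in> borel_measurable borel" using borel_measurable_integrable[OF I(1)] by simp
 have "integrable lborel (\<lambda>x. \<bar>f x\<bar> powr p)"
 proof (rule Bochner_Integration.integrable_bound)
  show "integrable lborel (\<lambda>x. \<bar>f x\<bar> + (f x)\<^sup>2)" using I by (simp add: integrable_abs)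
  have "y powr p \<le> y + y\<^sup>2" if "y \<ge> 0" for y :: real
  proof (cases "y \<le> 1")
   case True
   have "y powr p \<le> y powr 1" by (rule powr_mono') (use that True p in auto)
   then show ?thesis using that by (simp add: add_increasing2)
  next
   case False
   have "y powr p \<le> y powr 2" by (rule powr_mono) (use False p in auto)
   then show ?thesis using that by simp
  qed
  from this[of "\<bar>f x\<bar>" for x]
  show "AE x in lborel. norm (\<bar>f x\<bar> powr p) \<le> norm (\<bar>f x\<bar> + (f x)\<^sup>2)" by (intro AE_I2) simp
 qed measurable
 then show ?thesis using m by (simp add: Lp_def)
qed

text \<open>The factor \<open>sgn (f x)\<close> splits \<open>\<bar>f x\<bar> powr p\<close> into
  the powers of the positive and the negative part, whose integrals form the numerator of the
  skewness.\<close>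

lemma stable_exponent:
 fixes f :: "'a::euclidean_space \<Rightarrow> real"
 assumes f: "f \<in> Lp p" and p: "p > 0"
 shows "(CLINT x|lborel. complex_of_real (- (p * \<bar>f x\<bar> powr p)) * (1 - \<i> * complex_of_real (sgn (f x) * T))) =
  p *\<^sub>R (- complex_of_real (Lp_norm p f powr p) * (1 - \<i> * complex_of_real (stable_skewness p f * T)))"
proof -
 let ?t2 = "(\<integral>x. - (p * \<bar>f x\<bar> powr p) \<partial>lborel)"
 let ?t1 = "(\<integral>x. p * T * (\<bar>max (f x) 0\<bar> powr p - \<bar>- min (f x) 0\<bar> powr p) \<partial>lborel)"
 have [measurable]: "f \<in> borel_measurable borel" and i: "integrable lborel (\<lambda>x. \<bar>f x\<bar> powr p)"
  using f by (simp_all add: Lp_def)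
 define I where "I = (\<integral>x. \<bar>f x\<bar> powr p \<partial>lborel)"
 define Ip where "Ip = (\<integral>x. \<bar>max (f x) 0\<bar> powr p \<partial>lborel)"
 define Im where "Im = (\<integral>x. \<bar>- min (f x) 0\<bar> powr p \<partial>lborel)"
 have bnd: "\<bar>max y 0\<bar> powr p \<le> \<bar>y\<bar> powr p" "\<bar>- min y 0\<bar> powr p \<le> \<bar>y\<bar> powr p" for y :: real
  using p by (auto simp: max_def min_def)
 have ip: "integrable lborel (\<lambda>x. \<bar>max (f x) 0\<bar> powr p)"
  by (rule Bochner_Integration.integrable_bound[OF i]) (use bnd(1) in auto)
 have im: "integrable lborel (\<lambda>x. \<bar>- min (f x) 0\<bar> powr p)"
  by (rule Bochner_Integration.integrable_bound[OF i]) (use bnd(2) in auto)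
 have nn: "I \<ge> 0" "Ip \<ge> 0" "Im \<ge> 0" "Ip \<le> I" "Im \<le> I" unfolding I_def Ip_def Im_def
  by (rule Bochner_Integration.integral_nonneg powr_ge_zero integral_mono[OF ip i bnd(1)] integral_mono[OF im i bnd(2)])+
 have norm: "Lp_norm p g powr p = (\<integral>x. \<bar>g x\<bar> powr p \<partial>lborel)" for g :: "'a \<Rightarrow> real"
  unfolding Lp_norm_def using p Bochner_Integration.integral_nonneg[of lborel "\<lambda>x. \<bar>g x\<bar> powr p"] by (simp add: powr_powr)
 \<comment> \<open>Multiplication by \<open>I\<close> avoids the quotient: if \<open>I = 0\<close>,
   the integrals of both parts vanish too and either side is 0.\<close>
 have sk: "I * stable_skewness p f = Ip - Im"
 proof (cases "I = 0")
  case False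
  have "Lp_norm p f powr (- p) = 1 / I" using norm[of f] by (simp add: powr_minus_divide I_def)
  then show ?thesis using False by (simp add: stable_skewness_def norm Ip_def Im_def)
 qed (use nn in simp)
 have sg: "sgn y * \<bar>y\<bar> powr p = \<bar>max y 0\<bar> powr p - \<bar>- min y 0\<bar> powr p" for y :: real
  by (cases y "0 :: real" rule: linorder_cases) (auto simp: max_def min_def)
 have e: "complex_of_real (- (p * \<bar>f x\<bar> powr p)) * (1 - \<i> * complex_of_real (sgn (f x) * T)) =
   complex_of_real (- (p * \<bar>f x\<bar> powr p)) + \<i> * complex_of_real (p * T * (\<bar>max (f x) 0\<bar> powr p - \<bar>- min (f x) 0\<bar> powr p))" for x
  unfolding sg[symmetric] by (simp add: complex_eq_iff)
 have i1: "integrable lborel (\<lambda>x. - (p * \<bar>f x\<bar> powr p))" "integrable lborel (\<lambda>x. p * T * (\<bar>max (f x) 0\<bar> powr p - \<bar>- min (f x) 0\<bar> powr p))"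
  by (intro integrable_minus integrable_mult_right i Bochner_Integration.integrable_diff ip im)+
 have "(CLINT x|lborel. complex_of_real (- (p * \<bar>f x\<bar> powr p)) * (1 - \<i> * complex_of_real (sgn (f x) * T))) =
  complex_of_real ?t2 + \<i> * complex_of_real ?t1" unfolding e using i1
  by (subst Bochner_Integration.integral_add[OF integrable_of_real integrable_mult_right[OF integrable_of_real]])
   (simp_all only: integral_complex_of_real integral_mult_right_zero)
 also have "?t2 = - (p * I)" by (simp add: I_def)
 also have "?t1 = p * T * (Ip - Im)"
  using Bochner_Integration.integral_diff[OF ip im] by (simp add: Ip_def Im_def)
 also have "p * T * (Ip - Im) = p * (I * (stable_skewness p f * T))" unfolding sk[symmetric] by simp
 finally show ?thesis unfolding norm I_def[symmetric] by (simp add: complex_eq_iff)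
qed

lemma signed_density_sum:
 assumes f: "\<And>k. k < n \<Longrightarrow> integrable lborel (f k)" and A: "A \<in> sets borel"
 shows "(\<Sum>k<(n::nat). c k * signed_density (f k) A) = signed_density (\<lambda>x. \<Sum>k<n. c k * f k x) A" (is "_ = ?r1")
proof -
 have i: "integrable lborel (\<lambda>x. c k * (indicator A x * f k x))" if "k < n" for k
  using integrable_real_mult_indicator[OF _ f[OF that], of A] A by (simp add: mult.commute)
 have "?r1 = (\<integral>x. (\<Sum>k<n. c k * (indicator A x * f k x)) \<partial>lborel)"
  using A by (simp add: signed_density_def set_lebesgue_integral_def sum_distrib_left mult.left_commute)
 also have "\<dots> = (\<Sum>k<n. \<integral>x. c k * (indicator A x * f k x) \<partial>lborel)"
  by (rule Bochner_Integration.integral_sum) (use i in simp)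
 finally show ?thesis using A by (simp add: signed_density_def set_lebesgue_integral_def)
qed

text \<open>The measure with density \<open>\<bar>f\<bar>\<close> bounds
  \<open>signed_density f\<close> setwise, which is the form in which
  \<open>integrable_grain_intensity\<close> accepts a functional.\<close>

lemma abs_signed_density_le:
 fixes f :: "'a::euclidean_space \<Rightarrow> real"
 assumes f: "integrable lborel f"
 defines "M \<equiv> density lborel (\<lambda>x. ennreal \<bar>f x\<bar>)"
 shows "finite_measure M" "sets M = sets borel" "A \<in> sets borel \<Longrightarrow> \<bar>signed_density f A\<bar> \<le> measure M A"
proof -
 have [measurable]: "f \<in> borel_measurable borel" using borel_measurable_integrable[OF f] by simp
 show fin: "finite_measure M"
  unfolding M_def using f by (intro finite_measureI) (simp add: emeasure_density integrable_iff_bounded less_top)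
 interpret finite_measure M by fact
 show "sets M = sets borel" by (simp add: M_def)
 assume A[measurable]: "A \<in> sets borel"
 have i: "integrable lborel (\<lambda>x. indicator A x *\<^sub>R f x)"
  using integrable_mult_indicator[OF _ f, of A] by simp
 have "ennreal \<bar>signed_density f A\<bar> \<le> (\<integral>\<^sup>+x. ennreal (norm (indicator A x *\<^sub>R f x)) \<partial>lborel)"
  using integral_norm_bound_ennreal[OF i] A by (simp add: signed_density_def set_lebesgue_integral_def)
 also have "\<dots> = emeasure M A"
  unfolding M_def by (subst emeasure_density) (auto intro!: nn_integral_cong simp: indicator_def)
 finally show "\<bar>signed_density f A\<bar> \<le> measure M A" by (simp add: emeasure_eq_measure)
qed

text \<open>By the Galois connection the set under the infimum is the closed half-line that starts
  at \<open>r * quantile (1 / u)\<close>.\<close>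

lemma (in rv_tail) reciprocal_inverse_eq:
 assumes F: "F = cdf \<mu>" and r: "r > 0" and u: "u > 1"
 shows "reciprocal_inverse (Fbar F r) u = r * quantile (1 / u)"
proof -
 have "1 / Fbar F r v \<ge> u \<longleftrightarrow> r * quantile (1 / u) \<le> v" for v
 proof -
  have G: "Fbar F r v = G (v / r)" by (simp add: Fbar_def F G_def)
  have "u \<le> 1 / G (v / r) \<longleftrightarrow> G (v / r) \<le> 1 / u"
   using G_pos[of "v / r"] u by (simp add: pos_le_divide_eq mult.commute)
  also have "\<dots> \<longleftrightarrow> quantile (1 / u) \<le> v / r"
   by (rule quantile_le_iff[symmetric]) (use u in auto)
  also have "\<dots> \<longleftrightarrow> r * quantile (1 / u) \<le> v"
   using r by (simp add: pos_le_divide_eq mult.commute)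
  finally show ?thesis unfolding G .
 qed
 then have "{v. 1 / Fbar F r v \<ge> u} = {r * quantile (1 / u)..}" by auto
 then show ?thesis by (simp add: reciprocal_inverse_def)
qed

text \<open>The limit objects are arbitrary realizations on spaces of their own, so they enter only
  through measurability and their characteristic functions. In each regime the exponents before the
  limit converge to the exponent of the limit object.\<close>

theorem theorem2:
 fixes C :: "'a::euclidean_space set"
  and Q :: "'q measure" and V :: "'q \<Rightarrow> real" and F :: "real \<Rightarrow> real"
  and P :: "real \<Rightarrow> real \<Rightarrow> 'w measure"
  and N :: "real \<Rightarrow> real \<Rightarrow> 'w \<Rightarrow> ('a \<times> real) measure"
  and lam :: "real \<Rightarrow> real" and \<gamma> \<alpha> :: real
 assumes C: "bounded C" "C \<in> sets borel" "measure lborel C = 1"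
   "emeasure lborel (frontier C) = 0" and V: "prob_space Q" "V \<in> borel_measurable Q" "AE q in Q. V q > 0"
   "integrable Q V" "(\<integral>q. V q \<partial>Q) = 1" and F: "F = cdf (distr Q borel V)"
  and \<gamma>: "1 < \<gamma>" "\<gamma> < 2" and reg: "regularly_varying (\<lambda>v. 1 - F v) \<gamma>"
  and N: "\<And>l \<rho>. l > 0 \<Longrightarrow> \<rho> > 0 \<Longrightarrow>
   poisson_random_measure (P l \<rho>) (N l \<rho>) (grain_intensity Q V l \<rho>)"
  and \<alpha>: "0 < \<alpha>" "\<alpha> < 2 - \<gamma>" and lam: "filterlim lam at_top (at_right 0)"
 shows "(filterlim (\<lambda>\<rho>. lam \<rho> * Fbar F \<rho> 1) at_top (at_right 0) \<longrightarrow>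
   (\<forall>(PW :: 'w1 measure) W. is_W \<gamma> C PW W \<longrightarrow>
    fdd_converges (\<lambda>\<rho>. P (lam \<rho>) \<rho>)
     (\<lambda>\<rho> \<phi> \<omega>. centered_grain_functional C (P (lam \<rho>) \<rho>) (N (lam \<rho>) \<rho>) \<phi> \<omega> /
       (\<gamma> * lam \<rho> * Fbar F \<rho> 1) powr (1 / 2))
     (at_right 0) (Malpha \<alpha>) PW W)) \<and>
  (\<forall>\<sigma>\<^sub>0>0. ((\<lambda>\<rho>. lam \<rho> * Fbar F \<rho> 1) \<longlongrightarrow> \<sigma>\<^sub>0) (at_right 0) \<longrightarrow>
   (\<forall>(PJ :: 'w2 measure) N\<^sub>\<gamma>. poisson_random_measure PJ N\<^sub>\<gamma> (limit_intensity \<gamma>) \<longrightarrow>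
    fdd_converges (\<lambda>\<rho>. P (lam \<rho>) \<rho>)
     (\<lambda>\<rho>. centered_grain_functional C (P (lam \<rho>) \<rho>) (N (lam \<rho>) \<rho>))
     (at_right 0) (Malpha \<alpha>) PJ
     (\<lambda>\<phi>. J_star \<gamma> C PJ N\<^sub>\<gamma>
       (dilate ((\<gamma> * \<sigma>\<^sub>0) powr (1 / ((\<gamma> - 1) * real DIM('a)))) \<phi>)))) \<and>
  (((\<lambda>\<rho>. lam \<rho> * Fbar F \<rho> 1) \<longlongrightarrow> 0) (at_right 0) \<longrightarrow>
   (\<forall>(PL :: 'w3 measure) \<Lambda>. is_stable_random_measure \<gamma> PL \<Lambda> \<longrightarrow>
    fdd_converges (\<lambda>\<rho>. P (lam \<rho>) \<rho>)
     (\<lambda>\<rho> \<phi> \<omega>. centered_grain_functional C (P (lam \<rho>) \<rho>) (N (lam \<rho>) \<rho>)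
        (signed_density \<phi>) \<omega> /
       (c_gamma \<gamma> * reciprocal_inverse (Fbar F \<rho>) (\<gamma> * lam \<rho>)))
     (at_right 0) (Lp 1 \<inter> Lp 2) PL \<Lambda>))"
proof -
 interpret Q: prob_space Q by fact
 define \<mu> where "\<mu> = distr Q borel V"
 have F\<mu>: "F = cdf \<mu>" by (simp add: F \<mu>_def)
 obtain R where R: "R > 0" "C \<subseteq> cball 0 R"
  using bounded_subset_ballD[OF C(1), of 0] ball_subset_cball by (metis order.trans)
 have "emeasure lborel C \<noteq> \<infinity>" using C(3) by (auto simp: measure_def)
 then have C1: "emeasure lborel C = 1" using C(3) by (simp add: emeasure_eq_ennreal_measure)
 interpret grain_model \<mu> \<gamma> C R
 proof -
  interpret real_distribution \<mu> unfolding \<mu>_def by (rule Q.real_distribution_distr) (use V in simp)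
  show "grain_model \<mu> \<gamma> C R"
  proof unfold_locales
   show "AE v in \<mu>. v > 0" unfolding \<mu>_def using V(2,3) by (subst AE_distr_iff) auto
   show "regularly_varying (\<lambda>v. 1 - cdf \<mu> v) \<gamma>" using reg by (simp only: F\<mu>)
  qed (use \<gamma> C C1 R in auto)
 qed
 note V\<mu> = V(2) \<mu>_def
 have Fb: "Fbar F \<rho> 1 = G (1 / \<rho>)" for \<rho> by (simp add: Fbar_def F\<mu> G_def)
 \<comment> \<open>Beyond positivity, \<open>lam \<rho> > 1\<close> gives
   \<open>\<gamma> * lam \<rho> > 1\<close>, so that in the third regime the quantile is taken
   inside the unit interval.\<close>
 have "\<forall>\<^sub>F \<rho> in at_right 0. lam \<rho> > 1" using lam by (simp add: filterlim_at_top_dense)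
 then obtain r where r: "r > 0" and lr: "\<And>\<rho>. 0 < \<rho> \<Longrightarrow> \<rho> < r \<Longrightarrow> lam \<rho> > 1"
  unfolding eventually_at_right_field by auto
 have N': "poisson_random_measure (P (lam \<rho>) \<rho>) (N (lam \<rho>) \<rho>) (grain_intensity Q V (lam \<rho>) \<rho>)"
  if "0 < \<rho>" "\<rho> < r" for \<rho> using lr[OF that] that by (intro N) auto
 have prob: "prob_space (P (lam \<rho>) \<rho>)" if "0 < \<rho>" "\<rho> < r" for \<rho>
  using N'[OF that] unfolding poisson_random_measure_def by (rule conjunct1)
 have C_fin: "emeasure lborel C < \<infinity>" by (simp add: C1)
 have intg: "integrable (grain_intensity Q V (lam \<rho>) \<rho>) (\<lambda>z. \<phi> (grain_at C z))"
  if \<rho>: "0 < \<rho>" "\<rho> < r" and "finite_measure M" "sets M = sets borel"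
   "(\<lambda>z. \<phi> (grain_at C z)) \<in> borel_measurable borel2"
   "\<And>A. A \<in> sets borel \<Longrightarrow> \<bar>\<phi> A\<bar> \<le> measure M A" for \<rho> \<phi> M
  by (rule integrable_grain_intensity[OF C(2) C_fin V(1-4) _ \<rho>(1) that(3-6)]) (use lr[OF \<rho>] in simp)
 \<comment> \<open>The gap between \<gamma> and \<open>2 - \<alpha>\<close>, and the one between 1
   and \<gamma>, are spent on the loss in Potter's bound.\<close>
 obtain \<delta> where \<delta>: "0 < \<delta>" "1 < \<gamma> - \<delta>" "\<gamma> + \<delta> < 2 - \<alpha>" "\<delta> < \<gamma>" using delta_exists[OF \<alpha>(2)] .
 have intM: "integrable (grain_intensity Q V (lam \<rho>) \<rho>) (\<lambda>z. \<phi> (grain_at C z))"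
  if "0 < \<rho>" "\<rho> < r" "\<phi> \<in> Malpha \<alpha>" for \<rho> \<phi>
  using dominated_Malpha[OF that(3) \<delta>(1-3)] unfolding dominated_def
  by (intro intg[OF that(1,2) finite_measure_total_variation[OF Malpha_M1[OF that(3)]] sets_total_variation])
   (elim conjunct1 abs_le_total_variation[OF Malpha_M1[OF that(3)]])+
 have intL: "integrable (grain_intensity Q V (lam \<rho>) \<rho>) (\<lambda>z. signed_density f (grain_at C z))"
  if "0 < \<rho>" "\<rho> < r" "f \<in> Lp 1 \<inter> Lp 2" for \<rho> and f :: "'a \<Rightarrow> real"
 proof -
  note f = Lp_1_2_integrable(1)[OF that(3)]
  have "f \<in> borel_measurable borel" using borel_measurable_integrable[OF f] by simp
  then show ?thesis
   by (intro intg[OF that(1,2) abs_signed_density_le(1,2)[OF f]] abs_signed_density_le(3)[OF f] signed_density_grain_measurable[OF C(2)])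
 qed
 have seq: "filterlim S (at_right 0) sequentially" if "\<And>i. 0 < S i" "S \<longlonglongrightarrow> 0" for S :: "nat \<Rightarrow> real"
  using that by (intro filterlim_at_withinI) (auto intro: always_eventually)
 have dom: "dominated \<delta> (\<lambda>A. \<Sum>k<n. c k * t k A)" if "\<And>k. k < n \<Longrightarrow> t k \<in> Malpha \<alpha>" for n and t :: "nat \<Rightarrow> 'a set \<Rightarrow> real" and c
  by (intro dominated_sum dominated_Malpha[OF that \<delta>(1-3)])
 have l0: "lam (S i) > 0" if "\<And>i. 0 < S i" "\<And>i. S i < r" for S :: "nat \<Rightarrow> real" and i
  using lr[OF that[of i]] by simp
 show ?thesis
 proof (intro conjI allI impI, goal_cases)
  case (1 PW W)
  have rl: "random_linear_functional PW (Malpha (2 - \<gamma>)) W"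
   using 1(2) unfolding is_W_def centered_gaussian_functional_def by (elim conjE)
  show ?case
  proof (rule fdd_converges_at_rightI[OF r], goal_cases)
   case (1 \<rho>)
   then show ?case by (rule prob)
  next
   case (2 \<rho> \<phi>)
   then show ?case by (intro borel_measurable_divide borel_measurable_const centered_grain_functional_measurable[OF N' intM])
  next
   case 3
   show ?case using rl unfolding random_linear_functional_def by (elim conjE)
  next
   case (4 \<phi>)
   have "\<phi> \<in> Malpha (2 - \<gamma>)" by (rule Malpha_mono[OF 4]) (use \<alpha> \<gamma> in auto)
   moreover have "\<forall>t\<in>Malpha (2 - \<gamma>). W t \<in> borel_measurable PW"
    using rl unfolding random_linear_functional_def by (elim conjE)
   ultimately show ?case by (rule bspec[rotated])
  next
   case (5 n t c S)
   note t = 5(1) and S = 5(2-4)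
   have "filterlim (\<lambda>i. lam (S i) * G (1 / S i)) at_top sequentially"
    using filterlim_compose[OF 1(1) seq[OF S(1,3)]] by (simp only: Fb)
   from tendsto_exp[OF large_grain_limit[OF V\<mu> S(1,3) l0[of S, OF S(1,2)] dom[of n t c, OF t] \<delta>(1,4) this]]
   show ?case
    by (simp only: char_W[where \<phi> = t, OF 1(2) t \<alpha>(2)] char_centered_grain_functional[where \<phi> = t, OF N'[OF S(1,2)] intM[OF S(1,2) t]] Fb)
  qed
 next
  case (2 \<sigma>\<^sub>0 PJ N\<^sub>\<gamma>)
  define \<sigma> where "\<sigma> = (\<gamma> * \<sigma>\<^sub>0) powr (1 / ((\<gamma> - 1) * real DIM('a)))"
  \<comment> \<open>The exponent of \<sigma> undoes the scaling factor in
    \<open>J_star_char\<close>.\<close>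
  have \<sigma>: "\<sigma> > 0" "\<sigma> powr ((\<gamma> - 1) * real DIM('a)) = \<gamma> * \<sigma>\<^sub>0"
   using 2(1) \<gamma> by (simp_all add: \<sigma>_def powr_powr)
  show ?case unfolding \<sigma>_def[symmetric]
  proof (rule fdd_converges_at_rightI[OF r], goal_cases)
   case (1 \<rho>)
   then show ?case by (rule prob)
  next
   case (2 \<rho> \<phi>)
   then show ?case by (intro centered_grain_functional_measurable[OF N' intM])
  next
   case 3
   show ?case using 2(3) unfolding poisson_random_measure_def by (rule conjunct1)
  next
   case (4 \<phi>)
   show ?case
    by (rule J_star_char(1)[where \<phi> = "\<lambda>_. \<phi>" and n = 1 and k = 0, OF 2(3) dominated_Malpha[OF 4 \<delta>(1-3)] \<delta>(1,4) \<sigma>(1)]) simp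
  next
   case (5 n t c S)
   note t = 5(1) and S = 5(2-4)
   have "(\<lambda>i. lam (S i) * G (1 / S i)) \<longlonglongrightarrow> \<sigma>\<^sub>0"
    using filterlim_compose[OF 2(2) seq[OF S(1,3)]] by (simp only: Fb)
   from tendsto_exp[OF intermediate_limit[OF V\<mu> S(1,3) l0[of S, OF S(1,2)] dom[of n t c, OF t] \<delta>(1,4) this]]
   show ?case
    by (simp only: J_star_char(2)[where \<phi> = t, OF 2(3) dominated_Malpha[OF t \<delta>(1-3)] \<delta>(1,4) \<sigma>(1)] \<sigma>(2) div_by_1
     char_centered_grain_functional[where \<phi> = t and b = 1, OF N'[OF S(1,2)] intM[OF S(1,2) t], unfolded div_by_1])
  qed
 next
  case (3 PL \<Lambda>)
  have rl: "prob_space PL" "\<forall>t\<in>Lp \<gamma>. \<Lambda> t \<in> borel_measurable PL"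
   "\<forall>(n::nat) (c :: nat \<Rightarrow> real) t. (\<forall>k<n. t k \<in> Lp \<gamma>) \<longrightarrow>
    (AE \<omega> in PL. \<Lambda> (\<lambda>b. \<Sum>k<n. c k * t k b) \<omega> = (\<Sum>k<n. c k * \<Lambda> (t k) \<omega>))"
   using 3(2)[unfolded is_stable_random_measure_def random_linear_functional_def, THEN conjunct1]
   by (rule conjunct1, elim conjunct1[OF conjunct2], elim conjunct2[OF conjunct2])
  note char = bspec[OF 3(2)[unfolded is_stable_random_measure_def, THEN conjunct2]]
  have Lg: "f \<in> Lp \<gamma>" if "f \<in> Lp 1 \<inter> Lp 2" for f :: "'a \<Rightarrow> real"
   by (rule Lp_interpolation[OF that]) (use \<gamma> in auto)
  show ?case
  proof (rule fdd_converges_at_rightI[OF r], goal_cases)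
   case (1 \<rho>)
   then show ?case by (rule prob)
  next
   case (2 \<rho> f)
   then show ?case by (intro borel_measurable_divide borel_measurable_const centered_grain_functional_measurable[OF N' intL])
  next
   case 3
   show ?case by (rule rl(1))
  next
   case (4 f)
   show ?case by (rule bspec[OF rl(2) Lg[OF 4]])
  next
   case (5 n t c S)
   note t = 5(1) and S = 5(2-4)
   \<comment> \<open>Combinations of densities are again densities, so the vector is replaced by the
     single function \<open>f\<close> on both sides; for \<Lambda> this uses almost sure
     linearity.\<close>
   define f where "f = (\<lambda>x. \<Sum>k<n. c k * t k x)"
   have f: "f \<in> Lp 1 \<inter> Lp 2" unfolding f_def by (rule Lp_1_2_sum[OF t])
   have l1: "lam (S i) > 1" for i by (rule lr[OF S(1,2)])
   have linf: "filterlim (\<lambda>i. lam (S i)) at_top sequentially" by (rule filterlim_compose[OF lam seq[OF S(1,3)]])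
   have "(\<lambda>i. lam (S i) * G (1 / S i)) \<longlonglongrightarrow> 0"
    using filterlim_compose[OF 3(1) seq[OF S(1,3)]] by (simp only: Fb)
   note lim3 = small_grain_limit[OF V\<mu> S(1,3) l1 linf this Lp_1_2_integrable[OF f] stable_integral(2)[OF \<gamma>]]
   have g0: "\<gamma> > 0" using \<gamma> by simp
   \<comment> \<open>The \<open>1 / \<gamma>\<close> left by the intensity cancels the factor
     \<gamma> produced by \<open>stable_exponent\<close>.\<close>
   have "(1 / \<gamma>) *\<^sub>R (\<gamma> *\<^sub>R z) = z" for z :: complex using g0 by simp
   note lim4 = tendsto_exp[OF lim3[unfolded stable_integral(1)[OF \<gamma>] stable_exponent[OF Lg[OF f] g0] this]]
   have b: "c_gamma \<gamma> * reciprocal_inverse (Fbar F (S i)) (\<gamma> * lam (S i)) = c_gamma \<gamma> * (S i * quantile (1 / (\<gamma> * lam (S i))))" for i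
   proof -
    have "1 * 1 < \<gamma> * lam (S i)" using \<gamma> l1[of i] by (intro mult_strict_mono) auto
    then show ?thesis by (subst reciprocal_inverse_eq[OF F\<mu> S(1)]) auto
   qed
   have sum: "(\<Sum>k<n. c k * signed_density (t k) (grain C x v)) = signed_density f (grain C x v)" for x v
    unfolding f_def by (rule signed_density_sum[OF Lp_1_2_integrable(1)[OF t] sets_grain[OF C(2)]])
   have ae: "AE \<omega> in PL. \<Lambda> f \<omega> = (\<Sum>k<n. c k * \<Lambda> (t k) \<omega>)"
    unfolding f_def by (rule rl(3)[rule_format]) (rule Lg[OF t])
   have [measurable]: "\<Lambda> f \<in> borel_measurable PL" by (rule bspec[OF rl(2) Lg[OF f]])
   have [measurable]: "(\<lambda>\<omega>. \<Sum>k<n. c k * \<Lambda> (t k) \<omega>) \<in> borel_measurable PL"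
    by (intro borel_measurable_sum borel_measurable_times borel_measurable_const bspec[OF rl(2)] Lg[OF t]) simp
   have rhs: "(CLINT \<omega>|PL. iexp (\<Sum>k<n. c k * \<Lambda> (t k) \<omega>)) = (CLINT \<omega>|PL. iexp (\<Lambda> f \<omega>))"
   proof (rule integral_cong_AE, goal_cases)
    case 3
    show ?case using ae by eventually_elim (simp only:)
   qed measurable
   show ?case using lim4
    by (simp only: rhs char[OF Lg[OF f]] b char_centered_grain_functional[where \<phi> = "\<lambda>k. signed_density (t k)", OF N'[OF S(1,2)] intL[OF S(1,2) t]] sum)
  qed
 qed
qed

end
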